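(* Let $\mathcal{C}$ be a small preadditive category and let $\mathcal{B}$ be an additive (full) subcategory of $\mathrm{Mod}\text{-}\mathcal{C}$. The following assertions are equivalent: (1) $\mathcal{B}$ is fully exact; (2) $\mathcal{B}$ is bireflective; (3) there is a small preadditive category $\mathcal{C}'$ and an epimorphism of preadditive categories $f:\mathcal{C}\to\mathcal{C}'$ (that can be taken to be surjective on objects) such that $\mathcal{B}$ is the essential image of $f_*:\mathrm{Mod}\text{-}\mathcal{C}'\to\mathrm{Mod}\text{-}\mathcal{C}$.
   Context: Subcategories are full and closed under isomorphisms; an additive subcategory contains $0$ and is closed under finite coproducts. $\mathrm{Mod}\text{-}\mathcal{C}$ is the category of additive functors $\mathcal{C}^{\mathrm{op}}\to\mathrm{Ab}$. A subcategory of a bicomplete abelian category is fully exact if it is closed under kernels, cokernels, (arbitrary) coproducts and (arbitrary) products. A subcategory is bireflective if its inclusion functor has both a left adjoint and a right adjoint. For an additive functor $f:\mathcal{C}\to\mathcal{C}'$ between small preadditive categories, $f_*:\mathrm{Mod}\text{-}\mathcal{C}'\to\mathrm{Mod}\text{-}\mathcal{C}$ is the restriction of scalars functor $M\mapsto M\circ f$; $f$ is called an epimorphism of preadditive categories when $f_*$ is fully faithful. *)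

theory Defs
  imports "HOL-Algebra.Group" "HOL-Library.Equipollence" "HOL-Library.FuncSet"
begin

section \<open>Size\<close>

text \<open>
  The type \<open>'u\<close> plays the role of the universe of sets: a set, over any type, is small when it has
  strictly smaller cardinality than \<open>'u\<close>. The closure conditions needed for a universe of sets say
  that the cardinality of \<open>'u\<close> is strongly inaccessible. HOL does not prove that such a type exists,
  hence it is a hypothesis on \<open>'u\<close>.
\<close>

definition small :: "'u itself \<Rightarrow> 'x set \<Rightarrow> bool" where
  "small _ A \<longleftrightarrow> A \<prec> (UNIV :: 'u set)"

definition inaccessible :: "'u itself \<Rightarrow> bool" where
  "inaccessible U \<longleftrightarrow>
     small U (UNIV :: nat set) \<and>
     (\<forall>A :: 'u set. small U A \<longrightarrow> small U (Pow A)) \<and>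
     (\<forall>(I :: 'u set) (A :: 'u \<Rightarrow> 'u set).
        small U I \<longrightarrow> (\<forall>i\<in>I. small U (A i)) \<longrightarrow> small U (\<Union>i\<in>I. A i))"

section \<open>Categories and functors\<close>

text \<open>
  Hom sets of different pairs of objects may overlap; therefore composition, and the action of a
  functor on arrows, take the objects as arguments: \<open>ccomp C X Y Z g f\<close> is the composite of
  \<open>f : X \<rightarrow> Y\<close> followed by \<open>g : Y \<rightarrow> Z\<close>.
\<close>

record ('o, 'a) cat =
  obj :: "'o set"
  arr :: "'o \<Rightarrow> 'o \<Rightarrow> 'a set"
  ident :: "'o \<Rightarrow> 'a"
  ccomp :: "'o \<Rightarrow> 'o \<Rightarrow> 'o \<Rightarrow> 'a \<Rightarrow> 'a \<Rightarrow> 'a"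

locale category =
  fixes C :: "('o, 'a, 'z) cat_scheme"
  assumes ident_arr: "X \<in> obj C \<Longrightarrow> ident C X \<in> arr C X X"
    and comp_arr: "\<lbrakk>X \<in> obj C; Y \<in> obj C; Z \<in> obj C; f \<in> arr C X Y; g \<in> arr C Y Z\<rbrakk>
      \<Longrightarrow> ccomp C X Y Z g f \<in> arr C X Z"
    and comp_ident_right: "\<lbrakk>X \<in> obj C; Y \<in> obj C; f \<in> arr C X Y\<rbrakk>
      \<Longrightarrow> ccomp C X X Y f (ident C X) = f"
    and comp_ident_left: "\<lbrakk>X \<in> obj C; Y \<in> obj C; f \<in> arr C X Y\<rbrakk>
      \<Longrightarrow> ccomp C X Y Y (ident C Y) f = f"
    and comp_assoc: "\<lbrakk>W \<in> obj C; X \<in> obj C; Y \<in> obj C; Z \<in> obj C;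
        f \<in> arr C W X; g \<in> arr C X Y; h \<in> arr C Y Z\<rbrakk>
      \<Longrightarrow> ccomp C W Y Z h (ccomp C W X Y g f) = ccomp C W X Z (ccomp C X Y Z h g) f"

definition isomorphic :: "('o, 'a, 'z) cat_scheme \<Rightarrow> 'o \<Rightarrow> 'o \<Rightarrow> bool" where
  "isomorphic C X Y \<longleftrightarrow>
     (\<exists>f\<in>arr C X Y. \<exists>g\<in>arr C Y X. ccomp C X Y X g f = ident C X \<and> ccomp C Y X Y f g = ident C Y)"

record ('o1, 'a1, 'o2, 'a2) cfunctor =
  omap :: "'o1 \<Rightarrow> 'o2"
  amap :: "'o1 \<Rightarrow> 'o1 \<Rightarrow> 'a1 \<Rightarrow> 'a2"

definition is_functor ::
  "('o1, 'a1, 'y) cat_scheme \<Rightarrow> ('o2, 'a2, 'z) cat_scheme \<Rightarrow> ('o1, 'a1, 'o2, 'a2) cfunctor \<Rightarrow> bool" where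
  "is_functor C D F \<longleftrightarrow>
     (\<forall>X\<in>obj C. omap F X \<in> obj D) \<and>
     (\<forall>X\<in>obj C. \<forall>Y\<in>obj C. \<forall>f\<in>arr C X Y. amap F X Y f \<in> arr D (omap F X) (omap F Y)) \<and>
     (\<forall>X\<in>obj C. amap F X X (ident C X) = ident D (omap F X)) \<and>
     (\<forall>X\<in>obj C. \<forall>Y\<in>obj C. \<forall>Z\<in>obj C. \<forall>f\<in>arr C X Y. \<forall>g\<in>arr C Y Z.
        amap F X Z (ccomp C X Y Z g f) =
          ccomp D (omap F X) (omap F Y) (omap F Z) (amap F Y Z g) (amap F X Y f))"

definition comp_functor ::
  "('o2, 'a2, 'o3, 'a3) cfunctor \<Rightarrow> ('o1, 'a1, 'o2, 'a2) cfunctor \<Rightarrow> ('o1, 'a1, 'o3, 'a3) cfunctor" where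
  "comp_functor G F =
     \<lparr>omap = \<lambda>X. omap G (omap F X),
      amap = \<lambda>X Y f. amap G (omap F X) (omap F Y) (amap F X Y f)\<rparr>"

text \<open>A functor between two categories, viewed as a functor between their opposites.\<close>

definition op_functor :: "('o1, 'a1, 'o2, 'a2) cfunctor \<Rightarrow> ('o1, 'a1, 'o2, 'a2) cfunctor" where
  "op_functor F = \<lparr>omap = omap F, amap = \<lambda>X Y f. amap F Y X f\<rparr>"

definition fully_faithful ::
  "('o1, 'a1, 'y) cat_scheme \<Rightarrow> ('o2, 'a2, 'z) cat_scheme \<Rightarrow> ('o1, 'a1, 'o2, 'a2) cfunctor \<Rightarrow> bool" where
  "fully_faithful C D F \<longleftrightarrow>
     (\<forall>X\<in>obj C. \<forall>Y\<in>obj C. bij_betw (amap F X Y) (arr C X Y) (arr D (omap F X) (omap F Y)))"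

definition essential_image ::
  "('o1, 'a1, 'y) cat_scheme \<Rightarrow> ('o2, 'a2, 'z) cat_scheme \<Rightarrow> ('o1, 'a1, 'o2, 'a2) cfunctor \<Rightarrow> 'o2 set" where
  "essential_image C D F = {Y \<in> obj D. \<exists>X\<in>obj C. isomorphic D Y (omap F X)}"

text \<open>
  \<open>L : C \<rightarrow> D\<close> is left adjoint to \<open>R : D \<rightarrow> C\<close>: there are bijections
  \<open>\<phi> X Y : D(L X, Y) \<rightarrow> C(X, R Y)\<close>, natural in \<open>X\<close> and \<open>Y\<close>.
\<close>

definition adjoint_functors ::
  "('o1, 'a1, 'y) cat_scheme \<Rightarrow> ('o2, 'a2, 'z) cat_scheme \<Rightarrow>
   ('o1, 'a1, 'o2, 'a2) cfunctor \<Rightarrow> ('o2, 'a2, 'o1, 'a1) cfunctor \<Rightarrow> bool" where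
  "adjoint_functors C D L R \<longleftrightarrow>
     is_functor C D L \<and> is_functor D C R \<and>
     (\<exists>\<phi>. (\<forall>X\<in>obj C. \<forall>Y\<in>obj D.
             bij_betw (\<phi> X Y) (arr D (omap L X) Y) (arr C X (omap R Y))) \<and>
          (\<forall>X\<in>obj C. \<forall>X'\<in>obj C. \<forall>Y\<in>obj D. \<forall>Y'\<in>obj D.
             \<forall>u\<in>arr C X' X. \<forall>v\<in>arr D Y Y'. \<forall>g\<in>arr D (omap L X) Y.
             \<phi> X' Y' (ccomp D (omap L X') Y Y' v (ccomp D (omap L X') (omap L X) Y g (amap L X' X u))) =
             ccomp C X' (omap R Y) (omap R Y') (amap R Y Y' v) (ccomp C X' X (omap R Y) (\<phi> X Y g) u)))"

section \<open>Preadditive categories\<close>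

record ('o, 'a) preadd_cat = "('o, 'a) cat" +
  arr_add :: "'o \<Rightarrow> 'o \<Rightarrow> 'a \<Rightarrow> 'a \<Rightarrow> 'a"
  arr_zero :: "'o \<Rightarrow> 'o \<Rightarrow> 'a"

definition arr_group :: "('o, 'a, 'z) preadd_cat_scheme \<Rightarrow> 'o \<Rightarrow> 'o \<Rightarrow> 'a monoid" where
  "arr_group C X Y = \<lparr>carrier = arr C X Y, mult = arr_add C X Y, one = arr_zero C X Y\<rparr>"

locale preadditive_category = category C
  for C :: "('o, 'a, 'z) preadd_cat_scheme" +
  assumes arr_comm_group: "\<lbrakk>X \<in> obj C; Y \<in> obj C\<rbrakk> \<Longrightarrow> comm_group (arr_group C X Y)"
    and comp_add_right: "\<lbrakk>X \<in> obj C; Y \<in> obj C; Z \<in> obj C;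
        f \<in> arr C X Y; f' \<in> arr C X Y; g \<in> arr C Y Z\<rbrakk>
      \<Longrightarrow> ccomp C X Y Z g (arr_add C X Y f f') = arr_add C X Z (ccomp C X Y Z g f) (ccomp C X Y Z g f')"
    and comp_add_left: "\<lbrakk>X \<in> obj C; Y \<in> obj C; Z \<in> obj C;
        f \<in> arr C X Y; g \<in> arr C Y Z; g' \<in> arr C Y Z\<rbrakk>
      \<Longrightarrow> ccomp C X Y Z (arr_add C Y Z g g') f = arr_add C X Z (ccomp C X Y Z g f) (ccomp C X Y Z g' f)"

definition small_category :: "'u itself \<Rightarrow> ('o, 'a, 'z) cat_scheme \<Rightarrow> bool" where
  "small_category U C \<longleftrightarrow> small U (obj C) \<and> (\<forall>X\<in>obj C. \<forall>Y\<in>obj C. small U (arr C X Y))"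

definition op_cat :: "('o, 'a) preadd_cat \<Rightarrow> ('o, 'a) preadd_cat" where
  "op_cat C =
     \<lparr>obj = obj C, arr = \<lambda>X Y. arr C Y X, ident = ident C,
      ccomp = \<lambda>X Y Z g f. ccomp C Z Y X f g,
      arr_add = \<lambda>X Y. arr_add C Y X, arr_zero = \<lambda>X Y. arr_zero C Y X\<rparr>"

definition additive_functor ::
  "('o1, 'a1, 'y) preadd_cat_scheme \<Rightarrow> ('o2, 'a2, 'z) preadd_cat_scheme \<Rightarrow>
   ('o1, 'a1, 'o2, 'a2) cfunctor \<Rightarrow> bool" where
  "additive_functor C D F \<longleftrightarrow> is_functor C D F \<and>
     (\<forall>X\<in>obj C. \<forall>Y\<in>obj C. \<forall>f\<in>arr C X Y. \<forall>g\<in>arr C X Y.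
        amap F X Y (arr_add C X Y f g) = arr_add D (omap F X) (omap F Y) (amap F X Y f) (amap F X Y g))"

text \<open>
  Abelian groups are HOL-Algebra's (multiplicatively written) commutative groups. Homomorphisms are
  made extensional so that they are determined by their values on the carrier.
\<close>

definition Ab :: "('u monoid, 'u \<Rightarrow> 'u) preadd_cat" where
  "Ab =
     \<lparr>obj = {G. comm_group G \<and> small TYPE('u) (carrier G)},
      arr = \<lambda>G H. hom G H \<inter> extensional (carrier G),
      ident = \<lambda>G. (\<lambda>x\<in>carrier G. x),
      ccomp = \<lambda>G H K g f. compose (carrier G) g f,
      arr_add = \<lambda>G H f g. (\<lambda>x\<in>carrier G. f x \<otimes>\<^bsub>H\<^esub> g x),
      arr_zero = \<lambda>G H. (\<lambda>x\<in>carrier G. \<one>\<^bsub>H\<^esub>)\<rparr>"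

section \<open>Modules\<close>

definition nat_trans ::
  "('o1, 'a1, 'y) cat_scheme \<Rightarrow> ('o2, 'a2, 'z) cat_scheme \<Rightarrow>
   ('o1, 'a1, 'o2, 'a2) cfunctor \<Rightarrow> ('o1, 'a1, 'o2, 'a2) cfunctor \<Rightarrow> ('o1 \<Rightarrow> 'a2) set" where
  "nat_trans C D F G =
     {\<eta> \<in> extensional (obj C).
        (\<forall>X\<in>obj C. \<eta> X \<in> arr D (omap F X) (omap G X)) \<and>
        (\<forall>X\<in>obj C. \<forall>Y\<in>obj C. \<forall>f\<in>arr C X Y.
           ccomp D (omap F X) (omap F Y) (omap G Y) (\<eta> Y) (amap F X Y f) =
           ccomp D (omap F X) (omap G X) (omap G Y) (amap G X Y f) (\<eta> X))}"

definition additive_functors ::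
  "('o1, 'a1) preadd_cat \<Rightarrow> ('o2, 'a2) preadd_cat \<Rightarrow>
   (('o1, 'a1, 'o2, 'a2) cfunctor, 'o1 \<Rightarrow> 'a2) preadd_cat" where
  "additive_functors C D =
     \<lparr>obj = {F. additive_functor C D F},
      arr = nat_trans C D,
      ident = \<lambda>F. (\<lambda>X\<in>obj C. ident D (omap F X)),
      ccomp = \<lambda>F G H \<beta> \<alpha>. (\<lambda>X\<in>obj C. ccomp D (omap F X) (omap G X) (omap H X) (\<beta> X) (\<alpha> X)),
      arr_add = \<lambda>F G \<alpha> \<beta>. (\<lambda>X\<in>obj C. arr_add D (omap F X) (omap G X) (\<alpha> X) (\<beta> X)),
      arr_zero = \<lambda>F G. (\<lambda>X\<in>obj C. arr_zero D (omap F X) (omap G X))\<rparr>"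

type_synonym ('o, 'a, 'u) cmodule = "('o, 'a, 'u monoid, 'u \<Rightarrow> 'u) cfunctor"

definition Mod :: "('o, 'a) preadd_cat \<Rightarrow> (('o, 'a, 'u) cmodule, 'o \<Rightarrow> 'u \<Rightarrow> 'u) preadd_cat" where
  "Mod C = additive_functors (op_cat C) Ab"

text \<open>Restriction of scalars along \<open>f : C \<rightarrow> C'\<close>.\<close>

definition restriction ::
  "('o, 'a) preadd_cat \<Rightarrow> ('o, 'a, 'p, 'b) cfunctor \<Rightarrow>
   (('p, 'b, 'u) cmodule, 'p \<Rightarrow> 'u \<Rightarrow> 'u, ('o, 'a, 'u) cmodule, 'o \<Rightarrow> 'u \<Rightarrow> 'u) cfunctor" where
  "restriction C f =
     \<lparr>omap = \<lambda>M. comp_functor M (op_functor f),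
      amap = \<lambda>M N \<eta>. (\<lambda>X\<in>obj C. \<eta> (omap f X))\<rparr>"

definition preadditive_epi ::
  "'u itself \<Rightarrow> ('o, 'a) preadd_cat \<Rightarrow> ('p, 'b) preadd_cat \<Rightarrow> ('o, 'a, 'p, 'b) cfunctor \<Rightarrow> bool" where
  "preadditive_epi _ C C' f \<longleftrightarrow> additive_functor C C' f \<and>
     fully_faithful
       (Mod C' :: (('p, 'b, 'u) cmodule, 'p \<Rightarrow> 'u \<Rightarrow> 'u) preadd_cat)
       (Mod C :: (('o, 'a, 'u) cmodule, 'o \<Rightarrow> 'u \<Rightarrow> 'u) preadd_cat)
       (restriction C f)"

section \<open>Limits and colimits\<close>

definition is_zero_object :: "('o, 'a, 'z) cat_scheme \<Rightarrow> 'o \<Rightarrow> bool" where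
  "is_zero_object A Z \<longleftrightarrow> Z \<in> obj A \<and>
     (\<forall>X\<in>obj A. (\<exists>!f. f \<in> arr A X Z) \<and> (\<exists>!f. f \<in> arr A Z X))"

definition is_coproduct ::
  "('o, 'a, 'z) cat_scheme \<Rightarrow> 'i set \<Rightarrow> ('i \<Rightarrow> 'o) \<Rightarrow> 'o \<Rightarrow> ('i \<Rightarrow> 'a) \<Rightarrow> bool" where
  "is_coproduct A I X P \<iota> \<longleftrightarrow>
     P \<in> obj A \<and> (\<forall>i\<in>I. X i \<in> obj A \<and> \<iota> i \<in> arr A (X i) P) \<and>
     (\<forall>Y\<in>obj A. \<forall>f. (\<forall>i\<in>I. f i \<in> arr A (X i) Y) \<longrightarrow>
        (\<exists>!h. h \<in> arr A P Y \<and> (\<forall>i\<in>I. ccomp A (X i) P Y h (\<iota> i) = f i)))"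

definition is_product ::
  "('o, 'a, 'z) cat_scheme \<Rightarrow> 'i set \<Rightarrow> ('i \<Rightarrow> 'o) \<Rightarrow> 'o \<Rightarrow> ('i \<Rightarrow> 'a) \<Rightarrow> bool" where
  "is_product A I X P \<pi> \<longleftrightarrow>
     P \<in> obj A \<and> (\<forall>i\<in>I. X i \<in> obj A \<and> \<pi> i \<in> arr A P (X i)) \<and>
     (\<forall>Y\<in>obj A. \<forall>f. (\<forall>i\<in>I. f i \<in> arr A Y (X i)) \<longrightarrow>
        (\<exists>!h. h \<in> arr A Y P \<and> (\<forall>i\<in>I. ccomp A Y P (X i) (\<pi> i) h = f i)))"

definition is_kernel ::
  "('o, 'a, 'z) preadd_cat_scheme \<Rightarrow> 'o \<Rightarrow> 'o \<Rightarrow> 'a \<Rightarrow> 'o \<Rightarrow> 'a \<Rightarrow> bool" where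
  "is_kernel A X Y f K k \<longleftrightarrow>
     K \<in> obj A \<and> k \<in> arr A K X \<and> ccomp A K X Y f k = arr_zero A K Y \<and>
     (\<forall>T\<in>obj A. \<forall>t\<in>arr A T X. ccomp A T X Y f t = arr_zero A T Y \<longrightarrow>
        (\<exists>!h. h \<in> arr A T K \<and> ccomp A T K X k h = t))"

definition is_cokernel ::
  "('o, 'a, 'z) preadd_cat_scheme \<Rightarrow> 'o \<Rightarrow> 'o \<Rightarrow> 'a \<Rightarrow> 'o \<Rightarrow> 'a \<Rightarrow> bool" where
  "is_cokernel A X Y f Q q \<longleftrightarrow>
     Q \<in> obj A \<and> q \<in> arr A Y Q \<and> ccomp A X Y Q q f = arr_zero A X Q \<and>
     (\<forall>T\<in>obj A. \<forall>t\<in>arr A Y T. ccomp A X Y T t f = arr_zero A X T \<longrightarrow>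
        (\<exists>!h. h \<in> arr A Q T \<and> ccomp A Y Q T h q = t))"

section \<open>Subcategories\<close>

text \<open>A (full, isomorphism-closed) subcategory is given by its set of objects.\<close>

definition subcategory :: "('o, 'a, 'z) cat_scheme \<Rightarrow> 'o set \<Rightarrow> bool" where
  "subcategory A B \<longleftrightarrow> B \<subseteq> obj A \<and> (\<forall>X\<in>B. \<forall>Y\<in>obj A. isomorphic A X Y \<longrightarrow> Y \<in> B)"

definition additive_subcategory :: "('o, 'a, 'z) cat_scheme \<Rightarrow> 'o set \<Rightarrow> bool" where
  "additive_subcategory A B \<longleftrightarrow> subcategory A B \<and>
     (\<forall>Z. is_zero_object A Z \<longrightarrow> Z \<in> B) \<and>
     (\<forall>(I :: nat set) X P \<iota>. finite I \<longrightarrow> (\<forall>i\<in>I. X i \<in> B) \<longrightarrow> is_coproduct A I X P \<iota> \<longrightarrow> P \<in> B)"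

definition fully_exact :: "'u itself \<Rightarrow> ('o, 'a, 'z) preadd_cat_scheme \<Rightarrow> 'o set \<Rightarrow> bool" where
  "fully_exact U A B \<longleftrightarrow> subcategory A B \<and>
     (\<forall>X\<in>B. \<forall>Y\<in>B. \<forall>f\<in>arr A X Y. \<forall>K k. is_kernel A X Y f K k \<longrightarrow> K \<in> B) \<and>
     (\<forall>X\<in>B. \<forall>Y\<in>B. \<forall>f\<in>arr A X Y. \<forall>Q q. is_cokernel A X Y f Q q \<longrightarrow> Q \<in> B) \<and>
     (\<forall>(I :: 'u set) X P \<iota>. small U I \<longrightarrow> (\<forall>i\<in>I. X i \<in> B) \<longrightarrow> is_coproduct A I X P \<iota> \<longrightarrow> P \<in> B) \<and>
     (\<forall>(I :: 'u set) X P \<pi>. small U I \<longrightarrow> (\<forall>i\<in>I. X i \<in> B) \<longrightarrow> is_product A I X P \<pi> \<longrightarrow> P \<in> B)"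

definition full_subcat :: "('o, 'a, 'z) cat_scheme \<Rightarrow> 'o set \<Rightarrow> ('o, 'a, 'z) cat_scheme" where
  "full_subcat A B = A\<lparr>obj := B\<rparr>"

definition inclusion :: "('o, 'a, 'o, 'a) cfunctor" where
  "inclusion = \<lparr>omap = \<lambda>X. X, amap = \<lambda>X Y f. f\<rparr>"

definition bireflective :: "('o, 'a, 'z) cat_scheme \<Rightarrow> 'o set \<Rightarrow> bool" where
  "bireflective A B \<longleftrightarrow> subcategory A B \<and>
     (\<exists>L. adjoint_functors A (full_subcat A B) L inclusion) \<and>
     (\<exists>R. adjoint_functors (full_subcat A B) A inclusion R)"

text \<open>
  Every small preadditive category is isomorphic to one whose objects and arrows are elements of
  \<open>'u\<close>, so \<open>C'\<close> may be taken over that type.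
\<close>

definition essential_image_of_epi ::
  "('o, 'a) preadd_cat \<Rightarrow> ('o, 'a, 'u) cmodule set \<Rightarrow>
   ('u, 'u) preadd_cat \<Rightarrow> ('o, 'a, 'u, 'u) cfunctor \<Rightarrow> bool" where
  "essential_image_of_epi C B C' f \<longleftrightarrow>
     preadditive_category C' \<and> small_category TYPE('u) C' \<and>
     preadditive_epi TYPE('u) C C' f \<and>
     B = essential_image (Mod C') (Mod C) (restriction C f)"

end

theory Submission
  imports Defs "HOL-Algebra.FiniteProduct"
begin

text \<open>
  A reflective subcategory is closed under limits, and dually for coreflective ones, so bireflective
  subcategories are fully exact.

  Let \<open>B\<close> be fully exact. The reflection of a module \<open>M\<close> is found by the solution set condition, but \<open>B\<close>
  is not known to be closed under subobjects, so one has to bound the modules \<open>Y\<close> of \<open>B\<close> that have no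
  proper submodule in \<open>B\<close> containing the image of \<open>M\<close>. Since reduced products of members of \<open>B\<close> are in
  \<open>B\<close>, a compactness argument shows that each element of such a \<open>Y\<close> is determined by a finite system of
  linear equations with constants in \<open>M\<close>, and there is only a small set of these systems.

  Let \<open>C'\<close> be the full subcategory of the reflections of the representable modules. Any \<open>C'\<close>-module has
  a presentation by representable modules, which restrict to these reflections; hence restriction along
  \<open>C \<rightarrow> C'\<close> takes values in \<open>B\<close>, and \<open>B\<close> is its essential image. Maps from the reflected representables
  into \<open>M\<close> form a \<open>C'\<close>-module whose restriction is the coreflection of \<open>M\<close>. Conversely, essential
  images of fully faithful restriction functors are fully exact because restriction preserves pointwise
  limits and colimits.
\<close>

section \<open>Small sets\<close>

text \<open>Reduced products stay in \<open>B\<close> because they are cokernels. In a product of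
  members of \<open>B\<close>, the families vanishing on a prescribed set of factors form an
  intersection of kernels, which again lies in \<open>B\<close>; a directed union of such submodules
  is the image of their coproduct, and dividing by it is a cokernel of a map in \<open>B\<close>.

  That a system determines an element is expressed through its homogeneous form: two solutions with
  the same constants differ by a solution with constants zero, so it suffices that the homogeneous
  system forces the chosen variable to vanish in every member of \<open>B\<close>.

  Restriction along \<open>C -> C'\<close> is full because a homomorphism from a reflected
  representable to a member of \<open>B\<close> is known from its value at one element, the image of
  the identity. Linearity over the arrows of \<open>C'\<close> is checked at this element only.

  Products, cosets and homomorphisms serve as elements of modules, so the constructions are carried
  out with elements of any type, and membership in \<open>B\<close> is read up to
  isomorphism.\<close>

lemma small_lepoll: "small U B \<Longrightarrow> A \<lesssim> B \<Longrightarrow> small U A"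
  unfolding small_def by (rule lesspoll_trans1)

lemma small_subset: "small U B \<Longrightarrow> A \<subseteq> B \<Longrightarrow> small U A"
  by (rule small_lepoll[OF _ subset_imp_lepoll])

lemma small_image: "small U A \<Longrightarrow> small U (f ` A)"
  by (rule small_lepoll[OF _ image_lepoll])

lemma small_inj_on: "inj_on f A \<Longrightarrow> f ` A \<subseteq> B \<Longrightarrow> small U B \<Longrightarrow> small U A"
  by (rule small_lepoll) (auto simp: lepoll_def)

lemma small_ex_inj:
  assumes "small (U :: 'u itself) (A :: 'x set)"
  obtains e :: "'x \<Rightarrow> 'u" where "inj_on e A"
  using assms unfolding small_def lesspoll_def lepoll_def by blast

locale universe =
  fixes U :: "'u itself"
  assumes inacc: "inaccessible U"
begin

lemma small_nat: "small U (UNIV :: nat set)"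
  using inacc by (simp add: inaccessible_def)

lemma infinite_universe: "infinite (UNIV :: 'u set)"
  using small_nat infinite_le_lepoll lesspoll_imp_lepoll unfolding small_def by blast

lemma small_finite: "finite A \<Longrightarrow> small U A"
  using infinite_universe unfolding small_def by (simp add: finite_lesspoll_infinite)

text \<open>An infinite set has the same cardinality as its square. Only an injection is kept: it
  pairs codes when dependent sums are embedded in \<open>'u\<close>.\<close>

lemma ex_pairing: "\<exists>p :: 'u \<times> 'u \<Rightarrow> 'u. inj p"
proof -
  have "(card_of (UNIV \<times> UNIV :: ('u \<times> 'u) set), card_of (UNIV :: 'u set)) \<in> ordLeq"
    using card_of_Times_same_infinite[OF infinite_universe] by (rule ordIso_imp_ordLeq)
  then show ?thesis
    unfolding card_of_ordLeq[symmetric] by auto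
qed

lemma small_Pow: assumes "small U A" shows "small U (Pow A)"
proof -
  obtain e :: "_ \<Rightarrow> 'u" where e: "inj_on e A" using small_ex_inj[OF assms] .
  have "small U (Pow (e ` A))"
    using inacc small_image[OF assms] by (auto simp: inaccessible_def)
  then show ?thesis
    by (rule small_inj_on[OF inj_on_image_Pow[OF e], rotated]) auto
qed

lemma small_Sigma:
  assumes I: "small U I" and A: "\<And>i. i \<in> I \<Longrightarrow> small U (A i)"
  shows "small U (Sigma I A)"
proof -
  obtain p :: "'u \<times> 'u \<Rightarrow> 'u" where p: "inj p" using ex_pairing by blast
  obtain e :: "_ \<Rightarrow> 'u" where e: "inj_on e I" using small_ex_inj[OF I] .
  have "\<forall>i\<in>I. \<exists>d :: _ \<Rightarrow> 'u. inj_on d (A i)"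
    by (metis A small_ex_inj)
  then obtain d where d: "\<And>i. i \<in> I \<Longrightarrow> inj_on (d i :: _ \<Rightarrow> 'u) (A i)"
    by metis
  \<comment> \<open>Inaccessibility speaks of families of subsets of \<open>'u\<close> indexed by a
    subset of \<open>'u\<close>. Indices are therefore replaced by their codes \<open>v\<close>, and
    pairing with \<open>v\<close> keeps the copies of different fibres disjoint.\<close>
  define T where "T v = (\<lambda>x. p (v, d (inv_into I e v) x)) ` A (inv_into I e v)" for v
  have *: "small U (\<Union>v\<in>e ` I. T v)"
  proof -
    have "small U (e ` I)" by (rule small_image[OF I])
    moreover have "\<forall>v\<in>e ` I. small U (T v)"
      unfolding T_def by (auto intro!: small_image A simp: e)
    ultimately show ?thesis using inacc unfolding inaccessible_def by blast
  qed
  have inj: "inj_on (\<lambda>(i, x). p (e i, d i x)) (Sigma I A)"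
  proof (rule inj_onI, clarify)
    fix i x j y assume "i \<in> I" "x \<in> A i" "j \<in> I" "y \<in> A j" and eq: "p (e i, d i x) = p (e j, d j y)"
    from injD[OF p eq] have "e i = e j" and dd: "d i x = d j y" by auto
    then have "i = j" using e \<open>i \<in> I\<close> \<open>j \<in> I\<close> by (simp add: inj_onD)
    moreover have "x = y"
      using inj_onD[OF d[OF \<open>i \<in> I\<close>], of x y] dd \<open>x \<in> A i\<close> \<open>y \<in> A j\<close> \<open>i = j\<close> by simp
    ultimately show "i = j \<and> x = y" by simp
  qed
  have sub: "(\<lambda>(i, x). p (e i, d i x)) ` Sigma I A \<subseteq> (\<Union>v\<in>e ` I. T v)"
  proof clarify
    fix i x assume "i \<in> I" "x \<in> A i"
    then have "p (e i, d i x) \<in> T (e i)" unfolding T_def by (simp add: e)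
    then show "p (e i, d i x) \<in> (\<Union>v\<in>e ` I. T v)" using \<open>i \<in> I\<close> by blast
  qed
  show ?thesis by (rule small_inj_on[OF inj sub *])
qed

lemma small_UN:
  assumes "small U I" "\<And>i. i \<in> I \<Longrightarrow> small U (A i)"
  shows "small U (\<Union>i\<in>I. A i)"
proof -
  have "(\<Union>i\<in>I. A i) \<subseteq> snd ` Sigma I A"
  proof
    fix x assume "x \<in> (\<Union>i\<in>I. A i)"
    then obtain i where "(i, x) \<in> Sigma I A" by blast
    then show "x \<in> snd ` Sigma I A" by (rule rev_image_eqI) simp
  qed
  moreover have "small U (snd ` Sigma I A)" by (intro small_image small_Sigma assms)
  ultimately show ?thesis by (rule small_subset[rotated])
qed

lemma small_Times: "small U A \<Longrightarrow> small U B \<Longrightarrow> small U (A \<times> B)"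
  by (rule small_Sigma)

lemma small_Un: assumes "small U A" "small U B" shows "small U (A \<union> B)"
proof -
  have "A \<union> B = (\<Union>b\<in>(UNIV :: bool set). if b then A else B)" by auto
  moreover have "small U (\<Union>b\<in>(UNIV :: bool set). if b then A else B)"
    by (rule small_UN) (auto simp: assms intro: small_finite)
  ultimately show ?thesis by simp
qed

lemma small_insert: "small U A \<Longrightarrow> small U (insert a A)"
  using small_Un[OF small_finite, of "{a}" A] by simp

text \<open>An extensional function is determined by its graph, which is a subset of the dependent
  sum.\<close>

lemma small_PiE:
  assumes "small U I" "\<And>i. i \<in> I \<Longrightarrow> small U (A i)"
  shows "small U (PiE I A)"
proof (rule small_inj_on)
  show "inj_on (\<lambda>f. (\<lambda>i. (i, f i)) ` I) (PiE I A)"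
  proof (rule inj_onI)
    fix f g assume f: "f \<in> PiE I A" and g: "g \<in> PiE I A"
      and eq: "(\<lambda>i. (i, f i)) ` I = (\<lambda>i. (i, g i)) ` I"
    have "f i = g i" if "i \<in> I" for i
    proof -
      have "(i, f i) \<in> (\<lambda>i. (i, g i)) ` I" using eq that by blast
      then show ?thesis by auto
    qed
    then show "f = g" using f g by (auto intro: PiE_ext)
  qed
  show "(\<lambda>f. (\<lambda>i. (i, f i)) ` I) ` PiE I A \<subseteq> Pow (Sigma I A)" by auto
  show "small U (Pow (Sigma I A))" by (intro small_Pow small_Sigma assms)
qed

lemma small_Fpow: "small U A \<Longrightarrow> small U (Fpow A)"
  by (rule small_subset[OF small_Pow]) (auto simp: Fpow_def)

end

section \<open>Modules over a preadditive category\<close>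

abbreviation car :: "('o, 'a, 'x) cmodule \<Rightarrow> 'o \<Rightarrow> 'x set" where
  "car M X \<equiv> carrier (omap M X)"

text \<open>The content of an additive functor from the opposite of \<open>C\<close> to abelian
  groups, but with elements of an arbitrary type \<open>'x\<close> and without conditions of
  smallness or extensionality. Families, cosets and natural transformations occur as elements below,
  and these do not live in \<open>'u\<close>.\<close>

locale cat_module =
  fixes C :: "('o, 'a) preadd_cat" and M :: "('o, 'a, 'x) cmodule"
  assumes grp: "X \<in> obj C \<Longrightarrow> comm_group (omap M X)"
    and act_hom: "\<lbrakk>X \<in> obj C; Y \<in> obj C; a \<in> arr C Y X\<rbrakk> \<Longrightarrow> amap M X Y a \<in> hom (omap M X) (omap M Y)"
    and act_ident: "\<lbrakk>X \<in> obj C; x \<in> car M X\<rbrakk> \<Longrightarrow> amap M X X (ident C X) x = x"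
    and act_comp: "\<lbrakk>X \<in> obj C; Y \<in> obj C; Z \<in> obj C; a \<in> arr C Y X; b \<in> arr C Z Y; x \<in> car M X\<rbrakk>
      \<Longrightarrow> amap M X Z (ccomp C Z Y X a b) x = amap M Y Z b (amap M X Y a x)"
    and act_add: "\<lbrakk>X \<in> obj C; Y \<in> obj C; a \<in> arr C Y X; b \<in> arr C Y X; x \<in> car M X\<rbrakk>
      \<Longrightarrow> amap M X Y (arr_add C Y X a b) x = amap M X Y a x \<otimes>\<^bsub>omap M Y\<^esub> amap M X Y b x"
begin

lemma group [simp]: "X \<in> obj C \<Longrightarrow> group (omap M X)"
  using grp by (simp add: comm_group.axioms)

lemma monoid [simp]: "X \<in> obj C \<Longrightarrow> monoid (omap M X)"
  by (simp add: group.is_monoid)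

lemma one_closed [simp]: "X \<in> obj C \<Longrightarrow> \<one>\<^bsub>omap M X\<^esub> \<in> car M X"
  by (simp add: monoid.one_closed)

lemma mult_closed [simp]: "X \<in> obj C \<Longrightarrow> x \<in> car M X \<Longrightarrow> y \<in> car M X \<Longrightarrow> x \<otimes>\<^bsub>omap M X\<^esub> y \<in> car M X"
  by (simp add: monoid.m_closed)

lemma inv_closed [simp]: "X \<in> obj C \<Longrightarrow> x \<in> car M X \<Longrightarrow> inv\<^bsub>omap M X\<^esub> x \<in> car M X"
  by (simp add: group.inv_closed)

lemma act_closed [simp]:
  "\<lbrakk>X \<in> obj C; Y \<in> obj C; a \<in> arr C Y X; x \<in> car M X\<rbrakk> \<Longrightarrow> amap M X Y a x \<in> car M Y"
  using act_hom by (meson hom_in_carrier)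

lemma act_mult:
  "\<lbrakk>X \<in> obj C; Y \<in> obj C; a \<in> arr C Y X; x \<in> car M X; y \<in> car M X\<rbrakk>
    \<Longrightarrow> amap M X Y a (x \<otimes>\<^bsub>omap M X\<^esub> y) = amap M X Y a x \<otimes>\<^bsub>omap M Y\<^esub> amap M X Y a y"
  using act_hom by (simp add: hom_mult)

lemma act_one [simp]:
  "\<lbrakk>X \<in> obj C; Y \<in> obj C; a \<in> arr C Y X\<rbrakk> \<Longrightarrow> amap M X Y a \<one>\<^bsub>omap M X\<^esub> = \<one>\<^bsub>omap M Y\<^esub>"
  using act_hom by (simp add: hom_one)

lemma act_inv:
  "\<lbrakk>X \<in> obj C; Y \<in> obj C; a \<in> arr C Y X; x \<in> car M X\<rbrakk>
    \<Longrightarrow> amap M X Y a (inv\<^bsub>omap M X\<^esub> x) = inv\<^bsub>omap M Y\<^esub> amap M X Y a x"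
  using group_hom.hom_inv[of "omap M X" "omap M Y" "amap M X Y a" x] act_hom
  by (simp add: group_hom_def group_hom_axioms_def)

lemma inv_one [simp]: "X \<in> obj C \<Longrightarrow> inv\<^bsub>omap M X\<^esub> \<one>\<^bsub>omap M X\<^esub> = \<one>\<^bsub>omap M X\<^esub>"
  by (simp add: monoid.inv_one)

lemma mult_inv_eq_one_iff:
  "\<lbrakk>X \<in> obj C; x \<in> car M X; y \<in> car M X\<rbrakk> \<Longrightarrow> x \<otimes>\<^bsub>omap M X\<^esub> inv\<^bsub>omap M X\<^esub> y = \<one>\<^bsub>omap M X\<^esub> \<longleftrightarrow> x = y"
  by (metis group group.inv_closed group.inv_equality group.inv_inv group.r_inv)

text \<open>In a group only the unit is idempotent. This turns the vanishing of a variable into an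
  addition equation, a kind of equation available in \<open>atom\<close>.\<close>

lemma mult_self_iff:
  "\<lbrakk>X \<in> obj C; x \<in> car M X\<rbrakk> \<Longrightarrow> x \<otimes>\<^bsub>omap M X\<^esub> x = x \<longleftrightarrow> x = \<one>\<^bsub>omap M X\<^esub>"
  by (metis group group.l_cancel_one)

end

definition small_module :: "'u itself \<Rightarrow> ('o, 'a) preadd_cat \<Rightarrow> ('o, 'a, 'x) cmodule \<Rightarrow> bool" where
  "small_module U C M \<longleftrightarrow> (\<forall>X\<in>obj C. small U (car M X))"

text \<open>Source and target may have different types of elements, and values outside the carriers
  are unconstrained.\<close>

definition module_hom ::
  "('o, 'a) preadd_cat \<Rightarrow> ('o, 'a, 'x) cmodule \<Rightarrow> ('o, 'a, 'y) cmodule \<Rightarrow> ('o \<Rightarrow> 'x \<Rightarrow> 'y) \<Rightarrow> bool" where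
  "module_hom C M N h \<longleftrightarrow> (\<forall>X\<in>obj C. h X \<in> hom (omap M X) (omap N X)) \<and>
     (\<forall>X\<in>obj C. \<forall>Y\<in>obj C. \<forall>a\<in>arr C Y X. \<forall>x\<in>car M X.
        h Y (amap M X Y a x) = amap N X Y a (h X x))"

lemma module_homI:
  assumes "\<And>X x. \<lbrakk>X \<in> obj C; x \<in> car M X\<rbrakk> \<Longrightarrow> h X x \<in> car N X"
    and "\<And>X x y. \<lbrakk>X \<in> obj C; x \<in> car M X; y \<in> car M X\<rbrakk>
      \<Longrightarrow> h X (x \<otimes>\<^bsub>omap M X\<^esub> y) = h X x \<otimes>\<^bsub>omap N X\<^esub> h X y"
    and "\<And>X Y a x. \<lbrakk>X \<in> obj C; Y \<in> obj C; a \<in> arr C Y X; x \<in> car M X\<rbrakk>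
      \<Longrightarrow> h Y (amap M X Y a x) = amap N X Y a (h X x)"
  shows "module_hom C M N h"
  using assms unfolding module_hom_def by (auto intro!: homI)

lemma module_hom_closed: "module_hom C M N h \<Longrightarrow> X \<in> obj C \<Longrightarrow> x \<in> car M X \<Longrightarrow> h X x \<in> car N X"
  unfolding module_hom_def by (blast intro: hom_in_carrier)

lemma module_hom_mult:
  "\<lbrakk>module_hom C M N h; X \<in> obj C; x \<in> car M X; y \<in> car M X\<rbrakk>
    \<Longrightarrow> h X (x \<otimes>\<^bsub>omap M X\<^esub> y) = h X x \<otimes>\<^bsub>omap N X\<^esub> h X y"
  unfolding module_hom_def by (blast intro: hom_mult)

lemma module_hom_act:
  "\<lbrakk>module_hom C M N h; X \<in> obj C; Y \<in> obj C; a \<in> arr C Y X; x \<in> car M X\<rbrakk>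
    \<Longrightarrow> h Y (amap M X Y a x) = amap N X Y a (h X x)"
  unfolding module_hom_def by blast

lemma module_hom_one:
  "\<lbrakk>module_hom C M N h; cat_module C M; cat_module C N; X \<in> obj C\<rbrakk> \<Longrightarrow> h X \<one>\<^bsub>omap M X\<^esub> = \<one>\<^bsub>omap N X\<^esub>"
  unfolding module_hom_def by (meson cat_module.group hom_one)

lemma module_hom_inv:
  "\<lbrakk>module_hom C M N h; cat_module C M; cat_module C N; X \<in> obj C; x \<in> car M X\<rbrakk>
    \<Longrightarrow> h X (inv\<^bsub>omap M X\<^esub> x) = inv\<^bsub>omap N X\<^esub> h X x"
  using group_hom.hom_inv[of "omap M X" "omap N X" "h X" x]
  by (simp add: group_hom_def group_hom_axioms_def module_hom_def cat_module.group)

lemma module_hom_id: "module_hom C M M (\<lambda>X x. x)"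
  by (rule module_homI) auto

lemma module_hom_comp:
  "\<lbrakk>module_hom C M N h; module_hom C N P k\<rbrakk> \<Longrightarrow> module_hom C M P (\<lambda>X x. k X (h X x))"
  by (rule module_homI) (simp_all add: module_hom_closed module_hom_mult module_hom_act)

lemma module_hom_cong:
  assumes h: "module_hom C M N h" and M: "cat_module C M"
    and eq: "\<And>X x. \<lbrakk>X \<in> obj C; x \<in> car M X\<rbrakk> \<Longrightarrow> k X x = h X x"
  shows "module_hom C M N k"
proof -
  interpret cat_module C M by (rule M)
  show ?thesis
    by (rule module_homI)
      (simp_all add: eq h module_hom_closed[OF h] module_hom_mult[OF h] module_hom_act[OF h])
qed

lemma module_hom_zero:
  assumes "cat_module C N"
  shows "module_hom C M N (\<lambda>X x. \<one>\<^bsub>omap N X\<^esub>)"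
proof -
  interpret cat_module C N by (rule assms)
  show ?thesis by (rule module_homI) simp_all
qed

lemma module_hom_diff:
  assumes "cat_module C N" "module_hom C M N h" "module_hom C M N k"
  shows "module_hom C M N (\<lambda>X x. h X x \<otimes>\<^bsub>omap N X\<^esub> inv\<^bsub>omap N X\<^esub> k X x)"
proof -
  interpret cat_module C N by (rule assms)
  note * = module_hom_closed[OF assms(2)] module_hom_closed[OF assms(3)]
  show ?thesis
  proof (rule module_homI)
    fix X x y assume X: "X \<in> obj C" and x: "x \<in> car M X" and y: "y \<in> car M X"
    interpret G: comm_group "omap N X" by (rule grp[OF X])
    show "h X (x \<otimes>\<^bsub>omap M X\<^esub> y) \<otimes>\<^bsub>omap N X\<^esub> inv\<^bsub>omap N X\<^esub> k X (x \<otimes>\<^bsub>omap M X\<^esub> y) =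
       h X x \<otimes>\<^bsub>omap N X\<^esub> inv\<^bsub>omap N X\<^esub> k X x \<otimes>\<^bsub>omap N X\<^esub> (h X y \<otimes>\<^bsub>omap N X\<^esub> inv\<^bsub>omap N X\<^esub> k X y)"
      using X x y * by (simp add: module_hom_mult[OF assms(2)] module_hom_mult[OF assms(3)]
          G.inv_mult G.m_ac)
  qed (use * in \<open>simp_all add: act_mult act_inv module_hom_act[OF assms(2)] module_hom_act[OF assms(3)]\<close>)
qed

definition module_iso ::
  "('o, 'a) preadd_cat \<Rightarrow> ('o, 'a, 'x) cmodule \<Rightarrow> ('o, 'a, 'y) cmodule \<Rightarrow> ('o \<Rightarrow> 'x \<Rightarrow> 'y) \<Rightarrow> bool" where
  "module_iso C M N h \<longleftrightarrow> module_hom C M N h \<and> (\<forall>X\<in>obj C. bij_betw (h X) (car M X) (car N X))"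

lemma module_iso_id: "module_iso C M M (\<lambda>X x. x)"
  unfolding module_iso_def by (auto simp: module_hom_id bij_betw_def inj_on_def)

lemma module_iso_comp:
  assumes h: "module_iso C M N h" and k: "module_iso C N P k"
  shows "module_iso C M P (\<lambda>X x. k X (h X x))"
  unfolding module_iso_def
proof (intro conjI ballI)
  show "module_hom C M P (\<lambda>X x. k X (h X x))"
    using h k unfolding module_iso_def by (blast intro: module_hom_comp)
  fix X assume "X \<in> obj C"
  then have "bij_betw (h X) (car M X) (car N X)" "bij_betw (k X) (car N X) (car P X)"
    using h k by (simp_all add: module_iso_def)
  from bij_betw_trans[OF this] show "bij_betw (\<lambda>x. k X (h X x)) (car M X) (car P X)"
    by (simp add: comp_def)
qed

lemma module_iso_inverse:
  assumes M: "cat_module C M" and h: "module_iso C M N h"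
  obtains k where "module_iso C N M k"
    and "\<And>X x. X \<in> obj C \<Longrightarrow> x \<in> car M X \<Longrightarrow> k X (h X x) = x"
    and "\<And>X x. X \<in> obj C \<Longrightarrow> x \<in> car N X \<Longrightarrow> h X (k X x) = x"
proof -
  interpret cat_module C M by (rule M)
  from h have hh: "module_hom C M N h" and bij: "\<And>X. X \<in> obj C \<Longrightarrow> bij_betw (h X) (car M X) (car N X)"
    by (auto simp: module_iso_def)
  define k where "k X = inv_into (car M X) (h X)" for X
  have kh: "k X (h X x) = x" if "X \<in> obj C" "x \<in> car M X" for X x
    unfolding k_def using bij[OF that(1)] that(2) by (simp add: bij_betw_def)
  have hk: "h X (k X x) = x" if "X \<in> obj C" "x \<in> car N X" for X x
    unfolding k_def using bij[OF that(1)] that(2) by (simp add: bij_betw_def f_inv_into_f)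
  have kb: "bij_betw (k X) (car N X) (car M X)" if "X \<in> obj C" for X
    unfolding k_def using bij[OF that] by (rule bij_betw_inv_into)
  have kc: "k X x \<in> car M X" if "X \<in> obj C" "x \<in> car N X" for X x
    using kb[OF that(1)] that(2) by (rule bij_betwE[THEN bspec])
  have "module_hom C N M k"
  proof (rule module_homI)
    fix X x y assume *: "X \<in> obj C" "x \<in> car N X" "y \<in> car N X"
    have "h X (k X x \<otimes>\<^bsub>omap M X\<^esub> k X y) = x \<otimes>\<^bsub>omap N X\<^esub> y"
      using * by (simp add: module_hom_mult[OF hh] kc hk)
    then show "k X (x \<otimes>\<^bsub>omap N X\<^esub> y) = k X x \<otimes>\<^bsub>omap M X\<^esub> k X y"
      using kh[OF *(1) mult_closed[OF *(1) kc[OF *(1,2)] kc[OF *(1,3)]]] by simp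
  next
    fix X Y a x assume *: "X \<in> obj C" "Y \<in> obj C" "a \<in> arr C Y X" "x \<in> car N X"
    have "h Y (amap M X Y a (k X x)) = amap N X Y a x"
      using * by (simp add: module_hom_act[OF hh] kc hk)
    then show "k Y (amap N X Y a x) = amap M X Y a (k X x)"
      using kh[OF *(2) act_closed[OF *(1-3) kc[OF *(1,4)]]] by simp
  qed (simp add: kc)
  then have "module_iso C N M k" using kb by (simp add: module_iso_def)
  then show thesis using kh hk that by blast
qed

section \<open>The category of modules\<close>

lemma (in preadditive_category) arr_add_closed:
  assumes "X \<in> obj C" "Y \<in> obj C" "f \<in> arr C X Y" "g \<in> arr C X Y"
  shows "arr_add C X Y f g \<in> arr C X Y"
proof -
  interpret G: comm_group "arr_group C X Y" using assms(1,2) by (rule arr_comm_group)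
  show ?thesis using G.m_closed[of f g] assms by (simp add: arr_group_def)
qed

lemma small_moduleD: "small_module U C M \<Longrightarrow> X \<in> obj C \<Longrightarrow> small U (car M X)"
  by (simp add: small_module_def)

lemma obj_ModD:
  fixes M :: "('o, 'a, 'u) cmodule"
  assumes "M \<in> obj (Mod C)"
  shows "cat_module C M" "small_module TYPE('u) C M"
    "\<lbrakk>X \<in> obj C; Y \<in> obj C; a \<in> arr C Y X\<rbrakk> \<Longrightarrow> amap M X Y a \<in> extensional (car M X)"
proof -
  have af: "additive_functor (op_cat C) Ab M" using assms by (simp add: Mod_def additive_functors_def)
  then show "small_module TYPE('u) C M"
    "\<lbrakk>X \<in> obj C; Y \<in> obj C; a \<in> arr C Y X\<rbrakk> \<Longrightarrow> amap M X Y a \<in> extensional (car M X)"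
    by (auto simp: additive_functor_def is_functor_def op_cat_def Ab_def small_module_def)
  show "cat_module C M"
  proof (rule cat_module.intro)
    fix X Y Z a b x assume *: "X \<in> obj C" "Y \<in> obj C" "Z \<in> obj C" "a \<in> arr C Y X" "b \<in> arr C Z Y" "x \<in> car M X"
    have "amap M X Z (ccomp C Z Y X a b) = compose (car M X) (amap M Y Z b) (amap M X Y a)"
      using af * by (simp add: additive_functor_def is_functor_def op_cat_def Ab_def)
    then show "amap M X Z (ccomp C Z Y X a b) x = amap M Y Z b (amap M X Y a x)"
      using * by (simp add: compose_eq)
  qed (use af in \<open>auto simp: additive_functor_def is_functor_def op_cat_def Ab_def\<close>)
qed

lemma obj_ModI:
  fixes M :: "('o, 'a, 'u) cmodule" and C' :: "('o, 'a) preadd_cat"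
  assumes C': "preadditive_category C'"
    and M: "cat_module C' M" and small: "small_module TYPE('u) C' M"
    and ext: "\<And>X Y a. \<lbrakk>X \<in> obj C'; Y \<in> obj C'; a \<in> arr C' Y X\<rbrakk> \<Longrightarrow> amap M X Y a \<in> extensional (car M X)"
  shows "M \<in> obj (Mod C')"
proof -
  interpret C': preadditive_category C' by (rule C')
  interpret cat_module C' M by (rule M)
  have small': "\<And>X. X \<in> obj C' \<Longrightarrow> small TYPE('u) (car M X)"
    using small by (simp add: small_module_def)
  have 1: "amap M X X (ident C' X) = (\<lambda>x\<in>car M X. x)" if "X \<in> obj C'" for X
    by (rule extensionalityI[of _ "car M X"]) (use that in \<open>simp_all add: ext act_ident C'.ident_arr\<close>)
  have 2: "amap M X Z (ccomp C' Z Y X a b) = compose (car M X) (amap M Y Z b) (amap M X Y a)"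
    if "X \<in> obj C'" "Y \<in> obj C'" "Z \<in> obj C'" "a \<in> arr C' Y X" "b \<in> arr C' Z Y" for X Y Z a b
    by (rule extensionalityI[of _ "car M X"])
      (use that in \<open>simp_all add: ext act_comp compose_eq C'.comp_arr\<close>)
  have 3: "amap M X Y (arr_add C' Y X a b) = (\<lambda>x\<in>car M X. amap M X Y a x \<otimes>\<^bsub>omap M Y\<^esub> amap M X Y b x)"
    if "X \<in> obj C'" "Y \<in> obj C'" "a \<in> arr C' Y X" "b \<in> arr C' Y X" for X Y a b
  proof (rule extensionalityI[of _ "car M X"])
    have "arr_add C' Y X a b \<in> arr C' Y X" using that by (intro C'.arr_add_closed)
    then show "amap M X Y (arr_add C' Y X a b) \<in> extensional (car M X)"
      using that by (simp add: ext)
  qed (use that in \<open>simp_all add: act_add\<close>)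
  show ?thesis
    unfolding Mod_def additive_functors_def additive_functor_def is_functor_def
    by (simp add: op_cat_def Ab_def grp small' act_hom ext 1 2 3)
qed

text \<open>Arrows of \<open>Mod C\<close> are extensional both in the object and in the element;
  cutting a homomorphism down in both arguments yields the arrow it represents.\<close>

definition mod_arr ::
  "('o, 'a) preadd_cat \<Rightarrow> ('o, 'a, 'u) cmodule \<Rightarrow> ('o \<Rightarrow> 'u \<Rightarrow> 'u) \<Rightarrow> ('o \<Rightarrow> 'u \<Rightarrow> 'u)" where
  "mod_arr C M h = (\<lambda>X\<in>obj C. \<lambda>x\<in>car M X. h X x)"

lemma mod_arr_apply [simp]: "X \<in> obj C \<Longrightarrow> x \<in> car M X \<Longrightarrow> mod_arr C M h X x = h X x"
  by (simp add: mod_arr_def)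

lemma arr_Mod_iff:
  fixes M N :: "('o, 'a, 'u) cmodule"
  assumes M: "M \<in> obj (Mod C)" and N: "N \<in> obj (Mod C)"
  shows "h \<in> arr (Mod C) M N \<longleftrightarrow>
    module_hom C M N h \<and> h \<in> extensional (obj C) \<and> (\<forall>X\<in>obj C. h X \<in> extensional (car M X))"
proof -
  interpret M: cat_module C M by (rule obj_ModD[OF M])
  interpret N: cat_module C N by (rule obj_ModD[OF N])
  have "(\<forall>x\<in>car M X. h Y (amap M X Y a x) = amap N X Y a (h X x)) \<longleftrightarrow>
     compose (car M X) (h Y) (amap M X Y a) = compose (car M X) (amap N X Y a) (h X)"
    if "X \<in> obj C" "Y \<in> obj C" "a \<in> arr C Y X" for X Y a
    by (auto simp: compose_def fun_eq_iff restrict_def split: if_splits)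
  then show ?thesis
    unfolding Mod_def additive_functors_def nat_trans_def module_hom_def
    by (auto simp: op_cat_def Ab_def)
qed

lemma arr_Mod_hom:
  "\<lbrakk>M \<in> obj (Mod C); N \<in> obj (Mod C); h \<in> arr (Mod C) M N\<rbrakk> \<Longrightarrow> module_hom C M N h"
  by (simp add: arr_Mod_iff)

lemma mod_arr_in:
  assumes "M \<in> obj (Mod C)" "N \<in> obj (Mod C)" "module_hom C M N h"
  shows "mod_arr C M h \<in> arr (Mod C) M N"
  unfolding arr_Mod_iff[OF assms(1,2)]
  by (auto simp: mod_arr_def intro!: module_hom_cong[OF assms(3)] obj_ModD[OF assms(1)])

lemma mod_arr_cong:
  "(\<And>X x. \<lbrakk>X \<in> obj C; x \<in> car M X\<rbrakk> \<Longrightarrow> h X x = k X x) \<Longrightarrow> mod_arr C M h = mod_arr C M k"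
  by (auto simp: mod_arr_def fun_eq_iff restrict_def)

lemma arr_Mod_eqI:
  assumes "M \<in> obj (Mod C)" "N \<in> obj (Mod C)" "N' \<in> obj (Mod C)"
    and "h \<in> arr (Mod C) M N" "k \<in> arr (Mod C) M N'"
    and "\<And>X x. \<lbrakk>X \<in> obj C; x \<in> car M X\<rbrakk> \<Longrightarrow> h X x = k X x"
  shows "h = k"
proof (rule extensionalityI[of _ "obj C"])
  show "h X = k X" if "X \<in> obj C" for X
    by (rule extensionalityI[of _ "car M X"])
      (use that assms in \<open>auto simp: arr_Mod_iff\<close>)
qed (use assms in \<open>auto simp: arr_Mod_iff\<close>)

lemma ccomp_Mod: "ccomp (Mod C) M N P g f = mod_arr C M (\<lambda>X x. g X (f X x))"
  by (auto simp: Mod_def additive_functors_def op_cat_def Ab_def mod_arr_def compose_def)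

lemma ident_Mod: "ident (Mod C) M = mod_arr C M (\<lambda>X x. x)"
  by (auto simp: Mod_def additive_functors_def op_cat_def Ab_def mod_arr_def)

lemma arr_add_Mod: "arr_add (Mod C) M N f g = mod_arr C M (\<lambda>X x. f X x \<otimes>\<^bsub>omap N X\<^esub> g X x)"
  by (auto simp: Mod_def additive_functors_def op_cat_def Ab_def mod_arr_def)

lemma arr_zero_Mod: "arr_zero (Mod C) M N = mod_arr C M (\<lambda>X x. \<one>\<^bsub>omap N X\<^esub>)"
  by (auto simp: Mod_def additive_functors_def op_cat_def Ab_def mod_arr_def)

lemma module_hom_add:
  assumes "cat_module C M" "cat_module C N" "module_hom C M N h" "module_hom C M N k"
  shows "module_hom C M N (\<lambda>X x. h X x \<otimes>\<^bsub>omap N X\<^esub> k X x)"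
proof -
  interpret M: cat_module C M by (rule assms)
  interpret N: cat_module C N by (rule assms)
  note * = module_hom_closed[OF assms(3)] module_hom_closed[OF assms(4)]
  show ?thesis
  proof (rule module_homI)
    fix X x y assume X: "X \<in> obj C" and x: "x \<in> car M X" and y: "y \<in> car M X"
    interpret G: comm_group "omap N X" by (rule N.grp[OF X])
    show "h X (x \<otimes>\<^bsub>omap M X\<^esub> y) \<otimes>\<^bsub>omap N X\<^esub> k X (x \<otimes>\<^bsub>omap M X\<^esub> y) =
       h X x \<otimes>\<^bsub>omap N X\<^esub> k X x \<otimes>\<^bsub>omap N X\<^esub> (h X y \<otimes>\<^bsub>omap N X\<^esub> k X y)"
      using X x y * by (simp add: module_hom_mult[OF assms(3)] module_hom_mult[OF assms(4)] G.m_ac)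
  qed (use * in \<open>simp_all add: N.act_mult module_hom_act[OF assms(3)] module_hom_act[OF assms(4)]\<close>)
qed

lemma module_hom_mod_arr:
  "\<lbrakk>cat_module C M; module_hom C M N h\<rbrakk> \<Longrightarrow> module_hom C M N (mod_arr C M h)"
  by (rule module_hom_cong) simp_all

lemma preadditive_Mod:
  fixes C :: "('o, 'a) preadd_cat"
  shows "preadditive_category (Mod C :: (('o, 'a, 'u) cmodule, 'o \<Rightarrow> 'u \<Rightarrow> 'u) preadd_cat)"
    (is "preadditive_category ?A")
proof -
  have comp: "ccomp ?A M N P g f \<in> arr ?A M P"
    if "M \<in> obj ?A" "N \<in> obj ?A" "P \<in> obj ?A" "f \<in> arr (Mod C) M N" "g \<in> arr (Mod C) N P" for M N P f g
    unfolding ccomp_Mod using that by (blast intro: mod_arr_in module_hom_comp arr_Mod_hom)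
  have closed: "f X x \<in> car N X"
    if "M \<in> obj ?A" "N \<in> obj ?A" "f \<in> arr (Mod C) M N" "X \<in> obj C" "x \<in> car M X" for M N f X x
    using arr_Mod_hom[OF that(1-3)] that(4,5) by (rule module_hom_closed)
  have ident: "ident ?A M \<in> arr ?A M M" if "M \<in> obj ?A" for M
    unfolding ident_Mod by (rule mod_arr_in[OF that that module_hom_id])
  have add: "arr_add ?A M N f g \<in> arr ?A M N"
    if "M \<in> obj ?A" "N \<in> obj ?A" "f \<in> arr (Mod C) M N" "g \<in> arr (Mod C) M N" for M N f g
    unfolding arr_add_Mod using that
    by (intro mod_arr_in module_hom_add obj_ModD arr_Mod_hom)
  have zero: "arr_zero ?A M N \<in> arr ?A M N" if "M \<in> obj ?A" "N \<in> obj ?A" for M N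
    unfolding arr_zero_Mod using that by (intro mod_arr_in module_hom_zero obj_ModD)
  show ?thesis
  proof (intro preadditive_category.intro category.intro preadditive_category_axioms.intro)
    fix M N assume M: "M \<in> obj ?A" and N: "N \<in> obj ?A"
    interpret N: cat_module C N by (rule obj_ModD[OF N])
    show "comm_group (arr_group ?A M N)"
    proof (rule comm_groupI; simp add: arr_group_def)
      fix f assume f: "f \<in> arr ?A M N"
      \<comment> \<open>The additive inverse is written as zero minus \<open>f\<close>, so that
        closure under differences already provides it.\<close>
      have "module_hom C M N (\<lambda>X x. \<one>\<^bsub>omap N X\<^esub> \<otimes>\<^bsub>omap N X\<^esub> inv\<^bsub>omap N X\<^esub> f X x)"
        by (intro module_hom_diff module_hom_zero obj_ModD[OF N] arr_Mod_hom[OF M N f])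
      then have "mod_arr C M (\<lambda>X x. \<one>\<^bsub>omap N X\<^esub> \<otimes>\<^bsub>omap N X\<^esub> inv\<^bsub>omap N X\<^esub> f X x) \<in> arr ?A M N" (is "?k \<in> _")
        by (rule mod_arr_in[OF M N])
      moreover have "arr_add ?A M N ?k f = arr_zero ?A M N"
        unfolding arr_add_Mod arr_zero_Mod
        by (rule mod_arr_cong) (simp add: closed[OF M N f] group.l_inv monoid.l_one)
      ultimately show "\<exists>k\<in>arr ?A M N. arr_add ?A M N k f = arr_zero ?A M N" by blast
      show "arr_add ?A M N (arr_zero ?A M N) f = f"
        by (rule arr_Mod_eqI[OF M N N add[OF M N zero[OF M N] f] f])
          (simp add: arr_add_Mod arr_zero_Mod closed[OF M N f] monoid.l_one)
      fix g assume g: "g \<in> arr ?A M N"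
      show "arr_add ?A M N f g \<in> arr ?A M N" by (rule add[OF M N f g])
      show "arr_add ?A M N f g = arr_add ?A M N g f"
        unfolding arr_add_Mod
        by (rule mod_arr_cong)
          (simp add: closed[OF M N f] closed[OF M N g] comm_monoid.m_comm comm_group.axioms(1) N.grp)
      fix h assume h: "h \<in> arr ?A M N"
      show "arr_add ?A M N (arr_add ?A M N f g) h = arr_add ?A M N f (arr_add ?A M N g h)"
        unfolding arr_add_Mod
        by (rule mod_arr_cong)
          (simp add: closed[OF M N f] closed[OF M N g] closed[OF M N h] monoid.m_assoc)
    next
      show "arr_zero ?A M N \<in> arr ?A M N" by (rule zero[OF M N])
    qed
  next
    fix M N P f g assume *: "M \<in> obj ?A" "N \<in> obj ?A" "P \<in> obj ?A" "f \<in> arr ?A M N" "g \<in> arr ?A N P"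
    then show "ccomp ?A M N P g f \<in> arr ?A M P" by (rule comp)
  next
    fix M N f assume *: "M \<in> obj ?A" "N \<in> obj ?A" "f \<in> arr ?A M N"
    have i: "ident ?A M \<in> arr ?A M M" "ident ?A N \<in> arr ?A N N"
      using * ident by auto
    show "ccomp ?A M M N f (ident ?A M) = f"
      by (rule arr_Mod_eqI[OF *(1,2,2) comp[OF *(1,1,2) i(1) *(3)] *(3)])
        (simp add: ccomp_Mod ident_Mod)
    show "ccomp ?A M N N (ident ?A N) f = f"
      by (rule arr_Mod_eqI[OF *(1,2,2) comp[OF *(1,2,2) *(3) i(2)] *(3)])
        (simp add: ccomp_Mod ident_Mod closed[OF *])
  next
    fix M N P Q f g h
    assume *: "M \<in> obj ?A" "N \<in> obj ?A" "P \<in> obj ?A" "Q \<in> obj ?A"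
      "f \<in> arr ?A M N" "g \<in> arr ?A N P" "h \<in> arr ?A P Q"
    show "ccomp ?A M P Q h (ccomp ?A M N P g f) = ccomp ?A M N Q (ccomp ?A N P Q h g) f"
      unfolding ccomp_Mod by (rule mod_arr_cong) (simp add: closed[OF *(1,2,5)])
  next
    fix M N P f f' g
    assume *: "M \<in> obj ?A" "N \<in> obj ?A" "P \<in> obj ?A" "f \<in> arr ?A M N" "f' \<in> arr ?A M N" "g \<in> arr ?A N P"
    show "ccomp ?A M N P g (arr_add ?A M N f f') = arr_add ?A M P (ccomp ?A M N P g f) (ccomp ?A M N P g f')"
      unfolding ccomp_Mod arr_add_Mod
      by (rule mod_arr_cong)
        (simp add: closed[OF *(1,2,4)] closed[OF *(1,2,5)] module_hom_mult[OF arr_Mod_hom[OF *(2,3,6)]])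
  next
    fix M N P f g g'
    assume *: "M \<in> obj ?A" "N \<in> obj ?A" "P \<in> obj ?A" "f \<in> arr ?A M N" "g \<in> arr ?A N P" "g' \<in> arr ?A N P"
    show "ccomp ?A M N P (arr_add ?A N P g g') f = arr_add ?A M P (ccomp ?A M N P g f) (ccomp ?A M N P g' f)"
      unfolding ccomp_Mod arr_add_Mod
      by (rule mod_arr_cong) (simp add: closed[OF *(1,2,4)])
  qed (rule ident)
qed

text \<open>The inverse of a bijective homomorphism is a homomorphism, so bijectivity at each object
  suffices. Unlike \<open>isomorphic\<close>, the right-hand notion also makes sense between modules
  with different types of elements.\<close>

lemma isomorphic_Mod_iff:
  fixes M N :: "('o, 'a, 'u) cmodule"
  assumes M: "M \<in> obj (Mod C)" and N: "N \<in> obj (Mod C)"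
  shows "isomorphic (Mod C) M N \<longleftrightarrow> (\<exists>h. module_iso C M N h)"
proof
  assume "isomorphic (Mod C) M N"
  then obtain f g where f: "f \<in> arr (Mod C) M N" and g: "g \<in> arr (Mod C) N M"
    and gf: "ccomp (Mod C) M N M g f = ident (Mod C) M" and fg: "ccomp (Mod C) N M N f g = ident (Mod C) N"
    unfolding isomorphic_def by blast
  have 1: "g X (f X x) = x" if "X \<in> obj C" "x \<in> car M X" for X x
    using fun_cong[OF fun_cong[OF gf, of X], of x] that by (simp add: ccomp_Mod ident_Mod)
  have 2: "f X (g X x) = x" if "X \<in> obj C" "x \<in> car N X" for X x
    using fun_cong[OF fun_cong[OF fg, of X], of x] that by (simp add: ccomp_Mod ident_Mod)
  have "module_iso C M N f"
    unfolding module_iso_def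
  proof (intro conjI ballI)
    show "bij_betw (f X) (car M X) (car N X)" if "X \<in> obj C" for X
      by (rule bij_betw_byWitness[of _ "g X"])
        (use that 1 2 module_hom_closed[OF arr_Mod_hom[OF M N f]]
          module_hom_closed[OF arr_Mod_hom[OF N M g]] in auto)
  qed (rule arr_Mod_hom[OF M N f])
  then show "\<exists>h. module_iso C M N h" by blast
next
  assume "\<exists>h. module_iso C M N h"
  then obtain h where h: "module_iso C M N h" by blast
  obtain k where k: "module_iso C N M k"
    and kh: "\<And>X x. X \<in> obj C \<Longrightarrow> x \<in> car M X \<Longrightarrow> k X (h X x) = x"
    and hk: "\<And>X x. X \<in> obj C \<Longrightarrow> x \<in> car N X \<Longrightarrow> h X (k X x) = x"
    using module_iso_inverse[OF obj_ModD(1)[OF M] h] by blast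
  have hh: "module_hom C M N h" and kk: "module_hom C N M k"
    using h k by (auto simp: module_iso_def)
  show "isomorphic (Mod C) M N"
    unfolding isomorphic_def
  proof (intro bexI conjI)
    show "mod_arr C M h \<in> arr (Mod C) M N" by (rule mod_arr_in[OF M N hh])
    show "mod_arr C N k \<in> arr (Mod C) N M" by (rule mod_arr_in[OF N M kk])
    show "ccomp (Mod C) M N M (mod_arr C N k) (mod_arr C M h) = ident (Mod C) M"
      unfolding ccomp_Mod ident_Mod
      by (rule mod_arr_cong) (simp add: module_hom_closed[OF hh] kh)
    show "ccomp (Mod C) N M N (mod_arr C M h) (mod_arr C N k) = ident (Mod C) N"
      unfolding ccomp_Mod ident_Mod
      by (rule mod_arr_cong) (simp add: module_hom_closed[OF kk] hk)
  qed
qed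

section \<open>Submodules, quotients, products and coproducts\<close>

text \<open>Pairs of an object and an element: a submodule is a single set, so that inclusions,
  intersections and cardinality bounds are those of sets.\<close>

definition submodule :: "('o, 'a) preadd_cat \<Rightarrow> ('o, 'a, 'x) cmodule \<Rightarrow> ('o \<times> 'x) set \<Rightarrow> bool" where
  "submodule C M S \<longleftrightarrow> S \<subseteq> Sigma (obj C) (car M) \<and>
     (\<forall>X\<in>obj C. (X, \<one>\<^bsub>omap M X\<^esub>) \<in> S) \<and>
     (\<forall>X x y. (X, x) \<in> S \<longrightarrow> (X, y) \<in> S \<longrightarrow> (X, x \<otimes>\<^bsub>omap M X\<^esub> y) \<in> S) \<and>
     (\<forall>X x. (X, x) \<in> S \<longrightarrow> (X, inv\<^bsub>omap M X\<^esub> x) \<in> S) \<and>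
     (\<forall>X x. \<forall>Y\<in>obj C. \<forall>a\<in>arr C Y X. (X, x) \<in> S \<longrightarrow> (Y, amap M X Y a x) \<in> S)"

definition subm :: "('o, 'a, 'x) cmodule \<Rightarrow> ('o \<times> 'x) set \<Rightarrow> ('o, 'a, 'x) cmodule" where
  "subm M S = \<lparr>omap = \<lambda>X. (omap M X)\<lparr>carrier := S `` {X}\<rparr>, amap = amap M\<rparr>"

lemma subm_simps [simp]:
  "x \<in> car (subm M S) X \<longleftrightarrow> (X, x) \<in> S"
  "mult (omap (subm M S) X) = mult (omap M X)"
  "one (omap (subm M S) X) = one (omap M X)"
  "amap (subm M S) = amap M"
  by (simp_all add: subm_def)

lemma submoduleD:
  assumes "submodule C M S"
  shows "(X, x) \<in> S \<Longrightarrow> X \<in> obj C" "(X, x) \<in> S \<Longrightarrow> x \<in> car M X"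
    "X \<in> obj C \<Longrightarrow> (X, \<one>\<^bsub>omap M X\<^esub>) \<in> S"
    "(X, x) \<in> S \<Longrightarrow> (X, y) \<in> S \<Longrightarrow> (X, x \<otimes>\<^bsub>omap M X\<^esub> y) \<in> S"
    "(X, x) \<in> S \<Longrightarrow> (X, inv\<^bsub>omap M X\<^esub> x) \<in> S"
    "(X, x) \<in> S \<Longrightarrow> Y \<in> obj C \<Longrightarrow> a \<in> arr C Y X \<Longrightarrow> (Y, amap M X Y a x) \<in> S"
  using assms unfolding submodule_def by blast+

lemma cat_module_subm:
  assumes M: "cat_module C M" and S: "submodule C M S"
  shows "cat_module C (subm M S)"
proof -
  interpret cat_module C M by (rule M)
  note SD = submoduleD[OF S]
  show ?thesis
  proof (rule cat_module.intro)
    fix X assume X: "X \<in> obj C"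
    interpret G: comm_group "omap M X" by (rule grp[OF X])
    show "comm_group (omap (subm M S) X)"
    proof (rule comm_groupI, simp_all add: SD X)
      fix x y z assume "(X, x) \<in> S" "(X, y) \<in> S" "(X, z) \<in> S"
      then have x: "x \<in> car M X" "y \<in> car M X" "z \<in> car M X" using SD by blast+
      then show "x \<otimes>\<^bsub>omap M X\<^esub> y \<otimes>\<^bsub>omap M X\<^esub> z = x \<otimes>\<^bsub>omap M X\<^esub> (y \<otimes>\<^bsub>omap M X\<^esub> z)"
        by (rule G.m_assoc)
    next
      fix x y assume "(X, x) \<in> S" "(X, y) \<in> S"
      then have x: "x \<in> car M X" "y \<in> car M X" using SD by blast+
      then show "x \<otimes>\<^bsub>omap M X\<^esub> y = y \<otimes>\<^bsub>omap M X\<^esub> x" by (rule G.m_comm)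
    next
      fix x assume x: "(X, x) \<in> S"
      then have "x \<in> car M X" using SD by blast
      then show "\<exists>y\<in>car (subm M S) X. y \<otimes>\<^bsub>omap M X\<^esub> x = \<one>\<^bsub>omap M X\<^esub>"
        using SD(5)[OF x] G.l_inv by (intro bexI[of _ "inv\<^bsub>omap M X\<^esub> x"]) auto
    qed
  next
    fix X Y a assume "X \<in> obj C" "Y \<in> obj C" "a \<in> arr C Y X"
    then show "amap (subm M S) X Y a \<in> hom (omap (subm M S) X) (omap (subm M S) Y)"
      by (intro homI) (auto simp: SD act_mult)
  qed (auto simp: SD act_ident act_comp act_add)
qed

lemma subm_incl: "submodule C M S \<Longrightarrow> module_hom C (subm M S) M (\<lambda>X x. x)"
  by (rule module_homI) (auto dest: submoduleD)

lemma module_hom_into_subm: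
  "\<lbrakk>module_hom C N M h; \<And>X x. \<lbrakk>X \<in> obj C; x \<in> car N X\<rbrakk> \<Longrightarrow> (X, h X x) \<in> S\<rbrakk>
    \<Longrightarrow> module_hom C N (subm M S) h"
  by (rule module_homI) (auto simp: module_hom_mult module_hom_act)

lemma module_hom_from_subm:
  "module_hom C M N h \<Longrightarrow> submodule C M S \<Longrightarrow> module_hom C (subm M S) N h"
  by (rule module_hom_comp[OF subm_incl])

lemma submodule_full: "cat_module C M \<Longrightarrow> submodule C M (Sigma (obj C) (car M))"
  unfolding submodule_def by (auto simp: cat_module.one_closed cat_module.mult_closed
    cat_module.inv_closed cat_module.act_closed)

definition kerm :: "('o, 'a) preadd_cat \<Rightarrow> ('o, 'a, 'x) cmodule \<Rightarrow> ('o, 'a, 'y) cmodule \<Rightarrow>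
    ('o \<Rightarrow> 'x \<Rightarrow> 'y) \<Rightarrow> ('o \<times> 'x) set" where
  "kerm C M N h = {(X, x). X \<in> obj C \<and> x \<in> car M X \<and> h X x = \<one>\<^bsub>omap N X\<^esub>}"

definition imm :: "('o, 'a) preadd_cat \<Rightarrow> ('o, 'a, 'x) cmodule \<Rightarrow> ('o \<Rightarrow> 'x \<Rightarrow> 'y) \<Rightarrow> ('o \<times> 'y) set" where
  "imm C M h = (SIGMA X:obj C. h X ` car M X)"

lemma submodule_kerm:
  assumes M: "cat_module C M" and N: "cat_module C N" and h: "module_hom C M N h"
  shows "submodule C M (kerm C M N h)"
proof -
  interpret M: cat_module C M by (rule M)
  interpret N: cat_module C N by (rule N)
  have inv: "inv\<^bsub>omap N X\<^esub> \<one>\<^bsub>omap N X\<^esub> = \<one>\<^bsub>omap N X\<^esub>" if "X \<in> obj C" for X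
    by (simp add: monoid.inv_one that)
  show ?thesis
    unfolding submodule_def kerm_def
    by (auto simp: module_hom_one[OF h M N] module_hom_mult[OF h] module_hom_inv[OF h M N]
      module_hom_act[OF h] monoid.l_one inv)
qed

lemma submodule_imm:
  assumes M: "cat_module C M" and N: "cat_module C N" and h: "module_hom C M N h"
  shows "submodule C N (imm C M h)"
proof -
  interpret M: cat_module C M by (rule M)
  interpret N: cat_module C N by (rule N)
  show ?thesis
    unfolding submodule_def imm_def
  proof (safe, goal_cases)
    case (1 X y x) then show ?case by (simp add: module_hom_closed[OF h])
  next
    case (2 X) then show ?case using module_hom_one[OF h M N] M.one_closed by (metis imageI)
  next
    case (3 X _ _ x y) then show ?case using module_hom_mult[OF h] M.mult_closed by (metis imageI)
  next
    case (4 X _ x) then show ?case using module_hom_inv[OF h M N] M.inv_closed by (metis imageI)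
  next
    case (5 X _ Y a x) then show ?case using module_hom_act[OF h] M.act_closed by (metis imageI)
  qed
qed

text \<open>
  Transport of structure along maps \<open>e X\<close> defined on the carriers: for injective \<open>e\<close> this moves a
  module to another type of elements, and for \<open>e\<close> sending an element to its coset it is a quotient.
\<close>

definition imgm :: "('o, 'a, 'x) cmodule \<Rightarrow> ('o \<Rightarrow> 'x \<Rightarrow> 'y) \<Rightarrow> ('o, 'a, 'y) cmodule" where
  "imgm M e = \<lparr>
     omap = \<lambda>X. \<lparr>carrier = e X ` car M X,
       mult = \<lambda>u v. e X (inv_into (car M X) (e X) u \<otimes>\<^bsub>omap M X\<^esub> inv_into (car M X) (e X) v),
       one = e X \<one>\<^bsub>omap M X\<^esub>\<rparr>,
     amap = \<lambda>X Y a. \<lambda>u\<in>e X ` car M X. e Y (amap M X Y a (inv_into (car M X) (e X) u))\<rparr>"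

definition mod_congruence :: "('o, 'a) preadd_cat \<Rightarrow> ('o, 'a, 'x) cmodule \<Rightarrow> ('o \<Rightarrow> 'x \<Rightarrow> 'y) \<Rightarrow> bool" where
  "mod_congruence C M e \<longleftrightarrow>
     (\<forall>X\<in>obj C. \<forall>x\<in>car M X. \<forall>x'\<in>car M X. \<forall>y\<in>car M X. \<forall>y'\<in>car M X.
        e X x = e X x' \<longrightarrow> e X y = e X y' \<longrightarrow> e X (x \<otimes>\<^bsub>omap M X\<^esub> y) = e X (x' \<otimes>\<^bsub>omap M X\<^esub> y')) \<and>
     (\<forall>X\<in>obj C. \<forall>Y\<in>obj C. \<forall>a\<in>arr C Y X. \<forall>x\<in>car M X. \<forall>x'\<in>car M X.
        e X x = e X x' \<longrightarrow> e Y (amap M X Y a x) = e Y (amap M X Y a x'))"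

lemma car_imgm [simp]: "car (imgm M e) X = e X ` car M X"
  by (simp add: imgm_def)

lemma one_imgm [simp]: "one (omap (imgm M e) X) = e X \<one>\<^bsub>omap M X\<^esub>"
  by (simp add: imgm_def)

lemma mod_congruence_mult:
  "\<lbrakk>mod_congruence C M e; X \<in> obj C; x \<in> car M X; x' \<in> car M X; y \<in> car M X; y' \<in> car M X;
    e X x = e X x'; e X y = e X y'\<rbrakk> \<Longrightarrow> e X (x \<otimes>\<^bsub>omap M X\<^esub> y) = e X (x' \<otimes>\<^bsub>omap M X\<^esub> y')"
  unfolding mod_congruence_def by blast

lemma mod_congruence_act:
  "\<lbrakk>mod_congruence C M e; X \<in> obj C; Y \<in> obj C; a \<in> arr C Y X; x \<in> car M X; x' \<in> car M X;
    e X x = e X x'\<rbrakk> \<Longrightarrow> e Y (amap M X Y a x) = e Y (amap M X Y a x')"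
  unfolding mod_congruence_def by blast

lemma imgm_mult:
  assumes "mod_congruence C M e" "X \<in> obj C" "x \<in> car M X" "y \<in> car M X"
  shows "e X x \<otimes>\<^bsub>omap (imgm M e) X\<^esub> e X y = e X (x \<otimes>\<^bsub>omap M X\<^esub> y)"
proof -
  have "e X (inv_into (car M X) (e X) (e X x) \<otimes>\<^bsub>omap M X\<^esub> inv_into (car M X) (e X) (e X y)) =
    e X (x \<otimes>\<^bsub>omap M X\<^esub> y)"
    by (rule mod_congruence_mult[OF assms(1,2)]) (use assms(3,4) in \<open>auto intro: inv_into_into f_inv_into_f\<close>)
  then show ?thesis by (simp add: imgm_def)
qed

lemma imgm_act:
  assumes "mod_congruence C M e" "X \<in> obj C" "Y \<in> obj C" "a \<in> arr C Y X" "x \<in> car M X"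
  shows "amap (imgm M e) X Y a (e X x) = e Y (amap M X Y a x)"
proof -
  have "e Y (amap M X Y a (inv_into (car M X) (e X) (e X x))) = e Y (amap M X Y a x)"
    by (rule mod_congruence_act[OF assms(1-4)]) (use assms(5) in \<open>auto intro: inv_into_into f_inv_into_f\<close>)
  then show ?thesis using assms by (simp add: imgm_def)
qed

lemma cat_module_imgm:
  assumes P: "preadditive_category C" and M: "cat_module C M" and e: "mod_congruence C M e"
  shows "cat_module C (imgm M e)"
proof -
  interpret preadditive_category C by (rule P)
  interpret cat_module C M by (rule M)
  note em = imgm_mult[OF e]
  note ea = imgm_act[OF e]
  show ?thesis
  proof (rule cat_module.intro)
    fix X assume X: "X \<in> obj C"
    interpret G: comm_group "omap M X" by (rule grp[OF X])
    show "comm_group (omap (imgm M e) X)"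
    proof (rule comm_groupI)
      fix u v assume "u \<in> car (imgm M e) X" "v \<in> car (imgm M e) X"
      then obtain x y where x: "x \<in> car M X" "u = e X x" and y: "y \<in> car M X" "v = e X y" by auto
      show "u \<otimes>\<^bsub>omap (imgm M e) X\<^esub> v \<in> car (imgm M e) X"
        "u \<otimes>\<^bsub>omap (imgm M e) X\<^esub> v = v \<otimes>\<^bsub>omap (imgm M e) X\<^esub> u"
        using x y X by (simp_all add: em G.m_comm)
      fix w assume "w \<in> car (imgm M e) X"
      then obtain z where z: "z \<in> car M X" "w = e X z" by auto
      show "u \<otimes>\<^bsub>omap (imgm M e) X\<^esub> v \<otimes>\<^bsub>omap (imgm M e) X\<^esub> w =
          u \<otimes>\<^bsub>omap (imgm M e) X\<^esub> (v \<otimes>\<^bsub>omap (imgm M e) X\<^esub> w)"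
        using x y z X by (simp add: em G.m_assoc)
    next
      fix u assume "u \<in> car (imgm M e) X"
      then obtain x where x: "x \<in> car M X" "u = e X x" by auto
      show "\<one>\<^bsub>omap (imgm M e) X\<^esub> \<otimes>\<^bsub>omap (imgm M e) X\<^esub> u = u"
        using x X by (simp add: em)
      show "\<exists>v\<in>car (imgm M e) X. v \<otimes>\<^bsub>omap (imgm M e) X\<^esub> u = \<one>\<^bsub>omap (imgm M e) X\<^esub>"
        by (rule bexI[of _ "e X (inv\<^bsub>omap M X\<^esub> x)"]) (use x X in \<open>simp_all add: em\<close>)
    qed (simp add: X)
  next
    fix X Y a assume "X \<in> obj C" "Y \<in> obj C" "a \<in> arr C Y X"
    then show "amap (imgm M e) X Y a \<in> hom (omap (imgm M e) X) (omap (imgm M e) Y)"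
      by (intro homI) (auto simp: em ea act_mult)
  next
    fix X Y a b u
    assume *: "X \<in> obj C" "Y \<in> obj C" "a \<in> arr C Y X" "b \<in> arr C Y X" "u \<in> car (imgm M e) X"
    then have "arr_add C Y X a b \<in> arr C Y X"
      by (intro arr_add_closed)
    with * show "amap (imgm M e) X Y (arr_add C Y X a b) u =
       amap (imgm M e) X Y a u \<otimes>\<^bsub>omap (imgm M e) Y\<^esub> amap (imgm M e) X Y b u"
      by (auto simp: em ea act_add)
  qed (auto simp: ea act_ident act_comp ident_arr comp_arr)
qed

lemma imgm_hom: "mod_congruence C M e \<Longrightarrow> module_hom C M (imgm M e) e"
  by (rule module_homI) (simp_all add: imgm_mult imgm_act)

lemma mod_congruence_inj:
  assumes "\<And>X. X \<in> obj C \<Longrightarrow> inj_on (e X) (car M X)"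
  shows "mod_congruence C M e"
  using assms unfolding mod_congruence_def by (metis inj_onD)

lemma imgm_iso:
  assumes "\<And>X. X \<in> obj C \<Longrightarrow> inj_on (e X) (car M X)"
  shows "module_iso C M (imgm M e) e"
  unfolding module_iso_def
  by (auto simp: assms bij_betw_def intro!: imgm_hom mod_congruence_inj)

lemma imgm_ext: "amap (imgm M e) X Y a \<in> extensional (car (imgm M e) X)"
  by (simp add: imgm_def)

text \<open>Each carrier embeds in \<open>'u\<close> by smallness, and the structure is carried
  along the embedding. This is the way back from modules over auxiliary types to objects of
  \<open>Mod C\<close>.\<close>

lemma ex_Mod_iso:
  fixes M :: "('o, 'a, 'x) cmodule"
  assumes P: "preadditive_category C" and M: "cat_module C M" and small: "small_module TYPE('u) C M"
  obtains N :: "('o, 'a, 'u) cmodule" and h where "N \<in> obj (Mod C)" "module_iso C M N h"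
proof -
  have "\<forall>X\<in>obj C. \<exists>e :: 'x \<Rightarrow> 'u. inj_on e (car M X)"
    using small_ex_inj[OF small_moduleD[OF small]] by metis
  then obtain e where e: "\<And>X. X \<in> obj C \<Longrightarrow> inj_on (e X :: 'x \<Rightarrow> 'u) (car M X)" by metis
  have "cat_module C (imgm M e)"
    by (rule cat_module_imgm[OF P M mod_congruence_inj]) (rule e)
  moreover have "small_module TYPE('u) C (imgm M e)"
    using small by (auto simp: small_module_def intro: small_image)
  ultimately have "imgm M e \<in> obj (Mod C)"
    by (intro obj_ModI P imgm_ext)
  then show thesis using imgm_iso[OF e] that by blast
qed

section \<open>Quotients by submodules, with cosets as elements\<close>

definition quot_map :: "('o, 'a, 'x) cmodule \<Rightarrow> ('o \<times> 'x) set \<Rightarrow> 'o \<Rightarrow> 'x \<Rightarrow> 'x set" where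
  "quot_map M S X x = {y \<in> car M X. (X, y \<otimes>\<^bsub>omap M X\<^esub> inv\<^bsub>omap M X\<^esub> x) \<in> S}"

definition quotm :: "('o, 'a, 'x) cmodule \<Rightarrow> ('o \<times> 'x) set \<Rightarrow> ('o, 'a, 'x set) cmodule" where
  "quotm M S = imgm M (quot_map M S)"

lemma quot_map_eq_iff:
  assumes M: "cat_module C M" and S: "submodule C M S"
    and X: "X \<in> obj C" and x: "x \<in> car M X" and y: "y \<in> car M X"
  shows "quot_map M S X x = quot_map M S X y \<longleftrightarrow> (X, x \<otimes>\<^bsub>omap M X\<^esub> inv\<^bsub>omap M X\<^esub> y) \<in> S"
proof -
  interpret cat_module C M by (rule M)
  interpret G: comm_group "omap M X" by (rule grp[OF X])
  note SD = submoduleD[OF S]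
  show ?thesis
  proof
    assume eq: "quot_map M S X x = quot_map M S X y"
    have "x \<in> quot_map M S X x" using x X SD by (simp add: quot_map_def)
    then show "(X, x \<otimes>\<^bsub>omap M X\<^esub> inv\<^bsub>omap M X\<^esub> y) \<in> S" unfolding eq by (simp add: quot_map_def)
  next
    assume xy: "(X, x \<otimes>\<^bsub>omap M X\<^esub> inv\<^bsub>omap M X\<^esub> y) \<in> S"
    have "(X, z \<otimes>\<^bsub>omap M X\<^esub> inv\<^bsub>omap M X\<^esub> x) \<in> S \<longleftrightarrow> (X, z \<otimes>\<^bsub>omap M X\<^esub> inv\<^bsub>omap M X\<^esub> y) \<in> S"
      if z: "z \<in> car M X" for z
    proof
      assume "(X, z \<otimes>\<^bsub>omap M X\<^esub> inv\<^bsub>omap M X\<^esub> x) \<in> S"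
      from SD(4)[OF this xy] show "(X, z \<otimes>\<^bsub>omap M X\<^esub> inv\<^bsub>omap M X\<^esub> y) \<in> S"
        using x y z by (simp add: G.m_assoc G.l_inv[OF x] G.inv_solve_left flip: G.m_assoc[of "inv\<^bsub>omap M X\<^esub> x"])
    next
      assume "(X, z \<otimes>\<^bsub>omap M X\<^esub> inv\<^bsub>omap M X\<^esub> y) \<in> S"
      from SD(4)[OF this SD(5)[OF xy]] show "(X, z \<otimes>\<^bsub>omap M X\<^esub> inv\<^bsub>omap M X\<^esub> x) \<in> S"
        using x y z by (simp add: G.m_assoc G.inv_mult_group flip: G.m_assoc[of "inv\<^bsub>omap M X\<^esub> y"])
    qed
    then show "quot_map M S X x = quot_map M S X y" by (auto simp: quot_map_def)
  qed
qed

lemma mod_congruence_quot: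
  assumes M: "cat_module C M" and S: "submodule C M S"
  shows "mod_congruence C M (quot_map M S)"
proof -
  interpret cat_module C M by (rule M)
  note SD = submoduleD[OF S]
  note q = quot_map_eq_iff[OF M S]
  show ?thesis
    unfolding mod_congruence_def
  proof (intro conjI ballI impI)
    fix X x x' y y' assume X: "X \<in> obj C" and *: "x \<in> car M X" "x' \<in> car M X" "y \<in> car M X" "y' \<in> car M X"
      and 1: "quot_map M S X x = quot_map M S X x'" and 2: "quot_map M S X y = quot_map M S X y'"
    interpret G: comm_group "omap M X" by (rule grp[OF X])
    have "(X, (x \<otimes>\<^bsub>omap M X\<^esub> inv\<^bsub>omap M X\<^esub> x') \<otimes>\<^bsub>omap M X\<^esub> (y \<otimes>\<^bsub>omap M X\<^esub> inv\<^bsub>omap M X\<^esub> y')) \<in> S"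
      by (rule SD(4)) (use 1 2 * X in \<open>simp_all add: q\<close>)
    then show "quot_map M S X (x \<otimes>\<^bsub>omap M X\<^esub> y) = quot_map M S X (x' \<otimes>\<^bsub>omap M X\<^esub> y')"
      using X * by (simp add: q G.inv_mult G.m_ac)
  next
    fix X Y a x x' assume *: "X \<in> obj C" "Y \<in> obj C" "a \<in> arr C Y X" "x \<in> car M X" "x' \<in> car M X"
      and 1: "quot_map M S X x = quot_map M S X x'"
    have "(Y, amap M X Y a (x \<otimes>\<^bsub>omap M X\<^esub> inv\<^bsub>omap M X\<^esub> x')) \<in> S"
      by (rule SD(6)) (use 1 * in \<open>simp_all add: q\<close>)
    then show "quot_map M S Y (amap M X Y a x) = quot_map M S Y (amap M X Y a x')"
      using * by (simp add: q act_mult act_inv)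
  qed
qed

lemma cat_module_quotm:
  "\<lbrakk>preadditive_category C; cat_module C M; submodule C M S\<rbrakk> \<Longrightarrow> cat_module C (quotm M S)"
  unfolding quotm_def by (intro cat_module_imgm mod_congruence_quot)

lemma quot_map_hom:
  "\<lbrakk>cat_module C M; submodule C M S\<rbrakk> \<Longrightarrow> module_hom C M (quotm M S) (quot_map M S)"
  unfolding quotm_def by (intro imgm_hom mod_congruence_quot)

lemma car_quotm: "car (quotm M S) X = quot_map M S X ` car M X"
  by (simp add: quotm_def)

lemma quot_map_eq_one_iff:
  assumes M: "cat_module C M" and S: "submodule C M S" and X: "X \<in> obj C" and x: "x \<in> car M X"
  shows "quot_map M S X x = \<one>\<^bsub>omap (quotm M S) X\<^esub> \<longleftrightarrow> (X, x) \<in> S"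
proof -
  interpret cat_module C M by (rule M)
  interpret G: comm_group "omap M X" by (rule grp[OF X])
  show ?thesis using quot_map_eq_iff[OF M S X x one_closed[OF X]] x by (simp add: quotm_def)
qed

lemma small_quotm: "small_module U C M \<Longrightarrow> small_module U C (quotm M S)"
  by (auto simp: small_module_def car_quotm intro: small_image)

lemma small_subm: "small_module U C M \<Longrightarrow> submodule C M S \<Longrightarrow> small_module U C (subm M S)"
  unfolding small_module_def
  by (auto dest: submoduleD(2) intro!: small_subset[of _ "car M X" "car (subm M S) X" for X])

section \<open>Products of families, and coproducts as finitely supported families\<close>

definition prodm :: "'i set \<Rightarrow> ('i \<Rightarrow> ('o, 'a, 'x) cmodule) \<Rightarrow> ('o, 'a, 'i \<Rightarrow> 'x) cmodule" where
  "prodm I M = \<lparr>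
     omap = \<lambda>X. \<lparr>carrier = (\<Pi>\<^sub>E i\<in>I. car (M i) X), mult = \<lambda>s t. \<lambda>i\<in>I. s i \<otimes>\<^bsub>omap (M i) X\<^esub> t i,
       one = \<lambda>i\<in>I. \<one>\<^bsub>omap (M i) X\<^esub>\<rparr>,
     amap = \<lambda>X Y a s. \<lambda>i\<in>I. amap (M i) X Y a (s i)\<rparr>"

lemma prodm_simps [simp]:
  "car (prodm I M) X = (\<Pi>\<^sub>E i\<in>I. car (M i) X)"
  "s \<otimes>\<^bsub>omap (prodm I M) X\<^esub> t = (\<lambda>i\<in>I. s i \<otimes>\<^bsub>omap (M i) X\<^esub> t i)"
  "\<one>\<^bsub>omap (prodm I M) X\<^esub> = (\<lambda>i\<in>I. \<one>\<^bsub>omap (M i) X\<^esub>)"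
  "amap (prodm I M) X Y a s = (\<lambda>i\<in>I. amap (M i) X Y a (s i))"
  by (simp_all add: prodm_def)

lemma cat_module_prodm:
  assumes M: "\<And>i. i \<in> I \<Longrightarrow> cat_module C (M i)"
  shows "cat_module C (prodm I M)"
proof (rule cat_module.intro)
  note MM = M[THEN cat_module.grp]
  note simps = cat_module.one_closed[OF M] cat_module.mult_closed[OF M] cat_module.act_closed[OF M]
    cat_module.act_mult[OF M] cat_module.act_ident[OF M] cat_module.act_comp[OF M] cat_module.act_add[OF M]
  fix X assume X: "X \<in> obj C"
  show "comm_group (omap (prodm I M) X)"
  proof (rule comm_groupI)
    fix s t u
    assume *: "s \<in> car (prodm I M) X" "t \<in> car (prodm I M) X" "u \<in> car (prodm I M) X"
    show "s \<otimes>\<^bsub>omap (prodm I M) X\<^esub> t \<otimes>\<^bsub>omap (prodm I M) X\<^esub> u =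
      s \<otimes>\<^bsub>omap (prodm I M) X\<^esub> (t \<otimes>\<^bsub>omap (prodm I M) X\<^esub> u)"
      using * by (auto simp: PiE_iff restrict_def fun_eq_iff X
          intro!: monoid.m_assoc cat_module.monoid[OF M])
  next
    fix s t
    assume *: "s \<in> car (prodm I M) X" "t \<in> car (prodm I M) X"
    then show "s \<otimes>\<^bsub>omap (prodm I M) X\<^esub> t \<in> car (prodm I M) X"
      using X by (auto simp: PiE_iff simps)
    show "s \<otimes>\<^bsub>omap (prodm I M) X\<^esub> t = t \<otimes>\<^bsub>omap (prodm I M) X\<^esub> s"
      using * by (auto simp: PiE_iff restrict_def fun_eq_iff X
          intro!: comm_monoid.m_comm comm_group.axioms(1) MM)
  next
    show "\<one>\<^bsub>omap (prodm I M) X\<^esub> \<in> car (prodm I M) X"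
      using X by (auto simp: simps)
  next
    fix s assume s: "s \<in> car (prodm I M) X"
    show "\<one>\<^bsub>omap (prodm I M) X\<^esub> \<otimes>\<^bsub>omap (prodm I M) X\<^esub> s = s"
    proof (rule extensionalityI[of _ I])
      fix i assume i: "i \<in> I"
      then have "s i \<in> car (M i) X" using s by auto
      then show "(\<one>\<^bsub>omap (prodm I M) X\<^esub> \<otimes>\<^bsub>omap (prodm I M) X\<^esub> s) i = s i"
        using i by (simp add: monoid.l_one cat_module.monoid[OF M] X)
    qed (use s in \<open>auto simp: PiE_iff\<close>)
    show "\<exists>t\<in>car (prodm I M) X. t \<otimes>\<^bsub>omap (prodm I M) X\<^esub> s = \<one>\<^bsub>omap (prodm I M) X\<^esub>"
    proof (rule bexI[of _ "\<lambda>i\<in>I. inv\<^bsub>omap (M i) X\<^esub> s i"])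
      show "(\<lambda>i\<in>I. inv\<^bsub>omap (M i) X\<^esub> s i) \<otimes>\<^bsub>omap (prodm I M) X\<^esub> s = \<one>\<^bsub>omap (prodm I M) X\<^esub>"
        using s by (auto simp: PiE_iff restrict_def fun_eq_iff X
          intro!: group.l_inv cat_module.group[OF M])
    qed (use s in \<open>auto simp: PiE_iff X cat_module.inv_closed[OF M]\<close>)
  qed
next
  fix X Y a assume "X \<in> obj C" "Y \<in> obj C" "a \<in> arr C Y X"
  then show "amap (prodm I M) X Y a \<in> hom (omap (prodm I M) X) (omap (prodm I M) Y)"
    by (intro homI) (auto simp: PiE_iff extensional_def restrict_def fun_eq_iff cat_module.act_closed[OF M] cat_module.act_mult[OF M])
next
  fix X s assume *: "X \<in> obj C" "s \<in> car (prodm I M) X"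
  show "amap (prodm I M) X X (ident C X) s = s"
    by (rule extensionalityI[of _ I]) (use * in \<open>auto simp: PiE_iff cat_module.act_ident[OF M]\<close>)
qed (auto simp: PiE_iff restrict_def fun_eq_iff cat_module.act_comp[OF M] cat_module.act_add[OF M])

lemma prodm_proj: "i \<in> I \<Longrightarrow> module_hom C (prodm I M) (M i) (\<lambda>X s. s i)"
  by (rule module_homI) (auto simp: PiE_iff)

lemma prodm_tuple:
  assumes "\<And>i. i \<in> I \<Longrightarrow> module_hom C N (M i) (f i)"
  shows "module_hom C N (prodm I M) (\<lambda>X x. \<lambda>i\<in>I. f i X x)"
  by (rule module_homI) (auto simp: restrict_def fun_eq_iff module_hom_closed[OF assms]
      module_hom_mult[OF assms] module_hom_act[OF assms])

lemma (in universe) small_prodm: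
  "\<lbrakk>small U I; \<And>i. i \<in> I \<Longrightarrow> small_module U C (M i)\<rbrakk> \<Longrightarrow> small_module U C (prodm I M)"
  unfolding small_module_def by (auto intro!: small_PiE)

definition finsupp :: "('o, 'a) preadd_cat \<Rightarrow> 'i set \<Rightarrow> ('i \<Rightarrow> ('o, 'a, 'x) cmodule) \<Rightarrow> ('o \<times> ('i \<Rightarrow> 'x)) set" where
  "finsupp C I M = {(X, s). X \<in> obj C \<and> s \<in> (\<Pi>\<^sub>E i\<in>I. car (M i) X) \<and> finite {i \<in> I. s i \<noteq> \<one>\<^bsub>omap (M i) X\<^esub>}}"

definition copm :: "('o, 'a) preadd_cat \<Rightarrow> 'i set \<Rightarrow> ('i \<Rightarrow> ('o, 'a, 'x) cmodule) \<Rightarrow> ('o, 'a, 'i \<Rightarrow> 'x) cmodule" where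
  "copm C I M = subm (prodm I M) (finsupp C I M)"

definition cop_in :: "'i set \<Rightarrow> ('i \<Rightarrow> ('o, 'a, 'x) cmodule) \<Rightarrow> 'i \<Rightarrow> 'o \<Rightarrow> 'x \<Rightarrow> 'i \<Rightarrow> 'x" where
  "cop_in I M i X x = (\<lambda>j\<in>I. if j = i then x else \<one>\<^bsub>omap (M j) X\<^esub>)"

lemma submodule_finsupp:
  assumes M: "\<And>i. i \<in> I \<Longrightarrow> cat_module C (M i)"
  shows "submodule C (prodm I M) (finsupp C I M)"
proof -
  interpret P: cat_module C "prodm I M" by (rule cat_module_prodm[OF M])
  have inv: "(inv\<^bsub>omap (prodm I M) X\<^esub> s) i = inv\<^bsub>omap (M i) X\<^esub> s i"
    if "X \<in> obj C" "s \<in> car (prodm I M) X" "i \<in> I" for X s i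
    by (rule module_hom_inv[OF prodm_proj P.cat_module_axioms M]) (use that in auto)
  have inv1: "inv\<^bsub>omap (M i) X\<^esub> \<one>\<^bsub>omap (M i) X\<^esub> = \<one>\<^bsub>omap (M i) X\<^esub>" if "X \<in> obj C" "i \<in> I" for X i
    by (simp add: monoid.inv_one cat_module.monoid[OF M] that)
  show ?thesis
    unfolding submodule_def
  proof (intro conjI allI ballI impI)
    fix X s t assume "(X, s) \<in> finsupp C I M" "(X, t) \<in> finsupp C I M"
    then have X: "X \<in> obj C" and st: "s \<in> car (prodm I M) X" "t \<in> car (prodm I M) X"
      and fin: "finite {i \<in> I. s i \<noteq> \<one>\<^bsub>omap (M i) X\<^esub>}" "finite {i \<in> I. t i \<noteq> \<one>\<^bsub>omap (M i) X\<^esub>}"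
      by (auto simp: finsupp_def)
    have "{i \<in> I. (s \<otimes>\<^bsub>omap (prodm I M) X\<^esub> t) i \<noteq> \<one>\<^bsub>omap (M i) X\<^esub>} \<subseteq>
       {i \<in> I. s i \<noteq> \<one>\<^bsub>omap (M i) X\<^esub>} \<union> {i \<in> I. t i \<noteq> \<one>\<^bsub>omap (M i) X\<^esub>}"
      by (auto simp: monoid.l_one cat_module.monoid[OF M] cat_module.one_closed[OF M] X)
    from finite_subset[OF this] P.mult_closed[OF X st]
    show "(X, s \<otimes>\<^bsub>omap (prodm I M) X\<^esub> t) \<in> finsupp C I M"
      using fin X unfolding finsupp_def prodm_simps(1) by blast
  next
    fix X s assume "(X, s) \<in> finsupp C I M"
    then have X: "X \<in> obj C" and s: "s \<in> car (prodm I M) X"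
      and fin: "finite {i \<in> I. s i \<noteq> \<one>\<^bsub>omap (M i) X\<^esub>}"
      by (auto simp: finsupp_def)
    have "{i \<in> I. (inv\<^bsub>omap (prodm I M) X\<^esub> s) i \<noteq> \<one>\<^bsub>omap (M i) X\<^esub>} \<subseteq> {i \<in> I. s i \<noteq> \<one>\<^bsub>omap (M i) X\<^esub>}"
      by (auto simp: inv[OF X s] inv1[OF X])
    from finite_subset[OF this fin] P.inv_closed[OF X s] X
    show "(X, inv\<^bsub>omap (prodm I M) X\<^esub> s) \<in> finsupp C I M"
      unfolding finsupp_def prodm_simps(1) by blast
    fix Y a assume Y: "Y \<in> obj C" "a \<in> arr C Y X"
    have "{i \<in> I. (amap (prodm I M) X Y a s) i \<noteq> \<one>\<^bsub>omap (M i) Y\<^esub>} \<subseteq> {i \<in> I. s i \<noteq> \<one>\<^bsub>omap (M i) X\<^esub>}"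
      using X Y by (auto simp: cat_module.act_one[OF M])
    from finite_subset[OF this fin] P.act_closed[OF X Y s] Y
    show "(Y, amap (prodm I M) X Y a s) \<in> finsupp C I M"
      unfolding finsupp_def prodm_simps(1) by blast
  next
    fix X assume X: "X \<in> obj C"
    have "{i \<in> I. \<one>\<^bsub>omap (prodm I M) X\<^esub> i \<noteq> \<one>\<^bsub>omap (M i) X\<^esub>} = {}" by auto
    with P.one_closed[OF X] X show "(X, \<one>\<^bsub>omap (prodm I M) X\<^esub>) \<in> finsupp C I M"
      unfolding finsupp_def prodm_simps(1) by (simp add: restrict_PiE_iff)
  qed (auto simp: finsupp_def)
qed

lemma cat_module_copm:
  assumes "\<And>i. i \<in> I \<Longrightarrow> cat_module C (M i)"
  shows "cat_module C (copm C I M)"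
  unfolding copm_def by (intro cat_module_subm cat_module_prodm submodule_finsupp assms)

lemma (in universe) small_copm:
  assumes "\<And>i. i \<in> I \<Longrightarrow> cat_module C (M i)" "small U I" "\<And>i. i \<in> I \<Longrightarrow> small_module U C (M i)"
  shows "small_module U C (copm C I M)"
  unfolding copm_def by (intro small_subm small_prodm submodule_finsupp assms)

section \<open>Pointwise limits and colimits\<close>

text \<open>The conditions \<open>pker\<close>, \<open>pcok\<close>, \<open>pprod\<close> and
  \<open>pcop\<close> imply the universal properties, make sense for modules with any types of
  elements, and are inherited under restriction of scalars because they are stated one object at a
  time.\<close>

definition pker where
  "pker C M N g K k \<longleftrightarrow> module_hom C K M k \<and>
     (\<forall>X\<in>obj C. inj_on (k X) (car K X) \<and> k X ` car K X = {x \<in> car M X. g X x = \<one>\<^bsub>omap N X\<^esub>})"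

definition pcok where
  "pcok C M N g Q q \<longleftrightarrow> module_hom C N Q q \<and>
     (\<forall>X\<in>obj C. q X ` car N X = car Q X \<and> (\<forall>y\<in>car N X. q X y = \<one>\<^bsub>omap Q X\<^esub> \<longleftrightarrow> y \<in> g X ` car M X))"

definition pprod where
  "pprod C I M P \<pi> \<longleftrightarrow> (\<forall>i\<in>I. module_hom C P (M i) (\<pi> i)) \<and>
     (\<forall>X\<in>obj C. \<forall>x. (\<forall>i\<in>I. x i \<in> car (M i) X) \<longrightarrow> (\<exists>!p. p \<in> car P X \<and> (\<forall>i\<in>I. \<pi> i X p = x i)))"

text \<open>
  A coproduct is recognised by projections \<open>\<rho> i\<close> splitting the injections \<open>\<iota> i\<close> which jointly
  detect elements and of which only finitely many are nonzero on a given element.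
\<close>

definition pcop where
  "pcop C I M P \<iota> \<longleftrightarrow> (\<forall>i\<in>I. module_hom C (M i) P (\<iota> i)) \<and>
     (\<exists>\<rho>. (\<forall>i\<in>I. module_hom C P (M i) (\<rho> i)) \<and>
       (\<forall>i\<in>I. \<forall>X\<in>obj C. \<forall>x\<in>car (M i) X. \<rho> i X (\<iota> i X x) = x) \<and>
       (\<forall>i\<in>I. \<forall>j\<in>I. i \<noteq> j \<longrightarrow> (\<forall>X\<in>obj C. \<forall>x\<in>car (M i) X. \<rho> j X (\<iota> i X x) = \<one>\<^bsub>omap (M j) X\<^esub>)) \<and>
       (\<forall>X\<in>obj C. \<forall>p\<in>car P X. finite {i \<in> I. \<rho> i X p \<noteq> \<one>\<^bsub>omap (M i) X\<^esub>}) \<and>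
       (\<forall>X\<in>obj C. \<forall>p\<in>car P X. (\<forall>i\<in>I. \<rho> i X p = \<one>\<^bsub>omap (M i) X\<^esub>) \<longrightarrow> p = \<one>\<^bsub>omap P X\<^esub>))"

section \<open>Factoring homomorphisms through injections and surjections\<close>

lemma module_hom_inj_iff:
  assumes M: "cat_module C M" and N: "cat_module C N" and h: "module_hom C M N h" and X: "X \<in> obj C"
  shows "inj_on (h X) (car M X) \<longleftrightarrow> (\<forall>x\<in>car M X. h X x = \<one>\<^bsub>omap N X\<^esub> \<longrightarrow> x = \<one>\<^bsub>omap M X\<^esub>)"
proof -
  interpret M: cat_module C M by (rule M)
  interpret N: cat_module C N by (rule N)
  show ?thesis
  proof (intro iffI ballI impI inj_onI)
    fix x assume "inj_on (h X) (car M X)" "x \<in> car M X" "h X x = \<one>\<^bsub>omap N X\<^esub>"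
    then show "x = \<one>\<^bsub>omap M X\<^esub>"
      using module_hom_one[OF h M N X] M.one_closed[OF X] by (metis inj_onD)
  next
    fix x y assume *: "\<forall>x\<in>car M X. h X x = \<one>\<^bsub>omap N X\<^esub> \<longrightarrow> x = \<one>\<^bsub>omap M X\<^esub>"
      and xy: "x \<in> car M X" "y \<in> car M X" "h X x = h X y"
    have "h X (x \<otimes>\<^bsub>omap M X\<^esub> inv\<^bsub>omap M X\<^esub> y) = h X x \<otimes>\<^bsub>omap N X\<^esub> inv\<^bsub>omap N X\<^esub> h X y"
      using X xy by (simp add: module_hom_mult[OF h] module_hom_inv[OF h M N])
    also have "\<dots> = \<one>\<^bsub>omap N X\<^esub>"
      using X xy by (simp add: N.mult_inv_eq_one_iff module_hom_closed[OF h])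
    finally have "x \<otimes>\<^bsub>omap M X\<^esub> inv\<^bsub>omap M X\<^esub> y = \<one>\<^bsub>omap M X\<^esub>" using * X xy by simp
    then show "x = y" using X xy by (simp add: M.mult_inv_eq_one_iff)
  qed
qed

text \<open>Preimages under the injective \<open>k\<close> are unique, so \<open>h\<close> inherits
  additivity and compatibility with the action from \<open>t\<close>.\<close>

lemma module_hom_factor_mono:
  assumes K: "cat_module C K" and k: "module_hom C K M k" and t: "module_hom C T M t"
    and inj: "\<And>X. X \<in> obj C \<Longrightarrow> inj_on (k X) (car K X)"
    and im: "\<And>X x. X \<in> obj C \<Longrightarrow> x \<in> car T X \<Longrightarrow> t X x \<in> k X ` car K X"
  obtains h where "module_hom C T K h" "\<And>X x. X \<in> obj C \<Longrightarrow> x \<in> car T X \<Longrightarrow> k X (h X x) = t X x"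
proof -
  interpret K: cat_module C K by (rule K)
  define h where "h X x = inv_into (car K X) (k X) (t X x)" for X x
  have kh: "k X (h X x) = t X x" and hc: "h X x \<in> car K X" if "X \<in> obj C" "x \<in> car T X" for X x
    using im[OF that] by (simp_all add: h_def f_inv_into_f inv_into_into)
  have "module_hom C T K h"
  proof (rule module_homI)
    fix X x y assume *: "X \<in> obj C" "x \<in> car T X" "y \<in> car T X"
    have eq: "k X (h X x \<otimes>\<^bsub>omap K X\<^esub> h X y) = t X (x \<otimes>\<^bsub>omap T X\<^esub> y)"
      using * by (simp add: module_hom_mult[OF k] module_hom_mult[OF t] kh hc)
    show "h X (x \<otimes>\<^bsub>omap T X\<^esub> y) = h X x \<otimes>\<^bsub>omap K X\<^esub> h X y"
      unfolding h_def[of X "x \<otimes>\<^bsub>omap T X\<^esub> y"] eq[symmetric]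
      using * by (intro inv_into_f_f inj K.mult_closed hc)
  next
    fix X Y a x assume *: "X \<in> obj C" "Y \<in> obj C" "a \<in> arr C Y X" "x \<in> car T X"
    have eq: "k Y (amap K X Y a (h X x)) = t Y (amap T X Y a x)"
      using * by (simp add: module_hom_act[OF k] module_hom_act[OF t] kh hc)
    show "h Y (amap T X Y a x) = amap K X Y a (h X x)"
      unfolding h_def[of Y "amap T X Y a x"] eq[symmetric]
      using * by (intro inv_into_f_f inj K.act_closed hc)
  qed (rule hc)
  then show thesis using kh that by blast
qed

text \<open>If \<open>q\<close> takes the same value at two elements, their difference lies in the
  kernel of \<open>q\<close>, where \<open>t\<close> vanishes; hence \<open>t\<close> is constant on
  the fibres of \<open>q\<close>.\<close>

lemma module_hom_factor_epi:
  assumes N: "cat_module C N" and Q: "cat_module C Q" and T: "cat_module C T"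
    and q: "module_hom C N Q q" and t: "module_hom C N T t"
    and surj: "\<And>X. X \<in> obj C \<Longrightarrow> q X ` car N X = car Q X"
    and ker: "\<And>X x. X \<in> obj C \<Longrightarrow> x \<in> car N X \<Longrightarrow> q X x = \<one>\<^bsub>omap Q X\<^esub> \<Longrightarrow> t X x = \<one>\<^bsub>omap T X\<^esub>"
  obtains h where "module_hom C Q T h" "\<And>X x. X \<in> obj C \<Longrightarrow> x \<in> car N X \<Longrightarrow> h X (q X x) = t X x"
proof -
  interpret N: cat_module C N by (rule N)
  interpret Q: cat_module C Q by (rule Q)
  interpret T: cat_module C T by (rule T)
  have eq: "t X x = t X y" if X: "X \<in> obj C" and xy: "x \<in> car N X" "y \<in> car N X" "q X x = q X y" for X x y
  proof -
    have "q X (x \<otimes>\<^bsub>omap N X\<^esub> inv\<^bsub>omap N X\<^esub> y) = \<one>\<^bsub>omap Q X\<^esub>"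
      using X xy by (simp add: module_hom_mult[OF q] module_hom_inv[OF q N Q] Q.mult_inv_eq_one_iff
          module_hom_closed[OF q])
    then have "t X (x \<otimes>\<^bsub>omap N X\<^esub> inv\<^bsub>omap N X\<^esub> y) = \<one>\<^bsub>omap T X\<^esub>"
      using X xy by (intro ker) simp_all
    then show ?thesis
      using X xy by (simp add: module_hom_mult[OF t] module_hom_inv[OF t N T] T.mult_inv_eq_one_iff
          module_hom_closed[OF t])
  qed
  define h where "h X y = t X (inv_into (car N X) (q X) y)" for X y
  have hq: "h X (q X x) = t X x" if "X \<in> obj C" "x \<in> car N X" for X x
    unfolding h_def using that by (intro eq) (auto intro: inv_into_into f_inv_into_f)
  have ex: "\<exists>x\<in>car N X. y = q X x" if "X \<in> obj C" "y \<in> car Q X" for X y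
    using surj[OF that(1)] that(2) by blast
  have "module_hom C Q T h"
  proof (rule module_homI)
    fix X y assume *: "X \<in> obj C" "y \<in> car Q X"
    then obtain x where x: "x \<in> car N X" "y = q X x" using ex by blast
    then show "h X y \<in> car T X" using * by (simp add: hq module_hom_closed[OF t])
    fix y' assume **: "y' \<in> car Q X"
    then obtain x' where x': "x' \<in> car N X" "y' = q X x'" using ex * by blast
    have "h X (q X (x \<otimes>\<^bsub>omap N X\<^esub> x')) = h X (q X x) \<otimes>\<^bsub>omap T X\<^esub> h X (q X x')"
      using * x x' by (simp add: hq module_hom_mult[OF t])
    then show "h X (y \<otimes>\<^bsub>omap Q X\<^esub> y') = h X y \<otimes>\<^bsub>omap T X\<^esub> h X y'"
      using * x x' by (simp add: module_hom_mult[OF q])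
  next
    fix X Y a y assume *: "X \<in> obj C" "Y \<in> obj C" "a \<in> arr C Y X" "y \<in> car Q X"
    then obtain x where x: "x \<in> car N X" "y = q X x" using ex by blast
    have "h Y (q Y (amap N X Y a x)) = amap T X Y a (h X (q X x))"
      using * x by (simp add: hq module_hom_act[OF t])
    then show "h Y (amap Q X Y a y) = amap T X Y a (h X y)"
      using * x by (simp add: module_hom_act[OF q])
  qed
  then show thesis using hq that by blast
qed

section \<open>Universal properties derived from the pointwise conditions\<close>

lemma pker_kernel:
  assumes M: "M \<in> obj (Mod C)" and N: "N \<in> obj (Mod C)" and K: "K \<in> obj (Mod C)"
    and g: "g \<in> arr (Mod C) M N" and k: "k \<in> arr (Mod C) K M" and p: "pker C M N g K k"
  shows "is_kernel (Mod C) M N g K k"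
  unfolding is_kernel_def
proof (intro conjI ballI impI K k)
  have inj: "\<And>X. X \<in> obj C \<Longrightarrow> inj_on (k X) (car K X)"
    and im: "\<And>X. X \<in> obj C \<Longrightarrow> k X ` car K X = {x \<in> car M X. g X x = \<one>\<^bsub>omap N X\<^esub>}"
    using p by (auto simp: pker_def)
  show "ccomp (Mod C) K M N g k = arr_zero (Mod C) K N"
    unfolding ccomp_Mod arr_zero_Mod by (rule mod_arr_cong) (use im in blast)
  fix T t assume T: "T \<in> obj (Mod C)" and t: "t \<in> arr (Mod C) T M"
    and z: "ccomp (Mod C) T M N g t = arr_zero (Mod C) T N"
  note kh = arr_Mod_hom[OF K M k] and th = arr_Mod_hom[OF T M t]
  have "t X x \<in> k X ` car K X" if "X \<in> obj C" "x \<in> car T X" for X x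
    using fun_cong[OF fun_cong[OF z, of X], of x] that
    by (simp add: im ccomp_Mod arr_zero_Mod module_hom_closed[OF th])
  then obtain h where h: "module_hom C T K h" and kheq: "\<And>X x. X \<in> obj C \<Longrightarrow> x \<in> car T X \<Longrightarrow> k X (h X x) = t X x"
    using module_hom_factor_mono[OF obj_ModD(1)[OF K] kh th inj] by blast
  show "\<exists>!h. h \<in> arr (Mod C) T K \<and> ccomp (Mod C) T K M k h = t"
  proof (intro ex1I conjI)
    show "mod_arr C T h \<in> arr (Mod C) T K" by (rule mod_arr_in[OF T K h])
    show "ccomp (Mod C) T K M k (mod_arr C T h) = t"
      by (rule arr_Mod_eqI[OF T M M _ t])
        (auto simp: ccomp_Mod kheq intro!: mod_arr_in T M module_hom_comp[OF _ kh] module_hom_mod_arr h obj_ModD)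
    fix h' assume "h' \<in> arr (Mod C) T K \<and> ccomp (Mod C) T K M k h' = t"
    then have h': "h' \<in> arr (Mod C) T K" and e: "ccomp (Mod C) T K M k h' = t" by auto
    show "h' = mod_arr C T h"
    proof (rule arr_Mod_eqI[OF T K K h' mod_arr_in[OF T K h]])
      fix X x assume *: "X \<in> obj C" "x \<in> car T X"
      have "k X (h' X x) = k X (h X x)"
        using fun_cong[OF fun_cong[OF e, of X], of x] * by (simp add: ccomp_Mod kheq)
      then show "h' X x = mod_arr C T h X x"
        using inj_onD[OF inj] * by (simp add: module_hom_closed[OF h] module_hom_closed[OF arr_Mod_hom[OF T K h']])
    qed
  qed
qed

lemma pcok_cokernel:
  assumes M: "M \<in> obj (Mod C)" and N: "N \<in> obj (Mod C)" and Q: "Q \<in> obj (Mod C)"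
    and g: "g \<in> arr (Mod C) M N" and q: "q \<in> arr (Mod C) N Q" and p: "pcok C M N g Q q"
  shows "is_cokernel (Mod C) M N g Q q"
  unfolding is_cokernel_def
proof (intro conjI ballI impI Q q)
  note gh = arr_Mod_hom[OF M N g] and qh = arr_Mod_hom[OF N Q q]
  have surj: "\<And>X. X \<in> obj C \<Longrightarrow> q X ` car N X = car Q X"
    and ker: "\<And>X y. X \<in> obj C \<Longrightarrow> y \<in> car N X \<Longrightarrow> q X y = \<one>\<^bsub>omap Q X\<^esub> \<longleftrightarrow> y \<in> g X ` car M X"
    using p by (auto simp: pcok_def)
  show "ccomp (Mod C) M N Q q g = arr_zero (Mod C) M Q"
    unfolding ccomp_Mod arr_zero_Mod by (rule mod_arr_cong) (simp add: ker module_hom_closed[OF gh])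
  fix T t assume T: "T \<in> obj (Mod C)" and t: "t \<in> arr (Mod C) N T"
    and z: "ccomp (Mod C) M N T t g = arr_zero (Mod C) M T"
  note th = arr_Mod_hom[OF N T t]
  have "t X (g X x) = \<one>\<^bsub>omap T X\<^esub>" if "X \<in> obj C" "x \<in> car M X" for X x
    using fun_cong[OF fun_cong[OF z, of X], of x] that by (simp add: ccomp_Mod arr_zero_Mod)
  then have "t X y = \<one>\<^bsub>omap T X\<^esub>" if "X \<in> obj C" "y \<in> car N X" "q X y = \<one>\<^bsub>omap Q X\<^esub>" for X y
    using that ker by auto
  then obtain h where h: "module_hom C Q T h" and hq: "\<And>X x. X \<in> obj C \<Longrightarrow> x \<in> car N X \<Longrightarrow> h X (q X x) = t X x"
    using module_hom_factor_epi[OF obj_ModD(1)[OF N] obj_ModD(1)[OF Q] obj_ModD(1)[OF T] qh th surj] by metis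
  show "\<exists>!h. h \<in> arr (Mod C) Q T \<and> ccomp (Mod C) N Q T h q = t"
  proof (intro ex1I conjI)
    show "mod_arr C Q h \<in> arr (Mod C) Q T" by (rule mod_arr_in[OF Q T h])
    show "ccomp (Mod C) N Q T (mod_arr C Q h) q = t"
      by (rule arr_Mod_eqI[OF N T T _ t])
        (auto simp: ccomp_Mod hq module_hom_closed[OF qh]
          intro!: mod_arr_in N T module_hom_comp[OF qh] module_hom_mod_arr h obj_ModD[OF Q])
    fix h' assume "h' \<in> arr (Mod C) Q T \<and> ccomp (Mod C) N Q T h' q = t"
    then have h': "h' \<in> arr (Mod C) Q T" and e: "ccomp (Mod C) N Q T h' q = t" by auto
    show "h' = mod_arr C Q h"
    proof (rule arr_Mod_eqI[OF Q T T h' mod_arr_in[OF Q T h]])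
      fix X y assume *: "X \<in> obj C" "y \<in> car Q X"
      then obtain x where x: "x \<in> car N X" "y = q X x" using surj by blast
      have "h' X (q X x) = t X x"
        using fun_cong[OF fun_cong[OF e, of X], of x] * x by (simp add: ccomp_Mod)
      then show "h' X y = mod_arr C Q h X y"
        using * x by (simp add: hq)
    qed
  qed
qed

text \<open>The value of \<open>h\<close> is the unique element with the prescribed components, and
  the same uniqueness makes \<open>h\<close> a homomorphism.\<close>

lemma pprod_extend:
  assumes M: "\<And>i. i \<in> I \<Longrightarrow> cat_module C (M i)" and P: "cat_module C P" and p: "pprod C I M P \<pi>"
    and T: "cat_module C T" and f: "\<And>i. i \<in> I \<Longrightarrow> module_hom C T (M i) (f i)"
  obtains h where "module_hom C T P h"
    "\<And>i X x. i \<in> I \<Longrightarrow> X \<in> obj C \<Longrightarrow> x \<in> car T X \<Longrightarrow> \<pi> i X (h X x) = f i X x"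
proof -
  interpret P: cat_module C P by (rule P)
  interpret T: cat_module C T by (rule T)
  have \<pi>: "\<And>i. i \<in> I \<Longrightarrow> module_hom C P (M i) (\<pi> i)"
    using p by (simp add: pprod_def)
  have ex: "\<exists>!p. p \<in> car P X \<and> (\<forall>i\<in>I. \<pi> i X p = x i)" if "X \<in> obj C" "\<forall>i\<in>I. x i \<in> car (M i) X" for X x
    using p that by (simp add: pprod_def)
  have uniq: "p = p'" if X: "X \<in> obj C" and pp: "p \<in> car P X" "p' \<in> car P X" "\<forall>i\<in>I. \<pi> i X p = \<pi> i X p'" for X p p'
    using ex[OF X, of "\<lambda>i. \<pi> i X p"] pp module_hom_closed[OF \<pi> X] by metis
  define h where "h X x = (THE p. p \<in> car P X \<and> (\<forall>i\<in>I. \<pi> i X p = f i X x))" for X x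
  have h: "h X x \<in> car P X \<and> (\<forall>i\<in>I. \<pi> i X (h X x) = f i X x)" if "X \<in> obj C" "x \<in> car T X" for X x
    unfolding h_def by (rule theI', rule ex) (use that module_hom_closed[OF f] in auto)
  have "module_hom C T P h"
  proof (rule module_homI)
    fix X x y assume *: "X \<in> obj C" "x \<in> car T X" "y \<in> car T X"
    show "h X (x \<otimes>\<^bsub>omap T X\<^esub> y) = h X x \<otimes>\<^bsub>omap P X\<^esub> h X y"
      by (rule uniq[OF *(1)]) (use * h in \<open>simp_all add: module_hom_mult[OF \<pi>] module_hom_mult[OF f]\<close>)
  next
    fix X Y a x assume *: "X \<in> obj C" "Y \<in> obj C" "a \<in> arr C Y X" "x \<in> car T X"
    show "h Y (amap T X Y a x) = amap P X Y a (h X x)"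
      by (rule uniq[OF *(2)]) (use * h in \<open>simp_all add: module_hom_act[OF \<pi>] module_hom_act[OF f]\<close>)
  qed (use h in auto)
  then show thesis using h that by blast
qed

lemma pprod_product:
  fixes M :: "'i \<Rightarrow> ('o, 'a, 'u) cmodule"
  assumes M: "\<And>i. i \<in> I \<Longrightarrow> M i \<in> obj (Mod C)" and P: "P \<in> obj (Mod C)"
    and \<pi>: "\<And>i. i \<in> I \<Longrightarrow> \<pi> i \<in> arr (Mod C) P (M i)" and p: "pprod C I M P \<pi>"
  shows "is_product (Mod C) I M P \<pi>"
  unfolding is_product_def
proof (intro conjI ballI allI impI)
  fix T f assume T: "T \<in> obj (Mod C)" and f: "\<forall>i\<in>I. f i \<in> arr (Mod C) T (M i)"
  have fh: "\<And>i. i \<in> I \<Longrightarrow> module_hom C T (M i) (f i)"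
    using f by (intro arr_Mod_hom T M) auto
  obtain h where h: "module_hom C T P h"
    and \<pi>h: "\<And>i X x. i \<in> I \<Longrightarrow> X \<in> obj C \<Longrightarrow> x \<in> car T X \<Longrightarrow> \<pi> i X (h X x) = f i X x"
    using pprod_extend[OF obj_ModD(1)[OF M] obj_ModD(1)[OF P] p obj_ModD(1)[OF T] fh] by metis
  have ex: "\<exists>!p. p \<in> car P X \<and> (\<forall>i\<in>I. \<pi> i X p = x i)" if "X \<in> obj C" "\<forall>i\<in>I. x i \<in> car (M i) X" for X x
    using p that by (simp add: pprod_def)
  show "\<exists>!h. h \<in> arr (Mod C) T P \<and> (\<forall>i\<in>I. ccomp (Mod C) T P (M i) (\<pi> i) h = f i)"
  proof (intro ex1I conjI ballI)
    show "mod_arr C T h \<in> arr (Mod C) T P" by (rule mod_arr_in[OF T P h])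
    fix i assume i: "i \<in> I"
    show "ccomp (Mod C) T P (M i) (\<pi> i) (mod_arr C T h) = f i"
      by (rule arr_Mod_eqI[OF T M[OF i] M[OF i] _ bspec[OF f i]])
        (auto simp: ccomp_Mod \<pi>h i intro!: mod_arr_in T M[OF i]
          module_hom_comp[OF _ arr_Mod_hom[OF P M[OF i] \<pi>[OF i]]] module_hom_mod_arr h obj_ModD[OF T])
  next
    fix h' assume "h' \<in> arr (Mod C) T P \<and> (\<forall>i\<in>I. ccomp (Mod C) T P (M i) (\<pi> i) h' = f i)"
    then have h': "h' \<in> arr (Mod C) T P" and e: "\<And>i. i \<in> I \<Longrightarrow> ccomp (Mod C) T P (M i) (\<pi> i) h' = f i" by auto
    show "h' = mod_arr C T h"
    proof (rule arr_Mod_eqI[OF T P P h' mod_arr_in[OF T P h]])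
      fix X x assume *: "X \<in> obj C" "x \<in> car T X"
      have 1: "\<pi> i X (h' X x) = f i X x" if "i \<in> I" for i
        using fun_cong[OF fun_cong[OF e[OF that], of X], of x] * by (simp add: ccomp_Mod)
      have "\<forall>i\<in>I. f i X x \<in> car (M i) X" using * module_hom_closed[OF fh] by blast
      from ex[OF *(1) this] show "h' X x = mod_arr C T h X x"
        using 1 \<pi>h * module_hom_closed[OF h] module_hom_closed[OF arr_Mod_hom[OF T P h']]
        by (metis mod_arr_apply)
    qed
  qed
qed (use M P \<pi> in auto)

lemma finprod_hom:
  assumes G: "comm_group G" and H: "comm_group H" and h: "h \<in> hom G H"
    and fin: "finite A" and f: "f \<in> A \<rightarrow> carrier G"
  shows "h (finprod G f A) = finprod H (\<lambda>i. h (f i)) A"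
proof -
  interpret G: comm_group G by (rule G)
  interpret H: comm_group H by (rule H)
  show ?thesis using fin f
  proof (induction A)
    case empty
    then show ?case using hom_one[OF h] by simp
  next
    case (insert a A)
    then have "f \<in> A \<rightarrow> carrier G" "f a \<in> carrier G" by auto
    moreover have "(\<lambda>i. h (f i)) \<in> A \<rightarrow> carrier H" "h (f a) \<in> carrier H"
      using calculation hom_in_carrier[OF h] by auto
    ultimately show ?case using insert hom_mult[OF h] by simp
  qed
qed

lemma pcopE:
  assumes "pcop C I M P \<iota>"
  obtains \<rho> where "\<And>i. i \<in> I \<Longrightarrow> module_hom C P (M i) (\<rho> i)"
    and "\<And>i X x. i \<in> I \<Longrightarrow> X \<in> obj C \<Longrightarrow> x \<in> car (M i) X \<Longrightarrow> \<rho> i X (\<iota> i X x) = x"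
    and "\<And>i j X x. i \<in> I \<Longrightarrow> j \<in> I \<Longrightarrow> i \<noteq> j \<Longrightarrow> X \<in> obj C \<Longrightarrow> x \<in> car (M i) X \<Longrightarrow>
        \<rho> j X (\<iota> i X x) = \<one>\<^bsub>omap (M j) X\<^esub>"
    and "\<And>X p. X \<in> obj C \<Longrightarrow> p \<in> car P X \<Longrightarrow> finite {i \<in> I. \<rho> i X p \<noteq> \<one>\<^bsub>omap (M i) X\<^esub>}"
    and "\<And>X p. X \<in> obj C \<Longrightarrow> p \<in> car P X \<Longrightarrow> \<forall>i\<in>I. \<rho> i X p = \<one>\<^bsub>omap (M i) X\<^esub> \<Longrightarrow> p = \<one>\<^bsub>omap P X\<^esub>"
proof -
  from assms obtain \<rho> where
    "\<forall>i\<in>I. module_hom C P (M i) (\<rho> i)"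
    "\<forall>i\<in>I. \<forall>X\<in>obj C. \<forall>x\<in>car (M i) X. \<rho> i X (\<iota> i X x) = x"
    "\<forall>i\<in>I. \<forall>j\<in>I. i \<noteq> j \<longrightarrow> (\<forall>X\<in>obj C. \<forall>x\<in>car (M i) X. \<rho> j X (\<iota> i X x) = \<one>\<^bsub>omap (M j) X\<^esub>)"
    "\<forall>X\<in>obj C. \<forall>p\<in>car P X. finite {i \<in> I. \<rho> i X p \<noteq> \<one>\<^bsub>omap (M i) X\<^esub>}"
    "\<forall>X\<in>obj C. \<forall>p\<in>car P X. (\<forall>i\<in>I. \<rho> i X p = \<one>\<^bsub>omap (M i) X\<^esub>) \<longrightarrow> p = \<one>\<^bsub>omap P X\<^esub>"
    unfolding pcop_def by (elim conjE exE) (rule that)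
  then show thesis by (intro that[of \<rho>]) simp_all
qed

text \<open>Induction on a finite set of indices outside which the components of the element vanish.
  The element is never expanded as a sum.\<close>

lemma pcop_unique:
  assumes M: "\<And>i. i \<in> I \<Longrightarrow> cat_module C (M i)" and P: "cat_module C P" and p: "pcop C I M P \<iota>"
    and T: "cat_module C T" and h: "module_hom C P T h" and k: "module_hom C P T k"
    and eq: "\<And>i X x. i \<in> I \<Longrightarrow> X \<in> obj C \<Longrightarrow> x \<in> car (M i) X \<Longrightarrow> h X (\<iota> i X x) = k X (\<iota> i X x)"
    and X: "X \<in> obj C" and x: "x \<in> car P X"
  shows "h X x = k X x"
proof -
  interpret P: cat_module C P by (rule P)
  interpret T: cat_module C T by (rule T)
  have \<iota>: "\<And>i. i \<in> I \<Longrightarrow> module_hom C (M i) P (\<iota> i)" using p by (simp add: pcop_def)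
  obtain \<rho> where \<rho>: "\<And>i. i \<in> I \<Longrightarrow> module_hom C P (M i) (\<rho> i)"
    and \<rho>\<iota>: "\<And>i X x. i \<in> I \<Longrightarrow> X \<in> obj C \<Longrightarrow> x \<in> car (M i) X \<Longrightarrow> \<rho> i X (\<iota> i X x) = x"
    and \<rho>\<iota>': "\<And>i j X x. i \<in> I \<Longrightarrow> j \<in> I \<Longrightarrow> i \<noteq> j \<Longrightarrow> X \<in> obj C \<Longrightarrow> x \<in> car (M i) X \<Longrightarrow>
        \<rho> j X (\<iota> i X x) = \<one>\<^bsub>omap (M j) X\<^esub>"
    and fin: "\<And>X p. X \<in> obj C \<Longrightarrow> p \<in> car P X \<Longrightarrow> finite {i \<in> I. \<rho> i X p \<noteq> \<one>\<^bsub>omap (M i) X\<^esub>}"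
    and det: "\<And>X p. X \<in> obj C \<Longrightarrow> p \<in> car P X \<Longrightarrow> \<forall>i\<in>I. \<rho> i X p = \<one>\<^bsub>omap (M i) X\<^esub> \<Longrightarrow> p = \<one>\<^bsub>omap P X\<^esub>"
    by (rule pcopE[OF p]) (rule that, assumption+)
  define A where "A = {i \<in> I. \<rho> i X x \<noteq> \<one>\<^bsub>omap (M i) X\<^esub>}"
  have "finite A" unfolding A_def by (rule fin[OF X x])
  moreover have "A \<subseteq> I" "\<forall>i\<in>I - A. \<rho> i X x = \<one>\<^bsub>omap (M i) X\<^esub>" by (auto simp: A_def)
  ultimately show ?thesis using x
  proof (induction A arbitrary: x)
    case empty
    then have "x = \<one>\<^bsub>omap P X\<^esub>" by (intro det[OF X]) auto
    then show ?case using module_hom_one[OF h P T X] module_hom_one[OF k P T X] by simp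
  next
    case (insert j A)
    have j: "j \<in> I" using insert.prems by simp
    interpret Mj: cat_module C "M j" by (rule M[OF j])
    have rx: "\<rho> j X x \<in> car (M j) X" using X insert.prems by (simp add: module_hom_closed[OF \<rho>[OF j]])
    define z where "z = \<iota> j X (\<rho> j X x)"
    have z: "z \<in> car P X" unfolding z_def by (rule module_hom_closed[OF \<iota>[OF j] X rx])
    \<comment> \<open>Removing the component at \<open>j\<close> leaves an element whose components
      vanish outside \<open>A\<close>, to which the induction hypothesis applies.\<close>
    define y where "y = x \<otimes>\<^bsub>omap P X\<^esub> inv\<^bsub>omap P X\<^esub> z"
    have y: "y \<in> car P X" using X z insert.prems by (simp add: y_def)
    have xyz: "x = y \<otimes>\<^bsub>omap P X\<^esub> z"
      using X z insert.prems unfolding y_def by (simp add: monoid.m_assoc group.l_inv)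
    have "h X y = k X y"
    proof (rule insert.IH)
      show "\<forall>i\<in>I - A. \<rho> i X y = \<one>\<^bsub>omap (M i) X\<^esub>"
      proof
        fix i assume i: "i \<in> I - A"
        then have iI: "i \<in> I" by simp
        interpret Mi: cat_module C "M i" by (rule M[OF iI])
        have e: "\<rho> i X y = \<rho> i X x \<otimes>\<^bsub>omap (M i) X\<^esub> inv\<^bsub>omap (M i) X\<^esub> \<rho> i X z"
          using X z insert.prems unfolding y_def
          by (simp add: module_hom_mult[OF \<rho>[OF iI]] module_hom_inv[OF \<rho>[OF iI] P Mi.cat_module_axioms])
        have rix: "\<rho> i X x \<in> car (M i) X" using X insert.prems by (simp add: module_hom_closed[OF \<rho>[OF iI]])
        show "\<rho> i X y = \<one>\<^bsub>omap (M i) X\<^esub>"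
        proof (cases "i = j")
          case True
          then show ?thesis unfolding e z_def using X rx
            by (simp add: \<rho>\<iota>[OF j] Mj.mult_inv_eq_one_iff)
        next
          case False
          then have "\<rho> i X x = \<one>\<^bsub>omap (M i) X\<^esub>" using i insert.prems by auto
          moreover have "\<rho> i X z = \<one>\<^bsub>omap (M i) X\<^esub>"
            unfolding z_def using False by (intro \<rho>\<iota>'[OF j iI] X rx) auto
          ultimately show ?thesis unfolding e using X by (simp add: Mi.mult_inv_eq_one_iff)
        qed
      qed
    qed (use insert.prems y in auto)
    moreover have "h X z = k X z" unfolding z_def by (rule eq[OF j X rx])
    ultimately show ?case unfolding xyz using X y z
      by (simp add: module_hom_mult[OF h] module_hom_mult[OF k])
  qed
qed

text \<open>The extension adds up the values of the \<open>f i\<close> at the finitely many nonzero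
  components of an element.\<close>

lemma pcop_extend:
  assumes M: "\<And>i. i \<in> I \<Longrightarrow> cat_module C (M i)" and P: "cat_module C P" and p: "pcop C I M P \<iota>"
    and T: "cat_module C T" and f: "\<And>i. i \<in> I \<Longrightarrow> module_hom C (M i) T (f i)"
  obtains h where "module_hom C P T h"
    "\<And>i X x. i \<in> I \<Longrightarrow> X \<in> obj C \<Longrightarrow> x \<in> car (M i) X \<Longrightarrow> h X (\<iota> i X x) = f i X x"
proof -
  interpret P: cat_module C P by (rule P)
  interpret T: cat_module C T by (rule T)
  have \<iota>: "\<And>i. i \<in> I \<Longrightarrow> module_hom C (M i) P (\<iota> i)" using p by (simp add: pcop_def)
  obtain \<rho> where \<rho>: "\<And>i. i \<in> I \<Longrightarrow> module_hom C P (M i) (\<rho> i)"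
    and \<rho>\<iota>: "\<And>i X x. i \<in> I \<Longrightarrow> X \<in> obj C \<Longrightarrow> x \<in> car (M i) X \<Longrightarrow> \<rho> i X (\<iota> i X x) = x"
    and \<rho>\<iota>': "\<And>i j X x. i \<in> I \<Longrightarrow> j \<in> I \<Longrightarrow> i \<noteq> j \<Longrightarrow> X \<in> obj C \<Longrightarrow> x \<in> car (M i) X \<Longrightarrow>
        \<rho> j X (\<iota> i X x) = \<one>\<^bsub>omap (M j) X\<^esub>"
    and fin: "\<And>X p. X \<in> obj C \<Longrightarrow> p \<in> car P X \<Longrightarrow> finite {i \<in> I. \<rho> i X p \<noteq> \<one>\<^bsub>omap (M i) X\<^esub>}"
    and det: "\<And>X p. X \<in> obj C \<Longrightarrow> p \<in> car P X \<Longrightarrow> \<forall>i\<in>I. \<rho> i X p = \<one>\<^bsub>omap (M i) X\<^esub> \<Longrightarrow> p = \<one>\<^bsub>omap P X\<^esub>"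
    by (rule pcopE[OF p]) (rule that, assumption+)
  define supp where "supp X p = {i \<in> I. \<rho> i X p \<noteq> \<one>\<^bsub>omap (M i) X\<^esub>}" for X p
  define h where "h X p = finprod (omap T X) (\<lambda>i. f i X (\<rho> i X p)) (supp X p)" for X p
  have fc: "f i X (\<rho> i X p) \<in> car T X" if "i \<in> I" "X \<in> obj C" "p \<in> car P X" for i X p
    using that by (intro module_hom_closed[OF f] module_hom_closed[OF \<rho>])
  \<comment> \<open>Terms outside the support are trivial, so the product may run over any finite
    set of indices containing it; elements with different supports are then compared over a common
    index set.\<close>
  have h_eq: "h X p = finprod (omap T X) (\<lambda>i. f i X (\<rho> i X p)) A"
    if "X \<in> obj C" "p \<in> car P X" "finite A" "A \<subseteq> I" "supp X p \<subseteq> A" for X p A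
  proof -
    interpret G: comm_group "omap T X" by (rule T.grp[OF that(1)])
    show ?thesis unfolding h_def
    proof (rule G.finprod_mono_neutral_cong_left[OF that(3,5)])
      fix i assume i: "i \<in> A - supp X p"
      then have iI: "i \<in> I" using that by auto
      then have "\<rho> i X p = \<one>\<^bsub>omap (M i) X\<^esub>" using i by (auto simp: supp_def)
      then show "f i X (\<rho> i X p) = \<one>\<^bsub>omap T X\<^esub>"
        using module_hom_one[OF f[OF iI] M[OF iI] T that(1)] by simp
    qed (use that fc in auto)
  qed
  have supp_fin: "finite (supp X p)" if "X \<in> obj C" "p \<in> car P X" for X p
    unfolding supp_def by (rule fin[OF that])
  have supp_sub: "supp X p \<subseteq> I" for X p by (auto simp: supp_def)
  have hom: "module_hom C P T h"
  proof (rule module_homI)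
    fix X p assume X: "X \<in> obj C" and p: "p \<in> car P X"
    interpret G: comm_group "omap T X" by (rule T.grp[OF X])
    show "h X p \<in> car T X" unfolding h_def
      using fc[OF _ X p] supp_sub by (intro G.finprod_closed) auto
    fix q assume q: "q \<in> car P X"
    define A where "A = supp X p \<union> supp X q \<union> supp X (p \<otimes>\<^bsub>omap P X\<^esub> q)"
    have A: "finite A" "A \<subseteq> I" unfolding A_def using supp_fin X p q supp_sub by auto
    have pq: "p \<otimes>\<^bsub>omap P X\<^esub> q \<in> car P X" using X p q by simp
    have "h X (p \<otimes>\<^bsub>omap P X\<^esub> q) = finprod (omap T X) (\<lambda>i. f i X (\<rho> i X (p \<otimes>\<^bsub>omap P X\<^esub> q))) A"
      by (rule h_eq[OF X pq A]) (auto simp: A_def)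
    also have "\<dots> = finprod (omap T X) (\<lambda>i. f i X (\<rho> i X p) \<otimes>\<^bsub>omap T X\<^esub> f i X (\<rho> i X q)) A"
    proof (rule G.finprod_cong'[OF refl])
      fix i assume "i \<in> A"
      then have i: "i \<in> I" using A by auto
      show "f i X (\<rho> i X (p \<otimes>\<^bsub>omap P X\<^esub> q)) = f i X (\<rho> i X p) \<otimes>\<^bsub>omap T X\<^esub> f i X (\<rho> i X q)"
        using X p q by (simp add: module_hom_mult[OF \<rho>[OF i]] module_hom_mult[OF f[OF i]] module_hom_closed[OF \<rho>[OF i]])
    qed (use A fc X p q in auto)
    also have "\<dots> = finprod (omap T X) (\<lambda>i. f i X (\<rho> i X p)) A \<otimes>\<^bsub>omap T X\<^esub> finprod (omap T X) (\<lambda>i. f i X (\<rho> i X q)) A"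
      using A fc X p q by (intro G.finprod_multf) auto
    also have "finprod (omap T X) (\<lambda>i. f i X (\<rho> i X p)) A = h X p"
      by (rule h_eq[OF X p A, symmetric]) (auto simp: A_def)
    also have "finprod (omap T X) (\<lambda>i. f i X (\<rho> i X q)) A = h X q"
      by (rule h_eq[OF X q A, symmetric]) (auto simp: A_def)
    finally show "h X (p \<otimes>\<^bsub>omap P X\<^esub> q) = h X p \<otimes>\<^bsub>omap T X\<^esub> h X q" .
  next
    fix X Y a p assume *: "X \<in> obj C" "Y \<in> obj C" "a \<in> arr C Y X" "p \<in> car P X"
    interpret G: comm_group "omap T Y" by (rule T.grp[OF *(2)])
    have ap: "amap P X Y a p \<in> car P Y" using * by simp
    define A where "A = supp X p \<union> supp Y (amap P X Y a p)"
    have A: "finite A" "A \<subseteq> I" unfolding A_def using supp_fin * ap supp_sub by auto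
    have "amap T X Y a (h X p) = amap T X Y a (finprod (omap T X) (\<lambda>i. f i X (\<rho> i X p)) A)"
      using h_eq[OF *(1,4) A] by (simp add: A_def)
    also have "\<dots> = finprod (omap T Y) (\<lambda>i. amap T X Y a (f i X (\<rho> i X p))) A"
      using A fc * by (intro finprod_hom T.grp T.act_hom) auto
    also have "\<dots> = finprod (omap T Y) (\<lambda>i. f i Y (\<rho> i Y (amap P X Y a p))) A"
    proof (rule G.finprod_cong'[OF refl])
      fix i assume "i \<in> A"
      then have i: "i \<in> I" using A by auto
      show "amap T X Y a (f i X (\<rho> i X p)) = f i Y (\<rho> i Y (amap P X Y a p))"
        using * by (simp add: module_hom_act[OF \<rho>[OF i]] module_hom_act[OF f[OF i]] module_hom_closed[OF \<rho>[OF i]])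
    qed (use A fc * ap in auto)
    also have "\<dots> = h Y (amap P X Y a p)"
      by (rule h_eq[OF *(2) ap A, symmetric]) (auto simp: A_def)
    finally show "h Y (amap P X Y a p) = amap T X Y a (h X p)" by simp
  qed
  have "h X (\<iota> i X x) = f i X x" if i: "i \<in> I" and X: "X \<in> obj C" and x: "x \<in> car (M i) X" for i X x
  proof -
    interpret G: comm_group "omap T X" by (rule T.grp[OF X])
    have ix: "\<iota> i X x \<in> car P X" by (rule module_hom_closed[OF \<iota>[OF i] X x])
    have "h X (\<iota> i X x) = finprod (omap T X) (\<lambda>j. f j X (\<rho> j X (\<iota> i X x))) {i}"
      by (rule h_eq[OF X ix]) (use \<rho>\<iota>'[OF i _ _ X x] i in \<open>auto simp: supp_def\<close>)
    then show ?thesis using fc[OF i X ix] \<rho>\<iota>[OF i X x] by simp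
  qed
  then show thesis using hom that by blast
qed

lemma pcop_coproduct:
  fixes M :: "'i \<Rightarrow> ('o, 'a, 'u) cmodule"
  assumes M: "\<And>i. i \<in> I \<Longrightarrow> M i \<in> obj (Mod C)" and P: "P \<in> obj (Mod C)"
    and \<iota>: "\<And>i. i \<in> I \<Longrightarrow> \<iota> i \<in> arr (Mod C) (M i) P" and p: "pcop C I M P \<iota>"
  shows "is_coproduct (Mod C) I M P \<iota>"
  unfolding is_coproduct_def
proof (intro conjI ballI allI impI)
  fix T f assume T: "T \<in> obj (Mod C)" and f: "\<forall>i\<in>I. f i \<in> arr (Mod C) (M i) T"
  have fh: "\<And>i. i \<in> I \<Longrightarrow> module_hom C (M i) T (f i)"
    using f by (intro arr_Mod_hom T M) auto
  have \<iota>h: "\<And>i. i \<in> I \<Longrightarrow> module_hom C (M i) P (\<iota> i)"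
    using \<iota> by (intro arr_Mod_hom P M) auto
  obtain h where h: "module_hom C P T h"
    and h\<iota>: "\<And>i X x. i \<in> I \<Longrightarrow> X \<in> obj C \<Longrightarrow> x \<in> car (M i) X \<Longrightarrow> h X (\<iota> i X x) = f i X x"
    using pcop_extend[OF obj_ModD(1)[OF M] obj_ModD(1)[OF P] p obj_ModD(1)[OF T] fh] by metis
  show "\<exists>!h. h \<in> arr (Mod C) P T \<and> (\<forall>i\<in>I. ccomp (Mod C) (M i) P T h (\<iota> i) = f i)"
  proof (intro ex1I conjI ballI)
    show "mod_arr C P h \<in> arr (Mod C) P T" by (rule mod_arr_in[OF P T h])
    fix i assume i: "i \<in> I"
    show "ccomp (Mod C) (M i) P T (mod_arr C P h) (\<iota> i) = f i"
      by (rule arr_Mod_eqI[OF M[OF i] T T _ bspec[OF f i]])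
        (auto simp: ccomp_Mod h\<iota> i module_hom_closed[OF \<iota>h[OF i]] intro!: mod_arr_in T M[OF i]
          module_hom_comp[OF \<iota>h[OF i]] module_hom_mod_arr h obj_ModD[OF P])
  next
    fix h' assume "h' \<in> arr (Mod C) P T \<and> (\<forall>i\<in>I. ccomp (Mod C) (M i) P T h' (\<iota> i) = f i)"
    then have h': "h' \<in> arr (Mod C) P T" and e: "\<And>i. i \<in> I \<Longrightarrow> ccomp (Mod C) (M i) P T h' (\<iota> i) = f i" by auto
    show "h' = mod_arr C P h"
    proof (rule arr_Mod_eqI[OF P T T h' mod_arr_in[OF P T h]])
      fix X x assume *: "X \<in> obj C" "x \<in> car P X"
      have "h' X x = h X x"
      proof (rule pcop_unique[OF obj_ModD(1)[OF M] obj_ModD(1)[OF P] p obj_ModD(1)[OF T] arr_Mod_hom[OF P T h'] h _ *])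
        fix i X x assume **: "i \<in> I" "X \<in> obj C" "x \<in> car (M i) X"
        show "h' X (\<iota> i X x) = h X (\<iota> i X x)"
          using fun_cong[OF fun_cong[OF e[OF **(1)], of X], of x] ** by (simp add: ccomp_Mod h\<iota>)
      qed
      then show "h' X x = mod_arr C P h X x" using * by simp
    qed
  qed
qed (use M P \<iota> in auto)

section \<open>Explicit kernels, cokernels, products and coproducts\<close>

lemma pker_kerm:
  assumes "cat_module C M" "cat_module C N" "module_hom C M N h"
  shows "pker C M N h (subm M (kerm C M N h)) (\<lambda>X x. x)"
  unfolding pker_def using subm_incl[OF submodule_kerm[OF assms]]
  by (auto simp: kerm_def)

lemma pcok_quotm:
  assumes "cat_module C M" "cat_module C N" "module_hom C M N h"
  shows "pcok C M N h (quotm N (imm C M h)) (quot_map N (imm C M h))"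
proof -
  note im = submodule_imm[OF assms]
  have "(X, y) \<in> imm C M h \<longleftrightarrow> y \<in> h X ` car M X" if "X \<in> obj C" for X y
    using that by (simp add: imm_def)
  then show ?thesis
    unfolding pcok_def by (simp add: quot_map_hom[OF assms(2) im] car_quotm quot_map_eq_one_iff[OF assms(2) im])
qed

lemma pprod_prodm: "pprod C I M (prodm I M) (\<lambda>i X s. s i)"
  unfolding pprod_def
proof (intro conjI ballI allI impI)
  fix X x assume x: "\<forall>i\<in>I. x i \<in> car (M i) X"
  show "\<exists>!s. s \<in> car (prodm I M) X \<and> (\<forall>i\<in>I. s i = x i)"
  proof (rule ex1I[of _ "restrict x I"])
    fix s assume "s \<in> car (prodm I M) X \<and> (\<forall>i\<in>I. s i = x i)"
    then show "s = restrict x I" by (auto simp: PiE_iff intro!: extensionalityI)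
  qed (use x in auto)
qed (rule prodm_proj)

lemma pcop_copm:
  assumes M: "\<And>i. i \<in> I \<Longrightarrow> cat_module C (M i)"
  shows "pcop C I M (copm C I M) (cop_in I M)"
proof -
  have "module_hom C (M i) (copm C I M) (cop_in I M i)" if i: "i \<in> I" for i
    unfolding copm_def
  proof (rule module_hom_into_subm)
    interpret Mi: cat_module C "M i" by (rule M[OF i])
    have "module_hom C (M i) (prodm I M) (\<lambda>X x. \<lambda>j\<in>I. if j = i then x else \<one>\<^bsub>omap (M j) X\<^esub>)"
    proof (rule prodm_tuple)
      fix j assume j: "j \<in> I"
      show "module_hom C (M i) (M j) (\<lambda>X x. if j = i then x else \<one>\<^bsub>omap (M j) X\<^esub>)"
        by (cases "j = i") (simp_all add: module_hom_id module_hom_zero M j)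
    qed
    then show *: "module_hom C (M i) (prodm I M) (cop_in I M i)"
      by (simp add: cop_in_def[abs_def])
    fix X x assume x: "X \<in> obj C" "x \<in> car (M i) X"
    have "{j \<in> I. cop_in I M i X x j \<noteq> \<one>\<^bsub>omap (M j) X\<^esub>} \<subseteq> {i}" by (auto simp: cop_in_def)
    then have "finite {j \<in> I. cop_in I M i X x j \<noteq> \<one>\<^bsub>omap (M j) X\<^esub>}" by (rule finite_subset) simp
    with module_hom_closed[OF * x] x show "(X, cop_in I M i X x) \<in> finsupp C I M"
      by (simp add: finsupp_def)
  qed
  moreover have "module_hom C (copm C I M) (M i) (\<lambda>X s. s i)" if "i \<in> I" for i
    unfolding copm_def by (intro module_hom_from_subm prodm_proj submodule_finsupp M that)
  moreover have "p = \<one>\<^bsub>omap (copm C I M) X\<^esub>"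
    if "p \<in> car (copm C I M) X" "\<forall>i\<in>I. p i = \<one>\<^bsub>omap (M i) X\<^esub>" for X p
    using that by (auto simp: copm_def finsupp_def PiE_iff intro!: extensionalityI[of _ I])
  ultimately show ?thesis
    unfolding pcop_def
    by (intro conjI exI[of _ "\<lambda>i X s. s i"]) (auto simp: cop_in_def copm_def finsupp_def)
qed

lemma cop_in_hom:
  assumes "\<And>i. i \<in> I \<Longrightarrow> cat_module C (M i)" "i \<in> I"
  shows "module_hom C (M i) (copm C I M) (cop_in I M i)"
proof -
  have "pcop C I M (copm C I M) (cop_in I M)" by (rule pcop_copm) (rule assms(1))
  then have "\<forall>i\<in>I. module_hom C (M i) (copm C I M) (cop_in I M i)"
    unfolding pcop_def by (rule conjunct1)
  then show ?thesis using assms(2) by (rule bspec)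
qed

section \<open>Transfer of the pointwise conditions along isomorphisms\<close>

lemma pker_transfer:
  assumes p: "pker C M N h K k"
    and M: "cat_module C M" and N: "cat_module C N" and N': "cat_module C N'"
    and h: "module_hom C M N h"
    and \<alpha>: "module_iso C M M' \<alpha>" and \<beta>: "module_iso C N N' \<beta>" and \<gamma>: "module_iso C K' K \<gamma>"
    and g: "\<And>X x. X \<in> obj C \<Longrightarrow> x \<in> car M X \<Longrightarrow> g X (\<alpha> X x) = \<beta> X (h X x)"
    and k': "module_hom C K' M' k'"
      "\<And>X x. X \<in> obj C \<Longrightarrow> x \<in> car K' X \<Longrightarrow> k' X x = \<alpha> X (k X (\<gamma> X x))"
  shows "pker C M' N' g K' k'"
  unfolding pker_def
proof (intro conjI ballI k'(1))
  have kh: "module_hom C K M k" using p by (simp add: pker_def)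
  fix X assume X: "X \<in> obj C"
  have bij: "bij_betw (\<alpha> X) (car M X) (car M' X)" "bij_betw (\<beta> X) (car N X) (car N' X)"
      "bij_betw (\<gamma> X) (car K' X) (car K X)" and \<beta>h: "module_hom C N N' \<beta>" and \<alpha>h: "module_hom C M M' \<alpha>"
    using X \<alpha> \<beta> \<gamma> by (auto simp: module_iso_def)
  have inj: "inj_on (k X) (car K X)" and im: "k X ` car K X = {x \<in> car M X. h X x = \<one>\<^bsub>omap N X\<^esub>}"
    using p X by (auto simp: pker_def)
  have "inj_on (\<lambda>x. \<alpha> X (k X (\<gamma> X x))) (car K' X)"
  proof (rule inj_onI)
    fix x y assume xy: "x \<in> car K' X" "y \<in> car K' X" "\<alpha> X (k X (\<gamma> X x)) = \<alpha> X (k X (\<gamma> X y))"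
    then have c: "\<gamma> X x \<in> car K X" "\<gamma> X y \<in> car K X" using bij(3) by (auto simp: bij_betw_def)
    then have "k X (\<gamma> X x) = k X (\<gamma> X y)"
      by (intro inj_onD[OF bij_betw_imp_inj_on[OF bij(1)] xy(3)] module_hom_closed[OF kh X])
    then have "\<gamma> X x = \<gamma> X y" by (rule inj_onD[OF inj _ c])
    then show "x = y" by (rule inj_onD[OF bij_betw_imp_inj_on[OF bij(3)] _ xy(1,2)])
  qed
  then show "inj_on (k' X) (car K' X)" using k'(2)[OF X] by (simp cong: inj_on_cong)
  have one: "\<beta> X y = \<one>\<^bsub>omap N' X\<^esub> \<longleftrightarrow> y = \<one>\<^bsub>omap N X\<^esub>" if "y \<in> car N X" for y
    using module_hom_inj_iff[OF N N' \<beta>h X] bij(2) that module_hom_one[OF \<beta>h N N' X]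
    by (auto simp: bij_betw_def)
  have "k' X ` car K' X = \<alpha> X ` (k X ` (\<gamma> X ` car K' X))"
    using k'(2)[OF X] by (simp add: image_image cong: image_cong_simp)
  also have "\<dots> = \<alpha> X ` {x \<in> car M X. h X x = \<one>\<^bsub>omap N X\<^esub>}"
    using bij(3) im by (simp add: bij_betw_def)
  also have "\<dots> = {x \<in> \<alpha> X ` car M X. g X x = \<one>\<^bsub>omap N' X\<^esub>}"
    using g[OF X] one module_hom_closed[OF h X] module_hom_one[OF \<beta>h N N' X] by auto
  finally show "k' X ` car K' X = {x \<in> car M' X. g X x = \<one>\<^bsub>omap N' X\<^esub>}"
    using bij(1) by (simp add: bij_betw_def)
qed

lemma pcok_transfer:
  assumes p: "pcok C M N h Q q"
    and M: "cat_module C M" and N: "cat_module C N" and Q: "cat_module C Q" and Q': "cat_module C Q'"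
    and h: "module_hom C M N h"
    and \<alpha>: "module_iso C M M' \<alpha>" and \<beta>: "module_iso C N N' \<beta>" and \<gamma>: "module_iso C Q Q' \<gamma>"
    and g: "\<And>X x. X \<in> obj C \<Longrightarrow> x \<in> car M X \<Longrightarrow> g X (\<alpha> X x) = \<beta> X (h X x)"
    and q': "module_hom C N' Q' q'"
      "\<And>X y. X \<in> obj C \<Longrightarrow> y \<in> car N X \<Longrightarrow> q' X (\<beta> X y) = \<gamma> X (q X y)"
  shows "pcok C M' N' g Q' q'"
  unfolding pcok_def
proof (intro conjI ballI q'(1))
  have qh: "module_hom C N Q q" using p by (simp add: pcok_def)
  fix X assume X: "X \<in> obj C"
  have bij: "bij_betw (\<alpha> X) (car M X) (car M' X)" "bij_betw (\<beta> X) (car N X) (car N' X)"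
      "bij_betw (\<gamma> X) (car Q X) (car Q' X)" and \<gamma>h: "module_hom C Q Q' \<gamma>"
    using X \<alpha> \<beta> \<gamma> by (auto simp: module_iso_def)
  have surj: "q X ` car N X = car Q X"
    and ker: "\<And>y. y \<in> car N X \<Longrightarrow> q X y = \<one>\<^bsub>omap Q X\<^esub> \<longleftrightarrow> y \<in> h X ` car M X"
    using p X by (auto simp: pcok_def)
  have "q' X ` car N' X = q' X ` (\<beta> X ` car N X)" using bij(2) by (simp add: bij_betw_def)
  also have "\<dots> = \<gamma> X ` (q X ` car N X)"
    using q'(2)[OF X] by (simp add: image_image cong: image_cong_simp)
  also have "\<dots> = car Q' X" using surj bij(3) by (simp add: bij_betw_def)
  finally show "q' X ` car N' X = car Q' X" .
  have one: "\<gamma> X y = \<one>\<^bsub>omap Q' X\<^esub> \<longleftrightarrow> y = \<one>\<^bsub>omap Q X\<^esub>" if "y \<in> car Q X" for y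
    using module_hom_inj_iff[OF Q Q' \<gamma>h X] bij(3) that module_hom_one[OF \<gamma>h Q Q' X]
    by (auto simp: bij_betw_def)
  have gim: "g X ` car M' X = \<beta> X ` (h X ` car M X)"
  proof -
    have "g X ` car M' X = g X ` (\<alpha> X ` car M X)" using bij(1) by (simp add: bij_betw_def)
    also have "\<dots> = \<beta> X ` (h X ` car M X)"
      using g[OF X] by (simp add: image_image cong: image_cong_simp)
    finally show ?thesis .
  qed
  fix y' assume "y' \<in> car N' X"
  then obtain y where y: "y \<in> car N X" "y' = \<beta> X y" using bij(2) by (auto simp: bij_betw_def)
  have "h X ` car M X \<subseteq> car N X" using module_hom_closed[OF h X] by auto
  then have "y' \<in> g X ` car M' X \<longleftrightarrow> y \<in> h X ` car M X"
    unfolding gim y(2) using bij_betw_imp_inj_on[OF bij(2)] y(1) by (intro inj_on_image_mem_iff)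
  also have "\<dots> \<longleftrightarrow> \<gamma> X (q X y) = \<one>\<^bsub>omap Q' X\<^esub>"
    using ker[OF y(1)] one module_hom_closed[OF qh X y(1)] by simp
  finally show "q' X y' = \<one>\<^bsub>omap Q' X\<^esub> \<longleftrightarrow> y' \<in> g X ` car M' X"
    using q'(2)[OF X y(1)] y(2) by simp
qed

text \<open>The reindexing \<open>f\<close> is included because closure of \<open>B\<close> under
  products concerns families indexed by subsets of \<open>'u\<close>, whereas the families met below
  are indexed by submodules or by systems of equations.\<close>

lemma pprod_transfer:
  assumes p: "pprod C I M P \<pi>"
    and f: "bij_betw f J I"
    and \<alpha>: "\<And>i. i \<in> I \<Longrightarrow> module_iso C (M i) (M' i) (\<alpha> i)" and \<gamma>: "module_iso C P' P \<gamma>"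
    and \<pi>': "\<And>j. j \<in> J \<Longrightarrow> module_hom C P' (M' (f j)) (\<pi>' j)"
      "\<And>j X x. j \<in> J \<Longrightarrow> X \<in> obj C \<Longrightarrow> x \<in> car P' X \<Longrightarrow> \<pi>' j X x = \<alpha> (f j) X (\<pi> (f j) X (\<gamma> X x))"
  shows "pprod C J (\<lambda>j. M' (f j)) P' \<pi>'"
  unfolding pprod_def
proof (intro conjI ballI allI impI \<pi>'(1))
  fix X x assume X: "X \<in> obj C" and x: "\<forall>j\<in>J. x j \<in> car (M' (f j)) X"
  have fJ: "f ` J = I" and finj: "inj_on f J" using f by (auto simp: bij_betw_def)
  have bij: "\<And>i. i \<in> I \<Longrightarrow> bij_betw (\<alpha> i X) (car (M i) X) (car (M' i) X)" "bij_betw (\<gamma> X) (car P' X) (car P X)"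
    using X \<alpha> \<gamma> by (auto simp: module_iso_def)
  have \<pi>: "\<And>i. i \<in> I \<Longrightarrow> module_hom C P (M i) (\<pi> i)" using p by (simp add: pprod_def)
  define y where "y i = inv_into (car (M i) X) (\<alpha> i X) (x (inv_into J f i))" for i
  have x': "x (inv_into J f i) \<in> car (M' i) X" if "i \<in> I" for i
    using x that fJ by (metis f_inv_into_f inv_into_into)
  have y: "y i \<in> car (M i) X" "\<alpha> i X (y i) = x (inv_into J f i)" if "i \<in> I" for i
    using x'[OF that] bij(1)[OF that] unfolding y_def
    by (simp_all add: bij_betw_def inv_into_into f_inv_into_f)
  have ex1: "\<exists>!p. p \<in> car P X \<and> (\<forall>i\<in>I. \<pi> i X p = y i)"
    using p X y(1) by (simp add: pprod_def)
  then obtain p where p: "p \<in> car P X" "\<forall>i\<in>I. \<pi> i X p = y i" by blast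
  have "p \<in> \<gamma> X ` car P' X" using p(1) bij(2) by (simp add: bij_betw_def)
  then obtain p' where p': "p' \<in> car P' X" "\<gamma> X p' = p" by blast
  have key: "(\<forall>j\<in>J. \<pi>' j X q = x j) \<longleftrightarrow> (\<forall>i\<in>I. \<pi> i X (\<gamma> X q) = y i)" if q: "q \<in> car P' X" for q
  proof -
    have "\<pi>' j X q = x j \<longleftrightarrow> \<pi> (f j) X (\<gamma> X q) = y (f j)" if j: "j \<in> J" for j
    proof -
      have fj: "f j \<in> I" using j fJ by blast
      have "\<gamma> X q \<in> car P X" using q bij(2) by (auto simp: bij_betw_def)
      then have "\<pi> (f j) X (\<gamma> X q) \<in> car (M (f j)) X" by (rule module_hom_closed[OF \<pi>[OF fj] X])
      then have "\<alpha> (f j) X (\<pi> (f j) X (\<gamma> X q)) = \<alpha> (f j) X (y (f j)) \<longleftrightarrow> \<pi> (f j) X (\<gamma> X q) = y (f j)"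
        by (rule inj_on_eq_iff[OF bij_betw_imp_inj_on[OF bij(1)[OF fj]] _ y(1)[OF fj]])
      then show ?thesis using \<pi>'(2)[OF j X q] y(2)[OF fj] finj j by simp
    qed
    then show ?thesis using fJ by auto
  qed
  show "\<exists>!p. p \<in> car P' X \<and> (\<forall>j\<in>J. \<pi>' j X p = x j)"
  proof (intro ex1I conjI)
    show "\<forall>j\<in>J. \<pi>' j X p' = x j" using key[OF p'(1)] p p' by simp
    fix q assume "q \<in> car P' X \<and> (\<forall>j\<in>J. \<pi>' j X q = x j)"
    then have q: "q \<in> car P' X" "\<forall>i\<in>I. \<pi> i X (\<gamma> X q) = y i" using key by auto
    then have "\<gamma> X q \<in> car P X" using bij(2) by (auto simp: bij_betw_def)
    then have "\<gamma> X q = p" using ex1 p q(2) by blast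
    then show "q = p'" using p' q bij(2) by (auto simp: bij_betw_def inj_on_def)
  qed (rule p'(1))
qed

lemma pcop_transfer:
  assumes p: "pcop C I M P \<iota>"
    and M: "\<And>i. i \<in> I \<Longrightarrow> cat_module C (M i)" and M': "\<And>i. i \<in> I \<Longrightarrow> cat_module C (M' i)"
    and P: "cat_module C P" and P': "cat_module C P'"
    and f: "bij_betw f J I"
    and \<alpha>: "\<And>i. i \<in> I \<Longrightarrow> module_iso C (M i) (M' i) (\<alpha> i)" and \<gamma>: "module_iso C P P' \<gamma>"
    and \<iota>': "\<And>j. j \<in> J \<Longrightarrow> module_hom C (M' (f j)) P' (\<iota>' j)"
      "\<And>j X x. j \<in> J \<Longrightarrow> X \<in> obj C \<Longrightarrow> x \<in> car (M (f j)) X \<Longrightarrow> \<iota>' j X (\<alpha> (f j) X x) = \<gamma> X (\<iota> (f j) X x)"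
  shows "pcop C J (\<lambda>j. M' (f j)) P' \<iota>'"
proof -
  obtain \<rho> where \<rho>: "\<And>i. i \<in> I \<Longrightarrow> module_hom C P (M i) (\<rho> i)"
    and \<rho>\<iota>: "\<And>i X x. i \<in> I \<Longrightarrow> X \<in> obj C \<Longrightarrow> x \<in> car (M i) X \<Longrightarrow> \<rho> i X (\<iota> i X x) = x"
    and \<rho>\<iota>': "\<And>i j X x. i \<in> I \<Longrightarrow> j \<in> I \<Longrightarrow> i \<noteq> j \<Longrightarrow> X \<in> obj C \<Longrightarrow> x \<in> car (M i) X \<Longrightarrow>
        \<rho> j X (\<iota> i X x) = \<one>\<^bsub>omap (M j) X\<^esub>"
    and fin: "\<And>X p. X \<in> obj C \<Longrightarrow> p \<in> car P X \<Longrightarrow> finite {i \<in> I. \<rho> i X p \<noteq> \<one>\<^bsub>omap (M i) X\<^esub>}"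
    and det: "\<And>X p. X \<in> obj C \<Longrightarrow> p \<in> car P X \<Longrightarrow> \<forall>i\<in>I. \<rho> i X p = \<one>\<^bsub>omap (M i) X\<^esub> \<Longrightarrow> p = \<one>\<^bsub>omap P X\<^esub>"
    by (rule pcopE[OF p]) (rule that, assumption+)
  have \<iota>: "\<And>i. i \<in> I \<Longrightarrow> module_hom C (M i) P (\<iota> i)" using p by (simp add: pcop_def)
  have fJ: "\<And>j. j \<in> J \<Longrightarrow> f j \<in> I" and fI: "f ` J = I" and finj: "inj_on f J" using f by (auto simp: bij_betw_def)
  obtain \<delta> where \<delta>: "module_iso C P' P \<delta>" and \<delta>\<gamma>: "\<And>X x. X \<in> obj C \<Longrightarrow> x \<in> car P X \<Longrightarrow> \<delta> X (\<gamma> X x) = x"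
    and \<gamma>\<delta>: "\<And>X x. X \<in> obj C \<Longrightarrow> x \<in> car P' X \<Longrightarrow> \<gamma> X (\<delta> X x) = x"
    by (rule module_iso_inverse[OF P \<gamma>]) (rule that, assumption+)
  have \<alpha>h: "\<And>i. i \<in> I \<Longrightarrow> module_hom C (M i) (M' i) (\<alpha> i)" and \<gamma>h: "module_hom C P P' \<gamma>"
    and \<delta>h: "module_hom C P' P \<delta>" using \<alpha> \<gamma> \<delta> by (auto simp: module_iso_def)
  have \<alpha>one: "\<alpha> i X x = \<one>\<^bsub>omap (M' i) X\<^esub> \<longleftrightarrow> x = \<one>\<^bsub>omap (M i) X\<^esub>"
    if "i \<in> I" "X \<in> obj C" "x \<in> car (M i) X" for i X x
    using module_hom_inj_iff[OF M[OF that(1)] M'[OF that(1)] \<alpha>h[OF that(1)] that(2)] \<alpha>[OF that(1)] that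
      module_hom_one[OF \<alpha>h[OF that(1)] M[OF that(1)] M'[OF that(1)] that(2)]
    by (auto simp: bij_betw_def module_iso_def)
  define \<rho>' where "\<rho>' j X x = \<alpha> (f j) X (\<rho> (f j) X (\<delta> X x))" for j X x
  have \<rho>'hom: "module_hom C P' (M' (f j)) (\<rho>' j)" if "j \<in> J" for j
    unfolding \<rho>'_def[abs_def]
    by (rule module_hom_comp[OF module_hom_comp[OF \<delta>h \<rho>[OF fJ[OF that]]] \<alpha>h[OF fJ[OF that]]])
  have \<rho>\<delta>: "\<rho> i X (\<delta> X x) \<in> car (M i) X" if "i \<in> I" "X \<in> obj C" "x \<in> car P' X" for i X x
    using that by (intro module_hom_closed[OF \<rho>] module_hom_closed[OF \<delta>h])
  have ex: "\<exists>y\<in>car (M (f j)) X. x = \<alpha> (f j) X y" if "j \<in> J" "X \<in> obj C" "x \<in> car (M' (f j)) X" for j X x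
    using \<alpha>[OF fJ[OF that(1)]] that by (auto simp: module_iso_def bij_betw_def)
  show ?thesis
    unfolding pcop_def
  proof (intro conjI exI[of _ \<rho>'] ballI impI)
    fix j assume "j \<in> J" then show "module_hom C (M' (f j)) P' (\<iota>' j)" by (rule \<iota>'(1))
  next
    fix j assume "j \<in> J" then show "module_hom C P' (M' (f j)) (\<rho>' j)" by (rule \<rho>'hom)
  next
    fix j X x assume *: "j \<in> J" "X \<in> obj C" "x \<in> car (M' (f j)) X"
    obtain y where y: "y \<in> car (M (f j)) X" "x = \<alpha> (f j) X y" using ex[OF *] by blast
    show "\<rho>' j X (\<iota>' j X x) = x"
      using * y by (simp add: \<rho>'_def \<iota>'(2) \<delta>\<gamma> module_hom_closed[OF \<iota>] \<rho>\<iota> fJ)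
    fix j' assume j': "j' \<in> J" "j \<noteq> j'"
    then have "f j \<noteq> f j'" using finj *(1) by (auto simp: inj_on_def)
    then show "\<rho>' j' X (\<iota>' j X x) = \<one>\<^bsub>omap (M' (f j')) X\<^esub>"
      using * y j' \<alpha>one cat_module.one_closed[OF M]
      by (simp add: \<rho>'_def \<iota>'(2) \<delta>\<gamma> module_hom_closed[OF \<iota>] \<rho>\<iota>' fJ)
  next
    fix X p assume *: "X \<in> obj C" "p \<in> car P' X"
    have \<delta>p: "\<delta> X p \<in> car P X" using * by (intro module_hom_closed[OF \<delta>h])
    have e: "\<rho>' j X p \<noteq> \<one>\<^bsub>omap (M' (f j)) X\<^esub> \<longleftrightarrow> \<rho> (f j) X (\<delta> X p) \<noteq> \<one>\<^bsub>omap (M (f j)) X\<^esub>" if "j \<in> J" for j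
      unfolding \<rho>'_def using \<alpha>one[OF fJ[OF that] *(1)] \<rho>\<delta>[OF fJ[OF that] *] by simp
    have "f ` {j \<in> J. \<rho>' j X p \<noteq> \<one>\<^bsub>omap (M' (f j)) X\<^esub>} \<subseteq> {i \<in> I. \<rho> i X (\<delta> X p) \<noteq> \<one>\<^bsub>omap (M i) X\<^esub>}"
      using e fJ by auto
    then have "finite (f ` {j \<in> J. \<rho>' j X p \<noteq> \<one>\<^bsub>omap (M' (f j)) X\<^esub>})"
      by (rule finite_subset[OF _ fin[OF *(1) \<delta>p]])
    then show "finite {j \<in> J. \<rho>' j X p \<noteq> \<one>\<^bsub>omap (M' (f j)) X\<^esub>}"
      by (rule finite_imageD) (rule inj_on_subset[OF finj], auto)
    assume "\<forall>j\<in>J. \<rho>' j X p = \<one>\<^bsub>omap (M' (f j)) X\<^esub>"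
    then have "\<forall>i\<in>I. \<rho> i X (\<delta> X p) = \<one>\<^bsub>omap (M i) X\<^esub>" using e fI by blast
    then have "\<delta> X p = \<one>\<^bsub>omap P X\<^esub>" by (rule det[OF *(1) \<delta>p])
    then show "p = \<one>\<^bsub>omap P' X\<^esub>"
      using \<gamma>\<delta>[OF *] module_hom_one[OF \<gamma>h P P' *(1)] by simp
  qed
qed

section \<open>Fully exact subcategories\<close>

text \<open>Membership in \<open>B\<close> up to isomorphism, for modules with elements of an arbitrary type.\<close>

definition in_sub :: "('o, 'a) preadd_cat \<Rightarrow> ('o, 'a, 'u) cmodule set \<Rightarrow> ('o, 'a, 'x) cmodule \<Rightarrow> bool" where
  "in_sub C B N \<longleftrightarrow> cat_module C N \<and> (\<exists>M\<in>B. \<exists>h. module_iso C N M h)"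

lemma in_subD: "in_sub C B N \<Longrightarrow> cat_module C N"
  by (simp add: in_sub_def)

lemma in_subE:
  assumes "in_sub C B N"
  obtains M h where "M \<in> B" "module_iso C N M h"
  using assms by (auto simp: in_sub_def)

lemma in_sub_iso: 
  assumes "in_sub C B N" "module_iso C N' N h" "cat_module C N'"
  shows "in_sub C B N'"
  using assms unfolding in_sub_def by (blast intro: module_iso_comp)

lemma in_sub_mem: "M \<in> B \<Longrightarrow> cat_module C M \<Longrightarrow> in_sub C B M"
  unfolding in_sub_def using module_iso_id by blast

lemma in_sub_small:
  fixes B :: "('o, 'a, 'u) cmodule set"
  assumes "in_sub C B N" "B \<subseteq> obj (Mod C)"
  shows "small_module TYPE('u) C N"
proof -
  obtain M h where M: "M \<in> B" and h: "module_iso C N M h" using assms(1) by (rule in_subE)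
  have *: "small_module TYPE('u) C M" using M assms(2) obj_ModD(2) by blast
  show ?thesis
    unfolding small_module_def
  proof
    fix X assume X: "X \<in> obj C"
    have "bij_betw (h X) (car N X) (car M X)" using h X by (simp add: module_iso_def)
    then show "small TYPE('u) (car N X)"
      using small_inj_on[of "h X" "car N X" "car M X"] small_moduleD[OF * X] by (simp add: bij_betw_def)
  qed
qed

locale fully_exact_modules = universe "TYPE('u)" + preadditive_category C
  for C :: "('o, 'a) preadd_cat" and B :: "('o, 'a, 'u) cmodule set" +
  assumes small_C: "small_category TYPE('u) C"
    and exact: "fully_exact TYPE('u) (Mod C) B"
begin

lemma B_sub: "B \<subseteq> obj (Mod C)"
  using exact by (simp add: fully_exact_def subcategory_def)

lemma small_in_sub: "in_sub C B N \<Longrightarrow> small_module TYPE('u) C N"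
  by (rule in_sub_small[OF _ B_sub])

lemma in_sub_B: "M \<in> B \<Longrightarrow> in_sub C B M"
  using B_sub obj_ModD(1) by (blast intro: in_sub_mem)

lemma B_coproduct:
  assumes "is_coproduct (Mod C) (I :: 'u set) M P \<iota>" "\<forall>i\<in>I. M i \<in> B" "small TYPE('u) I"
  shows "P \<in> B"
proof -
  have "\<forall>(I :: 'u set) X P \<iota>. small TYPE('u) I \<longrightarrow> (\<forall>i\<in>I. X i \<in> B) \<longrightarrow> is_coproduct (Mod C) I X P \<iota> \<longrightarrow> P \<in> B"
    using exact unfolding fully_exact_def by (elim conjE)
  then show ?thesis using assms by (elim allE[of _ I] allE[of _ M] allE[of _ P] allE[of _ \<iota>]) simp
qed

lemma B_product:
  assumes "is_product (Mod C) (I :: 'u set) M P \<pi>" "\<forall>i\<in>I. M i \<in> B" "small TYPE('u) I"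
  shows "P \<in> B"
proof -
  have "\<forall>(I :: 'u set) X P \<pi>. small TYPE('u) I \<longrightarrow> (\<forall>i\<in>I. X i \<in> B) \<longrightarrow> is_product (Mod C) I X P \<pi> \<longrightarrow> P \<in> B"
    using exact unfolding fully_exact_def by (elim conjE)
  then show ?thesis using assms by (elim allE[of _ I] allE[of _ M] allE[of _ P] allE[of _ \<pi>]) simp
qed

text \<open>The explicit kernel is copied into \<open>Mod C\<close>, where \<open>pker\<close> makes
  it a categorical kernel of the conjugate of \<open>h\<close> between representatives in
  \<open>B\<close>; closure of \<open>B\<close> applies to this copy. Cokernels, products and
  coproducts follow the same pattern.\<close>

lemma in_sub_kernel:
  assumes M: "in_sub C B M" and N: "in_sub C B N" and h: "module_hom C M N h"
  shows "in_sub C B (subm M (kerm C M N h))"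
proof -
  note Mc = in_subD[OF M] and Nc = in_subD[OF N]
  let ?K = "subm M (kerm C M N h)"
  have Kc: "cat_module C ?K" by (intro cat_module_subm submodule_kerm Mc Nc h)
  have Ks: "small_module TYPE('u) C ?K" by (intro small_subm small_in_sub M submodule_kerm Mc Nc h)
  obtain K' :: "('o, 'a, 'u) cmodule" and \<gamma> where K': "K' \<in> obj (Mod C)" and \<gamma>: "module_iso C ?K K' \<gamma>"
    by (rule ex_Mod_iso[OF preadditive_category_axioms Kc Ks]) (rule that)
  obtain \<delta> where \<delta>: "module_iso C K' ?K \<delta>" by (rule module_iso_inverse[OF Kc \<gamma>]) (rule that, assumption+)
  obtain M' \<alpha> where M'B: "M' \<in> B" and \<alpha>: "module_iso C M M' \<alpha>" using M by (rule in_subE)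
  obtain N' \<beta> where N'B: "N' \<in> B" and \<beta>: "module_iso C N N' \<beta>" using N by (rule in_subE)
  have M': "M' \<in> obj (Mod C)" and N': "N' \<in> obj (Mod C)" using M'B N'B B_sub by auto
  obtain \<alpha>' where \<alpha>': "module_iso C M' M \<alpha>'" and \<alpha>'\<alpha>: "\<And>X x. X \<in> obj C \<Longrightarrow> x \<in> car M X \<Longrightarrow> \<alpha>' X (\<alpha> X x) = x"
    by (rule module_iso_inverse[OF Mc \<alpha>]) (rule that, assumption+)
  have hs: "module_hom C M M' \<alpha>" "module_hom C N N' \<beta>" "module_hom C K' ?K \<delta>" "module_hom C M' M \<alpha>'"
    using \<alpha> \<beta> \<delta> \<alpha>' by (auto simp: module_iso_def)
  let ?g = "mod_arr C M' (\<lambda>X x. \<beta> X (h X (\<alpha>' X x)))" and ?k = "mod_arr C K' (\<lambda>X x. \<alpha> X (\<delta> X x))"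
  have g: "?g \<in> arr (Mod C) M' N'"
    by (rule mod_arr_in[OF M' N' module_hom_comp[OF module_hom_comp[OF hs(4) h] hs(2)]])
  have k: "?k \<in> arr (Mod C) K' M'"
    by (rule mod_arr_in[OF K' M' module_hom_comp[OF module_hom_comp[OF hs(3) subm_incl[OF submodule_kerm[OF Mc Nc h]]] hs(1)]])
  have "pker C M' N' ?g K' ?k"
    by (rule pker_transfer[OF pker_kerm[OF Mc Nc h] Mc Nc obj_ModD(1)[OF N'] h \<alpha> \<beta> \<delta>])
      (simp_all add: \<alpha>'\<alpha> module_hom_closed[OF hs(1)] arr_Mod_hom[OF K' M' k])
  then have "is_kernel (Mod C) M' N' ?g K' ?k"
    by (rule pker_kernel[OF M' N' K' g k])
  then have "K' \<in> B" using exact M'B N'B g unfolding fully_exact_def by blast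
  then show ?thesis using Kc \<gamma> unfolding in_sub_def by blast
qed

lemma in_sub_cokernel:
  assumes M: "in_sub C B M" and N: "in_sub C B N" and h: "module_hom C M N h"
  shows "in_sub C B (quotm N (imm C M h))"
proof -
  note Mc = in_subD[OF M] and Nc = in_subD[OF N]
  note im = submodule_imm[OF Mc Nc h]
  let ?Q = "quotm N (imm C M h)"
  have Qc: "cat_module C ?Q" by (intro cat_module_quotm preadditive_category_axioms im Nc)
  have Qs: "small_module TYPE('u) C ?Q" by (intro small_quotm small_in_sub N)
  obtain Q' :: "('o, 'a, 'u) cmodule" and \<gamma> where Q': "Q' \<in> obj (Mod C)" and \<gamma>: "module_iso C ?Q Q' \<gamma>"
    by (rule ex_Mod_iso[OF preadditive_category_axioms Qc Qs]) (rule that)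
  obtain M' \<alpha> where M'B: "M' \<in> B" and \<alpha>: "module_iso C M M' \<alpha>" using M by (rule in_subE)
  obtain N' \<beta> where N'B: "N' \<in> B" and \<beta>: "module_iso C N N' \<beta>" using N by (rule in_subE)
  have M': "M' \<in> obj (Mod C)" and N': "N' \<in> obj (Mod C)" using M'B N'B B_sub by auto
  obtain \<alpha>' where \<alpha>': "module_iso C M' M \<alpha>'" and \<alpha>'\<alpha>: "\<And>X x. X \<in> obj C \<Longrightarrow> x \<in> car M X \<Longrightarrow> \<alpha>' X (\<alpha> X x) = x"
    by (rule module_iso_inverse[OF Mc \<alpha>]) (rule that, assumption+)
  obtain \<beta>' where \<beta>': "module_iso C N' N \<beta>'" and \<beta>'\<beta>: "\<And>X x. X \<in> obj C \<Longrightarrow> x \<in> car N X \<Longrightarrow> \<beta>' X (\<beta> X x) = x"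
    by (rule module_iso_inverse[OF Nc \<beta>]) (rule that, assumption+)
  have hs: "module_hom C M M' \<alpha>" "module_hom C N N' \<beta>" "module_hom C ?Q Q' \<gamma>" "module_hom C M' M \<alpha>'" "module_hom C N' N \<beta>'"
    using \<alpha> \<beta> \<gamma> \<alpha>' \<beta>' by (auto simp: module_iso_def)
  let ?g = "mod_arr C M' (\<lambda>X x. \<beta> X (h X (\<alpha>' X x)))"
    and ?q = "mod_arr C N' (\<lambda>X x. \<gamma> X (quot_map N (imm C M h) X (\<beta>' X x)))"
  have g: "?g \<in> arr (Mod C) M' N'"
    by (rule mod_arr_in[OF M' N' module_hom_comp[OF module_hom_comp[OF hs(4) h] hs(2)]])
  have q: "?q \<in> arr (Mod C) N' Q'"
    by (rule mod_arr_in[OF N' Q' module_hom_comp[OF module_hom_comp[OF hs(5) quot_map_hom[OF Nc im]] hs(3)]])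
  have "pcok C M' N' ?g Q' ?q"
    by (rule pcok_transfer[OF pcok_quotm[OF Mc Nc h] Mc Nc Qc obj_ModD(1)[OF Q'] h \<alpha> \<beta> \<gamma>])
      (simp_all add: \<alpha>'\<alpha> \<beta>'\<beta> module_hom_closed[OF hs(1)] module_hom_closed[OF hs(2)] arr_Mod_hom[OF N' Q' q])
  then have "is_cokernel (Mod C) M' N' ?g Q' ?q"
    by (rule pcok_cokernel[OF M' N' Q' g q])
  then have "Q' \<in> B" using exact M'B N'B g unfolding fully_exact_def by blast
  then show ?thesis using Qc \<gamma> unfolding in_sub_def by blast
qed

text \<open>The choices common to products and coproducts: a coding of the index set in
  \<open>'u\<close>, representatives in \<open>B\<close>, and isomorphisms in both
  directions.\<close>

lemma in_sub_family:
  assumes M: "\<And>i. i \<in> I \<Longrightarrow> in_sub C B (M i)" and I: "small TYPE('u) (I :: 'i set)"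
  obtains f :: "'u \<Rightarrow> 'i" and J M' \<alpha> \<alpha>' where "small TYPE('u) J" "bij_betw f J I"
    "\<And>i. i \<in> I \<Longrightarrow> M' i \<in> B" "\<And>i. i \<in> I \<Longrightarrow> module_iso C (M i) (M' i) (\<alpha> i)"
    "\<And>i. i \<in> I \<Longrightarrow> module_iso C (M' i) (M i) (\<alpha>' i)"
    "\<And>i X x. i \<in> I \<Longrightarrow> X \<in> obj C \<Longrightarrow> x \<in> car (M i) X \<Longrightarrow> \<alpha>' i X (\<alpha> i X x) = x"
proof -
  obtain e :: "'i \<Rightarrow> 'u" where e: "inj_on e I" using small_ex_inj[OF I] .
  have "\<exists>M' \<alpha> \<alpha>'. M' \<in> B \<and> module_iso C (M i) M' \<alpha> \<and> module_iso C M' (M i) \<alpha>' \<and>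
    (\<forall>X x. X \<in> obj C \<longrightarrow> x \<in> car (M i) X \<longrightarrow> \<alpha>' X (\<alpha> X x) = x)" if i: "i \<in> I" for i
  proof -
    obtain M' \<alpha> where 1: "M' \<in> B" "module_iso C (M i) M' \<alpha>" using M[OF i] by (rule in_subE)
    obtain \<alpha>' where "module_iso C M' (M i) \<alpha>'" "\<And>X x. X \<in> obj C \<Longrightarrow> x \<in> car (M i) X \<Longrightarrow> \<alpha>' X (\<alpha> X x) = x"
      by (rule module_iso_inverse[OF in_subD[OF M[OF i]] 1(2)]) (rule that, assumption+)
    with 1 show ?thesis by blast
  qed
  then obtain M' \<alpha> \<alpha>' where "\<And>i. i \<in> I \<Longrightarrow> M' i \<in> B \<and> module_iso C (M i) (M' i) (\<alpha> i) \<and>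
    module_iso C (M' i) (M i) (\<alpha>' i) \<and> (\<forall>X x. X \<in> obj C \<longrightarrow> x \<in> car (M i) X \<longrightarrow> \<alpha>' i X (\<alpha> i X x) = x)"
    by metis
  moreover have "bij_betw (inv_into I e) (e ` I) I"
    by (rule bij_betw_inv_into) (simp add: bij_betw_def e)
  moreover have "small TYPE('u) (e ` I)" by (rule small_image[OF I])
  ultimately show thesis using that by blast
qed

lemma in_sub_prodm:
  assumes M: "\<And>i. i \<in> I \<Longrightarrow> in_sub C B (M i)" and I: "small TYPE('u) I"
  shows "in_sub C B (prodm I M)"
proof -
  obtain f :: "'u \<Rightarrow> _" and J M' \<alpha> \<alpha>' where J: "small TYPE('u) J" and f: "bij_betw f J I"
    and M': "\<And>i. i \<in> I \<Longrightarrow> M' i \<in> B" and \<alpha>: "\<And>i. i \<in> I \<Longrightarrow> module_iso C (M i) (M' i) (\<alpha> i)"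
    by (rule in_sub_family[OF M I]) (assumption | rule that)+
  let ?P = "prodm I M"
  have Pc: "cat_module C ?P" by (rule cat_module_prodm[OF in_subD[OF M]])
  have Ps: "small_module TYPE('u) C ?P" by (intro small_prodm I small_in_sub M)
  obtain P' :: "('o, 'a, 'u) cmodule" and \<gamma> where P': "P' \<in> obj (Mod C)" and \<gamma>: "module_iso C ?P P' \<gamma>"
    by (rule ex_Mod_iso[OF preadditive_category_axioms Pc Ps]) (rule that)
  obtain \<delta> where \<delta>: "module_iso C P' ?P \<delta>" by (rule module_iso_inverse[OF Pc \<gamma>]) (rule that, assumption+)
  have fJ: "\<And>j. j \<in> J \<Longrightarrow> f j \<in> I" using f by (auto simp: bij_betw_def)
  have \<alpha>h: "\<And>i. i \<in> I \<Longrightarrow> module_hom C (M i) (M' i) (\<alpha> i)" and \<delta>h: "module_hom C P' ?P \<delta>"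
    using \<alpha> \<delta> by (auto simp: module_iso_def)
  let ?\<pi> = "\<lambda>j. mod_arr C P' (\<lambda>X x. \<alpha> (f j) X (\<delta> X x (f j)))"
  have M'o: "M' (f j) \<in> obj (Mod C)" if "j \<in> J" for j using M'[OF fJ[OF that]] B_sub by blast
  have \<pi>: "?\<pi> j \<in> arr (Mod C) P' (M' (f j))" if "j \<in> J" for j
    by (rule mod_arr_in[OF P' M'o[OF that] module_hom_comp[OF module_hom_comp[OF \<delta>h prodm_proj[OF fJ[OF that]]] \<alpha>h[OF fJ[OF that]]]])
  have "pprod C J (\<lambda>j. M' (f j)) P' ?\<pi>"
    by (rule pprod_transfer[OF pprod_prodm f \<alpha> \<delta>]) (simp_all add: arr_Mod_hom[OF P' M'o \<pi>])
  then have "is_product (Mod C) J (\<lambda>j. M' (f j)) P' ?\<pi>"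
    by (intro pprod_product M'o P' \<pi>)
  moreover have "\<forall>j\<in>J. M' (f j) \<in> B" using M' fJ by blast
  ultimately have "P' \<in> B" using J by (rule B_product)
  then show ?thesis using Pc \<gamma> unfolding in_sub_def by blast
qed

lemma in_sub_copm:
  assumes M: "\<And>i. i \<in> I \<Longrightarrow> in_sub C B (M i)" and I: "small TYPE('u) I"
  shows "in_sub C B (copm C I M)"
proof -
  obtain f :: "'u \<Rightarrow> _" and J M' \<alpha> \<alpha>' where J: "small TYPE('u) J" and f: "bij_betw f J I"
    and M': "\<And>i. i \<in> I \<Longrightarrow> M' i \<in> B" and \<alpha>: "\<And>i. i \<in> I \<Longrightarrow> module_iso C (M i) (M' i) (\<alpha> i)"
    and \<alpha>': "\<And>i. i \<in> I \<Longrightarrow> module_iso C (M' i) (M i) (\<alpha>' i)"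
    and \<alpha>'\<alpha>: "\<And>i X x. i \<in> I \<Longrightarrow> X \<in> obj C \<Longrightarrow> x \<in> car (M i) X \<Longrightarrow> \<alpha>' i X (\<alpha> i X x) = x"
    by (rule in_sub_family[OF M I]) (assumption | rule that)+
  note Mc = in_subD[OF M]
  let ?P = "copm C I M"
  have Pc: "cat_module C ?P" by (intro cat_module_copm Mc)
  have Ps: "small_module TYPE('u) C ?P" by (intro small_copm I small_in_sub M Mc)
  obtain P' :: "('o, 'a, 'u) cmodule" and \<gamma> where P': "P' \<in> obj (Mod C)" and \<gamma>: "module_iso C ?P P' \<gamma>"
    by (rule ex_Mod_iso[OF preadditive_category_axioms Pc Ps]) (rule that)
  have fJ: "\<And>j. j \<in> J \<Longrightarrow> f j \<in> I" using f by (auto simp: bij_betw_def)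
  have hs: "\<And>i. i \<in> I \<Longrightarrow> module_hom C (M i) (M' i) (\<alpha> i)" "\<And>i. i \<in> I \<Longrightarrow> module_hom C (M' i) (M i) (\<alpha>' i)"
    "module_hom C ?P P' \<gamma>"
    using \<alpha> \<alpha>' \<gamma> by (auto simp: module_iso_def)
  have \<iota>h: "\<And>i. i \<in> I \<Longrightarrow> module_hom C (M i) ?P (cop_in I M i)"
    by (rule cop_in_hom[OF Mc])
  let ?\<iota> = "\<lambda>j. mod_arr C (M' (f j)) (\<lambda>X x. \<gamma> X (cop_in I M (f j) X (\<alpha>' (f j) X x)))"
  have M'o: "M' i \<in> obj (Mod C)" if "i \<in> I" for i using M'[OF that] B_sub by blast
  have \<iota>: "?\<iota> j \<in> arr (Mod C) (M' (f j)) P'" if "j \<in> J" for j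
    by (rule mod_arr_in[OF M'o[OF fJ[OF that]] P'
        module_hom_comp[OF module_hom_comp[OF hs(2)[OF fJ[OF that]] \<iota>h[OF fJ[OF that]]] hs(3)]])
  have "pcop C J (\<lambda>j. M' (f j)) P' ?\<iota>"
    by (rule pcop_transfer[OF pcop_copm[OF Mc] Mc obj_ModD(1)[OF M'o] Pc obj_ModD(1)[OF P'] f \<alpha> \<gamma>])
      (simp_all add: arr_Mod_hom[OF M'o P' \<iota>] fJ \<alpha>'\<alpha> module_hom_closed[OF hs(1)])
  then have "is_coproduct (Mod C) J (\<lambda>j. M' (f j)) P' ?\<iota>"
    by (intro pcop_coproduct M'o fJ P' \<iota>)
  moreover have "\<forall>j\<in>J. M' (f j) \<in> B" using M' fJ by blast
  ultimately have "P' \<in> B" using J by (rule B_coproduct)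
  then show ?thesis using Pc \<gamma> unfolding in_sub_def by blast
qed

end

section \<open>Finite systems of equations\<close>

text \<open>
  Atoms are equations between variables, which are sorted by the objects of \<open>C\<close>:
  \<open>x\<^sub>i + x\<^sub>j = x\<^sub>k\<close>, \<open>x\<^sub>i a = x\<^sub>j\<close>, and \<open>x\<^sub>i = m\<close> for a constant \<open>m\<close> of a module mapping to the given one.
\<close>

datatype ('o, 'a, 'v, 'm) atom = AddAt 'o 'v 'v 'v | ActAt 'o 'o 'a 'v 'v | ConstAt 'o 'v 'm

text \<open>The map \<open>g\<close> interprets the constants; putting the zero map in its place
  turns a system into its homogeneous form.\<close>

fun holds :: "('o, 'a, 'x) cmodule \<Rightarrow> ('o \<Rightarrow> 'm \<Rightarrow> 'x) \<Rightarrow> ('o \<Rightarrow> 'v \<Rightarrow> 'x) \<Rightarrow> ('o, 'a, 'v, 'm) atom \<Rightarrow> bool" where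
  "holds N g p (AddAt X i j k) \<longleftrightarrow> p X i \<otimes>\<^bsub>omap N X\<^esub> p X j = p X k"
| "holds N g p (ActAt X Y a i j) \<longleftrightarrow> amap N X Y a (p X i) = p Y j"
| "holds N g p (ConstAt X i m) \<longleftrightarrow> p X i = g X m"

definition atoms :: "('o, 'a) preadd_cat \<Rightarrow> ('o \<Rightarrow> 'v set) \<Rightarrow> ('o \<Rightarrow> 'm set) \<Rightarrow> ('o, 'a, 'v, 'm) atom set" where
  "atoms C V K =
     {AddAt X i j k |X i j k. X \<in> obj C \<and> i \<in> V X \<and> j \<in> V X \<and> k \<in> V X} \<union>
     {ActAt X Y a i j |X Y a i j. X \<in> obj C \<and> Y \<in> obj C \<and> a \<in> arr C Y X \<and> i \<in> V X \<and> j \<in> V Y} \<union>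
     {ConstAt X i m |X i m. X \<in> obj C \<and> i \<in> V X \<and> m \<in> K X}"

text \<open>Variables that occur in no equation receive values as well, so a default value is
  supplied wherever an assignment is built from partial data.\<close>

definition assignment :: "('o, 'a) preadd_cat \<Rightarrow> ('o, 'a, 'x) cmodule \<Rightarrow> ('o \<Rightarrow> 'v \<Rightarrow> 'x) \<Rightarrow> bool" where
  "assignment C N p \<longleftrightarrow> (\<forall>X\<in>obj C. \<forall>i. p X i \<in> car N X)"

lemma (in universe) small_atoms:
  assumes "small_category U C" "\<And>X. X \<in> obj C \<Longrightarrow> small U (V X)" "\<And>X. X \<in> obj C \<Longrightarrow> small U (K X)"
  shows "small U (atoms C V K)"
proof -
  have C: "small U (obj C)" "\<And>X Y. X \<in> obj C \<Longrightarrow> Y \<in> obj C \<Longrightarrow> small U (arr C X Y)"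
    using assms(1) by (auto simp: small_category_def)
  have "atoms C V K \<subseteq>
     (\<lambda>(X, i, j, k). AddAt X i j k) ` (SIGMA X:obj C. V X \<times> V X \<times> V X) \<union>
     (\<lambda>(X, Y, a, i, j). ActAt X Y a i j) ` (SIGMA X:obj C. SIGMA Y:obj C. arr C Y X \<times> V X \<times> V Y) \<union>
     (\<lambda>(X, i, m). ConstAt X i m) ` (SIGMA X:obj C. V X \<times> K X)"
    unfolding atoms_def by (auto simp: image_iff)
  moreover have "small U \<dots>"
    by (intro small_Un small_image small_Sigma small_Times C assms(2,3))
  ultimately show ?thesis by (rule small_subset[rotated])
qed

lemma holds_map_atom: "holds N g p (map_atom id id r id A) \<longleftrightarrow> holds N g (\<lambda>X v. p X (r v)) A"
  by (cases A) simp_all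

lemma holds_cong:
  "(\<And>X v. v \<in> set3_atom A \<Longrightarrow> p X v = p' X v) \<Longrightarrow> holds N g p A \<longleftrightarrow> holds N g p' A"
  by (cases A) simp_all

lemma map_atom_atoms: "A \<in> atoms C V K \<Longrightarrow> map_atom id id r id A \<in> atoms C (\<lambda>_. UNIV) K"
  unfolding atoms_def by auto

lemma holds_hom:
  assumes "module_hom C N N' h" "assignment C N p" "A \<in> atoms C V K" "holds N g p A"
    and "\<And>X m. X \<in> obj C \<Longrightarrow> m \<in> K X \<Longrightarrow> g' X m = h X (g X m)"
  shows "holds N' g' (\<lambda>X i. h X (p X i)) A"
  using assms(2-4) unfolding atoms_def assignment_def
  by (auto simp: assms(5) module_hom_mult[OF assms(1), symmetric] module_hom_act[OF assms(1), symmetric])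

text \<open>The atoms are linear: addition and action commute with differences, and equal constants
  cancel.\<close>

lemma holds_diff:
  assumes N: "cat_module C N" and p: "assignment C N p" and p': "assignment C N p'"
    and A: "A \<in> atoms C V K" and 1: "holds N g p A" and 2: "holds N g p' A"
  shows "holds N (\<lambda>X m. \<one>\<^bsub>omap N X\<^esub>) (\<lambda>X i. p X i \<otimes>\<^bsub>omap N X\<^esub> inv\<^bsub>omap N X\<^esub> p' X i) A"
proof -
  interpret cat_module C N by (rule N)
  have c: "p X i \<in> car N X" "p' X i \<in> car N X" if "X \<in> obj C" for X i
    using p p' that by (auto simp: assignment_def)
  from A consider (add) X i j k where "A = AddAt X i j k" "X \<in> obj C"
    | (act) X Y a i j where "A = ActAt X Y a i j" "X \<in> obj C" "Y \<in> obj C" "a \<in> arr C Y X"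
    | (const) X i m where "A = ConstAt X i m" "X \<in> obj C"
    unfolding atoms_def by blast
  then show ?thesis
  proof cases
    case add
    interpret G: comm_group "omap N X" by (rule grp[OF add(2)])
    have "p X i \<otimes>\<^bsub>omap N X\<^esub> inv\<^bsub>omap N X\<^esub> p' X i \<otimes>\<^bsub>omap N X\<^esub> (p X j \<otimes>\<^bsub>omap N X\<^esub> inv\<^bsub>omap N X\<^esub> p' X j) =
      (p X i \<otimes>\<^bsub>omap N X\<^esub> p X j) \<otimes>\<^bsub>omap N X\<^esub> inv\<^bsub>omap N X\<^esub> (p' X i \<otimes>\<^bsub>omap N X\<^esub> p' X j)"
      using c[OF add(2)] by (simp add: G.inv_mult G.m_ac)
    then show ?thesis using add 1 2 by simp
  next
    case act
    then show ?thesis using c 1 2 by (simp add: act_mult act_inv)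
  next
    case const
    then show ?thesis using c(1)[OF const(2)] c(2)[OF const(2), of i] 1 2 by (simp add: mult_inv_eq_one_iff)
  qed
qed

section \<open>Submodules lying in the subcategory, and generation relative to it\<close>

context fully_exact_modules
begin

definition sub_in :: "('o, 'a, 'x) cmodule \<Rightarrow> ('o \<times> 'x) set \<Rightarrow> bool" where
  "sub_in M S \<longleftrightarrow> submodule C M S \<and> in_sub C B (subm M S)"

lemma sub_in_kerm:
  "\<lbrakk>in_sub C B M; in_sub C B N; module_hom C M N h\<rbrakk> \<Longrightarrow> sub_in M (kerm C M N h)"
  unfolding sub_in_def by (blast intro: submodule_kerm in_subD in_sub_kernel)

text \<open>The quotient is the cokernel of the inclusion of \<open>S\<close>, a homomorphism
  between modules of \<open>B\<close>.\<close>

lemma sub_in_quotm: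
  assumes M: "in_sub C B M" and S: "sub_in M S"
  shows "in_sub C B (quotm M S)"
proof -
  have s: "submodule C M S" and i: "in_sub C B (subm M S)" using S by (auto simp: sub_in_def)
  have "imm C (subm M S) (\<lambda>X x. x) = S"
    using submoduleD(1)[OF s] by (auto simp: imm_def)
  then show ?thesis using in_sub_cokernel[OF i M subm_incl[OF s]] by simp
qed

lemma small_Sigma_car: "in_sub C B M \<Longrightarrow> small TYPE('u) (Sigma (obj C) (car M))"
  using small_C small_moduleD[OF small_in_sub] by (auto simp: small_category_def intro!: small_Sigma)

text \<open>The intersection is the kernel of the map from \<open>M\<close> to the product of the
  quotients \<open>M / S\<close>. That product has a small index set, since the submodules of a
  small module belong to the power set of its small set of elements.\<close>

lemma sub_in_Inter:
  assumes M: "in_sub C B M" and S: "\<And>S. S \<in> \<S> \<Longrightarrow> sub_in M S" and ne: "\<S> \<noteq> {}"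
  shows "sub_in M (\<Inter>\<S>)"
proof -
  note Mc = in_subD[OF M]
  have s: "submodule C M S" if "S \<in> \<S>" for S using S[OF that] by (simp add: sub_in_def)
  have "S \<subseteq> Sigma (obj C) (car M)" if "S \<in> \<S>" for S
    using s[OF that] unfolding submodule_def by (rule conjunct1)
  then have "\<S> \<subseteq> Pow (Sigma (obj C) (car M))" by blast
  then have small: "small TYPE('u) \<S>"
    by (rule small_subset[OF small_Pow[OF small_Sigma_car[OF M]]])
  let ?P = "prodm \<S> (quotm M)" and ?h = "\<lambda>X x. \<lambda>S\<in>\<S>. quot_map M S X x"
  have P: "in_sub C B ?P" by (rule in_sub_prodm[OF sub_in_quotm[OF M S] small])
  have h: "module_hom C M ?P ?h" by (rule prodm_tuple) (rule quot_map_hom[OF Mc s])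
  have iff: "?h X x = \<one>\<^bsub>omap ?P X\<^esub> \<longleftrightarrow> (\<forall>S\<in>\<S>. (X, x) \<in> S)" if X: "X \<in> obj C" "x \<in> car M X" for X x
  proof -
    have "?h X x = \<one>\<^bsub>omap ?P X\<^esub> \<longleftrightarrow> (\<forall>S\<in>\<S>. quot_map M S X x = \<one>\<^bsub>omap (quotm M S) X\<^esub>)"
      unfolding prodm_simps by (auto simp: restrict_def fun_eq_iff)
    then show ?thesis using quot_map_eq_one_iff[OF Mc s X] by blast
  qed
  have "kerm C M ?P ?h = \<Inter>\<S>"
  proof (rule Set.set_eqI)
    fix z :: "'o \<times> 'b"
    obtain X x where z: "z = (X, x)" by (cases z)
    obtain S where "S \<in> \<S>" using ne by blast
    then have "z \<in> \<Inter>\<S> \<Longrightarrow> X \<in> obj C \<and> x \<in> car M X"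
      using submoduleD(1,2)[OF s] z by blast
    then show "z \<in> kerm C M ?P ?h \<longleftrightarrow> z \<in> \<Inter>\<S>"
      using iff[of X x] unfolding z kerm_def by blast
  qed
  then show ?thesis using sub_in_kerm[OF M P h] by simp
qed

lemma sub_in_full:
  assumes M: "in_sub C B M" shows "sub_in M (Sigma (obj C) (car M))"
proof -
  note s = submodule_full[OF in_subD[OF M]]
  have "module_iso C (subm M (Sigma (obj C) (car M))) M (\<lambda>X x. x)"
    unfolding module_iso_def using subm_incl[OF s] by (auto simp: bij_betw_def)
  then show ?thesis
    unfolding sub_in_def using s in_sub_iso[OF M _ cat_module_subm[OF in_subD[OF M] s]] by blast
qed

text \<open>An injective \<open>k\<close> identifies \<open>K\<close> with its image. In this way a
  module of \<open>B\<close> becomes a submodule that can be compared with closures.\<close>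

lemma sub_in_imm_mono:
  assumes K: "in_sub C B K" and M: "in_sub C B M" and k: "module_hom C K M k"
    and inj: "\<And>X. X \<in> obj C \<Longrightarrow> inj_on (k X) (car K X)"
  shows "sub_in M (imm C K k)"
proof -
  note s = submodule_imm[OF in_subD[OF K] in_subD[OF M] k]
  have iso: "module_iso C K (subm M (imm C K k)) k"
    unfolding module_iso_def
  proof (intro conjI ballI module_hom_into_subm[OF k])
    fix X assume "X \<in> obj C"
    then show "bij_betw (k X) (car K X) (car (subm M (imm C K k)) X)"
      using inj by (auto simp: bij_betw_def imm_def)
  qed (simp add: imm_def)
  obtain k' where "module_iso C (subm M (imm C K k)) K k'"
    by (rule module_iso_inverse[OF in_subD[OF K] iso]) (rule that)
  then show ?thesis
    unfolding sub_in_def using s in_sub_iso[OF K _ cat_module_subm[OF in_subD[OF M] s]] by blast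
qed

text \<open>This stands in for the submodule generated by \<open>T\<close>, which may fail to lie in
  \<open>B\<close>. Stability under intersections makes it the least submodule in \<open>B\<close>
  containing \<open>T\<close>.\<close>

definition closure_in :: "('o, 'a, 'x) cmodule \<Rightarrow> ('o \<times> 'x) set \<Rightarrow> ('o \<times> 'x) set" where
  "closure_in M T = \<Inter>{S. sub_in M S \<and> T \<subseteq> S}"

lemma sub_in_closure:
  assumes "in_sub C B M" "T \<subseteq> Sigma (obj C) (car M)"
  shows "sub_in M (closure_in M T)"
  unfolding closure_in_def by (rule sub_in_Inter[OF assms(1)]) (use sub_in_full assms in auto)

lemma closure_in_superset: "T \<subseteq> closure_in M T"
  unfolding closure_in_def by blast

lemma closure_in_least: "sub_in M S \<Longrightarrow> T \<subseteq> S \<Longrightarrow> closure_in M T \<subseteq> S"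
  unfolding closure_in_def by blast

lemma sub_in_subm:
  assumes M: "cat_module C M" and S: "submodule C M S" and T: "sub_in (subm M S) T"
  shows "sub_in M T" "T \<subseteq> S"
proof -
  note Sc = cat_module_subm[OF M S]
  have t: "submodule C (subm M S) T" using T by (simp add: sub_in_def)
  have TS: "(X, x) \<in> T \<Longrightarrow> (X, x) \<in> S" for X x using submoduleD(2)[OF t] by simp
  then show "T \<subseteq> S" by auto
  have inv: "inv\<^bsub>omap (subm M S) X\<^esub> x = inv\<^bsub>omap M X\<^esub> x" if "(X, x) \<in> S" for X x
    using module_hom_inv[OF subm_incl[OF S] Sc M] submoduleD(1)[OF S that] that by simp
  have "submodule C M T"
    unfolding submodule_def
  proof (intro conjI allI ballI impI)
    show "T \<subseteq> Sigma (obj C) (car M)" using TS submoduleD(1,2)[OF S] by auto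
    fix X assume "X \<in> obj C" then show "(X, \<one>\<^bsub>omap M X\<^esub>) \<in> T" using submoduleD(3)[OF t] by simp
  next
    fix X x y assume "(X, x) \<in> T" "(X, y) \<in> T"
    then show "(X, x \<otimes>\<^bsub>omap M X\<^esub> y) \<in> T" using submoduleD(4)[OF t] by simp
  next
    fix X x assume x: "(X, x) \<in> T"
    show "(X, inv\<^bsub>omap M X\<^esub> x) \<in> T" using submoduleD(5)[OF t x] inv[OF TS[OF x]] by simp
  next
    fix X x Y a assume "Y \<in> obj C" "a \<in> arr C Y X" "(X, x) \<in> T"
    then show "(Y, amap M X Y a x) \<in> T" using submoduleD(6)[OF t] by simp
  qed
  moreover have "subm (subm M S) T = subm M T" by (simp add: subm_def)
  ultimately show "sub_in M T" using T by (simp add: sub_in_def)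
qed

text \<open>The image of \<open>M\<close> lies in no proper submodule of \<open>Y\<close> belonging
  to \<open>B\<close>. This property takes the place of surjectivity of
  \<open>\<eta>\<close>.\<close>

definition generated :: "('o, 'a, 'm) cmodule \<Rightarrow> ('o, 'a, 'x) cmodule \<Rightarrow> ('o \<Rightarrow> 'm \<Rightarrow> 'x) \<Rightarrow> bool" where
  "generated M Y \<eta> \<longleftrightarrow> (\<forall>S. sub_in Y S \<longrightarrow> imm C M \<eta> \<subseteq> S \<longrightarrow> Sigma (obj C) (car Y) \<subseteq> S)"

lemma generated_closure:
  assumes W: "in_sub C B W" and T: "imm C M \<eta> \<subseteq> Sigma (obj C) (car W)"
  shows "generated M (subm W (closure_in W (imm C M \<eta>))) \<eta>"
  unfolding generated_def
proof (intro allI impI)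
  let ?Y = "closure_in W (imm C M \<eta>)"
  fix S assume S: "sub_in (subm W ?Y) S" and im: "imm C M \<eta> \<subseteq> S"
  have "submodule C W ?Y" using sub_in_closure[OF W T] by (simp add: sub_in_def)
  from sub_in_subm[OF in_subD[OF W] this S] have "?Y \<subseteq> S" using closure_in_least im by blast
  then show "Sigma (obj C) (car (subm W ?Y)) \<subseteq> S" by auto
qed

text \<open>The kernel of the difference of \<open>h\<close> and \<open>k\<close> is a submodule of
  \<open>Y\<close> lying in \<open>B\<close> and contains the image of \<open>M\<close>, hence it is
  everything.\<close>

lemma generated_unique:
  assumes Y: "in_sub C B Y" and Z: "in_sub C B Z" and gen: "generated M Y \<eta>"
    and \<eta>: "module_hom C M Y \<eta>" and h: "module_hom C Y Z h" and k: "module_hom C Y Z k"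
    and eq: "\<And>X m. X \<in> obj C \<Longrightarrow> m \<in> car M X \<Longrightarrow> h X (\<eta> X m) = k X (\<eta> X m)"
    and X: "X \<in> obj C" and y: "y \<in> car Y X"
  shows "h X y = k X y"
proof -
  interpret Z: cat_module C Z by (rule in_subD[OF Z])
  let ?d = "\<lambda>X x. h X x \<otimes>\<^bsub>omap Z X\<^esub> inv\<^bsub>omap Z X\<^esub> k X x"
  have d: "module_hom C Y Z ?d" by (rule module_hom_diff[OF Z.cat_module_axioms h k])
  have "imm C M \<eta> \<subseteq> kerm C Y Z ?d"
    using eq by (auto simp: imm_def kerm_def module_hom_closed[OF \<eta>] module_hom_closed[OF h]
        module_hom_closed[OF k] Z.mult_inv_eq_one_iff)
  then have "(X, y) \<in> kerm C Y Z ?d"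
    using gen sub_in_kerm[OF Y Z d] X y unfolding generated_def by blast
  then show ?thesis
    using X y by (simp add: kerm_def Z.mult_inv_eq_one_iff module_hom_closed[OF h] module_hom_closed[OF k])
qed

end

section \<open>Definability of elements by finite systems\<close>

context fully_exact_modules
begin

text \<open>
  Compactness: otherwise every finite set \<open>F\<close> of equations valid in \<open>Y\<close> is solved, with the
  constants replaced by zero, by some \<open>p F\<close> in some \<open>Z F\<close> in \<open>B\<close> with nonzero value at \<open>y\<close>.
  The reduced product of the \<open>Z F\<close> modulo families vanishing on all \<open>F \<supseteq> F\<^sub>1\<close> for some \<open>F\<^sub>1\<close>
  lies in \<open>B\<close>, and the \<open>p F\<close> define a homomorphism from \<open>Y\<close> to it which
  contradicts the hypothesis that \<open>Y\<close> is generated by \<open>\<eta>\<close>.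
\<close>

lemma finite_facts_determine:
  fixes Y :: "('o, 'a, 'x) cmodule" and M :: "('o, 'a, 'm) cmodule"
  assumes Y: "in_sub C B Y" and M: "small_module TYPE('u) C M"
    and \<eta>: "module_hom C M Y \<eta>" and gen: "generated M Y \<eta>"
    and c: "c \<in> obj C" and y: "y \<in> car Y c"
  defines "P0 \<equiv> \<lambda>X v. if v \<in> car Y X then v else \<one>\<^bsub>omap Y X\<^esub>"
  shows "\<exists>F. finite F \<and> F \<subseteq> atoms C (car Y) (car M) \<and> (\<forall>A\<in>F. holds Y \<eta> P0 A) \<and>
    (\<forall>Z\<in>B. \<forall>p. assignment C Z p \<longrightarrow> (\<forall>A\<in>F. holds Z (\<lambda>X m. \<one>\<^bsub>omap Z X\<^esub>) p A) \<longrightarrow> p c y = \<one>\<^bsub>omap Z c\<^esub>)"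
proof (rule ccontr)
  assume contra: "\<not> ?thesis"
  interpret Y: cat_module C Y by (rule in_subD[OF Y])
  \<comment> \<open>The diagram of \<open>Y\<close>: each element of \<open>Y\<close> is a variable
    standing for itself, and all equations true in \<open>Y\<close> are collected.\<close>
  define Fs where "Fs = {A \<in> atoms C (car Y) (car M). holds Y \<eta> P0 A}"
  define I where "I = Fpow Fs"
  have "small TYPE('u) (atoms C (car Y) (car M))"
    by (intro small_atoms small_C small_moduleD[OF small_in_sub[OF Y]] small_moduleD[OF M])
  then have I_small: "small TYPE('u) I"
    unfolding I_def Fs_def by (intro small_Fpow) (rule small_subset, auto)
  have "\<exists>Z p. Z \<in> B \<and> assignment C Z p \<and> (\<forall>A\<in>F. holds Z (\<lambda>X m. \<one>\<^bsub>omap Z X\<^esub>) p A) \<and>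
      p c y \<noteq> \<one>\<^bsub>omap Z c\<^esub>" if "F \<in> I" for F
  proof -
    have "finite F" "F \<subseteq> atoms C (car Y) (car M)" "\<forall>A\<in>F. holds Y \<eta> P0 A"
      using that by (auto simp: I_def Fs_def Fpow_def)
    then show ?thesis using contra by blast
  qed
  then obtain Z where "\<forall>F\<in>I. \<exists>p. Z F \<in> B \<and> assignment C (Z F) p \<and>
      (\<forall>A\<in>F. holds (Z F) (\<lambda>X m. \<one>\<^bsub>omap (Z F) X\<^esub>) p A) \<and> p c y \<noteq> \<one>\<^bsub>omap (Z F) c\<^esub>"
    using bchoice[of I "\<lambda>F Z. \<exists>p. Z \<in> B \<and> assignment C Z p \<and> (\<forall>A\<in>F. holds Z (\<lambda>X m. \<one>\<^bsub>omap Z X\<^esub>) p A) \<and>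
      p c y \<noteq> \<one>\<^bsub>omap Z c\<^esub>"] by blast
  then obtain p where Zp: "\<forall>F\<in>I. Z F \<in> B \<and> assignment C (Z F) (p F) \<and>
      (\<forall>A\<in>F. holds (Z F) (\<lambda>X m. \<one>\<^bsub>omap (Z F) X\<^esub>) (p F) A) \<and> p F c y \<noteq> \<one>\<^bsub>omap (Z F) c\<^esub>"
    using bchoice[of I "\<lambda>F p. Z F \<in> B \<and> assignment C (Z F) p \<and>
      (\<forall>A\<in>F. holds (Z F) (\<lambda>X m. \<one>\<^bsub>omap (Z F) X\<^esub>) p A) \<and> p c y \<noteq> \<one>\<^bsub>omap (Z F) c\<^esub>"] by blast
  have Z: "in_sub C B (Z F)" if "F \<in> I" for F using Zp that by (blast intro: in_sub_B)
  note Zc = in_subD[OF Z]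
  have pc: "p F X v \<in> car (Z F) X" if "F \<in> I" "X \<in> obj C" for F X v
    using Zp that by (auto simp: assignment_def)
  have ph: "holds (Z F) (\<lambda>X m. \<one>\<^bsub>omap (Z F) X\<^esub>) (p F) A" if "F \<in> I" "A \<in> F" for F A
    using Zp that by blast
  have py: "p F c y \<noteq> \<one>\<^bsub>omap (Z F) c\<^esub>" if "F \<in> I" for F using Zp that by blast
  have I_Un: "F \<union> G \<in> I" if "F \<in> I" "G \<in> I" for F G
    using that by (auto simp: I_def Fpow_def)
  have I_single: "{A} \<in> I" if "A \<in> Fs" for A
    using that by (auto simp: I_def Fpow_def)
  have I_empty: "{} \<in> I" by (auto simp: I_def Fpow_def)

  define R where "R = prodm I Z"
  have R: "in_sub C B R" unfolding R_def by (rule in_sub_prodm[OF Z I_small])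
  interpret R: cat_module C R by (rule in_subD[OF R])
  have proj: "module_hom C R (Z F) (\<lambda>X s. s F)" if "F \<in> I" for F
    unfolding R_def by (rule prodm_proj[OF that])
  \<comment> \<open>Families vanishing at every index that contains \<open>F0\<close>: an
    intersection of kernels of projections, hence a submodule in \<open>B\<close>.\<close>
  define K where "K F0 = \<Inter>((\<lambda>F. kerm C R (Z F) (\<lambda>X s. s F)) ` {F \<in> I. F0 \<subseteq> F})" for F0
  have K: "sub_in R (K F0)" if "F0 \<in> I" for F0
    unfolding K_def by (rule sub_in_Inter[OF R]) (use that in \<open>auto intro!: sub_in_kerm R Z proj\<close>)
  have K_iff: "(X, s) \<in> K F0 \<longleftrightarrow> X \<in> obj C \<and> s \<in> car R X \<and> (\<forall>F\<in>I. F0 \<subseteq> F \<longrightarrow> s F = \<one>\<^bsub>omap (Z F) X\<^esub>)"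
    if "F0 \<in> I" for X s F0
    using that by (auto simp: K_def kerm_def)
  have Ksub: "submodule C R (K F0)" and Kin: "in_sub C B (subm R (K F0))" if "F0 \<in> I" for F0
    using K[OF that] by (auto simp: sub_in_def)
  \<comment> \<open>This is the union of the \<open>K F0\<close>. It is directed because
    \<open>I\<close> is closed under binary unions, which makes \<open>T\<close> closed under the
    group law.\<close>
  define T where "T = {(X, s). X \<in> obj C \<and> s \<in> car R X \<and>
      (\<exists>F1\<in>I. \<forall>F\<in>I. F1 \<subseteq> F \<longrightarrow> s F = \<one>\<^bsub>omap (Z F) X\<^esub>)}"
  have T_K: "(X, s) \<in> T \<longleftrightarrow> (\<exists>F0\<in>I. (X, s) \<in> K F0)" for X s
    using K_iff by (auto simp: T_def)
  have K_mono: "K F0 \<subseteq> K F1" if "F0 \<in> I" "F1 \<in> I" "F0 \<subseteq> F1" for F0 F1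
    using K_iff that by auto
  have Tsub: "submodule C R T"
    unfolding submodule_def
  proof (intro conjI allI ballI impI)
    show "T \<subseteq> Sigma (obj C) (car R)" by (auto simp: T_def)
  next
    fix X assume "X \<in> obj C"
    then show "(X, \<one>\<^bsub>omap R X\<^esub>) \<in> T" using submoduleD(3)[OF Ksub[OF I_empty]] I_empty T_K by blast
  next
    fix X s t assume "(X, s) \<in> T" "(X, t) \<in> T"
    then obtain F0 F1 where F: "F0 \<in> I" "F1 \<in> I" "(X, s) \<in> K F0" "(X, t) \<in> K F1" using T_K by blast
    then have "(X, s) \<in> K (F0 \<union> F1)" "(X, t) \<in> K (F0 \<union> F1)"
      using K_mono I_Un by blast+
    then show "(X, s \<otimes>\<^bsub>omap R X\<^esub> t) \<in> T"
      using submoduleD(4)[OF Ksub[OF I_Un[OF F(1,2)]]] I_Un[OF F(1,2)] T_K by blast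
  next
    fix X s assume "(X, s) \<in> T"
    then obtain F0 where F: "F0 \<in> I" "(X, s) \<in> K F0" using T_K by blast
    then show "(X, inv\<^bsub>omap R X\<^esub> s) \<in> T" using submoduleD(5)[OF Ksub] T_K by blast
    fix X' a assume "X' \<in> obj C" "a \<in> arr C X' X"
    then show "(X', amap R X X' a s) \<in> T" using F submoduleD(6)[OF Ksub] T_K by blast
  qed
  have quot_one: "quot_map R T X s = \<one>\<^bsub>omap (quotm R T) X\<^esub> \<longleftrightarrow> (X, s) \<in> T"
    if "X \<in> obj C" "s \<in> car R X" for X s
    by (rule quot_map_eq_one_iff[OF R.cat_module_axioms Tsub that])
  note Qhom = quot_map_hom[OF R.cat_module_axioms Tsub]
  have Qc: "cat_module C (quotm R T)"
    by (rule cat_module_quotm[OF preadditive_category_axioms R.cat_module_axioms Tsub])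

  \<comment> \<open>\<open>T\<close> is the image of the coproduct of the \<open>K F\<close> in
    \<open>R\<close>, so the reduced product is a cokernel of a homomorphism between modules of
    \<open>B\<close>.\<close>
  have Q: "in_sub C B (quotm R T)"
  proof -
    let ?M = "\<lambda>F. subm R (K F)"
    have Mc: "\<And>F. F \<in> I \<Longrightarrow> cat_module C (?M F)" by (rule in_subD[OF Kin])
    define S where "S = copm C I ?M"
    have S: "in_sub C B S" unfolding S_def by (rule in_sub_copm[OF Kin I_small])
    have cop: "pcop C I ?M S (cop_in I ?M)" unfolding S_def by (rule pcop_copm[OF Mc])
    obtain u where u: "module_hom C S R u"
      and u\<iota>: "\<And>F X s. F \<in> I \<Longrightarrow> X \<in> obj C \<Longrightarrow> s \<in> car (?M F) X \<Longrightarrow> u X (cop_in I ?M F X s) = s"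
      by (rule pcop_extend[OF Mc in_subD[OF S] cop R.cat_module_axioms subm_incl[OF Ksub]])
        (assumption | rule that)+
    have \<iota>: "module_hom C (?M F) S (cop_in I ?M F)" if "F \<in> I" for F
      unfolding S_def by (rule cop_in_hom[OF Mc that])
    have "imm C S u = T"
    proof (rule equalityI)
      show "T \<subseteq> imm C S u"
      proof (rule subrelI)
        fix X s assume "(X, s) \<in> T"
        then obtain F where F: "F \<in> I" "(X, s) \<in> K F" using T_K by blast
        then have X: "X \<in> obj C" and s: "s \<in> car (?M F) X" using submoduleD(1)[OF Ksub] by auto
        have "s = u X (cop_in I ?M F X s)" using u\<iota>[OF F(1) X s] by simp
        then show "(X, s) \<in> imm C S u"
          unfolding imm_def using X module_hom_closed[OF \<iota>[OF F(1)] X s] by blast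
      qed
      show "imm C S u \<subseteq> T"
      proof (rule subrelI)
        fix X s assume "(X, s) \<in> imm C S u"
        then obtain z where X: "X \<in> obj C" and z: "z \<in> car S X" "s = u X z" by (auto simp: imm_def)
        have "quot_map R T X (u X z) = \<one>\<^bsub>omap (quotm R T) X\<^esub>"
        proof (rule pcop_unique[OF Mc in_subD[OF S] cop Qc module_hom_comp[OF u Qhom]
              module_hom_zero[OF Qc] _ X z(1)])
          fix F X s assume *: "F \<in> I" "X \<in> obj C" "s \<in> car (?M F) X"
          then have "(X, s) \<in> T" using T_K by auto
          moreover have "s \<in> car R X" using * submoduleD(2)[OF Ksub] by simp
          ultimately show "quot_map R T X (u X (cop_in I ?M F X s)) = \<one>\<^bsub>omap (quotm R T) X\<^esub>"
            using * by (simp add: u\<iota> quot_one)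
        qed
        then show "(X, s) \<in> T" using quot_one X module_hom_closed[OF u X z(1)] z(2) by simp
      qed
    qed
    then show ?thesis using in_sub_cokernel[OF S R u] by simp
  qed

  have quot_eq: "quot_map R T X s = quot_map R T X t"
    if X: "X \<in> obj C" and st: "s \<in> car R X" "t \<in> car R X"
      and F1: "F1 \<in> I" and eq: "\<And>F. F \<in> I \<Longrightarrow> F1 \<subseteq> F \<Longrightarrow> s F = t F" for X s t F1
  proof -
    have "(X, s \<otimes>\<^bsub>omap R X\<^esub> inv\<^bsub>omap R X\<^esub> t) \<in> K F1"
      unfolding K_iff[OF F1]
    proof (intro conjI ballI impI)
      fix F assume F: "F \<in> I" "F1 \<subseteq> F"
      interpret ZF: cat_module C "Z F" by (rule Zc[OF F(1)])
      note hF = proj[OF F(1)]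
      have "(s \<otimes>\<^bsub>omap R X\<^esub> inv\<^bsub>omap R X\<^esub> t) F = s F \<otimes>\<^bsub>omap (Z F) X\<^esub> inv\<^bsub>omap (Z F) X\<^esub> t F"
        using X st by (simp add: module_hom_mult[OF hF] module_hom_inv[OF hF R.cat_module_axioms ZF.cat_module_axioms])
      then show "(s \<otimes>\<^bsub>omap R X\<^esub> inv\<^bsub>omap R X\<^esub> t) F = \<one>\<^bsub>omap (Z F) X\<^esub>"
        using eq[OF F] X module_hom_closed[OF hF X st(1)] module_hom_closed[OF hF X st(2)]
        by (simp add: ZF.mult_inv_eq_one_iff)
    qed (use X st in simp_all)
    then have "(X, s \<otimes>\<^bsub>omap R X\<^esub> inv\<^bsub>omap R X\<^esub> t) \<in> T" using T_K F1 by blast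
    then show ?thesis using quot_map_eq_iff[OF R.cat_module_axioms Tsub X st] by simp
  qed
  \<comment> \<open>The values at \<open>v\<close> of all chosen solutions, one for each finite set
    of equations. An equation of the diagram holds at every \<open>F\<close> containing it, so it
    holds for classes modulo \<open>T\<close>; this makes \<open>?q\<close> a homomorphism.\<close>
  define t where "t X v = (\<lambda>F\<in>I. p F X v)" for X v
  have tc: "t X v \<in> car R X" if "X \<in> obj C" for X v
    using pc that by (auto simp: t_def R_def)
  have tF: "t X v F = p F X v" if "F \<in> I" for X v F using that by (simp add: t_def)
  let ?q = "\<lambda>X v. quot_map R T X (t X v)"
  have P0: "P0 X v = v" if "v \<in> car Y X" for X v using that by (simp add: P0_def)
  have q: "module_hom C Y (quotm R T) ?q"
  proof (rule module_homI)
    fix X v w assume *: "X \<in> obj C" "v \<in> car Y X" "w \<in> car Y X"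
    let ?A = "AddAt X v w (v \<otimes>\<^bsub>omap Y X\<^esub> w) :: ('o, 'a, 'x, 'm) atom"
    have A: "?A \<in> Fs" using * by (auto simp: Fs_def atoms_def P0)
    have "quot_map R T X (t X (v \<otimes>\<^bsub>omap Y X\<^esub> w)) = quot_map R T X (t X v \<otimes>\<^bsub>omap R X\<^esub> t X w)"
    proof (rule quot_eq[OF *(1) tc[OF *(1)] _ I_single[OF A]])
      fix F assume F: "F \<in> I" "{?A} \<subseteq> F"
      have "holds (Z F) (\<lambda>X m. \<one>\<^bsub>omap (Z F) X\<^esub>) (p F) ?A" by (rule ph[OF F(1)]) (use F(2) in simp)
      then show "t X (v \<otimes>\<^bsub>omap Y X\<^esub> w) F = (t X v \<otimes>\<^bsub>omap R X\<^esub> t X w) F"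
        using F * by (simp add: tF module_hom_mult[OF proj] tc)
    qed (use * tc in simp)
    then show "?q X (v \<otimes>\<^bsub>omap Y X\<^esub> w) = ?q X v \<otimes>\<^bsub>omap (quotm R T) X\<^esub> ?q X w"
      using * tc by (simp add: module_hom_mult[OF Qhom])
  next
    fix X X' a v assume *: "X \<in> obj C" "X' \<in> obj C" "a \<in> arr C X' X" "v \<in> car Y X"
    let ?A = "ActAt X X' a v (amap Y X X' a v) :: ('o, 'a, 'x, 'm) atom"
    have A: "?A \<in> Fs" using * by (auto simp: Fs_def atoms_def P0)
    have "quot_map R T X' (t X' (amap Y X X' a v)) = quot_map R T X' (amap R X X' a (t X v))"
    proof (rule quot_eq[OF *(2) tc[OF *(2)] _ I_single[OF A]])
      fix F assume F: "F \<in> I" "{?A} \<subseteq> F"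
      have "holds (Z F) (\<lambda>X m. \<one>\<^bsub>omap (Z F) X\<^esub>) (p F) ?A" by (rule ph[OF F(1)]) (use F(2) in simp)
      then show "t X' (amap Y X X' a v) F = amap R X X' a (t X v) F"
        using F * by (simp add: tF module_hom_act[OF proj] tc)
    qed (use * tc in simp)
    then show "?q X' (amap Y X X' a v) = amap (quotm R T) X X' a (?q X v)"
      using * tc by (simp add: module_hom_act[OF Qhom])
  qed (use tc module_hom_closed[OF Qhom] in blast)
  \<comment> \<open>Constants were interpreted by zero in the \<open>Z F\<close>, so at a variable
    \<open>\<eta> X m\<close> the solutions vanish from the index \<open>{?A}\<close> on.\<close>
  have im: "imm C M \<eta> \<subseteq> kerm C Y (quotm R T) ?q"
  proof (rule subrelI)
    fix X v assume "(X, v) \<in> imm C M \<eta>"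
    then obtain m where m: "X \<in> obj C" "m \<in> car M X" "v = \<eta> X m" by (auto simp: imm_def)
    have v: "v \<in> car Y X" using module_hom_closed[OF \<eta>] m by simp
    let ?A = "ConstAt X v m :: ('o, 'a, 'x, 'm) atom"
    have A: "?A \<in> Fs" using m v by (auto simp: Fs_def atoms_def P0)
    have "\<forall>F\<in>I. {?A} \<subseteq> F \<longrightarrow> t X v F = \<one>\<^bsub>omap (Z F) X\<^esub>"
      using ph[of _ ?A] by (auto simp: tF)
    then have "(X, t X v) \<in> T" unfolding T_def using m tc I_single[OF A] by blast
    then show "(X, v) \<in> kerm C Y (quotm R T) ?q"
      unfolding kerm_def using m v quot_one tc by simp
  qed
  have "Sigma (obj C) (car Y) \<subseteq> kerm C Y (quotm R T) ?q"
    using gen[unfolded generated_def, rule_format, OF sub_in_kerm[OF Y Q q] im] .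
  then have "(c, y) \<in> kerm C Y (quotm R T) ?q" using c y by blast
  then have "(c, t c y) \<in> T" using quot_one c tc by (simp add: kerm_def)
  \<comment> \<open>The family at \<open>y\<close> would vanish at the index \<open>F1\<close>,
    although every chosen solution is nonzero at \<open>y\<close>.\<close>
  then obtain F1 where "F1 \<in> I" "t c y F1 = \<one>\<^bsub>omap (Z F1) c\<^esub>" by (auto simp: T_def)
  then show False using py tF by simp
qed

text \<open>The finitely many variables are numbered, because over natural-number variables the
  finite systems with constants in \<open>M\<close> form a small set that does not depend on
  \<open>Y\<close>.\<close>

lemma definable:
  fixes Y :: "('o, 'a, 'x) cmodule" and M :: "('o, 'a, 'm) cmodule"
  assumes Y: "in_sub C B Y" and M: "small_module TYPE('u) C M"
    and \<eta>: "module_hom C M Y \<eta>" and gen: "generated M Y \<eta>"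
    and c: "c \<in> obj C" and y: "y \<in> car Y c"
  obtains \<Phi> and P :: "'o \<Rightarrow> nat \<Rightarrow> 'x" and n where
    "finite \<Phi>" "\<Phi> \<subseteq> atoms C (\<lambda>_. UNIV) (car M)" "assignment C Y P" "\<forall>A\<in>\<Phi>. holds Y \<eta> P A" "P c n = y"
    "\<forall>Z\<in>B. \<forall>p. assignment C Z p \<longrightarrow> (\<forall>A\<in>\<Phi>. holds Z (\<lambda>X m. \<one>\<^bsub>omap Z X\<^esub>) p A) \<longrightarrow> p c n = \<one>\<^bsub>omap Z c\<^esub>"
proof -
  interpret Y: cat_module C Y by (rule in_subD[OF Y])
  let ?P0 = "\<lambda>X v. if v \<in> car Y X then v else \<one>\<^bsub>omap Y X\<^esub>"
  have "\<exists>F. finite F \<and> F \<subseteq> atoms C (car Y) (car M) \<and> (\<forall>A\<in>F. holds Y \<eta> ?P0 A) \<and>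
    (\<forall>Z\<in>B. \<forall>p. assignment C Z p \<longrightarrow> (\<forall>A\<in>F. holds Z (\<lambda>X m. \<one>\<^bsub>omap Z X\<^esub>) p A) \<longrightarrow> p c y = \<one>\<^bsub>omap Z c\<^esub>)"
    by (rule finite_facts_determine[OF assms])
  then obtain F where F: "finite F" "F \<subseteq> atoms C (car Y) (car M)" "\<forall>A\<in>F. holds Y \<eta> ?P0 A"
    and det: "\<forall>Z\<in>B. \<forall>p. assignment C Z p \<longrightarrow> (\<forall>A\<in>F. holds Z (\<lambda>X m. \<one>\<^bsub>omap Z X\<^esub>) p A) \<longrightarrow> p c y = \<one>\<^bsub>omap Z c\<^esub>"
    by (elim exE conjE) (rule that)
  \<comment> \<open>The variable \<open>y\<close> must receive a number even if no equation of
    \<open>F\<close> mentions it.\<close>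
  define V where "V = insert y (\<Union>A\<in>F. set3_atom A)"
  have "finite (set3_atom A)" for A :: "('o, 'a, 'x, 'm) atom" by (cases A) simp_all
  then have "finite V" unfolding V_def using F(1) by simp
  from finite_imp_inj_to_nat_seg[OF this] obtain r :: "'x \<Rightarrow> nat" where r: "inj_on r V"
    by (elim exE conjE) (rule that)
  \<comment> \<open>A number that codes no variable of \<open>V\<close> may decode to anything;
    \<open>?P0\<close> replaces values outside the carrier by zero.\<close>
  define P where "P X n = ?P0 X (inv_into V r n)" for X n
  let ?\<Phi> = "map_atom id id r id ` F"
  have Pr: "P X (r v) = ?P0 X v" if "v \<in> V" for X v using r that by (simp add: P_def)
  show thesis
  proof (rule that[of ?\<Phi> P "r y"])
    show "finite ?\<Phi>" using F(1) by simp
    show "?\<Phi> \<subseteq> atoms C (\<lambda>_. UNIV) (car M)" using F(2) map_atom_atoms by blast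
    show "assignment C Y P" by (simp add: assignment_def P_def)
    show "P c (r y) = y" using y by (simp add: Pr V_def)
    show "\<forall>A\<in>?\<Phi>. holds Y \<eta> P A"
    proof (clarsimp simp: holds_map_atom)
      fix A assume A: "A \<in> F"
      have "holds Y \<eta> (\<lambda>X v. P X (r v)) A \<longleftrightarrow> holds Y \<eta> ?P0 A"
        by (rule holds_cong, rule Pr) (use A in \<open>auto simp: V_def\<close>)
      then show "holds Y \<eta> (\<lambda>X v. P X (r v)) A" using F(3) A by blast
    qed
    show "\<forall>Z\<in>B. \<forall>p. assignment C Z p \<longrightarrow> (\<forall>A\<in>?\<Phi>. holds Z (\<lambda>X m. \<one>\<^bsub>omap Z X\<^esub>) p A) \<longrightarrow> p c (r y) = \<one>\<^bsub>omap Z c\<^esub>"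
    proof (intro ballI allI impI)
      fix Z p assume Z: "Z \<in> B" and p: "assignment C Z p" "\<forall>A\<in>?\<Phi>. holds Z (\<lambda>X m. \<one>\<^bsub>omap Z X\<^esub>) p A"
      have "assignment C Z (\<lambda>X v. p X (r v))" using p(1) by (simp add: assignment_def)
      moreover have "\<forall>A\<in>F. holds Z (\<lambda>X m. \<one>\<^bsub>omap Z X\<^esub>) (\<lambda>X v. p X (r v)) A"
        using p(2) by (simp add: holds_map_atom)
      ultimately show "p c (r y) = \<one>\<^bsub>omap Z c\<^esub>" using det Z by blast
    qed
  qed
qed

end

section \<open>Reflections\<close>

context fully_exact_modules
begin

text \<open>
  Only a small set of finite systems of equations with constants in \<open>M\<close> is available. For each system
  which is not solvable in all homomorphisms from \<open>M\<close> to members of \<open>B\<close> choose one where it fails; the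
  reflection is the submodule generated by the image of \<open>M\<close> in the product \<open>W\<close> of these targets. An element
  generated by \<open>M\<close> in a larger product is a solution of some system \<open>\<Phi>\<close>. If the element vanishes in
  \<open>W\<close>, then \<open>\<Phi>\<close> together with \<open>x = 0\<close> is solvable everywhere, so that the element is zero.
\<close>

theorem reflection:
  fixes M :: "('o, 'a, 'm) cmodule"
  assumes Mc: "cat_module C M" and Ms: "small_module TYPE('u) C M"
  shows "\<exists>Y\<in>B. \<exists>\<eta>. module_hom C M Y \<eta> \<and> generated M Y \<eta> \<and>
    (\<forall>Z\<in>B. \<forall>g. module_hom C M Z g \<longrightarrow>
      (\<exists>h. module_hom C Y Z h \<and> (\<forall>X\<in>obj C. \<forall>m\<in>car M X. h X (\<eta> X m) = g X m)))"
proof -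
  \<comment> \<open>Failure of totality is witnessed by a single homomorphism from \<open>M\<close>
    to a member of \<open>B\<close>; one such witness per failing system is what gets
    chosen.\<close>
  define total :: "('o, 'a, nat, 'm) atom set \<Rightarrow> bool" where
    "total \<Phi> \<longleftrightarrow> (\<forall>Z\<in>B. \<forall>g. module_hom C M Z g \<longrightarrow> (\<exists>p. assignment C Z p \<and> (\<forall>A\<in>\<Phi>. holds Z g p A)))" for \<Phi>
  define At :: "('o, 'a, nat, 'm) atom set" where "At = atoms C (\<lambda>_. UNIV) (car M)"
  define T0 where "T0 = {\<Phi> \<in> Fpow At. \<not> total \<Phi>}"
  have "small TYPE('u) At" unfolding At_def by (intro small_atoms small_C small_nat small_moduleD[OF Ms])
  then have T0_small: "small TYPE('u) T0"
    unfolding T0_def by (intro small_subset[OF small_Fpow[of At]]) auto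
  have "\<forall>\<Phi>\<in>T0. \<exists>Zg. fst Zg \<in> B \<and> module_hom C M (fst Zg) (snd Zg) \<and>
      \<not> (\<exists>p. assignment C (fst Zg) p \<and> (\<forall>A\<in>\<Phi>. holds (fst Zg) (snd Zg) p A))"
    by (auto simp: T0_def total_def)
  from bchoice[OF this] obtain Zg where Zg: "\<forall>\<Phi>\<in>T0. fst (Zg \<Phi>) \<in> B \<and> module_hom C M (fst (Zg \<Phi>)) (snd (Zg \<Phi>)) \<and>
      \<not> (\<exists>p. assignment C (fst (Zg \<Phi>)) p \<and> (\<forall>A\<in>\<Phi>. holds (fst (Zg \<Phi>)) (snd (Zg \<Phi>)) p A))"
    by (rule exE)
  define Zf where "Zf \<Phi> = fst (Zg \<Phi>)" for \<Phi>
  define gf where "gf \<Phi> = snd (Zg \<Phi>)" for \<Phi>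
  have Zf: "Zf \<Phi> \<in> B" and gf: "module_hom C M (Zf \<Phi>) (gf \<Phi>)"
    and fails: "\<And>p. assignment C (Zf \<Phi>) p \<Longrightarrow> \<exists>A\<in>\<Phi>. \<not> holds (Zf \<Phi>) (gf \<Phi>) p A" if "\<Phi> \<in> T0" for \<Phi>
    using Zg[rule_format, OF that] by (auto simp: Zf_def gf_def)
  note Zf_in = in_sub_B[OF Zf]
  \<comment> \<open>Every finite system that is not total fails in one of the factors of
    \<open>W\<close>.\<close>
  define W where "W = prodm T0 Zf"
  have W: "in_sub C B W" unfolding W_def by (rule in_sub_prodm[OF Zf_in T0_small])
  note Wc = in_subD[OF W]
  define G where "G X m = (\<lambda>\<Phi>\<in>T0. gf \<Phi> X m)" for X m
  have G: "module_hom C M W G"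
    unfolding W_def G_def[abs_def] by (rule prodm_tuple) (rule gf)
  have imG: "imm C M G \<subseteq> Sigma (obj C) (car W)"
    using module_hom_closed[OF G] by (auto simp: imm_def)
  define Y0 where "Y0 = closure_in W (imm C M G)"
  have Y0: "sub_in W Y0" unfolding Y0_def by (rule sub_in_closure[OF W imG])
  then have Y0s: "submodule C W Y0" and Yin: "in_sub C B (subm W Y0)" by (auto simp: sub_in_def)
  have GY: "module_hom C M (subm W Y0) G"
  proof (rule module_hom_into_subm[OF G])
    fix X m assume "X \<in> obj C" "m \<in> car M X"
    then have "(X, G X m) \<in> imm C M G" by (auto simp: imm_def)
    then show "(X, G X m) \<in> Y0" using closure_in_superset unfolding Y0_def by blast
  qed
  have genY: "generated M (subm W Y0) G"
    unfolding Y0_def by (rule generated_closure[OF W imG])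
  \<comment> \<open>To extend \<open>g\<close>, the factor \<open>Z\<close> is added to the product
    and the closure of the image of \<open>M\<close> is taken there. Forgetting the factor
    \<open>Z\<close> is injective on this closure, so its image in \<open>W\<close> is a submodule
    in \<open>B\<close> that contains \<open>Y0\<close>; lifting \<open>Y0\<close> and projecting to
    \<open>Z\<close> gives \<open>h\<close>.\<close>
  have ext: "\<exists>h. module_hom C (subm W Y0) Z h \<and> (\<forall>X\<in>obj C. \<forall>m\<in>car M X. h X (G X m) = g X m)"
    if Z: "Z \<in> B" and g: "module_hom C M Z g" for Z g
  proof -
    \<comment> \<open>\<open>None\<close> is the index of the additional factor
      \<open>Z\<close>.\<close>
    define J where "J = insert None (Some ` T0)"
    define Zf' where "Zf' = case_option Z Zf"
    define V where "V = prodm J Zf'"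
    have J_small: "small TYPE('u) J" unfolding J_def by (intro small_insert small_image T0_small)
    have Zf'_in: "in_sub C B (Zf' j)" if "j \<in> J" for j
      using that in_sub_B[OF Z] Zf_in by (auto simp: J_def Zf'_def)
    have V: "in_sub C B V" unfolding V_def by (rule in_sub_prodm[OF Zf'_in J_small])
    define G' where "G' X m = (\<lambda>j\<in>J. case_option g gf j X m)" for X m
    have G': "module_hom C M V G'"
      unfolding V_def G'_def[abs_def]
      by (rule prodm_tuple) (auto simp: J_def Zf'_def g gf)
    have imG': "imm C M G' \<subseteq> Sigma (obj C) (car V)"
      using module_hom_closed[OF G'] by (auto simp: imm_def)
    define Y1 where "Y1 = closure_in V (imm C M G')"
    have Y1: "sub_in V Y1" unfolding Y1_def by (rule sub_in_closure[OF V imG'])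
    then have Y1s: "submodule C V Y1" and Y1in: "in_sub C B (subm V Y1)" by (auto simp: sub_in_def)
    let ?Y' = "subm V Y1"
    interpret Y': cat_module C ?Y' by (rule in_subD[OF Y1in])
    have G'Y: "module_hom C M ?Y' G'"
    proof (rule module_hom_into_subm[OF G'])
      fix X m assume "X \<in> obj C" "m \<in> car M X"
      then have "(X, G' X m) \<in> imm C M G'" by (auto simp: imm_def)
      then show "(X, G' X m) \<in> Y1" using closure_in_superset unfolding Y1_def by blast
    qed
    have genY': "generated M ?Y' G'"
      unfolding Y1_def by (rule generated_closure[OF V imG'])
    have projS: "module_hom C ?Y' (Zf \<Phi>) (\<lambda>X s. s (Some \<Phi>))" if "\<Phi> \<in> T0" for \<Phi>
    proof -
      have "module_hom C V (Zf' (Some \<Phi>)) (\<lambda>X s. s (Some \<Phi>))"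
        unfolding V_def by (rule prodm_proj) (use that in \<open>simp add: J_def\<close>)
      then show ?thesis using module_hom_from_subm[OF _ Y1s] by (simp add: Zf'_def)
    qed
    have projN: "module_hom C ?Y' Z (\<lambda>X s. s None)"
    proof -
      have "module_hom C V (Zf' None) (\<lambda>X s. s None)"
        unfolding V_def by (rule prodm_proj) (simp add: J_def)
      then show ?thesis using module_hom_from_subm[OF _ Y1s] by (simp add: Zf'_def)
    qed
    define q where "q X s = (\<lambda>\<Phi>\<in>T0. s (Some \<Phi>))" for X :: 'o and s :: "('o, 'a, nat, 'm) atom set option \<Rightarrow> 'u"
    have q: "module_hom C ?Y' W q"
      unfolding W_def q_def[abs_def] by (rule prodm_tuple) (rule projS)
    have inj: "inj_on (q c) (car ?Y' c)" if c: "c \<in> obj C" for c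
      unfolding module_hom_inj_iff[OF in_subD[OF Y1in] Wc q c]
    proof (intro ballI impI)
      fix y assume y: "y \<in> car ?Y' c" and qy: "q c y = \<one>\<^bsub>omap W c\<^esub>"
      obtain \<Phi> P n where \<Phi>: "finite \<Phi>" "\<Phi> \<subseteq> At" and P: "assignment C ?Y' P" "\<forall>A\<in>\<Phi>. holds ?Y' G' P A" "P c n = y"
        and functional: "\<forall>Z\<in>B. \<forall>p. assignment C Z p \<longrightarrow> (\<forall>A\<in>\<Phi>. holds Z (\<lambda>X m. \<one>\<^bsub>omap Z X\<^esub>) p A) \<longrightarrow> p c n = \<one>\<^bsub>omap Z c\<^esub>"
        by (rule definable[OF Y1in Ms G'Y genY' c y, folded At_def]) (rule that, assumption+)
      \<comment> \<open>The equation \<open>x + x = x\<close> for the variable \<open>n\<close>,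
        which names \<open>y\<close>: it says that this variable is zero.\<close>
      define A0 :: "('o, 'a, nat, 'm) atom" where "A0 = AddAt c n n n"
      have A0_holds: "holds N g p A0 \<longleftrightarrow> p c n \<otimes>\<^bsub>omap N c\<^esub> p c n = p c n"
        for N :: "('o, 'a, 'u) cmodule" and g p
        by (simp add: A0_def)
      have A0: "A0 \<in> At" unfolding A0_def At_def atoms_def using c by simp
      have "total (insert A0 \<Phi>)"
      proof (rule ccontr)
        assume "\<not> total (insert A0 \<Phi>)"
        then have T: "insert A0 \<Phi> \<in> T0" using \<Phi> A0 by (simp add: T0_def Fpow_def)
        interpret ZT: cat_module C "Zf (insert A0 \<Phi>)" by (rule in_subD[OF Zf_in[OF T]])
        \<comment> \<open>If the enlarged system were not total, it would be an index of
          \<open>W\<close>, and the factor at that index was chosen so that the system has no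
          solution there. Yet the coordinates of \<open>P\<close> at this factor solve it:
          projections preserve the equations of \<open>\<Phi>\<close>, and \<open>y\<close> vanishes
          at this coordinate.\<close>
        let ?p = "\<lambda>X i. P X i (Some (insert A0 \<Phi>))"
        have "assignment C (Zf (insert A0 \<Phi>)) ?p"
          using P(1) module_hom_closed[OF projS[OF T]] by (simp add: assignment_def)
        then obtain A where A: "A \<in> insert A0 \<Phi>" "\<not> holds (Zf (insert A0 \<Phi>)) (gf (insert A0 \<Phi>)) ?p A"
          using fails[OF T] by blast
        have "holds (Zf (insert A0 \<Phi>)) (gf (insert A0 \<Phi>)) ?p A" if "A \<in> \<Phi>" for A
          by (rule holds_hom[OF projS[OF T] P(1) _ bspec[OF P(2) that]])
            (use that \<Phi> T in \<open>auto simp: At_def G'_def J_def\<close>)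
        moreover have "?p c n = \<one>\<^bsub>omap (Zf (insert A0 \<Phi>)) c\<^esub>"
          using fun_cong[OF qy, of "insert A0 \<Phi>"] T P(3) by (simp add: q_def W_def)
        then have "holds (Zf (insert A0 \<Phi>)) (gf (insert A0 \<Phi>)) ?p A0"
          using c by (simp add: A0_holds ZT.mult_self_iff)
        ultimately show False using A by blast
      qed
      moreover obtain M1 \<alpha> where M1: "M1 \<in> B" and \<alpha>: "module_iso C ?Y' M1 \<alpha>" using Y1in by (rule in_subE)
      moreover have \<alpha>h: "module_hom C ?Y' M1 \<alpha>" using \<alpha> by (simp add: module_iso_def)
      \<comment> \<open>Totality is applied to \<open>?Y'\<close> itself, represented by
        \<open>M1\<close> in \<open>B\<close>. The solution obtained has value zero at the variable
        \<open>n\<close>.\<close>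
      ultimately obtain p where p: "assignment C M1 p"
        "\<forall>A\<in>insert A0 \<Phi>. holds M1 (\<lambda>X m. \<alpha> X (G' X m)) p A"
        using module_hom_comp[OF G'Y \<alpha>h] unfolding total_def by blast
      interpret M1: cat_module C M1 by (rule in_subD[OF in_sub_B[OF M1]])
      have pc: "p c n \<in> car M1 c" "\<alpha> c y \<in> car M1 c"
        using p(1) c module_hom_closed[OF \<alpha>h c y] by (auto simp: assignment_def)
      have "p c n = \<one>\<^bsub>omap M1 c\<^esub>" using p(2) c pc by (simp add: A0_holds M1.mult_self_iff)
      let ?P' = "\<lambda>X i. \<alpha> X (P X i)"
      have P': "assignment C M1 ?P'" using P(1) module_hom_closed[OF \<alpha>h] by (simp add: assignment_def)
      have "holds M1 (\<lambda>X m. \<alpha> X (G' X m)) ?P' A" if "A \<in> \<Phi>" for A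
        by (rule holds_hom[OF \<alpha>h P(1) _ bspec[OF P(2) that]]) (use that \<Phi> in \<open>auto simp: At_def\<close>)
      then have "\<forall>A\<in>\<Phi>. holds M1 (\<lambda>X m. \<one>\<^bsub>omap M1 X\<^esub>) (\<lambda>X i. ?P' X i \<otimes>\<^bsub>omap M1 X\<^esub> inv\<^bsub>omap M1 X\<^esub> p X i) A"
        using p(2) \<Phi>(2) by (auto intro!: holds_diff[OF M1.cat_module_axioms P' p(1)] simp: At_def)
      moreover have "assignment C M1 (\<lambda>X i. ?P' X i \<otimes>\<^bsub>omap M1 X\<^esub> inv\<^bsub>omap M1 X\<^esub> p X i)"
        using P' p(1) by (simp add: assignment_def)
      \<comment> \<open>The image of the defining solution and \<open>p\<close> solve the same
        equations, so their difference is a homogeneous solution and vanishes at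
        \<open>n\<close>.\<close>
      ultimately have "?P' c n \<otimes>\<^bsub>omap M1 c\<^esub> inv\<^bsub>omap M1 c\<^esub> p c n = \<one>\<^bsub>omap M1 c\<^esub>"
        using functional[rule_format, OF M1, of "\<lambda>X i. ?P' X i \<otimes>\<^bsub>omap M1 X\<^esub> inv\<^bsub>omap M1 X\<^esub> p X i"] by blast
      then have "\<alpha> c y = \<one>\<^bsub>omap M1 c\<^esub>"
        using pc c P(3) \<open>p c n = \<one>\<^bsub>omap M1 c\<^esub>\<close> by (simp add: M1.mult_inv_eq_one_iff)
      moreover have "inj_on (\<alpha> c) (car ?Y' c)" using \<alpha> c by (simp add: module_iso_def bij_betw_def)
      ultimately show "y = \<one>\<^bsub>omap ?Y' c\<^esub>"
        using module_hom_inj_iff[OF in_subD[OF Y1in] M1.cat_module_axioms \<alpha>h c] y by blast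
    qed
    have "sub_in W (imm C ?Y' q)" by (rule sub_in_imm_mono[OF Y1in W q inj])
    moreover have qG': "q X (G' X m) = G X m" if "X \<in> obj C" "m \<in> car M X" for X m
      by (auto simp: q_def G_def G'_def J_def)
    have "imm C M G \<subseteq> imm C ?Y' q"
    proof (rule subrelI)
      fix X w assume "(X, w) \<in> imm C M G"
      then obtain m where m: "X \<in> obj C" "m \<in> car M X" "w = G X m" by (auto simp: imm_def)
      then have "w = q X (G' X m)" using qG' by simp
      then show "(X, w) \<in> imm C ?Y' q"
        unfolding imm_def using m module_hom_closed[OF G'Y m(1,2)] by blast
    qed
    \<comment> \<open>\<open>Y0\<close> is the least submodule of \<open>W\<close> in
      \<open>B\<close> containing the image of \<open>M\<close>, and the image of \<open>?Y'\<close>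
      is also such a submodule.\<close>
    ultimately have "Y0 \<subseteq> imm C ?Y' q" unfolding Y0_def by (rule closure_in_least)
    then have "y \<in> q X ` car ?Y' X" if "X \<in> obj C" "y \<in> car (subm W Y0) X" for X y
      using that by (auto simp: imm_def)
    then obtain h where h: "module_hom C (subm W Y0) ?Y' h"
      and qh: "\<And>X y. X \<in> obj C \<Longrightarrow> y \<in> car (subm W Y0) X \<Longrightarrow> q X (h X y) = y"
      using module_hom_factor_mono[OF in_subD[OF Y1in] q subm_incl[OF Y0s] inj] by blast
    show ?thesis
    proof (intro exI conjI ballI)
      show "module_hom C (subm W Y0) Z (\<lambda>X y. h X y None)"
        by (rule module_hom_comp[OF h projN])
      fix X m assume *: "X \<in> obj C" "m \<in> car M X"
      have "h X (G X m) = G' X m"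
      proof (rule inj_onD[OF inj[OF *(1)]])
        show "q X (h X (G X m)) = q X (G' X m)"
          using qh[OF *(1) module_hom_closed[OF GY *]] qG'[OF *] by simp
      qed (use * module_hom_closed[OF GY] module_hom_closed[OF h] module_hom_closed[OF G'Y] in blast)+
      then show "h X (G X m) None = g X m" by (simp add: G'_def J_def)
    qed
  qed
  \<comment> \<open>The submodule of the product is replaced by an isomorphic copy that is literally
    an element of \<open>B\<close>; generation is carried over through the isomorphism.\<close>
  obtain Y \<beta> where YB: "Y \<in> B" and \<beta>: "module_iso C (subm W Y0) Y \<beta>" using Yin by (rule in_subE)
  obtain \<beta>' where \<beta>': "module_iso C Y (subm W Y0) \<beta>'"
    and \<beta>'\<beta>: "\<And>X x. X \<in> obj C \<Longrightarrow> x \<in> car (subm W Y0) X \<Longrightarrow> \<beta>' X (\<beta> X x) = x"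
    and \<beta>\<beta>': "\<And>X x. X \<in> obj C \<Longrightarrow> x \<in> car Y X \<Longrightarrow> \<beta> X (\<beta>' X x) = x"
    by (rule module_iso_inverse[OF in_subD[OF Yin] \<beta>]) (rule that, assumption+)
  have hs: "module_hom C (subm W Y0) Y \<beta>" "module_hom C Y (subm W Y0) \<beta>'"
    using \<beta> \<beta>' by (auto simp: module_iso_def)
  let ?\<eta> = "\<lambda>X m. \<beta> X (G X m)"
  have \<eta>: "module_hom C M Y ?\<eta>" by (rule module_hom_comp[OF GY hs(1)])
  have gen: "generated M Y ?\<eta>"
    unfolding generated_def
  proof (intro allI impI)
    fix S assume S: "sub_in Y S" and im: "imm C M ?\<eta> \<subseteq> S"
    note Ss = S[unfolded sub_in_def, THEN conjunct1] and Sin = S[unfolded sub_in_def, THEN conjunct2]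
    have k: "module_hom C (subm Y S) (subm W Y0) \<beta>'" by (rule module_hom_from_subm[OF hs(2) Ss])
    have "inj_on (\<beta>' X) (car (subm Y S) X)" if "X \<in> obj C" for X
      by (rule inj_on_subset[of _ "car Y X"])
        (use \<beta>' that submoduleD(2)[OF Ss] in \<open>auto simp: module_iso_def bij_betw_def\<close>)
    then have 1: "sub_in (subm W Y0) (imm C (subm Y S) \<beta>')"
      by (rule sub_in_imm_mono[OF Sin Yin k])
    have 2: "imm C M G \<subseteq> imm C (subm Y S) \<beta>'"
    proof (rule subrelI)
      fix X w assume "(X, w) \<in> imm C M G"
      then obtain m where m: "X \<in> obj C" "m \<in> car M X" "w = G X m" by (auto simp: imm_def)
      have "(X, \<beta> X (G X m)) \<in> S" using im m by (auto simp: imm_def)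
      moreover have "w = \<beta>' X (\<beta> X (G X m))" using m \<beta>'\<beta> module_hom_closed[OF GY] by simp
      ultimately show "(X, w) \<in> imm C (subm Y S) \<beta>'" unfolding imm_def using m(1) by auto
    qed
    show "Sigma (obj C) (car Y) \<subseteq> S"
    proof (rule subrelI)
      fix X y assume "(X, y) \<in> Sigma (obj C) (car Y)"
      then have Xy: "X \<in> obj C" "y \<in> car Y X" by auto
      have "(X, \<beta>' X y) \<in> imm C (subm Y S) \<beta>'"
        using genY[unfolded generated_def, rule_format, OF 1 2] Xy module_hom_closed[OF hs(2) Xy] by blast
      then obtain s where s: "(X, s) \<in> S" "\<beta>' X y = \<beta>' X s" by (auto simp: imm_def)
      have "y = \<beta> X (\<beta>' X y)" by (rule \<beta>\<beta>'[OF Xy, symmetric])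
      also have "\<dots> = s" unfolding s(2) by (rule \<beta>\<beta>'[OF Xy(1) submoduleD(2)[OF Ss s(1)]])
      finally have "y = s" .
      then show "(X, y) \<in> S" using s by simp
    qed
  qed
  have ex: "\<exists>h. module_hom C Y Z h \<and> (\<forall>X\<in>obj C. \<forall>m\<in>car M X. h X (?\<eta> X m) = g X m)"
    if Z: "Z \<in> B" and g: "module_hom C M Z g" for Z g
  proof -
    obtain h where h: "module_hom C (subm W Y0) Z h" "\<forall>X\<in>obj C. \<forall>m\<in>car M X. h X (G X m) = g X m"
      using ext[OF Z g] by blast
    show ?thesis
      by (rule exI[of _ "\<lambda>X y. h X (\<beta>' X y)"])
        (use h module_hom_comp[OF hs(2) h(1)] \<beta>'\<beta> module_hom_closed[OF GY] in simp)
  qed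
  show ?thesis
    by (intro bexI[OF _ YB] exI[of _ ?\<eta>] conjI \<eta> gen ballI allI impI) (rule ex)
qed

end

section \<open>Restriction of scalars and representable modules\<close>

abbreviation res :: "('o, 'a, 'p, 'b) cfunctor \<Rightarrow> ('p, 'b, 'x) cmodule \<Rightarrow> ('o, 'a, 'x) cmodule" where
  "res f N \<equiv> comp_functor N (op_functor f)"

lemma res_simps [simp]:
  "omap (res f N) X = omap N (omap f X)"
  "amap (res f N) X Y a = amap N (omap f X) (omap f Y) (amap f Y X a)"
  by (simp_all add: comp_functor_def op_functor_def)

lemma additive_functorD:
  assumes "additive_functor C D f"
  shows "X \<in> obj C \<Longrightarrow> omap f X \<in> obj D"
    "\<lbrakk>X \<in> obj C; Y \<in> obj C; a \<in> arr C X Y\<rbrakk> \<Longrightarrow> amap f X Y a \<in> arr D (omap f X) (omap f Y)"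
    "X \<in> obj C \<Longrightarrow> amap f X X (ident C X) = ident D (omap f X)"
    "\<lbrakk>X \<in> obj C; Y \<in> obj C; Z \<in> obj C; a \<in> arr C X Y; b \<in> arr C Y Z\<rbrakk> \<Longrightarrow>
       amap f X Z (ccomp C X Y Z b a) = ccomp D (omap f X) (omap f Y) (omap f Z) (amap f Y Z b) (amap f X Y a)"
    "\<lbrakk>X \<in> obj C; Y \<in> obj C; a \<in> arr C X Y; b \<in> arr C X Y\<rbrakk> \<Longrightarrow>
       amap f X Y (arr_add C X Y a b) = arr_add D (omap f X) (omap f Y) (amap f X Y a) (amap f X Y b)"
  using assms unfolding additive_functor_def is_functor_def by simp_all

lemma additive_functorI:
  assumes "\<And>X. X \<in> obj C \<Longrightarrow> omap f X \<in> obj D"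
    "\<And>X Y a. \<lbrakk>X \<in> obj C; Y \<in> obj C; a \<in> arr C X Y\<rbrakk> \<Longrightarrow> amap f X Y a \<in> arr D (omap f X) (omap f Y)"
    "\<And>X. X \<in> obj C \<Longrightarrow> amap f X X (ident C X) = ident D (omap f X)"
    "\<And>X Y Z a b. \<lbrakk>X \<in> obj C; Y \<in> obj C; Z \<in> obj C; a \<in> arr C X Y; b \<in> arr C Y Z\<rbrakk> \<Longrightarrow>
       amap f X Z (ccomp C X Y Z b a) = ccomp D (omap f X) (omap f Y) (omap f Z) (amap f Y Z b) (amap f X Y a)"
    "\<And>X Y a b. \<lbrakk>X \<in> obj C; Y \<in> obj C; a \<in> arr C X Y; b \<in> arr C X Y\<rbrakk> \<Longrightarrow>
       amap f X Y (arr_add C X Y a b) = arr_add D (omap f X) (omap f Y) (amap f X Y a) (amap f X Y b)"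
  shows "additive_functor C D f"
  using assms unfolding additive_functor_def is_functor_def by simp

lemma cat_module_res:
  assumes f: "additive_functor C D f" and N: "cat_module D N"
  shows "cat_module C (res f N)"
proof -
  interpret cat_module D N by (rule N)
  note fD = additive_functorD[OF f]
  show ?thesis
    by (rule cat_module.intro) (simp_all add: fD grp act_hom act_ident act_comp act_add)
qed

lemma module_hom_res:
  assumes f: "additive_functor C D f" and h: "module_hom D N N' h"
  shows "module_hom C (res f N) (res f N') (\<lambda>X. h (omap f X))"
  using additive_functorD[OF f]
  by (intro module_homI) (simp_all add: module_hom_closed[OF h] module_hom_mult[OF h] module_hom_act[OF h])

lemma small_module_res:
  "additive_functor C D f \<Longrightarrow> small_module U D N \<Longrightarrow> small_module U C (res f N)"
  unfolding small_module_def by (simp add: additive_functorD)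

lemma res_obj_Mod:
  fixes N :: "('p, 'b, 'u) cmodule"
  assumes C: "preadditive_category C" and f: "additive_functor C D f" and N: "N \<in> obj (Mod D)"
  shows "res f N \<in> obj (Mod C)"
  by (rule obj_ModI[OF C cat_module_res[OF f obj_ModD(1)[OF N]] small_module_res[OF f obj_ModD(2)[OF N]]])
    (simp add: additive_functorD[OF f] obj_ModD(3)[OF N])

section \<open>Representable modules and covers by their coproducts\<close>

definition rep :: "('o, 'a) preadd_cat \<Rightarrow> 'o \<Rightarrow> ('o, 'a, 'a) cmodule" where
  "rep C c = \<lparr>omap = \<lambda>X. arr_group C X c, amap = \<lambda>X Y a x. ccomp C Y X c x a\<rparr>"

lemma rep_simps [simp]:
  "car (rep C c) X = arr C X c"
  "x \<otimes>\<^bsub>omap (rep C c) X\<^esub> y = arr_add C X c x y"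
  "\<one>\<^bsub>omap (rep C c) X\<^esub> = arr_zero C X c"
  "amap (rep C c) X Y a x = ccomp C Y X c x a"
  by (simp_all add: rep_def arr_group_def)

lemma cat_module_rep:
  assumes C: "preadditive_category C" and c: "c \<in> obj C"
  shows "cat_module C (rep C c)"
proof -
  interpret preadditive_category C by (rule C)
  show ?thesis
  proof (rule cat_module.intro)
    fix X assume "X \<in> obj C"
    then show "comm_group (omap (rep C c) X)" using c by (simp add: rep_def arr_comm_group)
  next
    fix X Y a assume *: "X \<in> obj C" "Y \<in> obj C" "a \<in> arr C Y X"
    show "amap (rep C c) X Y a \<in> hom (omap (rep C c) X) (omap (rep C c) Y)"
      using * c by (intro homI) (simp_all add: comp_arr comp_add_left)
  qed (use c in \<open>simp_all add: comp_ident_right comp_assoc comp_add_right\<close>)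
qed

lemma small_rep: "small_category U C \<Longrightarrow> c \<in> obj C \<Longrightarrow> small_module U C (rep C c)"
  by (simp add: small_module_def small_category_def)

text \<open>One half of the Yoneda correspondence, \<open>n\<close> being the value at the identity.
  Additivity in \<open>a\<close> and compatibility with composition are module axioms of
  \<open>N\<close>.\<close>

lemma yoneda_hom:
  assumes N: "cat_module C N" and c: "c \<in> obj C" and n: "n \<in> car N c"
  shows "module_hom C (rep C c) N (\<lambda>X a. amap N c X a n)"
proof -
  interpret cat_module C N by (rule N)
  show ?thesis by (rule module_homI) (simp_all add: c n act_add act_comp)
qed

text \<open>One representable is taken for each pair in \<open>K\<close>, mapped by Yoneda to the
  element in that pair; the identity arrows then hit all of \<open>K\<close>.\<close>

lemma representable_cover:
  assumes C: "preadditive_category C" and Q: "cat_module C Q" and K: "submodule C Q K"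
  obtains r where "module_hom C (copm C K (\<lambda>j. rep C (fst j))) Q r"
    "imm C (copm C K (\<lambda>j. rep C (fst j))) r = K"
proof -
  interpret C: preadditive_category C by (rule C)
  interpret Q: cat_module C Q by (rule Q)
  let ?M = "\<lambda>j. rep C (fst j)"
  let ?S = "copm C K ?M"
  have Kc: "fst j \<in> obj C" "snd j \<in> car Q (fst j)" if "j \<in> K" for j
    using submoduleD(1,2)[OF K, of "fst j" "snd j"] that by auto
  have Mc: "cat_module C (?M j)" if "j \<in> K" for j by (rule cat_module_rep[OF C Kc(1)[OF that]])
  have S: "cat_module C ?S" by (rule cat_module_copm[OF Mc])
  have cop: "pcop C K ?M ?S (cop_in K ?M)" by (rule pcop_copm[OF Mc])
  let ?f = "\<lambda>j X a. amap Q (fst j) X a (snd j)"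
  have f: "module_hom C (?M j) Q (?f j)" if "j \<in> K" for j
    by (rule yoneda_hom[OF Q Kc[OF that]])
  obtain r where r: "module_hom C ?S Q r"
    and r\<iota>: "\<And>j X a. j \<in> K \<Longrightarrow> X \<in> obj C \<Longrightarrow> a \<in> car (?M j) X \<Longrightarrow> r X (cop_in K ?M j X a) = ?f j X a"
    by (rule pcop_extend[OF Mc S cop Q f]) (assumption | rule that)+
  have Qc: "cat_module C (quotm Q K)" by (rule cat_module_quotm[OF C Q K])
  note qh = quot_map_hom[OF Q K]
  have \<iota>: "module_hom C (?M j) ?S (cop_in K ?M j)" if "j \<in> K" for j by (rule cop_in_hom[OF Mc that])
  have "imm C ?S r = K"
  proof (rule equalityI)
    show "K \<subseteq> imm C ?S r"
    proof (rule subrelI)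
      fix c k assume k: "(c, k) \<in> K"
      then have c: "c \<in> obj C" "k \<in> car Q c" using submoduleD(1,2)[OF K] by auto
      have id: "ident C c \<in> car (?M (c, k)) c" using c by (simp add: C.ident_arr)
      have "k = r c (cop_in K ?M (c, k) c (ident C c))"
        using r\<iota>[OF k c(1) id] c by (simp add: Q.act_ident)
      then show "(c, k) \<in> imm C ?S r"
        unfolding imm_def using c module_hom_closed[OF \<iota>[OF k] c(1) id] by blast
    qed
    show "imm C ?S r \<subseteq> K"
    proof (rule subrelI)
      fix X s assume "(X, s) \<in> imm C ?S r"
      then obtain z where X: "X \<in> obj C" and z: "z \<in> car ?S X" "s = r X z" by (auto simp: imm_def)
      \<comment> \<open>That \<open>r\<close> takes values in \<open>K\<close> is tested after
        dividing by \<open>K\<close>: the composite and the zero map agree on the summands, so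
        uniqueness for coproducts applies.\<close>
      have "quot_map Q K X (r X z) = \<one>\<^bsub>omap (quotm Q K) X\<^esub>"
      proof (rule pcop_unique[OF Mc S cop Qc module_hom_comp[OF r qh] module_hom_zero[OF Qc] _ X z(1)])
        fix j X a assume *: "j \<in> K" "X \<in> obj C" "a \<in> car (?M j) X"
        have "(X, ?f j X a) \<in> K"
          using submoduleD(6)[OF K, of "fst j" "snd j" X a] * by simp
        moreover have "?f j X a \<in> car Q X" using Kc[OF *(1)] * by simp
        ultimately show "quot_map Q K X (r X (cop_in K ?M j X a)) = \<one>\<^bsub>omap (quotm Q K) X\<^esub>"
          using * by (simp add: r\<iota> quot_map_eq_one_iff[OF Q K])
      qed
      then show "(X, s) \<in> K"
        using quot_map_eq_one_iff[OF Q K X] module_hom_closed[OF r X z(1)] z(2) by simp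
    qed
  qed
  with r show thesis by (rule that)
qed

text \<open>Both maps are surjections from \<open>N\<close> whose kernel is the image of
  \<open>g\<close>. The two targets may have different types of elements.\<close>

lemma pcok_unique:
  assumes N: "cat_module C N" and Q: "cat_module C Q" and Q': "cat_module C Q'"
    and p: "pcok C M N g Q q" and p': "pcok C M N g Q' q'"
  obtains h where "module_iso C Q Q' h"
proof -
  have qh: "module_hom C N Q q" and qh': "module_hom C N Q' q'" using p p' by (auto simp: pcok_def)
  have im: "\<And>X. X \<in> obj C \<Longrightarrow> q X ` car N X = car Q X" "\<And>X. X \<in> obj C \<Longrightarrow> q' X ` car N X = car Q' X"
    and ker: "\<And>X y. X \<in> obj C \<Longrightarrow> y \<in> car N X \<Longrightarrow> q X y = \<one>\<^bsub>omap Q X\<^esub> \<longleftrightarrow> q' X y = \<one>\<^bsub>omap Q' X\<^esub>"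
    using p p' by (simp_all add: pcok_def)
  have k: "\<And>X x. X \<in> obj C \<Longrightarrow> x \<in> car N X \<Longrightarrow> q X x = \<one>\<^bsub>omap Q X\<^esub> \<Longrightarrow> q' X x = \<one>\<^bsub>omap Q' X\<^esub>"
    using ker by simp
  obtain h where h: "module_hom C Q Q' h" and hq: "\<And>X x. X \<in> obj C \<Longrightarrow> x \<in> car N X \<Longrightarrow> h X (q X x) = q' X x"
    by (rule module_hom_factor_epi[OF N Q Q' qh qh' im(1) k]) (assumption | rule that)+
  have "module_iso C Q Q' h"
    unfolding module_iso_def
  proof (intro conjI ballI h)
    fix X assume X: "X \<in> obj C"
    have "inj_on (h X) (car Q X)"
      unfolding module_hom_inj_iff[OF Q Q' h X]
    proof (intro ballI impI)
      fix y assume y: "y \<in> car Q X" "h X y = \<one>\<^bsub>omap Q' X\<^esub>"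
      then obtain x where x: "x \<in> car N X" "y = q X x" using im(1)[OF X] by blast
      then show "y = \<one>\<^bsub>omap Q X\<^esub>" using y(2) hq[OF X x(1)] ker[OF X x(1)] by simp
    qed
    moreover have "h X ` car Q X = car Q' X"
      unfolding im(1)[OF X, symmetric] im(2)[OF X, symmetric] image_image using hq[OF X] by (rule image_cong[OF refl])
    ultimately show "bij_betw (h X) (car Q X) (car Q' X)" by (simp add: bij_betw_def)
  qed
  then show thesis by (rule that)
qed

section \<open>The category of generators of a fully exact subcategory\<close>

text \<open>\<open>G c\<close> represents evaluation at \<open>c\<close> on \<open>B\<close>, with
  universal element \<open>gen c\<close>. It will be the reflection of the representable module at
  \<open>c\<close>, and \<open>gen c\<close> the image of the identity.\<close>

locale generators = fully_exact_modules C B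
  for C :: "('o, 'a) preadd_cat" and B :: "('o, 'a, 'u) cmodule set" +
  fixes G :: "'o \<Rightarrow> ('o, 'a, 'u) cmodule" and gen :: "'o \<Rightarrow> 'u"
  assumes G_B: "c \<in> obj C \<Longrightarrow> G c \<in> B"
    and gen_in: "c \<in> obj C \<Longrightarrow> gen c \<in> car (G c) c"
    and gen_ex: "\<lbrakk>c \<in> obj C; Z \<in> B; z \<in> car Z c\<rbrakk> \<Longrightarrow> \<exists>h. module_hom C (G c) Z h \<and> h c (gen c) = z"
    and gen_unique: "\<lbrakk>c \<in> obj C; Z \<in> B; module_hom C (G c) Z h; module_hom C (G c) Z k;
      h c (gen c) = k c (gen c); X \<in> obj C; y \<in> car (G c) X\<rbrakk> \<Longrightarrow> h X y = k X y"
begin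

lemma G_Mod: "c \<in> obj C \<Longrightarrow> G c \<in> obj (Mod C)"
  using G_B B_sub by blast

lemma gen_unique_in_sub:
  assumes Z: "in_sub C B Z" and c: "c \<in> obj C" and h: "module_hom C (G c) Z h" and k: "module_hom C (G c) Z k"
    and eq: "h c (gen c) = k c (gen c)" and X: "X \<in> obj C" and y: "y \<in> car (G c) X"
  shows "h X y = k X y"
proof -
  obtain Z' \<alpha> where Z': "Z' \<in> B" and \<alpha>: "module_iso C Z Z' \<alpha>" using Z by (rule in_subE)
  have \<alpha>h: "module_hom C Z Z' \<alpha>" and inj: "inj_on (\<alpha> X) (car Z X)"
    using \<alpha> X by (auto simp: module_iso_def bij_betw_def)
  have "\<alpha> X (h X y) = \<alpha> X (k X y)"
    by (rule gen_unique[OF c Z' module_hom_comp[OF h \<alpha>h] module_hom_comp[OF k \<alpha>h] _ X y]) (simp add: eq)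
  then show ?thesis
    by (rule inj_onD[OF inj]) (rule module_hom_closed[OF h X y], rule module_hom_closed[OF k X y])
qed

text \<open>The inverse of evaluation at \<open>gen c\<close>, that is, of the Yoneda bijection
  between arrows from \<open>G c\<close> to \<open>Z\<close> and elements of \<open>Z\<close> at
  \<open>c\<close>.\<close>

definition hom_of :: "'o \<Rightarrow> ('o, 'a, 'u) cmodule \<Rightarrow> 'u \<Rightarrow> 'o \<Rightarrow> 'u \<Rightarrow> 'u" where
  "hom_of c Z z = (THE h. h \<in> arr (Mod C) (G c) Z \<and> h c (gen c) = z)"

lemma hom_of:
  assumes c: "c \<in> obj C" and Z: "Z \<in> B" and z: "z \<in> car Z c"
  shows "hom_of c Z z \<in> arr (Mod C) (G c) Z" "hom_of c Z z c (gen c) = z"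
    and "\<And>h. h \<in> arr (Mod C) (G c) Z \<Longrightarrow> h c (gen c) = z \<Longrightarrow> h = hom_of c Z z"
proof -
  have ZM: "Z \<in> obj (Mod C)" using Z B_sub by blast
  obtain h where h: "module_hom C (G c) Z h" "h c (gen c) = z" using gen_ex[OF assms] by blast
  have ex1: "\<exists>!h. h \<in> arr (Mod C) (G c) Z \<and> h c (gen c) = z"
  proof (intro ex1I conjI)
    show "mod_arr C (G c) h \<in> arr (Mod C) (G c) Z" by (rule mod_arr_in[OF G_Mod[OF c] ZM h(1)])
    show "mod_arr C (G c) h c (gen c) = z" using h(2) c gen_in[OF c] by simp
    fix k assume k: "k \<in> arr (Mod C) (G c) Z \<and> k c (gen c) = z"
    show "k = mod_arr C (G c) h"
    proof (rule arr_Mod_eqI[OF G_Mod[OF c] ZM ZM conjunct1[OF k] mod_arr_in[OF G_Mod[OF c] ZM h(1)]])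
      fix X y assume "X \<in> obj C" "y \<in> car (G c) X"
      then show "k X y = mod_arr C (G c) h X y"
        using gen_unique[OF c Z arr_Mod_hom[OF G_Mod[OF c] ZM conjunct1[OF k]] h(1)] h(2) k by simp
    qed
  qed
  have t: "hom_of c Z z \<in> arr (Mod C) (G c) Z \<and> hom_of c Z z c (gen c) = z"
    unfolding hom_of_def by (rule theI'[OF ex1])
  show "hom_of c Z z \<in> arr (Mod C) (G c) Z" "hom_of c Z z c (gen c) = z"
    by (rule conjunct1[OF t], rule conjunct2[OF t])
  fix h assume "h \<in> arr (Mod C) (G c) Z" "h c (gen c) = z"
  then show "h = hom_of c Z z"
    unfolding hom_of_def using the1_equality[OF ex1, of h] by simp
qed

lemma arr_eq_of_gen:
  assumes "c \<in> obj C" "Z \<in> B" "h \<in> arr (Mod C) (G c) Z" "k \<in> arr (Mod C) (G c) Z" "h c (gen c) = k c (gen c)"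
  shows "h = k"
proof -
  have Z: "Z \<in> obj (Mod C)" using assms B_sub by blast
  have "k c (gen c) \<in> car Z c"
    by (rule module_hom_closed[OF arr_Mod_hom[OF G_Mod[OF assms(1)] Z assms(4)] assms(1) gen_in[OF assms(1)]])
  from hom_of(3)[OF assms(1,2) this assms(3,5)] hom_of(3)[OF assms(1,2) this assms(4) refl]
  show ?thesis by simp
qed

text \<open>The full subcategory on the modules \<open>G c\<close>, with objects named by those of
  \<open>C\<close>. The functor from \<open>C\<close> is therefore the identity on objects, and
  distinct objects remain distinct even if their modules coincide.\<close>

definition gen_cat :: "('o, 'o \<Rightarrow> 'u \<Rightarrow> 'u) preadd_cat" where
  "gen_cat = \<lparr>obj = obj C, arr = \<lambda>d c. arr (Mod C) (G d) (G c), ident = \<lambda>c. ident (Mod C) (G c),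
     ccomp = \<lambda>X Y Z. ccomp (Mod C) (G X) (G Y) (G Z),
     arr_add = \<lambda>X Y. arr_add (Mod C) (G X) (G Y), arr_zero = \<lambda>X Y. arr_zero (Mod C) (G X) (G Y)\<rparr>"

lemma gen_cat_simps [simp]:
  "obj gen_cat = obj C" "arr gen_cat d c = arr (Mod C) (G d) (G c)" "ident gen_cat c = ident (Mod C) (G c)"
  "ccomp gen_cat d c b = ccomp (Mod C) (G d) (G c) (G b)"
  "arr_add gen_cat d c = arr_add (Mod C) (G d) (G c)" "arr_zero gen_cat d c = arr_zero (Mod C) (G d) (G c)"
  by (simp_all add: gen_cat_def)

lemma preadditive_gen_cat: "preadditive_category gen_cat"
proof -
  interpret A: preadditive_category "Mod C :: (('o, 'a, 'u) cmodule, 'o \<Rightarrow> 'u \<Rightarrow> 'u) preadd_cat"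
    by (rule preadditive_Mod)
  have "arr_group gen_cat X Y = arr_group (Mod C) (G X) (G Y)" for X Y by (simp add: arr_group_def)
  then show ?thesis
    by (intro preadditive_category.intro category.intro preadditive_category_axioms.intro)
      (simp_all add: G_Mod A.ident_arr A.comp_arr A.comp_ident_right A.comp_ident_left A.comp_assoc
        A.arr_comm_group A.comp_add_right A.comp_add_left)
qed

text \<open>An arrow is recorded by its values, a family indexed by the elements of
  \<open>M\<close>.\<close>

lemma small_homs:
  fixes M N :: "('o, 'a, 'u) cmodule"
  assumes M: "M \<in> obj (Mod C)" and N: "N \<in> obj (Mod C)"
  shows "small TYPE('u) (arr (Mod C) M N)"
proof (rule small_inj_on)
  let ?r = "\<lambda>h. \<lambda>p\<in>Sigma (obj C) (car M). h (fst p) (snd p)"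
  show "inj_on ?r (arr (Mod C) M N)"
  proof (rule inj_onI)
    fix h k assume h: "h \<in> arr (Mod C) M N" and k: "k \<in> arr (Mod C) M N" and eq: "?r h = ?r k"
    show "h = k"
    proof (rule arr_Mod_eqI[OF M N N h k])
      fix X x assume "X \<in> obj C" "x \<in> car M X"
      then show "h X x = k X x" using fun_cong[OF eq, of "(X, x)"] by simp
    qed
  qed
  show "?r ` arr (Mod C) M N \<subseteq> (\<Pi>\<^sub>E p\<in>Sigma (obj C) (car M). car N (fst p))"
  proof (rule image_subsetI)
    fix h assume h: "h \<in> arr (Mod C) M N"
    have "h (fst p) (snd p) \<in> car N (fst p)" if "p \<in> Sigma (obj C) (car M)" for p
      by (rule module_hom_closed[OF arr_Mod_hom[OF M N h]]) (use that in auto)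
    then show "?r h \<in> (\<Pi>\<^sub>E p\<in>Sigma (obj C) (car M). car N (fst p))" by simp
  qed
  show "small TYPE('u) (\<Pi>\<^sub>E p\<in>Sigma (obj C) (car M). car N (fst p))"
    using small_C small_moduleD[OF obj_ModD(2)[OF M]] small_moduleD[OF obj_ModD(2)[OF N]]
    by (auto simp: small_category_def intro!: small_PiE small_Sigma)
qed

lemma small_gen_cat: "small_category TYPE('u) gen_cat"
  using small_C small_homs G_Mod by (simp add: small_category_def)

text \<open>The arrow \<open>a\<close> goes to the homomorphism carrying \<open>gen d\<close> to the
  translate of \<open>gen c\<close> by \<open>a\<close>; it corresponds to composition with
  \<open>a\<close> between representables.\<close>

definition gen_functor :: "('o, 'a, 'o, 'o \<Rightarrow> 'u \<Rightarrow> 'u) cfunctor" where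
  "gen_functor = \<lparr>omap = \<lambda>c. c, amap = \<lambda>d c a. hom_of d (G c) (amap (G c) c d a (gen c))\<rparr>"

lemma gen_functor_simps [simp]:
  "omap gen_functor c = c" "amap gen_functor d c a = hom_of d (G c) (amap (G c) c d a (gen c))"
  by (simp_all add: gen_functor_def)

lemma gen_functor_arr:
  assumes "d \<in> obj C" "c \<in> obj C" "a \<in> arr C d c"
  shows "amap gen_functor d c a \<in> arr (Mod C) (G d) (G c)"
    "amap gen_functor d c a d (gen d) = amap (G c) c d a (gen c)"
proof -
  have "amap (G c) c d a (gen c) \<in> car (G c) d"
    by (rule cat_module.act_closed[OF obj_ModD(1)[OF G_Mod]]) (use assms gen_in in auto)
  then show "amap gen_functor d c a \<in> arr (Mod C) (G d) (G c)"
    "amap gen_functor d c a d (gen d) = amap (G c) c d a (gen c)"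
    using hom_of assms G_B by auto
qed

text \<open>By \<open>arr_eq_of_gen\<close> each law is an equation between values at a generator,
  where it becomes a module axiom of the target.\<close>

lemma additive_gen_functor: "additive_functor C gen_cat gen_functor"
proof (rule additive_functorI)
  interpret A: preadditive_category gen_cat by (rule preadditive_gen_cat)
  fix X Y a b assume *: "X \<in> obj C" "Y \<in> obj C" "a \<in> arr C X Y"
  show "amap gen_functor X Y a \<in> arr gen_cat (omap gen_functor X) (omap gen_functor Y)"
    using gen_functor_arr[OF *] by simp
  assume b: "b \<in> arr C X Y"
  interpret GY: cat_module C "G Y" by (rule obj_ModD[OF G_Mod[OF *(2)]])
  have s: "arr_add C X Y a b \<in> arr C X Y" by (intro arr_add_closed * b)
  have "amap gen_functor X Y (arr_add C X Y a b) =
      arr_add (Mod C) (G X) (G Y) (amap gen_functor X Y a) (amap gen_functor X Y b)"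
  proof (rule arr_eq_of_gen[OF *(1) G_B[OF *(2)] gen_functor_arr(1)[OF *(1,2) s]])
    show "arr_add (Mod C) (G X) (G Y) (amap gen_functor X Y a) (amap gen_functor X Y b) \<in> arr (Mod C) (G X) (G Y)"
      using A.arr_add_closed[of X Y] gen_functor_arr(1)[OF *] gen_functor_arr(1)[OF *(1,2) b] * by simp
    show "amap gen_functor X Y (arr_add C X Y a b) X (gen X) =
        arr_add (Mod C) (G X) (G Y) (amap gen_functor X Y a) (amap gen_functor X Y b) X (gen X)"
      unfolding gen_functor_arr(2)[OF *(1,2) s] arr_add_Mod
      using * b gen_in gen_functor_arr(2)[OF *] gen_functor_arr(2)[OF *(1,2) b]
      by (simp add: GY.act_add del: gen_functor_simps)
  qed
  then show "amap gen_functor X Y (arr_add C X Y a b) =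
      arr_add gen_cat (omap gen_functor X) (omap gen_functor Y) (amap gen_functor X Y a) (amap gen_functor X Y b)"
    by simp
next
  interpret A: preadditive_category gen_cat by (rule preadditive_gen_cat)
  fix X assume X: "X \<in> obj C"
  interpret GX: cat_module C "G X" by (rule obj_ModD[OF G_Mod[OF X]])
  have "amap gen_functor X X (ident C X) = ident (Mod C) (G X)"
  proof (rule arr_eq_of_gen[OF X G_B[OF X] gen_functor_arr(1)[OF X X ident_arr[OF X]]])
    show "ident (Mod C) (G X) \<in> arr (Mod C) (G X) (G X)" using A.ident_arr[of X] X by simp
    show "amap gen_functor X X (ident C X) X (gen X) = ident (Mod C) (G X) X (gen X)"
      unfolding gen_functor_arr(2)[OF X X ident_arr[OF X]] ident_Mod
      using X gen_in by (simp add: GX.act_ident)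
  qed
  then show "amap gen_functor X X (ident C X) = ident gen_cat (omap gen_functor X)" by simp
next
  interpret A: preadditive_category gen_cat by (rule preadditive_gen_cat)
  fix X Y Z a b assume *: "X \<in> obj C" "Y \<in> obj C" "Z \<in> obj C" "a \<in> arr C X Y" "b \<in> arr C Y Z"
  interpret GZ: cat_module C "G Z" by (rule obj_ModD[OF G_Mod[OF *(3)]])
  have s: "ccomp C X Y Z b a \<in> arr C X Z" by (rule comp_arr[OF *])
  note a = gen_functor_arr[OF *(1,2,4)] and b = gen_functor_arr[OF *(2,3,5)]
  have "amap gen_functor X Z (ccomp C X Y Z b a) =
      ccomp (Mod C) (G X) (G Y) (G Z) (amap gen_functor Y Z b) (amap gen_functor X Y a)"
  proof (rule arr_eq_of_gen[OF *(1) G_B[OF *(3)] gen_functor_arr(1)[OF *(1,3) s]])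
    show "ccomp (Mod C) (G X) (G Y) (G Z) (amap gen_functor Y Z b) (amap gen_functor X Y a) \<in> arr (Mod C) (G X) (G Z)"
      using A.comp_arr[of X Y Z] a(1) b(1) * by simp
    have bh: "module_hom C (G Y) (G Z) (amap gen_functor Y Z b)"
      by (rule arr_Mod_hom[OF G_Mod G_Mod b(1)]) (rule *)+
    show "amap gen_functor X Z (ccomp C X Y Z b a) X (gen X) =
      ccomp (Mod C) (G X) (G Y) (G Z) (amap gen_functor Y Z b) (amap gen_functor X Y a) X (gen X)"
      unfolding gen_functor_arr(2)[OF *(1,3) s] ccomp_Mod
      using * gen_in a(2) b(2)
      by (simp add: GZ.act_comp module_hom_act[OF bh] del: gen_functor_simps)
  qed
  then show "amap gen_functor X Z (ccomp C X Y Z b a) =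
      ccomp gen_cat (omap gen_functor X) (omap gen_functor Y) (omap gen_functor Z)
        (amap gen_functor Y Z b) (amap gen_functor X Y a)"
    by simp
qed simp

text \<open>Yoneda inside \<open>B\<close>: arrows from \<open>G d\<close> to \<open>G c\<close> are
  the elements of \<open>G c\<close> at \<open>d\<close>. Thus representable modules over
  \<open>gen_cat\<close> restrict to members of \<open>B\<close> up to isomorphism.\<close>

lemma eval_gen_iso:
  assumes c: "c \<in> obj C"
  shows "module_iso C (res gen_functor (rep gen_cat c)) (G c) (\<lambda>d h. h d (gen d))"
  unfolding module_iso_def
proof (intro conjI ballI)
  have hc: "h X y \<in> car (G c) X" if "d \<in> obj C" "h \<in> arr (Mod C) (G d) (G c)" "X \<in> obj C" "y \<in> car (G d) X" for d h X y
    by (rule module_hom_closed[OF arr_Mod_hom[OF G_Mod G_Mod]]) (use that c in auto)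
  show "module_hom C (res gen_functor (rep gen_cat c)) (G c) (\<lambda>d h. h d (gen d))"
  proof (rule module_homI)
    fix d e a h assume *: "d \<in> obj C" "e \<in> obj C" "a \<in> arr C e d" "h \<in> car (res gen_functor (rep gen_cat c)) d"
    then have h: "module_hom C (G d) (G c) h" using arr_Mod_hom[OF G_Mod G_Mod] c by auto
    have "ccomp (Mod C) (G e) (G d) (G c) h (amap gen_functor e d a) e (gen e) = amap (G c) d e a (h d (gen d))"
      unfolding ccomp_Mod using * gen_in gen_functor_arr(2)[OF *(2,1,3)]
      by (simp add: module_hom_act[OF h] del: gen_functor_simps)
    then show "amap (res gen_functor (rep gen_cat c)) d e a h e (gen e) = amap (G c) d e a (h d (gen d))"
      by simp
  qed (use gen_in hc in \<open>simp_all add: arr_add_Mod\<close>)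
  fix d assume d: "d \<in> obj C"
  show "bij_betw (\<lambda>h. h d (gen d)) (car (res gen_functor (rep gen_cat c)) d) (car (G c) d)"
  proof (rule bij_betw_byWitness[of _ "hom_of d (G c)"])
    show "\<forall>h\<in>car (res gen_functor (rep gen_cat c)) d. hom_of d (G c) (h d (gen d)) = h"
      using hom_of(3)[OF d G_B[OF c]] hc[OF d _ d gen_in[OF d]] by simp
    show "\<forall>y\<in>car (G c) d. hom_of d (G c) y d (gen d) = y"
      using hom_of(2)[OF d G_B[OF c]] by simp
    show "(\<lambda>h. h d (gen d)) ` car (res gen_functor (rep gen_cat c)) d \<subseteq> car (G c) d"
      using hc[OF d _ d gen_in[OF d]] by auto
    show "hom_of d (G c) ` car (G c) d \<subseteq> car (res gen_functor (rep gen_cat c)) d"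
      using hom_of(1)[OF d G_B[OF c]] by auto
  qed
qed

lemma res_rep_in_sub: "c \<in> obj C \<Longrightarrow> in_sub C B (res gen_functor (rep gen_cat c))"
  by (rule in_sub_iso[OF in_sub_B[OF G_B] eval_gen_iso])
    (auto intro!: cat_module_res[OF additive_gen_functor] cat_module_rep preadditive_gen_cat)

text \<open>Direct sums are formed object by object, so restriction commutes with them as an
  equality and not merely up to isomorphism.\<close>

lemma res_copm: "res gen_functor (copm gen_cat J M) = copm C J (\<lambda>j. res gen_functor (M j))"
  by (simp add: copm_def subm_def prodm_def finsupp_def comp_functor_def op_functor_def fun_eq_iff Image_def)

lemma res_copm_rep_in_sub:
  assumes "small TYPE('u) J" "\<And>j. j \<in> J \<Longrightarrow> f j \<in> obj C"
  shows "in_sub C B (res gen_functor (copm gen_cat J (\<lambda>j. rep gen_cat (f j))))"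
  unfolding res_copm by (rule in_sub_copm) (use assms res_rep_in_sub in auto)

text \<open>
  Every module over the category of generators has a presentation by coproducts of representable
  modules, and these restrict to members of \<open>B\<close>.
\<close>

lemma res_in_sub:
  fixes N :: "('o, 'o \<Rightarrow> 'u \<Rightarrow> 'u, 'x) cmodule"
  assumes N: "cat_module gen_cat N" and Ns: "small_module TYPE('u) gen_cat N"
  shows "in_sub C B (res gen_functor N)"
proof -
  note D = preadditive_gen_cat and F = additive_gen_functor
  \<comment> \<open>All elements of \<open>N\<close> are taken as generators and, with
    \<open>K\<close> below, all elements of the kernel as relations; both sets are small.\<close>
  define J where "J = Sigma (obj C) (car N)"
  define Q where "Q = copm gen_cat J (\<lambda>j. rep gen_cat (fst j))"
  have Jc: "fst j \<in> obj gen_cat" if "j \<in> J" for j using that by (auto simp: J_def)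
  have J: "small TYPE('u) J"
    using small_C Ns by (auto simp: J_def small_category_def small_module_def intro!: small_Sigma)
  have Qc: "cat_module gen_cat Q" unfolding Q_def by (rule cat_module_copm) (rule cat_module_rep[OF D Jc])
  have Qs: "small_module TYPE('u) gen_cat Q"
    unfolding Q_def by (intro small_copm cat_module_rep[OF D Jc] J small_rep small_gen_cat Jc)
  have full: "submodule gen_cat N J" using submodule_full[OF N] by (simp add: J_def)
  obtain q where q: "module_hom gen_cat Q N q" and imq: "imm gen_cat Q q = J"
    unfolding Q_def by (rule representable_cover[OF D N full])
  define K where "K = kerm gen_cat Q N q"
  have Ksub: "submodule gen_cat Q K" unfolding K_def by (rule submodule_kerm[OF Qc N q])
  define S where "S = copm gen_cat K (\<lambda>j. rep gen_cat (fst j))"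
  have Kc: "fst j \<in> obj gen_cat" if "j \<in> K" for j using that by (auto simp: K_def kerm_def)
  have "K \<subseteq> Sigma (obj C) (car Q)" using Ksub by (simp add: submodule_def)
  then have K: "small TYPE('u) K"
    by (rule small_subset[rotated])
      (use small_C Qs in \<open>auto simp: small_category_def small_module_def intro!: small_Sigma\<close>)
  obtain r where r: "module_hom gen_cat S Q r" and imr: "imm gen_cat S r = K"
    unfolding S_def by (rule representable_cover[OF D Qc Ksub])
  let ?res = "\<lambda>M. res gen_functor M"
  have in1: "in_sub C B (?res Q)"
    unfolding Q_def by (rule res_copm_rep_in_sub[OF J]) (use Jc in simp)
  have in2: "in_sub C B (?res S)"
    unfolding S_def by (rule res_copm_rep_in_sub[OF K]) (use Kc in simp)
  have hq: "module_hom C (?res Q) (?res N) q" using module_hom_res[OF F q] by simp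
  have hr: "module_hom C (?res S) (?res Q) r" using module_hom_res[OF F r] by simp
  have Nc: "cat_module C (?res N)" by (rule cat_module_res[OF F N])
  have qi: "q X ` car Q X = car N X" if "X \<in> obj C" for X
    using imq that by (auto simp: imm_def J_def)
  have ri: "r X ` car S X = {x \<in> car Q X. q X x = \<one>\<^bsub>omap N X\<^esub>}" if "X \<in> obj C" for X
    using imr that by (auto simp: imm_def K_def kerm_def)
  \<comment> \<open>Restriction keeps the presentation exact, so the restriction of \<open>N\<close>
    is a cokernel of a homomorphism between modules of \<open>B\<close>.\<close>
  have p: "pcok C (?res S) (?res Q) r (?res N) q"
    unfolding pcok_def using hq qi ri by simp
  obtain h where "module_iso C (?res N) (quotm (?res Q) (imm C (?res S) r)) h"
    by (rule pcok_unique[OF in_subD[OF in1] Nc in_subD[OF in_sub_cokernel[OF in2 in1 hr]] p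
          pcok_quotm[OF in_subD[OF in2] in_subD[OF in1] hr]])
  then show ?thesis by (rule in_sub_iso[OF in_sub_cokernel[OF in2 in1 hr] _ Nc])
qed

text \<open>For \<open>x\<close> over \<open>X\<close>, the maps sending an arrow
  \<open>\<psi>\<close> into \<open>X\<close> to \<open>h (x \<psi>)\<close> and to
  \<open>(h x) \<psi>\<close> become, through \<open>G X\<close>, two homomorphisms over
  \<open>C\<close> into a module of \<open>B\<close>. They agree at the generator, which corresponds
  to the identity, hence at every arrow of \<open>gen_cat\<close>.\<close>

lemma res_full:
  fixes N :: "('o, 'o \<Rightarrow> 'u \<Rightarrow> 'u, 'x) cmodule" and N' :: "('o, 'o \<Rightarrow> 'u \<Rightarrow> 'u, 'y) cmodule"
  assumes N: "cat_module gen_cat N" and N': "cat_module gen_cat N'" and N's: "small_module TYPE('u) gen_cat N'"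
    and h: "module_hom C (res gen_functor N) (res gen_functor N') h"
  shows "module_hom gen_cat N N' h"
proof (rule module_homI)
  note D = preadditive_gen_cat and F = additive_gen_functor
  interpret N: cat_module gen_cat N by (rule N)
  interpret N': cat_module gen_cat N' by (rule N')
  fix X x assume X: "X \<in> obj gen_cat" and x: "x \<in> car N X"
  then show hX: "h X x \<in> car N' X" using module_hom_closed[OF h, of X x] by simp
  {
    fix y assume "y \<in> car N X"
    then show "h X (x \<otimes>\<^bsub>omap N X\<^esub> y) = h X x \<otimes>\<^bsub>omap N' X\<^esub> h X y"
      using module_hom_mult[OF h, of X x y] X x by simp
  }
  fix Y \<phi> assume Y: "Y \<in> obj gen_cat" and \<phi>: "\<phi> \<in> arr gen_cat Y X"
  have c: "X \<in> obj C" "Y \<in> obj C" using X Y by auto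
  \<comment> \<open>\<open>k\<close> turns an element of \<open>G X\<close> over \<open>d\<close>
    into the arrow from \<open>G d\<close> that carries \<open>gen d\<close> to it.\<close>
  obtain k where k: "module_iso C (G X) (res gen_functor (rep gen_cat X)) k"
    and k1: "\<And>d \<psi>. d \<in> obj C \<Longrightarrow> \<psi> \<in> car (res gen_functor (rep gen_cat X)) d \<Longrightarrow> k d (\<psi> d (gen d)) = \<psi>"
    by (rule module_iso_inverse[OF in_subD[OF res_rep_in_sub[OF c(1)]] eval_gen_iso[OF c(1)]])
      (rule that, assumption+)
  have kh: "module_hom C (G X) (res gen_functor (rep gen_cat X)) k" using k by (simp add: module_iso_def)
  have y1: "module_hom C (G X) (res gen_functor N) (\<lambda>d y. amap N X d (k d y) x)"
    using module_hom_comp[OF kh module_hom_res[OF F yoneda_hom[OF N X x]]] by simp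
  have y2: "module_hom C (G X) (res gen_functor N') (\<lambda>d y. amap N' X d (k d y) (h X x))"
    using module_hom_comp[OF kh module_hom_res[OF F yoneda_hom[OF N' X hX]]] by simp
  interpret A: preadditive_category gen_cat by (rule D)
  have kg: "k X (gen X) = ident gen_cat X"
  proof -
    have "ident (Mod C) (G X) X (gen X) = gen X" using c gen_in[OF c(1)] by (simp add: ident_Mod)
    then show ?thesis using k1[OF c(1), of "ident gen_cat X"] A.ident_arr[OF X] by simp
  qed
  have "h Y (amap N X Y (k Y (\<phi> Y (gen Y))) x) = amap N' X Y (k Y (\<phi> Y (gen Y))) (h X x)"
  proof (rule gen_unique_in_sub[OF res_in_sub[OF N' N's] c(1) module_hom_comp[OF y1 h] y2 _ c(2)])
    show "h X (amap N X X (k X (gen X)) x) = amap N' X X (k X (gen X)) (h X x)"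
      unfolding kg using X x hX by (simp only: N.act_ident N'.act_ident)
    show "\<phi> Y (gen Y) \<in> car (G X) Y"
      using module_hom_closed[OF arr_Mod_hom[OF G_Mod[OF c(2)] G_Mod[OF c(1)]] c(2) gen_in[OF c(2)]] \<phi> by simp
  qed
  then show "h Y (amap N X Y \<phi> x) = amap N' X Y \<phi> (h X x)"
    using k1[OF c(2), of \<phi>] \<phi> by simp
qed

text \<open>The module \<open>c \<mapsto> Hom(G c, M)\<close>. It is obtained by restricting the
  representable functor of \<open>M\<close> on \<open>Mod C\<close> along \<open>G\<close>, which
  supplies the module axioms.\<close>

definition hom_module :: "('o, 'a, 'u) cmodule \<Rightarrow> ('o, 'o \<Rightarrow> 'u \<Rightarrow> 'u, 'o \<Rightarrow> 'u \<Rightarrow> 'u) cmodule" where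
  "hom_module M = res \<lparr>omap = G, amap = \<lambda>d c \<phi>. \<phi>\<rparr> (rep (Mod C) M)"

lemma hom_module_simps [simp]:
  "car (hom_module M) c = arr (Mod C) (G c) M"
  "x \<otimes>\<^bsub>omap (hom_module M) X\<^esub> y = arr_add (Mod C) (G X) M x y"
  "amap (hom_module M) c d \<phi> \<psi> = ccomp (Mod C) (G d) (G c) M \<psi> \<phi>"
  by (simp_all add: hom_module_def)

lemma cat_module_hom_module: "M \<in> obj (Mod C) \<Longrightarrow> cat_module gen_cat (hom_module M)"
  unfolding hom_module_def
  by (rule cat_module_res[OF additive_functorI cat_module_rep[OF preadditive_Mod]]) (simp_all add: G_Mod)

lemma small_hom_module: "M \<in> obj (Mod C) \<Longrightarrow> small_module TYPE('u) gen_cat (hom_module M)"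
  by (simp add: small_module_def small_homs G_Mod)

lemma eval_hom:
  assumes M: "M \<in> obj (Mod C)"
  shows "module_hom C (res gen_functor (hom_module M)) M (\<lambda>c \<psi>. \<psi> c (gen c))"
proof (rule module_homI)
  fix c assume c: "c \<in> obj C"
  fix \<psi> assume \<psi>: "\<psi> \<in> car (res gen_functor (hom_module M)) c"
  then have h: "module_hom C (G c) M \<psi>" using arr_Mod_hom[OF G_Mod[OF c] M] by simp
  show "\<psi> c (gen c) \<in> car M c" by (rule module_hom_closed[OF h c gen_in[OF c]])
  fix d a assume *: "d \<in> obj C" "a \<in> arr C d c"
  have "ccomp (Mod C) (G d) (G c) M \<psi> (amap gen_functor d c a) d (gen d) = amap M c d a (\<psi> c (gen c))"
    unfolding ccomp_Mod using * c gen_in gen_functor_arr(2)[OF *(1) c *(2)]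
    by (simp add: module_hom_act[OF h] del: gen_functor_simps)
  then show "amap (res gen_functor (hom_module M)) c d a \<psi> d (gen d) = amap M c d a (\<psi> c (gen c))" by simp
qed (use gen_in in \<open>simp add: arr_add_Mod\<close>)

text \<open>For \<open>M\<close> in \<open>B\<close>, arrows from \<open>G c\<close> are the
  elements of \<open>M\<close> over \<open>c\<close>. Hence every member of \<open>B\<close> is, up
  to isomorphism, the restriction of a module over \<open>gen_cat\<close>.\<close>

lemma eval_hom_iso:
  assumes M: "M \<in> B"
  shows "module_iso C (res gen_functor (hom_module M)) M (\<lambda>c \<psi>. \<psi> c (gen c))"
  unfolding module_iso_def
proof (intro conjI ballI)
  have MM: "M \<in> obj (Mod C)" using M B_sub by blast
  show e: "module_hom C (res gen_functor (hom_module M)) M (\<lambda>c \<psi>. \<psi> c (gen c))" by (rule eval_hom[OF MM])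
  fix c assume c: "c \<in> obj C"
  show "bij_betw (\<lambda>\<psi>. \<psi> c (gen c)) (car (res gen_functor (hom_module M)) c) (car M c)"
  proof (rule bij_betw_byWitness[of _ "hom_of c M"])
    show "(\<lambda>\<psi>. \<psi> c (gen c)) ` car (res gen_functor (hom_module M)) c \<subseteq> car M c"
      using module_hom_closed[OF e c] by auto
    then show "\<forall>\<psi>\<in>car (res gen_functor (hom_module M)) c. hom_of c M (\<psi> c (gen c)) = \<psi>"
      using hom_of(3)[OF c M] by (auto simp: image_subset_iff)
  qed (use hom_of(1,2)[OF c M] in auto)
qed

text \<open>The counit is evaluation at the generators. A homomorphism \<open>g\<close> from a
  member \<open>Z\<close> of \<open>B\<close> is lifted by writing \<open>Z\<close> as the
  restriction of its own \<open>hom_module\<close> and composing arrows with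
  \<open>g\<close>.\<close>

lemma coreflection:
  fixes M :: "('o, 'a, 'u) cmodule"
  assumes M: "M \<in> obj (Mod C)"
  shows "\<exists>R\<in>B. \<exists>\<epsilon>. module_hom C R M \<epsilon> \<and>
    (\<forall>Z\<in>B. \<forall>g. module_hom C Z M g \<longrightarrow> (\<exists>h. module_hom C Z R h \<and> (\<forall>X\<in>obj C. \<forall>z\<in>car Z X. \<epsilon> X (h X z) = g X z))) \<and>
    (\<forall>Z\<in>B. \<forall>h k. module_hom C Z R h \<longrightarrow> module_hom C Z R k \<longrightarrow>
       (\<forall>X\<in>obj C. \<forall>z\<in>car Z X. \<epsilon> X (h X z) = \<epsilon> X (k X z)) \<longrightarrow> (\<forall>X\<in>obj C. \<forall>z\<in>car Z X. h X z = k X z))"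
proof -
  note F = additive_gen_functor
  let ?H = "hom_module M" and ?ev = "\<lambda>c (\<psi> :: 'o \<Rightarrow> 'u \<Rightarrow> 'u). \<psi> c (gen c)"
  let ?E = "res gen_functor ?H"
  have E: "in_sub C B ?E" by (rule res_in_sub[OF cat_module_hom_module[OF M] small_hom_module[OF M]])
  note ev = eval_hom[OF M]
  have ex: "\<exists>h. module_hom C Z ?E h \<and> (\<forall>X\<in>obj C. \<forall>z\<in>car Z X. ?ev X (h X z) = g X z)"
    if Z: "Z \<in> B" and g: "module_hom C Z M g" for Z g
  proof -
    have ZM: "Z \<in> obj (Mod C)" using Z B_sub by blast
    obtain k where k: "module_iso C Z (res gen_functor (hom_module Z)) k"
      and evk: "\<And>X z. X \<in> obj C \<Longrightarrow> z \<in> car Z X \<Longrightarrow> ?ev X (k X z) = z"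
      by (rule module_iso_inverse[OF cat_module_res[OF F cat_module_hom_module[OF ZM]] eval_hom_iso[OF Z]])
        (rule that, assumption+)
    have kh: "module_hom C Z (res gen_functor (hom_module Z)) k" using k by (simp add: module_iso_def)
    let ?g = "mod_arr C Z g"
    have ga: "?g \<in> arr (Mod C) Z M" by (rule mod_arr_in[OF ZM M g])
    interpret A: preadditive_category "Mod C :: (('o, 'a, 'u) cmodule, 'o \<Rightarrow> 'u \<Rightarrow> 'u) preadd_cat"
      by (rule preadditive_Mod)
    have post: "module_hom gen_cat (hom_module Z) ?H (\<lambda>c \<psi>. ccomp (Mod C) (G c) Z M ?g \<psi>)"
      by (rule module_homI) (simp_all add: G_Mod ZM M ga A.comp_arr A.comp_add_right A.comp_assoc)
    have post': "module_hom C (res gen_functor (hom_module Z)) ?E (\<lambda>c \<psi>. ccomp (Mod C) (G c) Z M ?g \<psi>)"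
      using module_hom_res[OF F post] by simp
    show ?thesis
    proof (intro exI conjI ballI)
      show "module_hom C Z ?E (\<lambda>c z. ccomp (Mod C) (G c) Z M ?g (k c z))"
        by (rule module_hom_comp[OF kh post'])
      fix X z assume *: "X \<in> obj C" "z \<in> car Z X"
      show "ccomp (Mod C) (G X) Z M ?g (k X z) X (gen X) = g X z"
        using * gen_in evk by (simp add: ccomp_Mod)
    qed
  qed
  \<comment> \<open>Evaluation at generators need not be injective when \<open>M\<close> is outside
    \<open>B\<close>. However, homomorphisms from \<open>Z\<close> into the coreflection are linear
    over \<open>gen_cat\<close> by \<open>res_full\<close>, which reduces the value at any
    \<open>y\<close> to a value at a generator.\<close>
  have uniq: "h X z = k X z"
    if Z: "Z \<in> B" and h: "module_hom C Z ?E h" and k: "module_hom C Z ?E k"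
      and eq: "\<And>X z. X \<in> obj C \<Longrightarrow> z \<in> car Z X \<Longrightarrow> ?ev X (h X z) = ?ev X (k X z)"
      and X: "X \<in> obj C" and z: "z \<in> car Z X" for Z h k X z
  proof -
    have ZM: "Z \<in> obj (Mod C)" using Z B_sub by blast
    let ?HZ = "hom_module Z"
    have lift: "module_hom gen_cat ?HZ ?H (\<lambda>c \<psi>. h c (\<psi> c (gen c)))" if "module_hom C Z ?E h" for h
      by (rule res_full[OF cat_module_hom_module[OF ZM] cat_module_hom_module[OF M] small_hom_module[OF M]
            module_hom_comp[OF eval_hom[OF ZM] that]])
    let ?\<psi> = "hom_of X Z z"
    note \<psi> = hom_of(1,2)[OF X Z z]
    have arrs: "h X z \<in> arr (Mod C) (G X) M" if "module_hom C Z ?E h" for h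
      using module_hom_closed[OF that X z] by simp
    \<comment> \<open>Linearity is used for the arrow from \<open>G d\<close> to \<open>G X\<close>
      that carries \<open>gen d\<close> to \<open>y\<close>; evaluating both sides at
      \<open>gen d\<close> gives the formula.\<close>
    have val: "h X z d y = h d (ccomp (Mod C) (G d) (G X) Z ?\<psi> (hom_of d (G X) y) d (gen d)) d (gen d)"
      if hh: "module_hom C Z ?E h" and d: "d \<in> obj C" and y: "y \<in> car (G X) d" for h d y
    proof -
      note \<phi> = hom_of(1,2)[OF d G_B[OF X] y]
      have "h d (amap ?HZ X d (hom_of d (G X) y) ?\<psi> d (gen d)) = amap ?H X d (hom_of d (G X) y) (h X (?\<psi> X (gen X)))"
        by (rule module_hom_act[OF lift[OF hh]]) (use X d \<phi>(1) \<psi>(1) in simp_all)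
      from fun_cong[OF fun_cong[OF this, of d], of "gen d"]
      show ?thesis using \<psi>(2) \<phi>(2) d gen_in[OF d] by (simp add: ccomp_Mod[of C "G d" "G X" M])
    qed
    show ?thesis
    proof (rule arr_Mod_eqI[OF G_Mod[OF X] M M arrs[OF h] arrs[OF k]])
      fix d y assume *: "d \<in> obj C" "y \<in> car (G X) d"
      interpret A: preadditive_category "Mod C :: (('o, 'a, 'u) cmodule, 'o \<Rightarrow> 'u \<Rightarrow> 'u) preadd_cat"
        by (rule preadditive_Mod)
      have "ccomp (Mod C) (G d) (G X) Z ?\<psi> (hom_of d (G X) y) \<in> arr (Mod C) (G d) Z"
        by (rule A.comp_arr) (use * X G_Mod ZM \<psi>(1) hom_of(1)[OF *(1) G_B[OF X] *(2)] in auto)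
      from module_hom_closed[OF arr_Mod_hom[OF G_Mod[OF *(1)] ZM this] *(1) gen_in[OF *(1)]]
      show "h X z d y = k X z d y"
        unfolding val[OF h *] val[OF k *] by (rule eq[OF *(1)])
    qed
  qed
  obtain R \<beta> where R: "R \<in> B" and \<beta>: "module_iso C ?E R \<beta>" using E by (rule in_subE)
  obtain \<beta>' where \<beta>': "module_iso C R ?E \<beta>'"
    and \<beta>'\<beta>: "\<And>X x. X \<in> obj C \<Longrightarrow> x \<in> car ?E X \<Longrightarrow> \<beta>' X (\<beta> X x) = x"
    and \<beta>\<beta>': "\<And>X x. X \<in> obj C \<Longrightarrow> x \<in> car R X \<Longrightarrow> \<beta> X (\<beta>' X x) = x"
    by (rule module_iso_inverse[OF in_subD[OF E] \<beta>]) (rule that, assumption+)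
  have hs: "module_hom C ?E R \<beta>" "module_hom C R ?E \<beta>'" using \<beta> \<beta>' by (auto simp: module_iso_def)
  show ?thesis
  proof (rule bexI[OF _ R], rule exI[of _ "\<lambda>X x. ?ev X (\<beta>' X x)"], intro conjI ballI allI impI)
    show "module_hom C R M (\<lambda>X x. ?ev X (\<beta>' X x))" by (rule module_hom_comp[OF hs(2) ev])
  next
    fix Z g assume Z: "Z \<in> B" and g: "module_hom C Z M g"
    then obtain h where h: "module_hom C Z ?E h" "\<forall>X\<in>obj C. \<forall>z\<in>car Z X. ?ev X (h X z) = g X z"
      using ex[OF Z g] by blast
    show "\<exists>h. module_hom C Z R h \<and> (\<forall>X\<in>obj C. \<forall>z\<in>car Z X. ?ev X (\<beta>' X (h X z)) = g X z)"
      by (rule exI[of _ "\<lambda>X z. \<beta> X (h X z)"])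
        (use module_hom_comp[OF h(1) hs(1)] h(2) \<beta>'\<beta> module_hom_closed[OF h(1)] in simp)
  next
    fix Z h k X z assume Z: "Z \<in> B" and h: "module_hom C Z R h" and k: "module_hom C Z R k"
      and eq: "\<forall>X\<in>obj C. \<forall>z\<in>car Z X. ?ev X (\<beta>' X (h X z)) = ?ev X (\<beta>' X (k X z))"
      and X: "X \<in> obj C" and z: "z \<in> car Z X"
    have "\<beta>' X (h X z) = \<beta>' X (k X z)"
      by (rule uniq[OF Z module_hom_comp[OF h hs(2)] module_hom_comp[OF k hs(2)] _ X z]) (use eq in blast)
    then have "\<beta> X (\<beta>' X (h X z)) = \<beta> X (\<beta>' X (k X z))" by (rule arg_cong)
    then show "h X z = k X z"
      using \<beta>\<beta>'[OF X module_hom_closed[OF h X z]] \<beta>\<beta>'[OF X module_hom_closed[OF k X z]] by simp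
  qed
qed

end

section \<open>Adjoints of an inclusion and universal arrows\<close>

text \<open>Universal arrows without a chosen functor. In this form \<open>coreflective\<close> is
  literally the same statement in the opposite category.\<close>

definition reflective :: "('o, 'a, 'z) cat_scheme \<Rightarrow> 'o set \<Rightarrow> bool" where
  "reflective A B \<longleftrightarrow> (\<forall>X\<in>obj A. \<exists>R\<in>B. \<exists>\<eta>\<in>arr A X R. \<forall>Z\<in>B. \<forall>g\<in>arr A X Z.
     \<exists>!h. h \<in> arr A R Z \<and> ccomp A X R Z h \<eta> = g)"

definition coreflective :: "('o, 'a, 'z) cat_scheme \<Rightarrow> 'o set \<Rightarrow> bool" where
  "coreflective A B \<longleftrightarrow> (\<forall>X\<in>obj A. \<exists>R\<in>B. \<exists>\<epsilon>\<in>arr A R X. \<forall>Z\<in>B. \<forall>g\<in>arr A Z X.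
     \<exists>!h. h \<in> arr A Z R \<and> ccomp A Z R X \<epsilon> h = g)"

lemma full_subcat_simps [simp]:
  "obj (full_subcat A B) = B" "arr (full_subcat A B) = arr A"
  "ident (full_subcat A B) = ident A" "ccomp (full_subcat A B) = ccomp A"
  by (simp_all add: full_subcat_def)

lemma inclusion_simps [simp]: "omap inclusion X = X" "amap inclusion X Y a = a"
  by (simp_all add: inclusion_def)

context category
begin

text \<open>The universal arrow of an adjunction is its unit. Conversely the universal arrows
  determine a functor, whose laws hold because both sides agree after composition with a
  unit.\<close>

lemma reflective_iff_adjoint:
  assumes B: "B \<subseteq> obj C"
  shows "reflective C B \<longleftrightarrow> (\<exists>L. adjoint_functors C (full_subcat C B) L inclusion)"
proof
  have BO: "Z \<in> obj C" if "Z \<in> B" for Z using B that by blast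
  assume "\<exists>L. adjoint_functors C (full_subcat C B) L inclusion"
  then obtain L where "adjoint_functors C (full_subcat C B) L inclusion" by blast
  then obtain \<phi> where L: "is_functor C (full_subcat C B) L"
    and bij: "\<forall>X\<in>obj C. \<forall>Y\<in>B. bij_betw (\<phi> X Y) (arr C (omap L X) Y) (arr C X Y)"
    and nat: "\<forall>X\<in>obj C. \<forall>X'\<in>obj C. \<forall>Y\<in>B. \<forall>Y'\<in>B. \<forall>u\<in>arr C X' X. \<forall>v\<in>arr C Y Y'. \<forall>g\<in>arr C (omap L X) Y.
             \<phi> X' Y' (ccomp C (omap L X') Y Y' v (ccomp C (omap L X') (omap L X) Y g (amap L X' X u))) =
             ccomp C X' Y Y' v (ccomp C X' X Y (\<phi> X Y g) u)"
    unfolding adjoint_functors_def by (auto simp del: bij_betw_def)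
  show "reflective C B"
    unfolding reflective_def
  proof
    fix X assume X: "X \<in> obj C"
    have LX: "omap L X \<in> B" and Lid: "amap L X X (ident C X) = ident C (omap L X)"
      using L X by (simp_all add: is_functor_def)
    let ?R = "omap L X"
    have RO: "?R \<in> obj C" by (rule BO[OF LX])
    define \<eta> where "\<eta> = \<phi> X ?R (ident C ?R)"
    have \<eta>: "\<eta> \<in> arr C X ?R"
      unfolding \<eta>_def using bij X LX ident_arr[OF RO] by (blast dest: bij_betwE)
    \<comment> \<open>Naturality of \<open>\<phi>\<close> in the second argument, taken at the
      identity of the reflection: \<open>\<phi>\<close> is composition with the unit.\<close>
    have key: "\<phi> X Z h = ccomp C X ?R Z h \<eta>" if Z: "Z \<in> B" and h: "h \<in> arr C ?R Z" for Z h
      using nat[rule_format, OF X X LX Z ident_arr[OF X] h ident_arr[OF RO]] X RO BO[OF Z] h \<eta> ident_arr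
      by (simp add: Lid comp_ident_left comp_ident_right \<eta>_def[symmetric])
    show "\<exists>R\<in>B. \<exists>\<eta>\<in>arr C X R. \<forall>Z\<in>B. \<forall>g\<in>arr C X Z. \<exists>!h. h \<in> arr C R Z \<and> ccomp C X R Z h \<eta> = g"
    proof (rule bexI[OF _ LX], rule bexI[OF _ \<eta>], intro ballI)
      fix Z g assume Z: "Z \<in> B" and g: "g \<in> arr C X Z"
      have b: "bij_betw (\<phi> X Z) (arr C ?R Z) (arr C X Z)" using bij X Z by blast
      then have "g \<in> \<phi> X Z ` arr C ?R Z" using g by (simp add: bij_betw_def)
      then obtain h where h: "h \<in> arr C ?R Z" "\<phi> X Z h = g" by blast
      show "\<exists>!h. h \<in> arr C ?R Z \<and> ccomp C X ?R Z h \<eta> = g"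
      proof (rule ex1I[of _ h])
        show "h \<in> arr C ?R Z \<and> ccomp C X ?R Z h \<eta> = g" using h key[OF Z h(1)] by simp
        fix k assume k: "k \<in> arr C ?R Z \<and> ccomp C X ?R Z k \<eta> = g"
        then have "\<phi> X Z k = \<phi> X Z h" using key[OF Z] h by simp
        then show "k = h" using b k h by (auto simp: bij_betw_def inj_on_def)
      qed
    qed
  qed
next
  have BO: "Z \<in> obj C" if "Z \<in> B" for Z using B that by blast
  assume r: "reflective C B"
  have "\<forall>X\<in>obj C. \<exists>p. fst p \<in> B \<and> snd p \<in> arr C X (fst p) \<and> (\<forall>Z\<in>B. \<forall>g\<in>arr C X Z.
     \<exists>!h. h \<in> arr C (fst p) Z \<and> ccomp C X (fst p) Z h (snd p) = g)"
    using r unfolding reflective_def split_paired_Ex fst_conv snd_conv by blast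
  from bchoice[OF this] obtain p where p: "\<forall>X\<in>obj C. fst (p X) \<in> B \<and> snd (p X) \<in> arr C X (fst (p X)) \<and>
    (\<forall>Z\<in>B. \<forall>g\<in>arr C X Z. \<exists>!h. h \<in> arr C (fst (p X)) Z \<and> ccomp C X (fst (p X)) Z h (snd (p X)) = g)"
    by (rule exE)
  define l where "l X = fst (p X)" for X
  define \<eta> where "\<eta> X = snd (p X)" for X
  have l: "l X \<in> B" and \<eta>: "\<eta> X \<in> arr C X (l X)"
    and univ: "\<And>Z g. Z \<in> B \<Longrightarrow> g \<in> arr C X Z \<Longrightarrow> \<exists>!h. h \<in> arr C (l X) Z \<and> ccomp C X (l X) Z h (\<eta> X) = g"
    if "X \<in> obj C" for X
    using p[rule_format, OF that] by (simp_all add: l_def \<eta>_def)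
  note lO = BO[OF l]
  have eq: "h = k" if "X \<in> obj C" "Z \<in> B" "h \<in> arr C (l X) Z" "k \<in> arr C (l X) Z"
    "ccomp C X (l X) Z h (\<eta> X) = ccomp C X (l X) Z k (\<eta> X)" for X Z h k
    using univ[OF that(1,2) comp_arr[OF that(1) lO[OF that(1)] BO[OF that(2)] \<eta>[OF that(1)] that(4)]] that(3-5)
    by blast
  \<comment> \<open>The only arrow between the reflections that is compatible with the
    units.\<close>
  define t where "t X Y u = (THE h. h \<in> arr C (l X) (l Y) \<and> ccomp C X (l X) (l Y) h (\<eta> X) = ccomp C X Y (l Y) (\<eta> Y) u)"
    for X Y u
  have t: "t X Y u \<in> arr C (l X) (l Y) \<and> ccomp C X (l X) (l Y) (t X Y u) (\<eta> X) = ccomp C X Y (l Y) (\<eta> Y) u"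
    if "X \<in> obj C" "Y \<in> obj C" "u \<in> arr C X Y" for X Y u
    unfolding t_def
    by (rule theI', rule univ[OF that(1) l[OF that(2)]], rule comp_arr) (use that lO \<eta> in auto)
  define L where "L = \<lparr>omap = l, amap = t\<rparr>"
  have L: "is_functor C (full_subcat C B) L"
    unfolding is_functor_def
  proof (intro conjI ballI)
    fix X assume X: "X \<in> obj C"
    have "t X X (ident C X) = ident C (l X)"
      by (rule eq[OF X l[OF X]])
        (use t[OF X X ident_arr[OF X]] X lO[OF X] \<eta>[OF X] in \<open>simp_all add: ident_arr comp_ident_left comp_ident_right\<close>)
    then show "amap L X X (ident C X) = ident (full_subcat C B) (omap L X)" by (simp add: L_def)
    fix Y u assume Y: "Y \<in> obj C" and u: "u \<in> arr C X Y"
    show "amap L X Y u \<in> arr (full_subcat C B) (omap L X) (omap L Y)" using t[OF X Y u] by (simp add: L_def)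
  next
    fix X Y Z u v assume X: "X \<in> obj C" and Y: "Y \<in> obj C" and Z: "Z \<in> obj C"
      and u: "u \<in> arr C X Y" and v: "v \<in> arr C Y Z"
    note tu = t[OF X Y u] and tv = t[OF Y Z v] and vu = comp_arr[OF X Y Z u v]
    have "t X Z (ccomp C X Y Z v u) = ccomp C (l X) (l Y) (l Z) (t Y Z v) (t X Y u)"
    proof (rule eq[OF X l[OF Z]])
      have "ccomp C X (l X) (l Z) (ccomp C (l X) (l Y) (l Z) (t Y Z v) (t X Y u)) (\<eta> X) =
        ccomp C X (l Y) (l Z) (t Y Z v) (ccomp C X (l X) (l Y) (t X Y u) (\<eta> X))"
        by (rule comp_assoc[symmetric]) (use X Y Z lO \<eta> tu tv in auto)
      also have "\<dots> = ccomp C X (l Y) (l Z) (t Y Z v) (ccomp C X Y (l Y) (\<eta> Y) u)" using tu by simp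
      also have "\<dots> = ccomp C X Y (l Z) (ccomp C Y (l Y) (l Z) (t Y Z v) (\<eta> Y)) u"
        by (rule comp_assoc) (use X Y Z u lO \<eta> tv in auto)
      also have "\<dots> = ccomp C X Y (l Z) (ccomp C Y Z (l Z) (\<eta> Z) v) u" using tv by simp
      also have "\<dots> = ccomp C X Z (l Z) (\<eta> Z) (ccomp C X Y Z v u)"
        by (rule comp_assoc[symmetric]) (use X Y Z u v lO \<eta> in auto)
      finally show "ccomp C X (l X) (l Z) (t X Z (ccomp C X Y Z v u)) (\<eta> X) =
        ccomp C X (l X) (l Z) (ccomp C (l X) (l Y) (l Z) (t Y Z v) (t X Y u)) (\<eta> X)"
        using t[OF X Z vu] by simp
    qed (use t[OF X Z vu] comp_arr[OF lO[OF X] lO[OF Y] lO[OF Z]] tu tv in auto)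
    then show "amap L X Z (ccomp C X Y Z v u) =
      ccomp (full_subcat C B) (omap L X) (omap L Y) (omap L Z) (amap L Y Z v) (amap L X Y u)"
      by (simp add: L_def)
  qed (simp add: L_def l)
  have "adjoint_functors C (full_subcat C B) L inclusion"
    unfolding adjoint_functors_def
  proof (intro conjI L exI[of _ "\<lambda>X Y h. ccomp C X (l X) Y h (\<eta> X)"] ballI)
    show "is_functor (full_subcat C B) C inclusion" using B by (auto simp: is_functor_def)
    fix X Y assume X: "X \<in> obj C" and Y: "Y \<in> obj (full_subcat C B)"
    have "bij_betw (\<lambda>h. ccomp C X (l X) Y h (\<eta> X)) (arr C (l X) Y) (arr C X Y)"
      unfolding bij_betw_def
    proof
      show "inj_on (\<lambda>h. ccomp C X (l X) Y h (\<eta> X)) (arr C (l X) Y)"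
        by (rule inj_onI) (use eq[OF X] Y in simp)
      show "(\<lambda>h. ccomp C X (l X) Y h (\<eta> X)) ` arr C (l X) Y = arr C X Y"
      proof (intro equalityI image_subsetI subsetI)
        fix h assume "h \<in> arr C (l X) Y"
        then show "ccomp C X (l X) Y h (\<eta> X) \<in> arr C X Y"
          by (intro comp_arr X lO \<eta>) (use Y BO in simp_all)
      next
        fix g assume "g \<in> arr C X Y"
        then show "g \<in> (\<lambda>h. ccomp C X (l X) Y h (\<eta> X)) ` arr C (l X) Y"
          using univ[OF X, of Y g] Y by auto
      qed
    qed
    then show "bij_betw (\<lambda>h. ccomp C X (l X) Y h (\<eta> X)) (arr (full_subcat C B) (omap L X) Y) (arr C X (omap inclusion Y))"
      by (simp add: L_def)
  next
    fix X X' Y Y' u v g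
    assume X: "X \<in> obj C" and X': "X' \<in> obj C" and Y: "Y \<in> obj (full_subcat C B)" and Y': "Y' \<in> obj (full_subcat C B)"
      and u: "u \<in> arr C X' X" and v: "v \<in> arr (full_subcat C B) Y Y'" and g: "g \<in> arr (full_subcat C B) (omap L X) Y"
    have YO: "Y \<in> obj C" "Y' \<in> obj C" using Y Y' BO by auto
    have v: "v \<in> arr C Y Y'" and g: "g \<in> arr C (l X) Y" using v g by (simp_all add: L_def)
    note tu = t[OF X' X u]
    have gt: "ccomp C (l X') (l X) Y g (t X' X u) \<in> arr C (l X') Y"
      by (rule comp_arr) (use X X' YO lO g tu in auto)
    have "ccomp C X' (l X') Y' (ccomp C (l X') Y Y' v (ccomp C (l X') (l X) Y g (t X' X u))) (\<eta> X') =
      ccomp C X' Y Y' v (ccomp C X' (l X') Y (ccomp C (l X') (l X) Y g (t X' X u)) (\<eta> X'))"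
      by (rule comp_assoc[symmetric]) (use X' YO lO \<eta> gt v in auto)
    also have "ccomp C X' (l X') Y (ccomp C (l X') (l X) Y g (t X' X u)) (\<eta> X') =
      ccomp C X' (l X) Y g (ccomp C X' (l X') (l X) (t X' X u) (\<eta> X'))"
      by (rule comp_assoc[symmetric]) (use X X' YO lO \<eta> tu g in auto)
    also have "ccomp C X' (l X') (l X) (t X' X u) (\<eta> X') = ccomp C X' X (l X) (\<eta> X) u" using tu by simp
    also have "ccomp C X' (l X) Y g (ccomp C X' X (l X) (\<eta> X) u) = ccomp C X' X Y (ccomp C X (l X) Y g (\<eta> X)) u"
      by (rule comp_assoc) (use X X' YO lO \<eta> u g in auto)
    finally show "ccomp C X' (l X') Y' (ccomp (full_subcat C B) (omap L X') Y Y' v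
        (ccomp (full_subcat C B) (omap L X') (omap L X) Y g (amap L X' X u))) (\<eta> X') =
      ccomp C X' (omap inclusion Y) (omap inclusion Y') (amap inclusion Y Y' v)
        (ccomp C X' X (omap inclusion Y) (ccomp C X (l X) Y g (\<eta> X)) u)"
      by (simp add: L_def)
  qed
  then show "\<exists>L. adjoint_functors C (full_subcat C B) L inclusion" by blast
qed

end

section \<open>Duality\<close>

lemma op_cat_simps [simp]:
  "obj (op_cat C) = obj C" "arr (op_cat C) X Y = arr C Y X" "ident (op_cat C) = ident C"
  "ccomp (op_cat C) X Y Z g f = ccomp C Z Y X f g"
  "arr_add (op_cat C) X Y = arr_add C Y X" "arr_zero (op_cat C) X Y = arr_zero C Y X"
  by (simp_all add: op_cat_def)

lemma op_functor_simps [simp]: "omap (op_functor F) X = omap F X" "amap (op_functor F) X Y = amap F Y X"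
  by (simp_all add: op_functor_def)

lemma op_op [simp]: "op_cat (op_cat C) = C" "op_functor (op_functor F) = F"
  by (simp_all add: op_cat_def op_functor_def)

lemma op_full_subcat: "op_cat (full_subcat C B) = full_subcat (op_cat C) B"
  by (simp add: op_cat_def full_subcat_def)

lemma op_inclusion: "op_functor inclusion = inclusion"
  by (simp add: op_functor_def inclusion_def)

lemma category_op: "category C \<Longrightarrow> category (op_cat C)"
  by (simp add: category_def)

lemma category_full_subcat: "category C \<Longrightarrow> B \<subseteq> obj C \<Longrightarrow> category (full_subcat C B)"
  unfolding category_def by (simp add: subset_iff)

lemma preadditive_op: "preadditive_category C \<Longrightarrow> preadditive_category (op_cat C)"
  by (simp add: preadditive_category_def preadditive_category_axioms_def category_op arr_group_def)

lemma is_functor_op: "is_functor C D F \<Longrightarrow> is_functor (op_cat C) (op_cat D) (op_functor F)"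
  unfolding is_functor_def by simp

text \<open>The inverse bijections form the adjunction between the opposite categories, in which the
  two functors exchange their roles.\<close>

lemma adjoint_functors_op:
  fixes C :: "('o, 'a) preadd_cat" and D :: "('p, 'b) preadd_cat"
  assumes C: "category C" and D: "category D" and adj: "adjoint_functors C D L R"
  shows "adjoint_functors (op_cat D) (op_cat C) (op_functor R) (op_functor L)"
proof -
  interpret C: category C by (rule C)
  interpret D: category D by (rule D)
  have L: "is_functor C D L" and R: "is_functor D C R" using adj by (simp_all add: adjoint_functors_def)
  obtain \<phi> where bij: "\<forall>X\<in>obj C. \<forall>Y\<in>obj D. bij_betw (\<phi> X Y) (arr D (omap L X) Y) (arr C X (omap R Y))"
    and nat: "\<forall>X\<in>obj C. \<forall>X'\<in>obj C. \<forall>Y\<in>obj D. \<forall>Y'\<in>obj D. \<forall>u\<in>arr C X' X. \<forall>v\<in>arr D Y Y'. \<forall>g\<in>arr D (omap L X) Y.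
       \<phi> X' Y' (ccomp D (omap L X') Y Y' v (ccomp D (omap L X') (omap L X) Y g (amap L X' X u))) =
       ccomp C X' (omap R Y) (omap R Y') (amap R Y Y' v) (ccomp C X' X (omap R Y) (\<phi> X Y g) u)"
    using adj unfolding adjoint_functors_def by (elim conjE exE) (rule that)
  define \<psi> where "\<psi> Y X = inv_into (arr D (omap L X) Y) (\<phi> X Y)" for Y X
  have LO: "omap L X \<in> obj D" if "X \<in> obj C" for X using L that by (simp add: is_functor_def)
  have RO: "omap R Y \<in> obj C" if "Y \<in> obj D" for Y using R that by (simp add: is_functor_def)
  have \<psi>: "bij_betw (\<psi> Y X) (arr C X (omap R Y)) (arr D (omap L X) Y)" if "X \<in> obj C" "Y \<in> obj D" for X Y
    unfolding \<psi>_def using bij that by (blast intro: bij_betw_inv_into)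
  have \<psi>_in: "\<psi> Y X g \<in> arr D (omap L X) Y" if "X \<in> obj C" "Y \<in> obj D" "g \<in> arr C X (omap R Y)" for X Y g
    using \<psi>[OF that(1,2)] that(3) by (rule bij_betwE[THEN bspec])
  have \<phi>\<psi>: "\<phi> X Y (\<psi> Y X g) = g" if "X \<in> obj C" "Y \<in> obj D" "g \<in> arr C X (omap R Y)" for X Y g
    unfolding \<psi>_def using bij that by (auto intro: bij_betw_inv_into_right)
  have \<psi>\<phi>: "\<psi> Y X (\<phi> X Y g) = g" if "X \<in> obj C" "Y \<in> obj D" "g \<in> arr D (omap L X) Y" for X Y g
    unfolding \<psi>_def using bij that by (auto intro: bij_betw_inv_into_left)
  \<comment> \<open>Naturality of \<open>\<phi>\<close> at \<open>\<psi> Y X g\<close> is read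
    backwards, with the composites rebracketed into the form that naturality takes in the opposite
    categories.\<close>
  have key: "\<psi> Y' X' (ccomp C X' X (omap R Y') (ccomp C X (omap R Y) (omap R Y') (amap R Y Y' v) g) u) =
      ccomp D (omap L X') (omap L X) Y' (ccomp D (omap L X) Y Y' v (\<psi> Y X g)) (amap L X' X u)"
    if X: "X \<in> obj C" and X': "X' \<in> obj C" and Y: "Y \<in> obj D" and Y': "Y' \<in> obj D"
      and u: "u \<in> arr C X' X" and v: "v \<in> arr D Y Y'" and g: "g \<in> arr C X (omap R Y)" for X X' Y Y' u v g
  proof -
    have Lu: "amap L X' X u \<in> arr D (omap L X') (omap L X)" using L X X' u by (simp add: is_functor_def)
    have Rv: "amap R Y Y' v \<in> arr C (omap R Y) (omap R Y')" using R Y Y' v by (simp add: is_functor_def)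
    note g' = \<psi>_in[OF X Y g]
    have c: "ccomp D (omap L X') Y Y' v (ccomp D (omap L X') (omap L X) Y (\<psi> Y X g) (amap L X' X u)) \<in> arr D (omap L X') Y'"
      by (intro D.comp_arr LO X X' Y Y' v g' Lu)
    have "\<phi> X' Y' (ccomp D (omap L X') Y Y' v (ccomp D (omap L X') (omap L X) Y (\<psi> Y X g) (amap L X' X u))) =
      ccomp C X' (omap R Y) (omap R Y') (amap R Y Y' v) (ccomp C X' X (omap R Y) g u)"
      using nat[rule_format, OF X X' Y Y' u v g'] by (simp add: \<phi>\<psi>[OF X Y g])
    also have "\<dots> = ccomp C X' X (omap R Y') (ccomp C X (omap R Y) (omap R Y') (amap R Y Y' v) g) u"
      by (rule C.comp_assoc[OF X' X RO[OF Y] RO[OF Y'] u g Rv])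
    finally show ?thesis
      using \<psi>\<phi>[OF X' Y' c] D.comp_assoc[OF LO[OF X'] LO[OF X] Y Y' Lu g' v] by simp
  qed
  show ?thesis
    unfolding adjoint_functors_def
    by (intro conjI is_functor_op L R exI[of _ \<psi>] ballI) (simp_all add: \<psi> key)
qed

lemma coreflective_op: "coreflective C B \<longleftrightarrow> reflective (op_cat C) B"
  by (simp add: coreflective_def reflective_def)

lemma isomorphic_op: "isomorphic (op_cat C) X Y \<longleftrightarrow> isomorphic C X Y"
  unfolding isomorphic_def by auto

lemma subcategory_op: "subcategory (op_cat C) B \<longleftrightarrow> subcategory C B"
  by (simp add: subcategory_def isomorphic_op)

lemma is_cokernel_op: "is_cokernel C X Y f Q q \<longleftrightarrow> is_kernel (op_cat C) Y X f Q q"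
  by (simp add: is_cokernel_def is_kernel_def)

lemma is_coproduct_op: "is_coproduct C I X P \<iota> \<longleftrightarrow> is_product (op_cat C) I X P \<iota>"
  by (simp add: is_coproduct_def is_product_def)

lemma coreflective_iff_adjoint:
  fixes C :: "('o, 'a) preadd_cat"
  assumes C: "category C" and B: "B \<subseteq> obj C"
  shows "coreflective C B \<longleftrightarrow> (\<exists>R. adjoint_functors (full_subcat C B) C inclusion R)"
proof -
  note CB = category_full_subcat[OF C B]
  have "coreflective C B \<longleftrightarrow> (\<exists>L. adjoint_functors (op_cat C) (op_cat (full_subcat C B)) L (op_functor inclusion))"
    unfolding coreflective_op op_full_subcat op_inclusion
    by (rule category.reflective_iff_adjoint[OF category_op[OF C]]) (simp add: B)
  also have "\<dots> \<longleftrightarrow> (\<exists>R. adjoint_functors (full_subcat C B) C inclusion R)"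
    using adjoint_functors_op[OF CB C, of inclusion]
      adjoint_functors_op[OF category_op[OF C] category_op[OF CB], of _ "op_functor inclusion"]
    by (metis op_op)
  finally show ?thesis .
qed

section \<open>Bireflective subcategories are fully exact\<close>

lemma reflectiveE:
  assumes "reflective A B" "X \<in> obj A"
  obtains R \<eta> where "R \<in> B" "\<eta> \<in> arr A X R"
    "\<And>Z g. Z \<in> B \<Longrightarrow> g \<in> arr A X Z \<Longrightarrow> \<exists>!h. h \<in> arr A R Z \<and> ccomp A X R Z h \<eta> = g"
proof -
  have "\<exists>R\<in>B. \<exists>\<eta>\<in>arr A X R. \<forall>Z\<in>B. \<forall>g\<in>arr A X Z. \<exists>!h. h \<in> arr A R Z \<and> ccomp A X R Z h \<eta> = g"
    using assms unfolding reflective_def by (rule bspec)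
  then obtain R \<eta> where R: "R \<in> B" "\<eta> \<in> arr A X R"
    and *: "\<forall>Z\<in>B. \<forall>g\<in>arr A X Z. \<exists>!h. h \<in> arr A R Z \<and> ccomp A X R Z h \<eta> = g"
    by (elim bexE) (rule that)
  show thesis by (rule that[OF R]) (rule *[rule_format])
qed

lemma ex1_eq: "\<lbrakk>\<exists>!x. P x \<and> Q x; P a; Q a; P b; Q b\<rbrakk> \<Longrightarrow> a = b"
  by blast

context preadditive_category
begin

lemma arr_zero_closed: "X \<in> obj C \<Longrightarrow> Y \<in> obj C \<Longrightarrow> arr_zero C X Y \<in> arr C X Y"
  using arr_comm_group[of X Y] monoid.one_closed[of "arr_group C X Y"]
  by (simp add: arr_group_def comm_group_def group_def)

lemma arr_zero_unique:
  assumes "X \<in> obj C" "Y \<in> obj C" "z \<in> arr C X Y" "arr_add C X Y z z = z"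
  shows "z = arr_zero C X Y"
proof -
  interpret G: comm_group "arr_group C X Y" by (rule arr_comm_group[OF assms(1,2)])
  show ?thesis using G.l_cancel_one[of z z] assms by (simp add: arr_group_def)
qed

lemma arr_zero_idem: "X \<in> obj C \<Longrightarrow> Y \<in> obj C \<Longrightarrow> arr_add C X Y (arr_zero C X Y) (arr_zero C X Y) = arr_zero C X Y"
  using arr_comm_group[of X Y] monoid.l_one[of "arr_group C X Y" "arr_zero C X Y"] arr_zero_closed[of X Y]
  by (simp add: arr_group_def comm_group_def group_def)

lemma comp_zero_left:
  assumes "X \<in> obj C" "Y \<in> obj C" "Z \<in> obj C" "f \<in> arr C X Y"
  shows "ccomp C X Y Z (arr_zero C Y Z) f = arr_zero C X Z"
  by (rule arr_zero_unique)
    (use assms in \<open>simp_all add: comp_arr arr_zero_closed arr_zero_idem flip: comp_add_left\<close>)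

text \<open>The kernel arrow extends over the reflection of \<open>K\<close>, and the extension is
  still annihilated by \<open>f\<close>, since arrows from the reflection to \<open>B\<close> are
  determined on \<open>K\<close>. It therefore factors through the kernel, and the factor inverts
  the unit.\<close>

lemma reflective_kernel:
  assumes B: "subcategory C B" and r: "reflective C B" and X: "X \<in> B" and Y: "Y \<in> B" and f: "f \<in> arr C X Y"
    and k: "is_kernel C X Y f K k"
  shows "K \<in> B"
proof -
  have BO: "Z \<in> obj C" if "Z \<in> B" for Z using B that by (auto simp: subcategory_def)
  have K: "K \<in> obj C" and ka: "k \<in> arr C K X" and fk: "ccomp C K X Y f k = arr_zero C K Y"
    and univ: "\<And>T t. T \<in> obj C \<Longrightarrow> t \<in> arr C T X \<Longrightarrow> ccomp C T X Y f t = arr_zero C T Y \<Longrightarrow>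
        \<exists>!h. h \<in> arr C T K \<and> ccomp C T K X k h = t"
    using k by (simp_all add: is_kernel_def)
  obtain R \<eta> where R: "R \<in> B" and \<eta>: "\<eta> \<in> arr C K R"
    and ru: "\<And>Z g. Z \<in> B \<Longrightarrow> g \<in> arr C K Z \<Longrightarrow> \<exists>!h. h \<in> arr C R Z \<and> ccomp C K R Z h \<eta> = g"
    by (rule reflectiveE[OF r K]) (rule that, assumption+)
  note XO = BO[OF X] and YO = BO[OF Y] and RO = BO[OF R]
  obtain k' where k': "k' \<in> arr C R X" "ccomp C K R X k' \<eta> = k" using ru[OF X ka] by blast
  have fk': "ccomp C R X Y f k' \<in> arr C R Y" by (rule comp_arr[OF RO XO YO k'(1) f])
  have "ccomp C K R Y (ccomp C R X Y f k') \<eta> = arr_zero C K Y"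
    using comp_assoc[OF K RO XO YO \<eta> k'(1) f] k'(2) fk by simp
  moreover have "ccomp C K R Y (arr_zero C R Y) \<eta> = arr_zero C K Y" by (rule comp_zero_left[OF K RO YO \<eta>])
  ultimately have "ccomp C R X Y f k' = arr_zero C R Y"
    by (rule ex1_eq[OF ru[OF Y arr_zero_closed[OF K YO]] fk' _ arr_zero_closed[OF RO YO]])
  then obtain h where h: "h \<in> arr C R K" "ccomp C R K X k h = k'" using univ[OF RO k'(1)] by blast
  have h\<eta>: "ccomp C K R K h \<eta> \<in> arr C K K" by (rule comp_arr[OF K RO K \<eta> h(1)])
  have "ccomp C K K X k (ccomp C K R K h \<eta>) = k"
    using comp_assoc[OF K RO K XO \<eta> h(1) ka] h(2) k'(2) by simp
  moreover have "ccomp C K K X k (ident C K) = k" by (rule comp_ident_right[OF K XO ka])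
  ultimately have 1: "ccomp C K R K h \<eta> = ident C K"
    by (rule ex1_eq[OF univ[OF K ka fk] h\<eta> _ ident_arr[OF K]])
  have \<eta>h: "ccomp C R K R \<eta> h \<in> arr C R R" by (rule comp_arr[OF RO K RO h(1) \<eta>])
  have "ccomp C K R R (ccomp C R K R \<eta> h) \<eta> = \<eta>"
    using comp_assoc[OF K RO K RO \<eta> h(1) \<eta>] 1 comp_ident_right[OF K RO \<eta>] by simp
  moreover have "ccomp C K R R (ident C R) \<eta> = \<eta>" by (rule comp_ident_left[OF K RO \<eta>])
  ultimately have 2: "ccomp C R K R \<eta> h = ident C R"
    by (rule ex1_eq[OF ru[OF R \<eta>] \<eta>h _ ident_arr[OF RO]])
  have "isomorphic C R K" unfolding isomorphic_def using h(1) \<eta> 1 2 by blast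
  then show ?thesis using B R K unfolding subcategory_def by blast
qed

text \<open>As for kernels: the projections extend over the reflection of \<open>P\<close>, and the
  arrow back to \<open>P\<close> which they induce inverts the unit.\<close>

lemma reflective_product:
  assumes B: "subcategory C B" and r: "reflective C B" and X: "\<And>i. i \<in> I \<Longrightarrow> X i \<in> B"
    and p: "is_product C I X P \<pi>"
  shows "P \<in> B"
proof -
  have BO: "Z \<in> obj C" if "Z \<in> B" for Z using B that by (auto simp: subcategory_def)
  have P: "P \<in> obj C" and \<pi>: "\<And>i. i \<in> I \<Longrightarrow> \<pi> i \<in> arr C P (X i)"
    and univ: "\<And>T f. T \<in> obj C \<Longrightarrow> \<forall>i\<in>I. f i \<in> arr C T (X i) \<Longrightarrow>
        \<exists>!h. h \<in> arr C T P \<and> (\<forall>i\<in>I. ccomp C T P (X i) (\<pi> i) h = f i)"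
    using p by (simp_all add: is_product_def)
  obtain R \<eta> where R: "R \<in> B" and \<eta>: "\<eta> \<in> arr C P R"
    and ru: "\<And>Z g. Z \<in> B \<Longrightarrow> g \<in> arr C P Z \<Longrightarrow> \<exists>!h. h \<in> arr C R Z \<and> ccomp C P R Z h \<eta> = g"
    by (rule reflectiveE[OF r P]) (rule that, assumption+)
  note RO = BO[OF R] and XO = BO[OF X]
  have "\<exists>k. k \<in> arr C R (X i) \<and> ccomp C P R (X i) k \<eta> = \<pi> i" if "i \<in> I" for i
    using ru[OF X[OF that] \<pi>[OF that]] by blast
  then obtain k where k: "\<And>i. i \<in> I \<Longrightarrow> k i \<in> arr C R (X i)" "\<And>i. i \<in> I \<Longrightarrow> ccomp C P R (X i) (k i) \<eta> = \<pi> i"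
    by metis
  have "\<forall>i\<in>I. k i \<in> arr C R (X i)" using k(1) by blast
  from univ[OF RO this] obtain h where h: "h \<in> arr C R P" "\<And>i. i \<in> I \<Longrightarrow> ccomp C R P (X i) (\<pi> i) h = k i" by blast
  have h\<eta>: "ccomp C P R P h \<eta> \<in> arr C P P" by (rule comp_arr[OF P RO P \<eta> h(1)])
  have "\<forall>i\<in>I. ccomp C P P (X i) (\<pi> i) (ccomp C P R P h \<eta>) = \<pi> i"
    using comp_assoc[OF P RO P XO \<eta> h(1) \<pi>] h(2) k(2) by simp
  moreover have "\<forall>i\<in>I. ccomp C P P (X i) (\<pi> i) (ident C P) = \<pi> i" using comp_ident_right[OF P XO \<pi>] by simp
  moreover have pi: "\<forall>i\<in>I. \<pi> i \<in> arr C P (X i)" using \<pi> by blast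
  ultimately have 1: "ccomp C P R P h \<eta> = ident C P"
    by (intro ex1_eq[OF univ[OF P pi] h\<eta> _ ident_arr[OF P]])
  have \<eta>h: "ccomp C R P R \<eta> h \<in> arr C R R" by (rule comp_arr[OF RO P RO h(1) \<eta>])
  have "ccomp C P R R (ccomp C R P R \<eta> h) \<eta> = \<eta>"
    using comp_assoc[OF P RO P RO \<eta> h(1) \<eta>] 1 comp_ident_right[OF P RO \<eta>] by simp
  moreover have "ccomp C P R R (ident C R) \<eta> = \<eta>" by (rule comp_ident_left[OF P RO \<eta>])
  ultimately have 2: "ccomp C R P R \<eta> h = ident C R"
    by (rule ex1_eq[OF ru[OF R \<eta>] \<eta>h _ ident_arr[OF RO]])
  have "isomorphic C R P" unfolding isomorphic_def using h(1) \<eta> 1 2 by blast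
  then show ?thesis using B R P unfolding subcategory_def by blast
qed

end

lemma bireflective_iff:
  fixes C :: "('o, 'a) preadd_cat"
  assumes "category C"
  shows "bireflective C B \<longleftrightarrow> subcategory C B \<and> reflective C B \<and> coreflective C B"
  unfolding bireflective_def
  using category.reflective_iff_adjoint[OF assms, of B] coreflective_iff_adjoint[OF assms, of B]
  by (auto simp: subcategory_def)

text \<open>Cokernels and coproducts are kernels and products in the opposite category, where
  \<open>B\<close> is reflective as well.\<close>

lemma bireflective_imp_fully_exact:
  fixes C :: "('o, 'a) preadd_cat" and U :: "'u itself"
  assumes C: "preadditive_category C" and bi: "bireflective C B"
  shows "fully_exact U C B"
proof -
  have B: "subcategory C B" "reflective C B" "coreflective C B"
    using bireflective_iff[OF preadditive_category.axioms(1)[OF C], THEN iffD1, OF bi] by blast+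
  note op = preadditive_op[OF C] and B' = subcategory_op[THEN iffD2, OF B(1)] coreflective_op[THEN iffD1, OF B(3)]
  show ?thesis
    unfolding fully_exact_def is_cokernel_op is_coproduct_op
  proof (intro conjI ballI allI impI B(1))
    fix X Y f K k assume "X \<in> B" "Y \<in> B" "f \<in> arr C X Y" "is_kernel C X Y f K k"
    then show "K \<in> B" by (rule preadditive_category.reflective_kernel[OF C B(1,2)])
  next
    fix X Y f Q q assume *: "X \<in> B" "Y \<in> B" "f \<in> arr C X Y" "is_kernel (op_cat C) Y X f Q q"
    then show "Q \<in> B" by (intro preadditive_category.reflective_kernel[OF op B' *(2,1) _ *(4)]) simp
  next
    fix I :: "'u set" and X P \<iota> assume "\<forall>i\<in>I. X i \<in> B" "is_product (op_cat C) I X P \<iota>"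
    then show "P \<in> B" using preadditive_category.reflective_product[OF op B', of I X P \<iota>] by simp
  next
    fix I :: "'u set" and X P \<pi> assume "\<forall>i\<in>I. X i \<in> B" "is_product C I X P \<pi>"
    then show "P \<in> B" using preadditive_category.reflective_product[OF C B(1,2), of I X P \<pi>] by simp
  qed
qed

section \<open>Fully exact subcategories are bireflective\<close>

context fully_exact_modules
begin

text \<open>\<open>G c\<close> is the reflection of the representable module at \<open>c\<close>.
  Existence is Yoneda followed by the reflection; for uniqueness, the value at the image of the
  identity fixes a homomorphism on the image of the representable, and this image generates.\<close>

lemma ex_generators: "\<exists>G gen. generators C B G gen"
proof -
  have "\<exists>Y x. Y \<in> B \<and> x \<in> car Y c \<and>
    (\<forall>Z\<in>B. \<forall>z\<in>car Z c. \<exists>h. module_hom C Y Z h \<and> h c x = z) \<and>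
    (\<forall>Z\<in>B. \<forall>h k. module_hom C Y Z h \<longrightarrow> module_hom C Y Z k \<longrightarrow> h c x = k c x \<longrightarrow>
      (\<forall>X\<in>obj C. \<forall>y\<in>car Y X. h X y = k X y))" if c: "c \<in> obj C" for c
  proof -
    note Rc = cat_module_rep[OF preadditive_category_axioms c]
    obtain Y \<eta> where Y: "Y \<in> B" and \<eta>: "module_hom C (rep C c) Y \<eta>" and gen: "generated (rep C c) Y \<eta>"
      and ex: "\<forall>Z\<in>B. \<forall>g. module_hom C (rep C c) Z g \<longrightarrow>
        (\<exists>h. module_hom C Y Z h \<and> (\<forall>X\<in>obj C. \<forall>m\<in>car (rep C c) X. h X (\<eta> X m) = g X m))"
      using reflection[OF Rc small_rep[OF small_C c]] by (elim bexE exE conjE) (rule that)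
    have id: "ident C c \<in> arr C c c" by (rule ident_arr[OF c])
    have Yc: "in_sub C B Y" by (rule in_sub_B[OF Y])
    show ?thesis
    proof (rule exI[of _ Y], rule exI[of _ "\<eta> c (ident C c)"], intro conjI ballI allI impI Y)
      show "\<eta> c (ident C c) \<in> car Y c" by (rule module_hom_closed[OF \<eta> c]) (simp add: id)
    next
      fix Z z assume Z: "Z \<in> B" and z: "z \<in> car Z c"
      interpret Z: cat_module C Z by (rule in_subD[OF in_sub_B[OF Z]])
      obtain h where h: "module_hom C Y Z h"
        "\<forall>X\<in>obj C. \<forall>m\<in>car (rep C c) X. h X (\<eta> X m) = amap Z c X m z"
        using ex[rule_format, OF Z yoneda_hom[OF Z.cat_module_axioms c z]] by blast
      have "h c (\<eta> c (ident C c)) = z" using h(2) c id z by (simp add: Z.act_ident)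
      then show "\<exists>h. module_hom C Y Z h \<and> h c (\<eta> c (ident C c)) = z" using h(1) by blast
    next
      fix Z h k X y
      assume Z: "Z \<in> B" and h: "module_hom C Y Z h" and k: "module_hom C Y Z k"
        and eq: "h c (\<eta> c (ident C c)) = k c (\<eta> c (ident C c))" and X: "X \<in> obj C" and y: "y \<in> car Y X"
      show "h X y = k X y"
      proof (rule generated_unique[OF Yc in_sub_B[OF Z] gen \<eta> h k _ X y])
        fix X m assume *: "X \<in> obj C" "m \<in> car (rep C c) X"
        have "\<eta> X m = amap Y c X m (\<eta> c (ident C c))"
          using module_hom_act[OF \<eta> c *(1), of m "ident C c"] * c id by (simp add: comp_ident_left)
        moreover have "\<eta> c (ident C c) \<in> car Y c" by (rule module_hom_closed[OF \<eta> c]) (simp add: id)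
        ultimately show "h X (\<eta> X m) = k X (\<eta> X m)"
          using * c eq by (simp add: module_hom_act[OF h] module_hom_act[OF k])
      qed
    qed
  qed
  then have "\<forall>c\<in>obj C. \<exists>p. fst p \<in> B \<and> snd p \<in> car (fst p) c \<and>
    (\<forall>Z\<in>B. \<forall>z\<in>car Z c. \<exists>h. module_hom C (fst p) Z h \<and> h c (snd p) = z) \<and>
    (\<forall>Z\<in>B. \<forall>h k. module_hom C (fst p) Z h \<longrightarrow> module_hom C (fst p) Z k \<longrightarrow> h c (snd p) = k c (snd p) \<longrightarrow>
      (\<forall>X\<in>obj C. \<forall>y\<in>car (fst p) X. h X y = k X y))"
    unfolding split_paired_Ex fst_conv snd_conv by (rule ballI)
  from bchoice[OF this] obtain p where p: "\<forall>c\<in>obj C. fst (p c) \<in> B \<and> snd (p c) \<in> car (fst (p c)) c \<and>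
    (\<forall>Z\<in>B. \<forall>z\<in>car Z c. \<exists>h. module_hom C (fst (p c)) Z h \<and> h c (snd (p c)) = z) \<and>
    (\<forall>Z\<in>B. \<forall>h k. module_hom C (fst (p c)) Z h \<longrightarrow> module_hom C (fst (p c)) Z k \<longrightarrow> h c (snd (p c)) = k c (snd (p c)) \<longrightarrow>
      (\<forall>X\<in>obj C. \<forall>y\<in>car (fst (p c)) X. h X y = k X y))"
    by (rule exE)
  define G where "G c = fst (p c)" for c
  define gen where "gen c = snd (p c)" for c
  note * = bspec[OF p, folded G_def gen_def]
  have "generators C B G gen"
  proof (intro generators.intro generators_axioms.intro fully_exact_modules_axioms)
    fix c assume c: "c \<in> obj C"
    show "G c \<in> B" "gen c \<in> car (G c) c" using *[OF c] by simp_all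
    fix Z assume Z: "Z \<in> B"
    show "\<exists>h. module_hom C (G c) Z h \<and> h c (gen c) = z" if "z \<in> car Z c" for z
      using *[OF c] Z that by simp
    show "h X y = k X y" if "module_hom C (G c) Z h" "module_hom C (G c) Z k" "h c (gen c) = k c (gen c)"
      "X \<in> obj C" "y \<in> car (G c) X" for h k X y
      using *[OF c] Z that by simp
  qed
  then show ?thesis by blast
qed

lemma reflective_B: "reflective (Mod C) B"
  unfolding reflective_def
proof
  fix M :: "('o, 'a, 'u) cmodule" assume M: "M \<in> obj (Mod C)"
  obtain Y \<eta> where Y: "Y \<in> B" and \<eta>: "module_hom C M Y \<eta>" and gen: "generated M Y \<eta>"
    and ex: "\<forall>Z\<in>B. \<forall>g. module_hom C M Z g \<longrightarrow>
      (\<exists>h. module_hom C Y Z h \<and> (\<forall>X\<in>obj C. \<forall>m\<in>car M X. h X (\<eta> X m) = g X m))"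
    using reflection[OF obj_ModD(1,2)[OF M]] by (elim bexE exE conjE) (rule that)
  have BO: "Z \<in> obj (Mod C)" if "Z \<in> B" for Z using that B_sub by blast
  note YO = BO[OF Y]
  have e: "mod_arr C M \<eta> \<in> arr (Mod C) M Y" by (rule mod_arr_in[OF M YO \<eta>])
  show "\<exists>R\<in>B. \<exists>\<eta>\<in>arr (Mod C) M R. \<forall>Z\<in>B. \<forall>g\<in>arr (Mod C) M Z. \<exists>!h. h \<in> arr (Mod C) R Z \<and> ccomp (Mod C) M R Z h \<eta> = g"
  proof (rule bexI[OF _ Y], rule bexI[OF _ e], intro ballI)
    fix Z g assume Z: "Z \<in> B" and g: "g \<in> arr (Mod C) M Z"
    note ZO = BO[OF Z] and gh = arr_Mod_hom[OF M BO[OF Z] g]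
    obtain h where h: "module_hom C Y Z h" "\<forall>X\<in>obj C. \<forall>m\<in>car M X. h X (\<eta> X m) = g X m"
      using ex[rule_format, OF Z gh] by blast
    show "\<exists>!h. h \<in> arr (Mod C) Y Z \<and> ccomp (Mod C) M Y Z h (mod_arr C M \<eta>) = g"
    proof (intro ex1I conjI)
      show "mod_arr C Y h \<in> arr (Mod C) Y Z" by (rule mod_arr_in[OF YO ZO h(1)])
      show "ccomp (Mod C) M Y Z (mod_arr C Y h) (mod_arr C M \<eta>) = g"
      proof (rule arr_Mod_eqI[OF M ZO ZO _ g])
        show "ccomp (Mod C) M Y Z (mod_arr C Y h) (mod_arr C M \<eta>) \<in> arr (Mod C) M Z"
          by (rule category.comp_arr[OF preadditive_category.axioms(1)[OF preadditive_Mod] M YO ZO e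
                mod_arr_in[OF YO ZO h(1)]])
      qed (use h(2) module_hom_closed[OF \<eta>] in \<open>simp add: ccomp_Mod\<close>)
      fix k assume "k \<in> arr (Mod C) Y Z \<and> ccomp (Mod C) M Y Z k (mod_arr C M \<eta>) = g"
      then have k: "k \<in> arr (Mod C) Y Z" and e: "ccomp (Mod C) M Y Z k (mod_arr C M \<eta>) = g" by auto
      show "k = mod_arr C Y h"
      proof (rule arr_Mod_eqI[OF YO ZO ZO k mod_arr_in[OF YO ZO h(1)]])
        fix X y assume X: "X \<in> obj C" and y: "y \<in> car Y X"
        have "k X y = h X y"
        proof (rule generated_unique[OF in_sub_B[OF Y] in_sub_B[OF Z] gen \<eta> arr_Mod_hom[OF YO ZO k] h(1) _ X y])
          fix X m assume *: "X \<in> obj C" "m \<in> car M X"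
          show "k X (\<eta> X m) = h X (\<eta> X m)"
            using fun_cong[OF fun_cong[OF e, of X], of m] * h(2) by (simp add: ccomp_Mod)
        qed
        then show "k X y = mod_arr C Y h X y" using X y by simp
      qed
    qed
  qed
qed

lemma coreflective_B: "coreflective (Mod C) B"
  unfolding coreflective_def
proof
  fix M :: "('o, 'a, 'u) cmodule" assume M: "M \<in> obj (Mod C)"
  obtain G gen where "generators C B G gen" using ex_generators by blast
  then interpret generators C B G gen .
  obtain R \<epsilon> where R: "R \<in> B" and \<epsilon>: "module_hom C R M \<epsilon>"
    and ex: "\<forall>Z\<in>B. \<forall>g. module_hom C Z M g \<longrightarrow> (\<exists>h. module_hom C Z R h \<and> (\<forall>X\<in>obj C. \<forall>z\<in>car Z X. \<epsilon> X (h X z) = g X z))"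
    and un: "\<forall>Z\<in>B. \<forall>h k. module_hom C Z R h \<longrightarrow> module_hom C Z R k \<longrightarrow>
       (\<forall>X\<in>obj C. \<forall>z\<in>car Z X. \<epsilon> X (h X z) = \<epsilon> X (k X z)) \<longrightarrow> (\<forall>X\<in>obj C. \<forall>z\<in>car Z X. h X z = k X z)"
    using coreflection[OF M] by (elim bexE exE conjE) (rule that)
  have BO: "Z \<in> obj (Mod C)" if "Z \<in> B" for Z using that B_sub by blast
  note RO = BO[OF R]
  have e: "mod_arr C R \<epsilon> \<in> arr (Mod C) R M" by (rule mod_arr_in[OF RO M \<epsilon>])
  show "\<exists>R\<in>B. \<exists>\<epsilon>\<in>arr (Mod C) R M. \<forall>Z\<in>B. \<forall>g\<in>arr (Mod C) Z M. \<exists>!h. h \<in> arr (Mod C) Z R \<and> ccomp (Mod C) Z R M \<epsilon> h = g"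
  proof (rule bexI[OF _ R], rule bexI[OF _ e], intro ballI)
    fix Z g assume Z: "Z \<in> B" and g: "g \<in> arr (Mod C) Z M"
    note ZO = BO[OF Z] and gh = arr_Mod_hom[OF BO[OF Z] M g]
    obtain h where h: "module_hom C Z R h" "\<forall>X\<in>obj C. \<forall>z\<in>car Z X. \<epsilon> X (h X z) = g X z"
      using ex[rule_format, OF Z gh] by blast
    show "\<exists>!h. h \<in> arr (Mod C) Z R \<and> ccomp (Mod C) Z R M (mod_arr C R \<epsilon>) h = g"
    proof (intro ex1I conjI)
      show "mod_arr C Z h \<in> arr (Mod C) Z R" by (rule mod_arr_in[OF ZO RO h(1)])
      show "ccomp (Mod C) Z R M (mod_arr C R \<epsilon>) (mod_arr C Z h) = g"
      proof (rule arr_Mod_eqI[OF ZO M M _ g])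
        show "ccomp (Mod C) Z R M (mod_arr C R \<epsilon>) (mod_arr C Z h) \<in> arr (Mod C) Z M"
          by (rule category.comp_arr[OF preadditive_category.axioms(1)[OF preadditive_Mod] ZO RO M
                mod_arr_in[OF ZO RO h(1)] e])
      qed (use h(2) module_hom_closed[OF h(1)] in \<open>simp add: ccomp_Mod\<close>)
      fix k assume "k \<in> arr (Mod C) Z R \<and> ccomp (Mod C) Z R M (mod_arr C R \<epsilon>) k = g"
      then have k: "k \<in> arr (Mod C) Z R" and e: "ccomp (Mod C) Z R M (mod_arr C R \<epsilon>) k = g" by auto
      note kh = arr_Mod_hom[OF ZO RO k]
      have "\<forall>X\<in>obj C. \<forall>z\<in>car Z X. \<epsilon> X (k X z) = \<epsilon> X (h X z)"
      proof (intro ballI)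
        fix X z assume *: "X \<in> obj C" "z \<in> car Z X"
        show "\<epsilon> X (k X z) = \<epsilon> X (h X z)"
          using fun_cong[OF fun_cong[OF e, of X], of z] * h(2) module_hom_closed[OF kh *] by (simp add: ccomp_Mod)
      qed
      then have "\<forall>X\<in>obj C. \<forall>z\<in>car Z X. k X z = h X z" using un[rule_format, OF Z kh h(1)] by blast
      then show "k = mod_arr C Z h"
        by (intro arr_Mod_eqI[OF ZO RO RO k mod_arr_in[OF ZO RO h(1)]]) simp
    qed
  qed
qed

lemma bireflective_B: "bireflective (Mod C) B"
  unfolding bireflective_iff[OF preadditive_category.axioms(1)[OF preadditive_Mod]]
  using reflective_B coreflective_B exact by (simp add: fully_exact_def)

end

section \<open>Essential images of restriction functors\<close>

context preadditive_category
begin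

lemma kernel_unique:
  assumes X: "X \<in> obj C" and k: "is_kernel C X Y f K k" and k': "is_kernel C X Y f K' k'"
  shows "isomorphic C K K'"
proof -
  have K: "K \<in> obj C" "k \<in> arr C K X" "ccomp C K X Y f k = arr_zero C K Y"
    and u: "\<And>T t. T \<in> obj C \<Longrightarrow> t \<in> arr C T X \<Longrightarrow> ccomp C T X Y f t = arr_zero C T Y \<Longrightarrow>
        \<exists>!h. h \<in> arr C T K \<and> ccomp C T K X k h = t"
    using k by (simp_all add: is_kernel_def)
  have K': "K' \<in> obj C" "k' \<in> arr C K' X" "ccomp C K' X Y f k' = arr_zero C K' Y"
    and u': "\<And>T t. T \<in> obj C \<Longrightarrow> t \<in> arr C T X \<Longrightarrow> ccomp C T X Y f t = arr_zero C T Y \<Longrightarrow>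
        \<exists>!h. h \<in> arr C T K' \<and> ccomp C T K' X k' h = t"
    using k' by (simp_all add: is_kernel_def)
  obtain h where h: "h \<in> arr C K K'" "ccomp C K K' X k' h = k" using u'[OF K] by blast
  obtain h' where h': "h' \<in> arr C K' K" "ccomp C K' K X k h' = k'" using u[OF K'] by blast
  have 1: "ccomp C K K' K h' h = ident C K"
    by (rule ex1_eq[OF u[OF K] comp_arr[OF K(1) K'(1) K(1) h(1) h'(1)] _ ident_arr[OF K(1)] comp_ident_right[OF K(1) X K(2)]])
      (simp add: comp_assoc[OF K(1) K'(1) K(1) X h(1) h'(1) K(2)] h'(2) h(2))
  have 2: "ccomp C K' K K' h h' = ident C K'"
    by (rule ex1_eq[OF u'[OF K'] comp_arr[OF K'(1) K(1) K'(1) h'(1) h(1)] _ ident_arr[OF K'(1)] comp_ident_right[OF K'(1) X K'(2)]])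
      (simp add: comp_assoc[OF K'(1) K(1) K'(1) X h'(1) h(1) K'(2)] h'(2) h(2))
  show ?thesis unfolding isomorphic_def using h(1) h'(1) 1 2 by blast
qed

lemma product_unique:
  assumes p: "is_product C I X P \<pi>" and p': "is_product C I X P' \<pi>'"
  shows "isomorphic C P P'"
proof -
  have P: "P \<in> obj C" and X: "\<And>i. i \<in> I \<Longrightarrow> X i \<in> obj C" and \<pi>: "\<forall>i\<in>I. \<pi> i \<in> arr C P (X i)"
    and u: "\<And>T f. T \<in> obj C \<Longrightarrow> \<forall>i\<in>I. f i \<in> arr C T (X i) \<Longrightarrow>
        \<exists>!h. h \<in> arr C T P \<and> (\<forall>i\<in>I. ccomp C T P (X i) (\<pi> i) h = f i)"
    using p by (simp_all add: is_product_def)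
  have P': "P' \<in> obj C" and \<pi>': "\<forall>i\<in>I. \<pi>' i \<in> arr C P' (X i)"
    and u': "\<And>T f. T \<in> obj C \<Longrightarrow> \<forall>i\<in>I. f i \<in> arr C T (X i) \<Longrightarrow>
        \<exists>!h. h \<in> arr C T P' \<and> (\<forall>i\<in>I. ccomp C T P' (X i) (\<pi>' i) h = f i)"
    using p' by (simp_all add: is_product_def)
  obtain h where h: "h \<in> arr C P P'" "\<forall>i\<in>I. ccomp C P P' (X i) (\<pi>' i) h = \<pi> i" using u'[OF P \<pi>] by blast
  obtain h' where h': "h' \<in> arr C P' P" "\<forall>i\<in>I. ccomp C P' P (X i) (\<pi> i) h' = \<pi>' i" using u[OF P' \<pi>'] by blast
  have 1: "ccomp C P P' P h' h = ident C P"
    by (rule ex1_eq[OF u[OF P \<pi>] comp_arr[OF P P' P h(1) h'(1)] _ ident_arr[OF P]])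
      (use comp_assoc[OF P P' P X h(1) h'(1)] \<pi> h(2) h'(2) comp_ident_right[OF P X] in auto)
  have 2: "ccomp C P' P P' h h' = ident C P'"
    by (rule ex1_eq[OF u'[OF P' \<pi>'] comp_arr[OF P' P P' h'(1) h(1)] _ ident_arr[OF P']])
      (use comp_assoc[OF P' P P' X h'(1) h(1)] \<pi>' h(2) h'(2) comp_ident_right[OF P' X] in auto)
  show ?thesis unfolding isomorphic_def using h(1) h'(1) 1 2 by blast
qed

end

lemma cokernel_unique:
  fixes C :: "('o, 'a) preadd_cat"
  assumes "preadditive_category C" "Y \<in> obj C" "is_cokernel C X Y f Q q" "is_cokernel C X Y f Q' q'"
  shows "isomorphic C Q Q'"
  using preadditive_category.kernel_unique[OF preadditive_op[OF assms(1)], of Y X f Q q Q' q'] assms(2-)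
  by (simp add: is_cokernel_op isomorphic_op)

lemma coproduct_unique:
  fixes C :: "('o, 'a) preadd_cat"
  assumes "preadditive_category C" "is_coproduct C I X P \<iota>" "is_coproduct C I X P' \<iota>'"
  shows "isomorphic C P P'"
  using preadditive_category.product_unique[OF preadditive_op[OF assms(1)], of I X P \<iota> P' \<iota>'] assms(2-)
  by (simp add: is_coproduct_op isomorphic_op)

section \<open>Restriction of scalars preserves the pointwise constructions\<close>

context
  fixes C :: "('o, 'a) preadd_cat" and D :: "('p, 'b) preadd_cat" and f :: "('o, 'a, 'p, 'b) cfunctor"
  assumes f: "additive_functor C D f"
begin

lemma module_iso_res: "module_iso D M N h \<Longrightarrow> module_iso C (res f M) (res f N) (\<lambda>X. h (omap f X))"
  unfolding module_iso_def
  by (intro conjI, rule module_hom_res[OF f], simp, simp add: additive_functorD(1)[OF f])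

lemma pker_res: "pker D M N g K k \<Longrightarrow>
    pker C (res f M) (res f N) (\<lambda>X. g (omap f X)) (res f K) (\<lambda>X. k (omap f X))"
  unfolding pker_def
  by (intro conjI, rule module_hom_res[OF f], simp, simp add: additive_functorD(1)[OF f])

lemma pcok_res: "pcok D M N g Q q \<Longrightarrow>
    pcok C (res f M) (res f N) (\<lambda>X. g (omap f X)) (res f Q) (\<lambda>X. q (omap f X))"
  unfolding pcok_def
  by (intro conjI, rule module_hom_res[OF f], simp, simp add: additive_functorD(1)[OF f])

lemma pprod_res: "pprod D I M P \<pi> \<Longrightarrow>
    pprod C I (\<lambda>i. res f (M i)) (res f P) (\<lambda>i X. \<pi> i (omap f X))"
  unfolding pprod_def
  by (intro conjI ballI, rule module_hom_res[OF f], simp, simp add: additive_functorD(1)[OF f])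

lemma pcop_res:
  assumes "pcop D I M P \<iota>"
  shows "pcop C I (\<lambda>i. res f (M i)) (res f P) (\<lambda>i X. \<iota> i (omap f X))"
proof -
  obtain \<rho> where r: "\<And>i. i \<in> I \<Longrightarrow> module_hom D P (M i) (\<rho> i)"
    "\<And>i X x. i \<in> I \<Longrightarrow> X \<in> obj D \<Longrightarrow> x \<in> car (M i) X \<Longrightarrow> \<rho> i X (\<iota> i X x) = x"
    "\<And>i j X x. i \<in> I \<Longrightarrow> j \<in> I \<Longrightarrow> i \<noteq> j \<Longrightarrow> X \<in> obj D \<Longrightarrow> x \<in> car (M i) X \<Longrightarrow>
        \<rho> j X (\<iota> i X x) = \<one>\<^bsub>omap (M j) X\<^esub>"
    "\<And>X p. X \<in> obj D \<Longrightarrow> p \<in> car P X \<Longrightarrow> finite {i \<in> I. \<rho> i X p \<noteq> \<one>\<^bsub>omap (M i) X\<^esub>}"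
    "\<And>X p. X \<in> obj D \<Longrightarrow> p \<in> car P X \<Longrightarrow> \<forall>i\<in>I. \<rho> i X p = \<one>\<^bsub>omap (M i) X\<^esub> \<Longrightarrow> p = \<one>\<^bsub>omap P X\<^esub>"
    by (rule pcopE[OF assms]) (rule that, assumption+)
  have \<iota>: "\<And>i. i \<in> I \<Longrightarrow> module_hom D (M i) P (\<iota> i)" using assms by (simp add: pcop_def)
  show ?thesis
    unfolding pcop_def
    by (intro conjI exI[of _ "\<lambda>i X. \<rho> i (omap f X)"] ballI impI)
      (simp_all add: r additive_functorD(1)[OF f] module_hom_res[OF f] \<iota>)
qed

end

context universe
begin

text \<open>A homomorphism between members of \<open>B\<close> comes from one over \<open>D\<close>;
  its kernel or cokernel is formed there and restricted, and families lift member by member for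
  products and coproducts. Uniqueness of limits and colimits identifies the result with the given
  one.\<close>

lemma essential_image_fully_exact:
  fixes C :: "('o, 'a) preadd_cat" and D :: "('p, 'b) preadd_cat" and B :: "('o, 'a, 'u) cmodule set"
  assumes C: "preadditive_category C" and D: "preadditive_category D"
    and f: "preadditive_epi TYPE('u) C D f"
    and B: "B = essential_image (Mod D) (Mod C) (restriction C f)"
  shows "fully_exact TYPE('u) (Mod C) B"
proof -
  interpret A: preadditive_category "Mod C :: (('o, 'a, 'u) cmodule, 'o \<Rightarrow> 'u \<Rightarrow> 'u) preadd_cat"
    by (rule preadditive_Mod)
  have F: "additive_functor C D f"
    and ff: "fully_faithful (Mod D :: (('p, 'b, 'u) cmodule, 'p \<Rightarrow> 'u \<Rightarrow> 'u) preadd_cat) (Mod C) (restriction C f)"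
    using f by (simp_all add: preadditive_epi_def)
  have resM: "res f M \<in> obj (Mod C)" if "M \<in> obj (Mod D)" for M :: "('p, 'b, 'u) cmodule"
    by (rule res_obj_Mod[OF C F that])
  have B_iff: "Y \<in> B \<longleftrightarrow> Y \<in> obj (Mod C) \<and> (\<exists>M\<in>obj (Mod D). isomorphic (Mod C) Y (res f M))" for Y
    by (simp add: B essential_image_def restriction_def)
  have BO: "Y \<in> obj (Mod C)" if "Y \<in> B" for Y using that B_iff by blast
  have iso_trans: "isomorphic (Mod C) X Z" if xy: "isomorphic (Mod C) X Y" and yz: "isomorphic (Mod C) Y Z"
    and o: "X \<in> obj (Mod C)" "Y \<in> obj (Mod C)" "Z \<in> obj (Mod C)" for X Y Z :: "('o, 'a, 'u) cmodule"
  proof -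
    obtain h k where "module_iso C X Y h" "module_iso C Y Z k"
      using xy yz isomorphic_Mod_iff[OF o(1,2)] isomorphic_Mod_iff[OF o(2,3)] by blast
    from module_iso_comp[OF this] show ?thesis using isomorphic_Mod_iff[OF o(1,3)] by blast
  qed
  have iso_sym: "isomorphic (Mod C) Y X" if "isomorphic (Mod C) X Y" for X Y :: "('o, 'a, 'u) cmodule"
    using that unfolding isomorphic_def by blast
  have closed: "Y \<in> B" if "isomorphic (Mod C) Y (res f M)" "M \<in> obj (Mod D)" "Y \<in> obj (Mod C)" for Y M
    using that B_iff by blast
  have sub: "subcategory (Mod C) B"
    unfolding subcategory_def
  proof (intro conjI ballI impI subsetI)
    fix X Y assume X: "X \<in> B" and Y: "Y \<in> obj (Mod C)" and iso: "isomorphic (Mod C) X Y"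
    obtain M where M: "M \<in> obj (Mod D)" "isomorphic (Mod C) X (res f M)" using X B_iff by blast
    show "Y \<in> B"
      by (rule closed[OF iso_trans[OF iso_sym[OF iso] M(2) Y BO[OF X] resM[OF M(1)]] M(1) Y])
  qed (rule BO)
  have rep_B: "\<exists>(M :: ('p, 'b, 'u) cmodule) \<theta>. M \<in> obj (Mod D) \<and> module_iso C (res f M) X \<theta>" if X: "X \<in> B" for X
  proof -
    obtain M where M: "M \<in> obj (Mod D)" "isomorphic (Mod C) X (res f M)" using X B_iff by blast
    have "\<exists>\<theta>. module_iso C (res f M) X \<theta>"
      using iso_sym[OF M(2)] unfolding isomorphic_Mod_iff[OF resM[OF M(1)] BO[OF X]] .
    then show ?thesis using M(1) by blast
  qed
  \<comment> \<open>The only place where fullness of restriction enters: \<open>g\<close>,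
    conjugated by the two isomorphisms, is the restriction of some \<open>g'\<close>.\<close>
  have lift: "\<exists>g'. module_hom D M N g' \<and> (\<forall>c\<in>obj C. \<forall>x\<in>car (res f M) c. \<beta> c (g' (omap f c) x) = g c (\<alpha> c x))"
    if M: "M \<in> obj (Mod D)" and N: "N \<in> obj (Mod D)" and X: "X \<in> obj (Mod C)" and Y: "Y \<in> obj (Mod C)"
      and \<alpha>: "module_iso C (res f M) X \<alpha>" and \<beta>: "module_iso C (res f N) Y \<beta>" and g: "g \<in> arr (Mod C) X Y"
    for M N :: "('p, 'b, 'u) cmodule" and X Y \<alpha> \<beta> g
  proof -
    obtain \<beta>' where \<beta>': "module_iso C Y (res f N) \<beta>'"
      and \<beta>\<beta>': "\<And>c x. c \<in> obj C \<Longrightarrow> x \<in> car Y c \<Longrightarrow> \<beta> c (\<beta>' c x) = x"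
      by (rule module_iso_inverse[OF obj_ModD(1)[OF resM[OF N]] \<beta>]) (rule that, assumption+)
    have \<alpha>h: "module_hom C (res f M) X \<alpha>" and \<beta>h': "module_hom C Y (res f N) \<beta>'"
      using \<alpha> \<beta>' by (simp_all add: module_iso_def)
    note gh = arr_Mod_hom[OF X Y g]
    let ?k = "mod_arr C (res f M) (\<lambda>c x. \<beta>' c (g c (\<alpha> c x)))"
    have k: "?k \<in> arr (Mod C) (res f M) (res f N)"
      by (rule mod_arr_in[OF resM[OF M] resM[OF N] module_hom_comp[OF module_hom_comp[OF \<alpha>h gh] \<beta>h']])
    have "bij_betw (\<lambda>\<eta>. \<lambda>c\<in>obj C. \<eta> (omap f c)) (arr (Mod D) M N) (arr (Mod C) (res f M) (res f N))"
      using ff M N by (simp add: fully_faithful_def restriction_def)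
    then have "?k \<in> (\<lambda>\<eta>. \<lambda>c\<in>obj C. \<eta> (omap f c)) ` arr (Mod D) M N"
      using k by (simp only: bij_betw_def)
    then obtain g' where g': "g' \<in> arr (Mod D) M N" "?k = (\<lambda>c\<in>obj C. g' (omap f c))" by blast
    have "\<beta> c (g' (omap f c) x) = g c (\<alpha> c x)" if "c \<in> obj C" "x \<in> car (res f M) c" for c x
    proof -
      have "g' (omap f c) x = ?k c x" using that by (simp add: g'(2))
      also have "\<dots> = \<beta>' c (g c (\<alpha> c x))" using that by simp
      finally show ?thesis
        using \<beta>\<beta>'[OF that(1) module_hom_closed[OF gh that(1) module_hom_closed[OF \<alpha>h that]]] by simp
    qed
    then show ?thesis using arr_Mod_hom[OF M N g'(1)] by blast
  qed
  have closed_iso: "P \<in> B" if "isomorphic (Mod C) P (res f K)" "K \<in> obj (Mod D)" "P \<in> obj (Mod C)" for P K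
    using closed that by blast
  show ?thesis
    unfolding fully_exact_def
  proof (intro conjI ballI allI impI sub)
    fix X Y g K k assume X: "X \<in> B" and Y: "Y \<in> B" and g: "g \<in> arr (Mod C) X Y" and k: "is_kernel (Mod C) X Y g K k"
    obtain M :: "('p, 'b, 'u) cmodule" and \<alpha> where M: "M \<in> obj (Mod D)" and \<alpha>: "module_iso C (res f M) X \<alpha>" using rep_B[OF X] by blast
    obtain N :: "('p, 'b, 'u) cmodule" and \<beta> where N: "N \<in> obj (Mod D)" and \<beta>: "module_iso C (res f N) Y \<beta>" using rep_B[OF Y] by blast
    obtain g' where g': "module_hom D M N g'" "\<forall>c\<in>obj C. \<forall>x\<in>car (res f M) c. \<beta> c (g' (omap f c) x) = g c (\<alpha> c x)"
      using lift[OF M N BO[OF X] BO[OF Y] \<alpha> \<beta> g] by blast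
    note Mc = obj_ModD(1)[OF M] and Nc = obj_ModD(1)[OF N]
    let ?K = "subm M (kerm D M N g')"
    have s: "submodule D M (kerm D M N g')" by (rule submodule_kerm[OF Mc Nc g'(1)])
    have Kc: "cat_module D ?K" by (rule cat_module_subm[OF Mc s])
    obtain K1 :: "('p, 'b, 'u) cmodule" and \<gamma> where K1: "K1 \<in> obj (Mod D)" and \<gamma>: "module_iso D ?K K1 \<gamma>"
      by (rule ex_Mod_iso[OF D Kc small_subm[OF obj_ModD(2)[OF M] s]]) (rule that)
    obtain \<delta> where \<delta>: "module_iso D K1 ?K \<delta>" by (rule module_iso_inverse[OF Kc \<gamma>]) (rule that)
    have \<delta>h: "module_hom D K1 ?K \<delta>" using \<delta> by (simp add: module_iso_def)
    have \<delta>': "module_iso C (res f K1) (res f ?K) (\<lambda>c. \<delta> (omap f c))"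
      by (rule module_iso_res[OF F \<delta>])
    let ?k = "mod_arr C (res f K1) (\<lambda>c x. \<alpha> c (\<delta> (omap f c) x))"
    have \<alpha>h: "module_hom C (res f M) X \<alpha>" using \<alpha> by (simp add: module_iso_def)
    have ka: "?k \<in> arr (Mod C) (res f K1) X"
      by (rule mod_arr_in[OF resM[OF K1] BO[OF X]
            module_hom_comp[OF module_hom_res[OF F module_hom_comp[OF \<delta>h subm_incl[OF s]]] \<alpha>h]])
    have "pker C X Y g (res f K1) ?k"
      by (rule pker_transfer[OF pker_res[OF F pker_kerm[OF Mc Nc g'(1)]] cat_module_res[OF F Mc]
            cat_module_res[OF F Nc] obj_ModD(1)[OF BO[OF Y]] module_hom_res[OF F g'(1)] \<alpha> \<beta> \<delta>' _
            arr_Mod_hom[OF resM[OF K1] BO[OF X] ka]])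
        (use g'(2) in simp_all)
    then have "is_kernel (Mod C) X Y g (res f K1) ?k"
      by (rule pker_kernel[OF BO[OF X] BO[OF Y] resM[OF K1] g ka])
    from A.kernel_unique[OF BO[OF X] k this] show "K \<in> B"
      by (rule closed_iso[OF _ K1]) (use k in \<open>simp add: is_kernel_def\<close>)
  next
    fix X Y g Q q assume X: "X \<in> B" and Y: "Y \<in> B" and g: "g \<in> arr (Mod C) X Y" and q: "is_cokernel (Mod C) X Y g Q q"
    obtain M :: "('p, 'b, 'u) cmodule" and \<alpha> where M: "M \<in> obj (Mod D)" and \<alpha>: "module_iso C (res f M) X \<alpha>" using rep_B[OF X] by blast
    obtain N :: "('p, 'b, 'u) cmodule" and \<beta> where N: "N \<in> obj (Mod D)" and \<beta>: "module_iso C (res f N) Y \<beta>" using rep_B[OF Y] by blast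
    obtain g' where g': "module_hom D M N g'" "\<forall>c\<in>obj C. \<forall>x\<in>car (res f M) c. \<beta> c (g' (omap f c) x) = g c (\<alpha> c x)"
      using lift[OF M N BO[OF X] BO[OF Y] \<alpha> \<beta> g] by blast
    note Mc = obj_ModD(1)[OF M] and Nc = obj_ModD(1)[OF N]
    let ?Q = "quotm N (imm D M g')"
    have s: "submodule D N (imm D M g')" by (rule submodule_imm[OF Mc Nc g'(1)])
    have Qc: "cat_module D ?Q" by (rule cat_module_quotm[OF D Nc s])
    obtain Q1 :: "('p, 'b, 'u) cmodule" and \<gamma> where Q1: "Q1 \<in> obj (Mod D)" and \<gamma>: "module_iso D ?Q Q1 \<gamma>"
      by (rule ex_Mod_iso[OF D Qc small_quotm[OF obj_ModD(2)[OF N]]]) (rule that)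
    have \<gamma>h: "module_hom D ?Q Q1 \<gamma>" using \<gamma> by (simp add: module_iso_def)
    have \<gamma>': "module_iso C (res f ?Q) (res f Q1) (\<lambda>c. \<gamma> (omap f c))"
      by (rule module_iso_res[OF F \<gamma>])
    obtain \<beta>' where \<beta>': "module_iso C Y (res f N) \<beta>'"
      and \<beta>'\<beta>: "\<And>c x. c \<in> obj C \<Longrightarrow> x \<in> car (res f N) c \<Longrightarrow> \<beta>' c (\<beta> c x) = x"
      by (rule module_iso_inverse[OF obj_ModD(1)[OF resM[OF N]] \<beta>]) (rule that, assumption+)
    have \<beta>h': "module_hom C Y (res f N) \<beta>'" and \<beta>h: "module_hom C (res f N) Y \<beta>"
      using \<beta>' \<beta> by (simp_all add: module_iso_def)
    let ?q = "mod_arr C Y (\<lambda>c y. \<gamma> (omap f c) (quot_map N (imm D M g') (omap f c) (\<beta>' c y)))"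
    have qa: "?q \<in> arr (Mod C) Y (res f Q1)"
      by (rule mod_arr_in[OF BO[OF Y] resM[OF Q1] module_hom_comp[OF \<beta>h'
              module_hom_res[OF F module_hom_comp[OF quot_map_hom[OF Nc s] \<gamma>h]]]])
    have "pcok C X Y g (res f Q1) ?q"
      by (rule pcok_transfer[OF pcok_res[OF F pcok_quotm[OF Mc Nc g'(1)]] cat_module_res[OF F Mc]
            cat_module_res[OF F Nc] cat_module_res[OF F Qc] obj_ModD(1)[OF resM[OF Q1]]
            module_hom_res[OF F g'(1)] \<alpha> \<beta> \<gamma>' _ arr_Mod_hom[OF BO[OF Y] resM[OF Q1] qa]])
        (use g'(2) \<beta>'\<beta> module_hom_closed[OF \<beta>h] in simp_all)
    then have "is_cokernel (Mod C) X Y g (res f Q1) ?q"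
      by (rule pcok_cokernel[OF BO[OF X] BO[OF Y] resM[OF Q1] g qa])
    from cokernel_unique[OF preadditive_Mod BO[OF Y] q this] show "Q \<in> B"
      by (rule closed_iso[OF _ Q1]) (use q in \<open>simp add: is_cokernel_def\<close>)
  next
    fix I :: "'u set" and X P \<iota>
    assume I: "small TYPE('u) I" and X: "\<forall>i\<in>I. X i \<in> B" and p: "is_coproduct (Mod C) I X P \<iota>"
    have "\<forall>i\<in>I. \<exists>p :: ('p, 'b, 'u) cmodule \<times> _. fst p \<in> obj (Mod D) \<and> module_iso C (res f (fst p)) (X i) (snd p)"
      using X rep_B by (simp add: split_paired_Ex)
    from bchoice[OF this] obtain m :: "'u \<Rightarrow> ('p, 'b, 'u) cmodule \<times> ('o \<Rightarrow> 'u \<Rightarrow> 'u)" where m: "\<forall>i\<in>I. fst (m i) \<in> obj (Mod D) \<and> module_iso C (res f (fst (m i))) (X i) (snd (m i))"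
      by (rule exE)
    define M where "M i = fst (m i)" for i
    define \<alpha> where "\<alpha> i = snd (m i)" for i
    have M: "M i \<in> obj (Mod D)" and \<alpha>: "module_iso C (res f (M i)) (X i) (\<alpha> i)" if "i \<in> I" for i
      using m that by (simp_all add: M_def \<alpha>_def)
    have XO: "X i \<in> obj (Mod C)" if "i \<in> I" for i using X BO that by blast
    note Mc = obj_ModD(1)[OF M]
    let ?P = "copm D I M"
    have Pc: "cat_module D ?P" by (rule cat_module_copm[OF Mc])
    \<comment> \<open>The value of the first argument of \<open>small\<close> is ignored and only
      its type matters, so the locale parameter and \<open>TYPE('u)\<close> are exchanged by
      unfolding.\<close>
    have I': "small U I" using I by (simp add: small_def)
    have Ps: "small_module U D ?P"
      by (rule small_copm[OF Mc I']) (use obj_ModD(2)[OF M] in \<open>simp_all add: small_module_def small_def\<close>)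
    then have Ps: "small_module TYPE('u) D ?P" by (simp add: small_module_def small_def)
    obtain P1 :: "('p, 'b, 'u) cmodule" and \<gamma> where P1: "P1 \<in> obj (Mod D)" and \<gamma>: "module_iso D ?P P1 \<gamma>"
      by (rule ex_Mod_iso[OF D Pc Ps]) (rule that)
    have \<gamma>h: "module_hom D ?P P1 \<gamma>" using \<gamma> by (simp add: module_iso_def)
    have \<gamma>': "module_iso C (res f ?P) (res f P1) (\<lambda>c. \<gamma> (omap f c))"
      by (rule module_iso_res[OF F \<gamma>])
    have "\<forall>i\<in>I. \<exists>a. module_iso C (X i) (res f (M i)) a \<and> (\<forall>c\<in>obj C. \<forall>x\<in>car (res f (M i)) c. a c (\<alpha> i c x) = x)"
    proof
      fix i assume i: "i \<in> I"
      obtain a where "module_iso C (X i) (res f (M i)) a"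
        "\<And>c x. c \<in> obj C \<Longrightarrow> x \<in> car (res f (M i)) c \<Longrightarrow> a c (\<alpha> i c x) = x"
        by (rule module_iso_inverse[OF obj_ModD(1)[OF resM[OF M[OF i]]] \<alpha>[OF i]]) (rule that, assumption+)
      then show "\<exists>a. module_iso C (X i) (res f (M i)) a \<and> (\<forall>c\<in>obj C. \<forall>x\<in>car (res f (M i)) c. a c (\<alpha> i c x) = x)"
        by (intro exI[of _ a]) simp
    qed
    from bchoice[OF this] obtain \<alpha>' where \<alpha>': "\<forall>i\<in>I. module_iso C (X i) (res f (M i)) (\<alpha>' i) \<and>
        (\<forall>c\<in>obj C. \<forall>x\<in>car (res f (M i)) c. \<alpha>' i c (\<alpha> i c x) = x)" by (rule exE)
    have \<alpha>h': "module_hom C (X i) (res f (M i)) (\<alpha>' i)" and \<alpha>h: "module_hom C (res f (M i)) (X i) (\<alpha> i)" if "i \<in> I" for i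
      using \<alpha>' \<alpha> that by (simp_all add: module_iso_def)
    have cin: "module_hom D (M i) ?P (cop_in I M i)" if "i \<in> I" for i by (rule cop_in_hom[OF Mc that])
    let ?\<iota> = "\<lambda>i. mod_arr C (X i) (\<lambda>c x. \<gamma> (omap f c) (cop_in I M i (omap f c) (\<alpha>' i c x)))"
    have ia: "?\<iota> i \<in> arr (Mod C) (X i) (res f P1)" if "i \<in> I" for i
      by (rule mod_arr_in[OF XO[OF that] resM[OF P1] module_hom_comp[OF \<alpha>h'[OF that]
              module_hom_res[OF F module_hom_comp[OF cin[OF that] \<gamma>h]]]])
    have cop: "pcop D I M ?P (cop_in I M)" by (rule pcop_copm[OF Mc])
    have idb: "bij_betw (\<lambda>i. i) I I" by (simp add: bij_betw_def)
    have "pcop C I (\<lambda>i. X i) (res f P1) ?\<iota>"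
      by (rule pcop_transfer[OF pcop_res[OF F cop] cat_module_res[OF F Mc] obj_ModD(1)[OF XO]
            cat_module_res[OF F Pc] obj_ModD(1)[OF resM[OF P1]] idb \<alpha> \<gamma>' arr_Mod_hom[OF XO resM[OF P1] ia]])
        (use \<alpha>' module_hom_closed[OF \<alpha>h] in simp_all)
    then have "is_coproduct (Mod C) I X (res f P1) ?\<iota>"
      by (intro pcop_coproduct XO resM P1 ia)
    from coproduct_unique[OF preadditive_Mod p this] show "P \<in> B"
      by (rule closed_iso[OF _ P1]) (use p in \<open>simp add: is_coproduct_def\<close>)
  next
    fix I :: "'u set" and X P \<pi>
    assume I: "small TYPE('u) I" and X: "\<forall>i\<in>I. X i \<in> B" and p: "is_product (Mod C) I X P \<pi>"
    have "\<forall>i\<in>I. \<exists>p :: ('p, 'b, 'u) cmodule \<times> _. fst p \<in> obj (Mod D) \<and> module_iso C (res f (fst p)) (X i) (snd p)"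
      using X rep_B by (simp add: split_paired_Ex)
    from bchoice[OF this] obtain m :: "'u \<Rightarrow> ('p, 'b, 'u) cmodule \<times> ('o \<Rightarrow> 'u \<Rightarrow> 'u)" where m: "\<forall>i\<in>I. fst (m i) \<in> obj (Mod D) \<and> module_iso C (res f (fst (m i))) (X i) (snd (m i))"
      by (rule exE)
    define M where "M i = fst (m i)" for i
    define \<alpha> where "\<alpha> i = snd (m i)" for i
    have M: "M i \<in> obj (Mod D)" and \<alpha>: "module_iso C (res f (M i)) (X i) (\<alpha> i)" if "i \<in> I" for i
      using m that by (simp_all add: M_def \<alpha>_def)
    have XO: "X i \<in> obj (Mod C)" if "i \<in> I" for i using X BO that by blast
    note Mc = obj_ModD(1)[OF M]
    let ?P = "prodm I M"
    have Pc: "cat_module D ?P" by (rule cat_module_prodm[OF Mc])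
    have I': "small U I" using I by (simp add: small_def)
    have Ps: "small_module U D ?P"
      by (rule small_prodm[OF I']) (use obj_ModD(2)[OF M] in \<open>simp_all add: small_module_def small_def\<close>)
    then have Ps: "small_module TYPE('u) D ?P" by (simp add: small_module_def small_def)
    obtain P1 :: "('p, 'b, 'u) cmodule" and \<gamma> where P1: "P1 \<in> obj (Mod D)" and \<gamma>: "module_iso D ?P P1 \<gamma>"
      by (rule ex_Mod_iso[OF D Pc Ps]) (rule that)
    obtain \<delta> where \<delta>: "module_iso D P1 ?P \<delta>" by (rule module_iso_inverse[OF Pc \<gamma>]) (rule that)
    have \<delta>h: "module_hom D P1 ?P \<delta>" using \<delta> by (simp add: module_iso_def)
    have \<delta>': "module_iso C (res f P1) (res f ?P) (\<lambda>c. \<delta> (omap f c))"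
      by (rule module_iso_res[OF F \<delta>])
    have \<alpha>h: "module_hom C (res f (M i)) (X i) (\<alpha> i)" if "i \<in> I" for i
      using \<alpha> that by (simp add: module_iso_def)
    let ?\<pi> = "\<lambda>i. mod_arr C (res f P1) (\<lambda>c x. \<alpha> i c (\<delta> (omap f c) x i))"
    have pa: "?\<pi> i \<in> arr (Mod C) (res f P1) (X i)" if "i \<in> I" for i
      by (rule mod_arr_in[OF resM[OF P1] XO[OF that] module_hom_comp[OF
              module_hom_res[OF F module_hom_comp[OF \<delta>h prodm_proj[OF that]]] \<alpha>h[OF that]]])
    have idb: "bij_betw (\<lambda>i. i) I I" by (simp add: bij_betw_def)
    have "pprod C I (\<lambda>i. X i) (res f P1) ?\<pi>"
      by (rule pprod_transfer[OF pprod_res[OF F pprod_prodm] idb \<alpha> \<delta>' arr_Mod_hom[OF resM[OF P1] XO pa]])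
        simp_all
    then have "is_product (Mod C) I X (res f P1) ?\<pi>"
      by (intro pprod_product XO resM P1 pa)
    from A.product_unique[OF p this] show "P \<in> B"
      by (rule closed_iso[OF _ P1]) (use p in \<open>simp add: is_product_def\<close>)
  qed
qed

end

section \<open>Transport of a small preadditive category to the universe\<close>

text \<open>All arrows together form a small set, so a single injection codes them. Hom sets of
  different pairs of objects are allowed to overlap, so the codes do not have to record source and
  target.\<close>

lemma ex_transported_category:
  fixes D :: "('p, 'b) preadd_cat" and U :: "'u itself"
  assumes "universe U" and D: "preadditive_category D" and small: "small_category U D"
  obtains C' :: "('u, 'u) preadd_cat" and E E' where
    "preadditive_category C'" "small_category U C'" "additive_functor D C' E" "additive_functor C' D E'"
    "omap E ` obj D = obj C'" "\<And>X. X \<in> obj D \<Longrightarrow> omap E' (omap E X) = X"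
    "\<And>X Y a. \<lbrakk>X \<in> obj D; Y \<in> obj D; a \<in> arr D X Y\<rbrakk> \<Longrightarrow> amap E' (omap E X) (omap E Y) (amap E X Y a) = a"
    "\<And>X Y b. \<lbrakk>X \<in> obj D; Y \<in> obj D; b \<in> arr C' (omap E X) (omap E Y)\<rbrakk> \<Longrightarrow>
       amap E X Y (amap E' (omap E X) (omap E Y) b) = b"
proof -
  interpret universe U by (rule assms(1))
  interpret D: preadditive_category D by (rule D)
  define A where "A = (\<Union>X\<in>obj D. \<Union>Y\<in>obj D. arr D X Y)"
  have "small U (obj D)" "small U A"
    using small unfolding A_def small_category_def by (auto intro!: small_UN)
  then obtain e :: "'p \<Rightarrow> 'u" and j :: "'b \<Rightarrow> 'u" where e: "inj_on e (obj D)" and j: "inj_on j A"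
    by (metis small_ex_inj)
  define e' where "e' = inv_into (obj D) e"
  define j' where "j' = inv_into A j"
  have ee [simp]: "e' (e X) = X" if "X \<in> obj D" for X using e that by (simp add: e'_def)
  have jj [simp]: "j' (j a) = a" if "X \<in> obj D" "Y \<in> obj D" "a \<in> arr D X Y" for X Y a
    using j that by (auto simp: j'_def A_def intro!: inv_into_f_f)
  define C' where "C' = \<lparr>obj = e ` obj D, arr = \<lambda>u v. j ` arr D (e' u) (e' v),
    ident = \<lambda>u. j (ident D (e' u)),
    ccomp = \<lambda>u v w g f. j (ccomp D (e' u) (e' v) (e' w) (j' g) (j' f)),
    arr_add = \<lambda>u v f g. j (arr_add D (e' u) (e' v) (j' f) (j' g)),
    arr_zero = \<lambda>u v. j (arr_zero D (e' u) (e' v))\<rparr>"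
  have C'_simps [simp]: "obj C' = e ` obj D" "arr C' u v = j ` arr D (e' u) (e' v)"
    "ident C' u = j (ident D (e' u))" "ccomp C' u v w g f = j (ccomp D (e' u) (e' v) (e' w) (j' g) (j' f))"
    "arr_add C' u v f g = j (arr_add D (e' u) (e' v) (j' f) (j' g))" "arr_zero C' u v = j (arr_zero D (e' u) (e' v))"
    for u v w f g
    by (simp_all add: C'_def)
  have C': "preadditive_category C'"
  proof (intro preadditive_category.intro category.intro preadditive_category_axioms.intro)
    fix u v assume "u \<in> obj C'" "v \<in> obj C'"
    then obtain X Y where X: "X \<in> obj D" "u = e X" and Y: "Y \<in> obj D" "v = e Y" by auto
    interpret G: comm_group "arr_group D X Y" by (rule D.arr_comm_group[OF X(1) Y(1)])
    note cl = D.arr_add_closed[OF X(1) Y(1)] and jX = jj[OF X(1) Y(1)]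
    show "comm_group (arr_group C' u v)"
    proof (rule comm_groupI)
      fix x assume "x \<in> carrier (arr_group C' u v)"
      then obtain a where a: "a \<in> arr D X Y" "x = j a" using X Y by (auto simp: arr_group_def)
      show "\<one>\<^bsub>arr_group C' u v\<^esub> \<otimes>\<^bsub>arr_group C' u v\<^esub> x = x"
        using a X Y G.l_one[of a] D.arr_zero_closed[OF X(1) Y(1)] jX by (simp add: arr_group_def)
      have "inv\<^bsub>arr_group D X Y\<^esub> a \<in> arr D X Y" using G.inv_closed[of a] a by (simp add: arr_group_def)
      then show "\<exists>y\<in>carrier (arr_group C' u v). y \<otimes>\<^bsub>arr_group C' u v\<^esub> x = \<one>\<^bsub>arr_group C' u v\<^esub>"
        using a X Y G.l_inv[of a] jX
        by (intro bexI[of _ "j (inv\<^bsub>arr_group D X Y\<^esub> a)"]) (simp_all add: arr_group_def)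
      fix y assume "y \<in> carrier (arr_group C' u v)"
      then obtain b where b: "b \<in> arr D X Y" "y = j b" using X Y by (auto simp: arr_group_def)
      show "x \<otimes>\<^bsub>arr_group C' u v\<^esub> y \<in> carrier (arr_group C' u v)"
        using a b X Y cl jX by (simp add: arr_group_def)
      show "x \<otimes>\<^bsub>arr_group C' u v\<^esub> y = y \<otimes>\<^bsub>arr_group C' u v\<^esub> x"
        using a b X Y G.m_comm[of a b] jX by (simp add: arr_group_def)
      fix z assume "z \<in> carrier (arr_group C' u v)"
      then obtain c where c: "c \<in> arr D X Y" "z = j c" using X Y by (auto simp: arr_group_def)
      show "x \<otimes>\<^bsub>arr_group C' u v\<^esub> y \<otimes>\<^bsub>arr_group C' u v\<^esub> z = x \<otimes>\<^bsub>arr_group C' u v\<^esub> (y \<otimes>\<^bsub>arr_group C' u v\<^esub> z)"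
        using a b c X Y G.m_assoc[of a b c] cl jX by (simp add: arr_group_def)
    qed (use X Y D.arr_zero_closed in \<open>simp add: arr_group_def\<close>)
  qed (auto simp: D.ident_arr D.comp_arr D.comp_ident_left D.comp_ident_right D.comp_assoc
      D.comp_add_left D.comp_add_right D.arr_add_closed)
  define E where "E = \<lparr>omap = e, amap = \<lambda>(X :: 'p) (Y :: 'p). j\<rparr>"
  define E' where "E' = \<lparr>omap = e', amap = \<lambda>(u :: 'u) (v :: 'u). j'\<rparr>"
  have [simp]: "omap E = e" "amap E X Y = j" "omap E' = e'" "amap E' u v = j'" for X Y u v
    by (simp_all add: E_def E'_def)
  have "additive_functor D C' E"
    by (rule additive_functorI) simp_all
  moreover have "additive_functor C' D E'"
    by (rule additive_functorI) (auto simp: D.ident_arr D.comp_arr D.arr_add_closed)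
  moreover have "small_category U C'"
    using small by (auto simp: small_category_def intro!: small_image)
  ultimately show thesis using C' by (intro that[of C' E E']) auto
qed

lemma additive_comp_functor:
  assumes f: "additive_functor C D f" and g: "additive_functor D E g"
  shows "additive_functor C E (comp_functor g f)"
  by (rule additive_functorI)
    (simp_all add: comp_functor_def additive_functorD[OF f] additive_functorD[OF g])

section \<open>Fully exact subcategories as essential images\<close>

context fully_exact_modules
begin

text \<open>The functor is \<open>gen_functor\<close> followed by the transport to
  \<open>'u\<close>. Restriction is faithful by surjectivity on objects and full by
  \<open>res_full\<close>; its essential image lies in \<open>B\<close> by \<open>res_in_sub\<close>
  and contains \<open>B\<close> by \<open>eval_hom_iso\<close>.\<close>

lemma ex_essential_image_of_epi:
  "\<exists>C' f. essential_image_of_epi C B C' f \<and> omap f ` obj C = obj C'"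
proof -
  obtain G gen where "generators C B G gen" using ex_generators by blast
  then interpret generators C B G gen .
  note F = additive_gen_functor
  obtain C' :: "('u, 'u) preadd_cat" and E E' where C': "preadditive_category C'" and C's: "small_category TYPE('u) C'"
    and E: "additive_functor gen_cat C' E" and E': "additive_functor C' gen_cat E'"
    and surj: "omap E ` obj gen_cat = obj C'"
    and E'E: "\<And>X. X \<in> obj gen_cat \<Longrightarrow> omap E' (omap E X) = X"
    and E'Ea: "\<And>X Y a. \<lbrakk>X \<in> obj gen_cat; Y \<in> obj gen_cat; a \<in> arr gen_cat X Y\<rbrakk> \<Longrightarrow>
       amap E' (omap E X) (omap E Y) (amap E X Y a) = a"
    and EE'a: "\<And>X Y b. \<lbrakk>X \<in> obj gen_cat; Y \<in> obj gen_cat; b \<in> arr C' (omap E X) (omap E Y)\<rbrakk> \<Longrightarrow>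
       amap E X Y (amap E' (omap E X) (omap E Y) b) = b"
    by (rule ex_transported_category[OF universe_axioms preadditive_gen_cat small_gen_cat]) (rule that, assumption+)
  let ?f = "comp_functor E gen_functor"
  have f_simps: "omap ?f X = omap E X" "amap ?f X Y a = amap E X Y (amap gen_functor X Y a)" for X Y a
    by (simp_all add: comp_functor_def)
  have res_f: "res ?f N = res gen_functor (res E N)" for N :: "('u, 'u, 'x) cmodule"
    by (simp add: comp_functor_def op_functor_def)
  have f: "additive_functor C C' ?f"
    by (rule additive_comp_functor[OF F E])
  have resM: "res ?f M \<in> obj (Mod C)" if "M \<in> obj (Mod C')" for M :: "('u, 'u, 'u) cmodule"
    by (rule res_obj_Mod[OF preadditive_category_axioms f that])
  have restr: "omap (restriction C ?f) M = res ?f M"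
    "amap (restriction C ?f) M N = (\<lambda>\<eta>. \<lambda>X\<in>obj C. \<eta> (omap E X))" for M N :: "('u, 'u, 'u) cmodule"
    by (simp_all add: restriction_def f_simps)
  have obj_C': "\<exists>X\<in>obj C. u = omap E X" if "u \<in> obj C'" for u using surj that by auto
  have EX: "omap E X \<in> obj C'" if "X \<in> obj C" for X using additive_functorD(1)[OF E] that by simp
  have "fully_faithful (Mod C' :: (('u, 'u, 'u) cmodule, 'u \<Rightarrow> 'u \<Rightarrow> 'u) preadd_cat) (Mod C) (restriction C ?f)"
    unfolding fully_faithful_def restr
  proof (intro ballI)
    fix M N :: "('u, 'u, 'u) cmodule" assume M: "M \<in> obj (Mod C')" and N: "N \<in> obj (Mod C')"
    interpret M: cat_module C' M by (rule obj_ModD[OF M])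
    let ?r = "\<lambda>\<eta> :: 'u \<Rightarrow> 'u \<Rightarrow> 'u. \<lambda>X\<in>obj C. \<eta> (omap E X)"
    have "?r \<eta> \<in> arr (Mod C) (res ?f M) (res ?f N)" if \<eta>: "\<eta> \<in> arr (Mod C') M N" for \<eta>
    proof -
      have h: "module_hom C (res ?f M) (res ?f N) (\<lambda>X. \<eta> (omap ?f X))"
        by (rule module_hom_res[OF f arr_Mod_hom[OF M N \<eta>]])
      have "module_hom C (res ?f M) (res ?f N) (?r \<eta>)"
        by (rule module_hom_cong[OF h obj_ModD(1)[OF resM[OF M]]]) (simp add: f_simps)
      moreover have "\<eta> u \<in> extensional (car M u)" if "u \<in> obj C'" for u
        using \<eta> that by (simp add: arr_Mod_iff[OF M N])
      ultimately show ?thesis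
        unfolding arr_Mod_iff[OF resM[OF M] resM[OF N]] using EX by (simp add: f_simps)
    qed
    moreover have "inj_on ?r (arr (Mod C') M N)"
    proof (rule inj_onI)
      fix \<eta> \<theta> assume \<eta>: "\<eta> \<in> arr (Mod C') M N" and \<theta>: "\<theta> \<in> arr (Mod C') M N" and eq: "?r \<eta> = ?r \<theta>"
      show "\<eta> = \<theta>"
      proof (rule arr_Mod_eqI[OF M N N \<eta> \<theta>])
        fix u x assume "u \<in> obj C'" "x \<in> car M u"
        then obtain X where "X \<in> obj C" "u = omap E X" using obj_C' by blast
        then show "\<eta> u x = \<theta> u x" using fun_cong[OF eq, of X] by simp
      qed
    qed
    moreover have "k \<in> ?r ` arr (Mod C') M N" if k: "k \<in> arr (Mod C) (res ?f M) (res ?f N)" for k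
    proof -
      have EM: "cat_module gen_cat (res E M)" and EN: "cat_module gen_cat (res E N)"
        and ENs: "small_module TYPE('u) gen_cat (res E N)"
        using M N by (auto intro: cat_module_res[OF E] small_module_res[OF E] obj_ModD)
      have kh: "module_hom gen_cat (res E M) (res E N) k"
        by (rule res_full[OF EM EN ENs]) (use arr_Mod_hom[OF resM[OF M] resM[OF N] k] in \<open>simp add: res_f\<close>)
      \<comment> \<open>Each object of \<open>C'\<close> comes from exactly one object of
        \<open>C\<close>, recovered by \<open>E'\<close>, so a family indexed by the objects of
        \<open>C\<close> can be read over \<open>C'\<close>.\<close>
      have k': "module_hom C' M N (\<lambda>u. k (omap E' u))"
      proof (rule module_homI)
        fix u x assume u: "u \<in> obj C'" and x: "x \<in> car M u"
        obtain X where X: "X \<in> obj C" "u = omap E X" using obj_C'[OF u] by blast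
        have xX: "x \<in> car (res E M) X" using x X by simp
        show "k (omap E' u) x \<in> car N u" using module_hom_closed[OF kh _ xX] X by (simp add: E'E)
        show "k (omap E' u) (x \<otimes>\<^bsub>omap M u\<^esub> y) = k (omap E' u) x \<otimes>\<^bsub>omap N u\<^esub> k (omap E' u) y"
          if "y \<in> car M u" for y
          using module_hom_mult[OF kh _ xX, of y] X that by (simp add: E'E)
        fix v b assume v: "v \<in> obj C'" and b: "b \<in> arr C' v u"
        obtain Y where Y: "Y \<in> obj C" "v = omap E Y" using obj_C'[OF v] by blast
        have a: "amap E' v u b \<in> arr gen_cat Y X"
          using additive_functorD(2)[OF E' v u b] X Y by (simp add: E'E)
        show "k (omap E' v) (amap M u v b x) = amap N u v b (k (omap E' u) x)"
          using module_hom_act[OF kh _ _ a xX] X Y EE'a[of Y X b] b by (simp add: E'E)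
      qed
      let ?\<eta> = "mod_arr C' M (\<lambda>u. k (omap E' u))"
      have "k = ?r ?\<eta>"
      proof (rule extensionalityI[of _ "obj C"])
        show "k \<in> extensional (obj C)" using k by (simp add: arr_Mod_iff[OF resM[OF M] resM[OF N]])
        fix X assume X: "X \<in> obj C"
        have "k X \<in> extensional (car M (omap E X))"
          using k X by (simp add: arr_Mod_iff[OF resM[OF M] resM[OF N]] f_simps)
        then show "k X = ?r ?\<eta> X"
          using X EX[OF X] by (intro extensionalityI[of _ "car M (omap E X)"]) (simp_all add: mod_arr_def E'E)
      qed simp
      then show ?thesis using mod_arr_in[OF M N k'] by blast
    qed
    ultimately show "bij_betw ?r (arr (Mod C') M N) (arr (Mod C) (res ?f M) (res ?f N))"
      unfolding bij_betw_def by blast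
  qed
  moreover have "B = essential_image (Mod C') (Mod C) (restriction C ?f)"
    unfolding essential_image_def restr
  proof (intro equalityI subsetI CollectI conjI)
    fix M assume M: "M \<in> B"
    then show MO: "M \<in> obj (Mod C)" using B_sub by blast
    let ?H = "hom_module M"
    have H: "cat_module gen_cat ?H" and Hs: "small_module TYPE('u) gen_cat ?H"
      by (rule cat_module_hom_module[OF MO], rule small_hom_module[OF MO])
    have N0: "cat_module C' (res E' ?H)" by (rule cat_module_res[OF E' H])
    obtain N :: "('u, 'u, 'u) cmodule" and \<psi> where N: "N \<in> obj (Mod C')" and \<psi>: "module_iso C' (res E' ?H) N \<psi>"
      by (rule ex_Mod_iso[OF C' N0 small_module_res[OF E' Hs]]) (rule that)
    have arrF: "amap gen_functor X Y a \<in> arr gen_cat X Y" if "X \<in> obj C" "Y \<in> obj C" "a \<in> arr C X Y" for X Y a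
      using additive_functorD(2)[OF F that] by (simp del: gen_cat_simps(2))
    \<comment> \<open>\<open>E'\<close> undoes \<open>E\<close> on objects and arrows, so the two
      restrictions have the same carriers and the same action, and the identity compares
      them.\<close>
    have "module_hom C (res gen_functor ?H) (res ?f (res E' ?H)) (\<lambda>X x. x)"
      using E'E E'Ea arrF by (intro module_homI) (simp_all add: f_simps del: gen_functor_simps(2) gen_cat_simps(2) hom_module_simps)
    then have i1: "module_iso C (res gen_functor ?H) (res ?f (res E' ?H)) (\<lambda>X x. x)"
      unfolding module_iso_def by (simp add: f_simps E'E bij_betw_def)
    obtain \<kappa> where i0: "module_iso C M (res gen_functor ?H) \<kappa>"
      by (rule module_iso_inverse[OF cat_module_res[OF F H] eval_hom_iso[OF M]]) (rule that)
    have "module_iso C M (res ?f N) (\<lambda>X x. \<psi> (omap ?f X) (\<kappa> X x))"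
      by (rule module_iso_comp[OF module_iso_comp[OF i0 i1] module_iso_res[OF f \<psi>]])
    then show "\<exists>N\<in>obj (Mod C'). isomorphic (Mod C) M (res ?f N)"
      using N isomorphic_Mod_iff[OF MO resM[OF N]] by blast
  next
    fix Y :: "('o, 'a, 'u) cmodule" assume "Y \<in> {Y \<in> obj (Mod C). \<exists>N\<in>obj (Mod C'). isomorphic (Mod C) Y (res ?f N)}"
    then obtain N :: "('u, 'u, 'u) cmodule" where Y: "Y \<in> obj (Mod C)" and N: "N \<in> obj (Mod C')"
      and iso: "isomorphic (Mod C) Y (res ?f N)" by blast
    have "in_sub C B (res gen_functor (res E N))"
      by (rule res_in_sub) (use N in \<open>auto intro: cat_module_res[OF E] small_module_res[OF E] obj_ModD\<close>)
    then obtain M h where M: "M \<in> B" and h: "module_iso C (res ?f N) M h"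
      unfolding res_f[symmetric] by (rule in_subE)
    obtain k where k: "module_iso C Y (res ?f N) k"
      using iso unfolding isomorphic_Mod_iff[OF Y resM[OF N]] by (rule exE)
    obtain k' where "module_iso C M Y k'"
      by (rule module_iso_inverse[OF obj_ModD(1)[OF Y] module_iso_comp[OF k h]]) (rule that)
    moreover have "M \<in> obj (Mod C)" using M B_sub by blast
    ultimately have "isomorphic (Mod C) M Y" using isomorphic_Mod_iff Y by blast
    moreover have "subcategory (Mod C) B" using exact by (simp add: fully_exact_def)
    ultimately show "Y \<in> B" using M Y unfolding subcategory_def by blast
  qed
  ultimately have "essential_image_of_epi C B C' ?f"
    using C' C's f by (simp add: essential_image_of_epi_def preadditive_epi_def)
  moreover have "omap ?f ` obj C = obj C'" using surj by (simp add: f_simps)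
  ultimately show ?thesis by blast
qed

end

text \<open>Full exactness yields the third condition together with surjectivity on objects, while
  the third condition without surjectivity already gives back full exactness; hence its two versions
  are equivalent.\<close>

theorem theorem9p14:
  fixes C :: "('o, 'a) preadd_cat"
    and B :: "('o, 'a, 'u) cmodule set"
  assumes "inaccessible TYPE('u)"
    and "preadditive_category C"
    and "small_category TYPE('u) C"
    and "additive_subcategory (Mod C) B"
  shows "(fully_exact TYPE('u) (Mod C) B \<longleftrightarrow> bireflective (Mod C) B) \<and>
    (bireflective (Mod C) B \<longleftrightarrow> (\<exists>C' f. essential_image_of_epi C B C' f)) \<and>
    ((\<exists>C' f. essential_image_of_epi C B C' f) \<longleftrightarrow>
      (\<exists>C' f. essential_image_of_epi C B C' f \<and> omap f ` obj C = obj C'))"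
proof -
  interpret universe "TYPE('u)" by (rule universe.intro[OF assms(1)])
  have exact_imp: "fully_exact_modules C B" if "fully_exact TYPE('u) (Mod C) B"
    by (intro fully_exact_modules.intro fully_exact_modules_axioms.intro universe_axioms assms(2,3) that)
  have "bireflective (Mod C) B" if "fully_exact TYPE('u) (Mod C) B"
    by (rule fully_exact_modules.bireflective_B[OF exact_imp[OF that]])
  moreover have "fully_exact TYPE('u) (Mod C) B" if "bireflective (Mod C) B"
    by (rule bireflective_imp_fully_exact[OF preadditive_Mod that])
  moreover have "\<exists>C' f. essential_image_of_epi C B C' f \<and> omap f ` obj C = obj C'"
    if "fully_exact TYPE('u) (Mod C) B"
    by (rule fully_exact_modules.ex_essential_image_of_epi[OF exact_imp[OF that]])
  moreover have "fully_exact TYPE('u) (Mod C) B" if "essential_image_of_epi C B C' f" for C' f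
    using that essential_image_fully_exact[OF assms(2)] unfolding essential_image_of_epi_def by blast
  ultimately show ?thesis by blast
qed

end
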